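(* Let $n,Q\geq1$ be integers and let $B_r\subset\mathbb{R}^2$ be the open disk of radius $r$ centered at the origin. Let $u\in W^{1,2}(B_2,\mathcal{A}_Q(\mathbb{R}^n))$ be Dir-minimizing and assume that its singular set is $\Sigma_u=\{0\}$. Then $|Du|\in L^p(B_1)$ for every $p<\frac{2Q}{Q-1}$.
   Context: **$Q$-points.** For $P\in\mathbb{R}^n$ let $[\![P]\!]$ be the Dirac mass at $P$. $\mathcal{A}_Q(\mathbb{R}^n)=\{\sum_{i=1}^Q[\![P_i]\!]:P_i\in\mathbb{R}^n\}$ is the space of unordered $Q$-tuples (with multiplicity), with metric $\mathcal{G}(\sum_i[\![P_i]\!],\sum_i[\![S_i]\!])=\min_{\sigma}\big(\sum_i|P_i-S_{\sigma(i)}|^2\big)^{1/2}$, the minimum being over permutations $\sigma$ of $\{1,\dots,Q\}$. **Sobolev $Q$-valued functions.** For $\Omega\subset\mathbb{R}^m$ open, a measurable $f:\Omega\to\mathcal{A}_Q(\mathbb{R}^n)$ belongs to $W^{1,2}(\Omega,\mathcal{A}_Q(\mathbb{R}^n))$ if there are $\varphi_1,\dots,\varphi_m\in L^2(\Omega;[0,\infty))$ such that, for every $T\in\mathcal{A}_Q(\mathbb{R}^n)$, the function $x\mapsto\mathcal{G}(f(x),T)$ is in $W^{1,2}(\Omega)$ and $|\partial_j\mathcal{G}(f,T)|\leq\varphi_j$ a.e. for every $j$. The minimal such $\varphi_j$ is denoted $|\partial_jf|$ (it equals $\sup_l|\partial_j\mathcal{G}(f,T_l)|$ a.e. for any countable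 dense $\{T_l\}\subset\mathcal{A}_Q(\mathbb{R}^n)$). Set $|Df|^2=\sum_j|\partial_jf|^2$ and $\mathrm{Dir}(f,\Omega)=\int_\Omega|Df|^2$. (Where $f=\sum_i[\![f_i]\!]$ locally with smooth $f_i$, $|Df|^2=\sum_i|Df_i|^2$.) **Dir-minimizing.** $u\in W^{1,2}(\Omega,\mathcal{A}_Q(\mathbb{R}^n))$ is Dir-minimizing if $\mathrm{Dir}(u,\Omega)\leq\mathrm{Dir}(v,\Omega)$ for every $v\in W^{1,2}(\Omega,\mathcal{A}_Q(\mathbb{R}^n))$ with the same trace on $\partial\Omega$, i.e. such that $\mathcal{G}(u,T)$ and $\mathcal{G}(v,T)$ have the same Sobolev trace on $\partial\Omega$ for every $T\in\mathcal{A}_Q(\mathbb{R}^n)$. A Dir-minimizing function is identified with its (locally Hölder) continuous representative. **Singular set.** A $Q$-valued function $f$ on $\Omega$ is regular at $x\in\Omega$ if there exist a neighborhood $U$ of $x$ and $Q$ analytic functions $f_i:U\to\mathbb{R}^n$ such that $f|_U=\sum_i[\![f_i]\!]$ and, for all $i,j$, either $f_i(y)\neq f_j(y)$ for every $y\in U$ or $f_i\equiv f_j$. The singular set $\Sigma_f$ is the complement in $\Omega$ of the set of regular points. (For $Q=1$ the number $\frac{2Q}{Q-1}$ is read as $+\infty$.) *)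

theory Defs
  imports
    "HOL-Analysis.Analysis"
    "HOL-Combinatorics.Combinatorics"
begin

section \<open>The space of unordered Q-tuples\<close>

text \<open>
  The Q-point \<open>\<Sum>\<^sub>i \<lbrakk>P\<^sub>i\<rbrakk>\<close> is the multiset of the \<open>P\<^sub>i\<close>.
\<close>

definition Q_points :: "nat \<Rightarrow> 'b multiset set" where
  "Q_points Q = {T. size T = Q}"

text \<open>
  The metric is the minimum over the permutations \<open>\<sigma>\<close>. It does not depend on the enumerations
  \<open>ps\<close> and \<open>qs\<close>, so letting these vary as well does not change the set of values. The value
  for multisets of different size is irrelevant; it makes the function symmetric on the whole
  type, as the locale \<^locale>\<open>Metric_space\<close> demands.
\<close>

definition Q_dist :: "'b::euclidean_space multiset \<Rightarrow> 'b multiset \<Rightarrow> real" where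
  "Q_dist A B = (if size A = size B
     then Min {sqrt (\<Sum>i<size A. (dist (ps ! i) (qs ! \<sigma> i))\<^sup>2) | ps qs \<sigma>.
            mset ps = A \<and> mset qs = B \<and> \<sigma> permutes {..<size A}}
     else 0)"

abbreviation Q_topology :: "nat \<Rightarrow> 'b::euclidean_space multiset topology" where
  "Q_topology Q \<equiv> Metric_space.mtopology (Q_points Q) Q_dist"

lemma Q_dist_alt:
  assumes "size A = size B"
  shows "Q_dist A B = Min ((\<lambda>(ps, qs). L2_set (\<lambda>i. dist (ps ! i) (qs ! i)) {..<size A}) `
           ({ps. mset ps = A} \<times> {qs. mset qs = B}))"
proof -
  have "{sqrt (\<Sum>i<size A. (dist (ps ! i) (qs ! \<sigma> i))\<^sup>2) | ps qs \<sigma>.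
            mset ps = A \<and> mset qs = B \<and> \<sigma> permutes {..<size A}}
      = (\<lambda>(ps, qs). L2_set (\<lambda>i. dist (ps ! i) (qs ! i)) {..<size A}) `
           ({ps. mset ps = A} \<times> {qs. mset qs = B})" (is "?L = ?R")
  proof
    show "?L \<subseteq> ?R"
    proof
      fix r assume "r \<in> ?L"
      then obtain ps qs \<sigma> where r: "r = sqrt (\<Sum>i<size A. (dist (ps ! i) (qs ! \<sigma> i))\<^sup>2)"
        and p: "mset ps = A" "mset qs = B" "\<sigma> permutes {..<size A}" by blast
      have len: "length qs = size A" using p assms by (metis size_mset)
      have "mset (permute_list \<sigma> qs) = B" using p len by (simp add: mset_permute_list)
      moreover have "r = L2_set (\<lambda>i. dist (ps ! i) (permute_list \<sigma> qs ! i)) {..<size A}"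
        unfolding r L2_set_def using p len by (simp add: permute_list_nth)
      ultimately show "r \<in> ?R" using p by (force simp: image_iff)
    qed
    show "?R \<subseteq> ?L"
    proof
      fix r assume "r \<in> ?R"
      then obtain ps qs where "mset ps = A" "mset qs = B"
        "r = L2_set (\<lambda>i. dist (ps ! i) (qs ! i)) {..<size A}" by auto
      then show "r \<in> ?L" unfolding L2_set_def
        by (intro CollectI exI[of _ ps] exI[of _ qs] exI[of _ id]) (auto simp: permutes_id)
    qed
  qed
  with assms show ?thesis by (simp add: Q_dist_def)
qed

lemma finite_enumerations: "finite {ps. mset ps = A}"
  using finite_permutations_of_multiset[of A] by (simp add: permutations_of_multiset_def)

lemma Q_dist_le:
  assumes "mset ps = A" "mset qs = B" "size A = size B"
  shows "Q_dist A B \<le> L2_set (\<lambda>i. dist (ps ! i) (qs ! i)) {..<size A}"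
  unfolding Q_dist_alt[OF assms(3)] using assms
  by (intro Min_le finite_imageI finite_cartesian_product finite_enumerations)
     (auto simp: image_iff)

lemma Q_dist_attained:
  assumes "size A = size B"
  obtains ps qs where "mset ps = A" "mset qs = B"
    "Q_dist A B = L2_set (\<lambda>i. dist (ps ! i) (qs ! i)) {..<size A}"
proof -
  let ?S = "(\<lambda>(ps, qs). L2_set (\<lambda>i. dist (ps ! i) (qs ! i)) {..<size A}) `
           ({ps. mset ps = A} \<times> {qs. mset qs = B})"
  have "?S \<noteq> {}" using ex_mset[of A] ex_mset[of B] by auto
  then have "Q_dist A B \<in> ?S"
    unfolding Q_dist_alt[OF assms]
    by (intro Min_in finite_imageI finite_cartesian_product finite_enumerations)
  then show ?thesis using that by auto
qed

lemma Metric_space_Q_points: "Metric_space (Q_points Q) (Q_dist :: 'b::euclidean_space multiset \<Rightarrow> _)"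
proof
  have nonneg: "0 \<le> Q_dist A B" for A B :: "'b multiset"
  proof (cases "size A = size B")
    case True
    then show ?thesis by (rule Q_dist_attained) simp
  qed (simp add: Q_dist_def)
  have le: "Q_dist A B \<le> Q_dist B A" if eq: "size A = size B" for A B :: "'b multiset"
  proof -
    obtain ps qs where "mset ps = B" "mset qs = A"
      "Q_dist B A = L2_set (\<lambda>i. dist (ps ! i) (qs ! i)) {..<size B}"
      using Q_dist_attained[OF eq[symmetric]] .
    then have "Q_dist B A = L2_set (\<lambda>i. dist (qs ! i) (ps ! i)) {..<size A}"
      using eq by (simp add: dist_commute)
    then show ?thesis using Q_dist_le[OF \<open>mset qs = A\<close> \<open>mset ps = B\<close> eq] by simp
  qed
  show "0 \<le> Q_dist A B" for A B :: "'b multiset" by (rule nonneg)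
  show "Q_dist A B = Q_dist B A" for A B :: "'b multiset"
  proof (cases "size A = size B")
    case True
    then show ?thesis using le[of A B] le[of B A] by simp
  next
    case False
    then show ?thesis unfolding Q_dist_def by simp
  qed
  show "Q_dist A B = 0 \<longleftrightarrow> A = B" if "A \<in> Q_points Q" "B \<in> Q_points Q" for A B :: "'b multiset"
  proof
    have sz: "size A = size B" using that by (simp add: Q_points_def)
    assume 0: "Q_dist A B = 0"
    obtain ps qs where *: "mset ps = A" "mset qs = B"
      "Q_dist A B = L2_set (\<lambda>i. dist (ps ! i) (qs ! i)) {..<size A}"
      using Q_dist_attained[OF sz] .
    then have "\<forall>i<size A. ps ! i = qs ! i" using 0 by (simp add: L2_set_eq_0_iff)
    moreover have "length ps = size A" "length qs = size A" using * sz by (metis size_mset)+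
    ultimately have "ps = qs" by (simp add: list_eq_iff_nth_eq)
    with * show "A = B" by simp
  next
    assume AB: "A = B"
    obtain ps where "mset ps = A" using ex_mset by blast
    then have "Q_dist A B \<le> 0" using Q_dist_le[of ps A ps B] AB by (simp add: L2_set_def)
    with nonneg show "Q_dist A B = 0" by (simp add: antisym)
  qed
  show "Q_dist A C \<le> Q_dist A B + Q_dist B C"
    if "A \<in> Q_points Q" "B \<in> Q_points Q" "C \<in> Q_points Q" for A B C :: "'b multiset"
  proof -
    have sz: "size A = Q" "size B = Q" "size C = Q" using that by (auto simp: Q_points_def)
    obtain ps qs where 1: "mset ps = A" "mset qs = B"
      "Q_dist A B = L2_set (\<lambda>i. dist (ps ! i) (qs ! i)) {..<Q}"
      using Q_dist_attained[of A B] unfolding sz by blast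
    obtain qs' rs where 2: "mset qs' = B" "mset rs = C"
      "Q_dist B C = L2_set (\<lambda>i. dist (qs' ! i) (rs ! i)) {..<Q}"
      using Q_dist_attained[of B C] unfolding sz by blast
    have len: "length qs' = Q" "length rs = Q" using 2 sz by (metis size_mset)+
    obtain \<pi> where \<pi>: "\<pi> permutes {..<Q}" "permute_list \<pi> qs' = qs"
      using mset_eq_permutation[of qs qs'] 1 2 len by metis
    have BC: "Q_dist B C = L2_set (\<lambda>i. dist (qs ! i) (permute_list \<pi> rs ! i)) {..<Q}"
    proof -
      have "(\<Sum>i<Q. (dist (qs' ! i) (rs ! i))\<^sup>2) = (\<Sum>i<Q. (dist (qs' ! \<pi> i) (rs ! \<pi> i))\<^sup>2)"
        using sum.permute[OF \<pi>(1), of "\<lambda>i. (dist (qs' ! i) (rs ! i))\<^sup>2"] by simp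
      also have "\<dots> = (\<Sum>i<Q. (dist (qs ! i) (permute_list \<pi> rs ! i))\<^sup>2)"
        using \<pi> len by (intro sum.cong) (auto simp: permute_list_nth)
      finally show ?thesis by (simp add: 2(3) L2_set_def)
    qed
    have "mset (permute_list \<pi> rs) = C" using 2 \<pi> len by simp
    then have "Q_dist A C \<le> L2_set (\<lambda>i. dist (ps ! i) (permute_list \<pi> rs ! i)) {..<Q}"
      using Q_dist_le[of ps A "permute_list \<pi> rs" C] 1 sz by simp
    also have "\<dots> \<le> L2_set (\<lambda>i. dist (ps ! i) (qs ! i) + dist (qs ! i) (permute_list \<pi> rs ! i)) {..<Q}"
      by (intro L2_set_mono) (auto simp: dist_triangle)
    also have "\<dots> \<le> L2_set (\<lambda>i. dist (ps ! i) (qs ! i)) {..<Q}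
        + L2_set (\<lambda>i. dist (qs ! i) (permute_list \<pi> rs ! i)) {..<Q}"
      by (rule L2_set_triangle_ineq)
    finally show ?thesis using 1(3) BC by simp
  qed
qed


section \<open>Scalar Sobolev functions\<close>

text \<open>As usual, elements of \<open>L\<^sup>p\<close> and of Sobolev spaces are represented by functions.\<close>

definition Lp :: "'a measure \<Rightarrow> real \<Rightarrow> ('a \<Rightarrow> real) set" where
  "Lp M p = {g \<in> borel_measurable M. integrable M (\<lambda>x. \<bar>g x\<bar> powr p)}"

primrec Ck :: "nat \<Rightarrow> ('a::euclidean_space \<Rightarrow> real) \<Rightarrow> bool" where
  "Ck 0 f \<longleftrightarrow> continuous_on UNIV f"
| "Ck (Suc k) f \<longleftrightarrow> (\<forall>x. f differentiable (at x)) \<and>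
     (\<forall>b\<in>Basis. Ck k (\<lambda>x. frechet_derivative f (at x) b))"

definition smooth :: "('a::euclidean_space \<Rightarrow> real) \<Rightarrow> bool" where
  "smooth f \<longleftrightarrow> (\<forall>k. Ck k f)"

definition test_functions :: "'a::euclidean_space set \<Rightarrow> ('a \<Rightarrow> real) set" where
  "test_functions \<Omega> = {\<phi>. smooth \<phi> \<and> compact (closure {x. \<phi> x \<noteq> 0}) \<and> closure {x. \<phi> x \<noteq> 0} \<subseteq> \<Omega>}"

definition weak_partial ::
  "'a::euclidean_space set \<Rightarrow> 'a \<Rightarrow> ('a \<Rightarrow> real) \<Rightarrow> ('a \<Rightarrow> real) \<Rightarrow> bool" where
  "weak_partial \<Omega> b g h \<longleftrightarrow>
     g \<in> Lp (lebesgue_on \<Omega>) 2 \<and> h \<in> Lp (lebesgue_on \<Omega>) 2 \<and>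
     (\<forall>\<phi>\<in>test_functions \<Omega>.
        (LINT x|lebesgue_on \<Omega>. g x * frechet_derivative \<phi> (at x) b)
          = - (LINT x|lebesgue_on \<Omega>. h x * \<phi> x))"

definition W12 :: "'a::euclidean_space set \<Rightarrow> ('a \<Rightarrow> real) set" where
  "W12 \<Omega> = {g \<in> Lp (lebesgue_on \<Omega>) 2. \<forall>b\<in>Basis. \<exists>h. weak_partial \<Omega> b g h}"

text \<open>
  The Sobolev trace on \<open>\<partial>\<Omega>\<close>, where \<open>S\<close> is the surface measure of \<open>\<partial>\<Omega>\<close>: the image under the
  continuous extension to \<open>W\<^sup>1\<^sup>,\<^sup>2(\<Omega>)\<close> of the restriction operator \<open>\<psi> \<mapsto> \<psi>|\<^bsub>\<partial>\<Omega>\<^esub>\<close> with values in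
  \<open>L\<^sup>2(\<partial>\<Omega>)\<close>. It is an element of \<open>L\<^sup>2(\<partial>\<Omega>)\<close>, here given as the set of its representatives.
  The nonnegative integral is used so that a non-integrable difference does not count as zero.
\<close>

definition sobolev_trace ::
  "'a::euclidean_space set \<Rightarrow> 'a measure \<Rightarrow> ('a \<Rightarrow> real) \<Rightarrow> ('a \<Rightarrow> real) set" where
  "sobolev_trace \<Omega> S g = {h \<in> Lp S 2. \<exists>D \<psi>.
     (\<forall>b\<in>Basis. weak_partial \<Omega> b g (D b)) \<and> (\<forall>k. smooth (\<psi> k)) \<and>
     (\<lambda>k. \<integral>\<^sup>+x. ennreal ((\<psi> k x - g x)\<^sup>2) \<partial>lebesgue_on \<Omega>) \<longlonglongrightarrow> 0 \<and>
     (\<forall>b\<in>Basis. (\<lambda>k. \<integral>\<^sup>+x. ennreal ((frechet_derivative (\<psi> k) (at x) b - D b x)\<^sup>2)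
                   \<partial>lebesgue_on \<Omega>) \<longlonglongrightarrow> 0) \<and>
     (\<lambda>k. \<integral>\<^sup>+x. ennreal ((\<psi> k x - h x)\<^sup>2) \<partial>S) \<longlonglongrightarrow> 0}"

text \<open>Arc length on the circle \<open>\<partial>B\<^sub>r\<close>.\<close>

definition circle_measure :: "real \<Rightarrow> (real^2) measure" where
  "circle_measure r = scale_measure (ennreal r)
     (distr (restrict_space lborel {0..<2*pi}) borel (\<lambda>t. vector [r * cos t, r * sin t]))"


section \<open>Q-valued Sobolev functions and Dir-minimizers\<close>

definition Q_measurable ::
  "'a::euclidean_space set \<Rightarrow> nat \<Rightarrow> ('a \<Rightarrow> 'b::euclidean_space multiset) \<Rightarrow> bool" where
  "Q_measurable \<Omega> Q f \<longleftrightarrow>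
     f \<in> measurable (lebesgue_on \<Omega>) (sigma (Q_points Q) {U. openin (Q_topology Q) U})"

text \<open>
  \<open>\<phi>\<close> is admissible as \<open>\<phi>\<^sub>j\<close> in the definition of \<open>W\<^sup>1\<^sup>,\<^sup>2(\<Omega>, \<A>\<^sub>Q)\<close>; the index \<open>j\<close> is represented
  by the basis vector \<open>b\<close>.
\<close>

definition partial_bound ::
  "'a::euclidean_space set \<Rightarrow> nat \<Rightarrow> ('a \<Rightarrow> 'b::euclidean_space multiset) \<Rightarrow> 'a \<Rightarrow> ('a \<Rightarrow> real) \<Rightarrow> bool"
  where
  "partial_bound \<Omega> Q f b \<phi> \<longleftrightarrow>
     \<phi> \<in> Lp (lebesgue_on \<Omega>) 2 \<and> (\<forall>x\<in>\<Omega>. 0 \<le> \<phi> x) \<and>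
     (\<forall>T\<in>Q_points Q. \<exists>h. weak_partial \<Omega> b (\<lambda>x. Q_dist (f x) T) h \<and>
        (AE x in lebesgue_on \<Omega>. \<bar>h x\<bar> \<le> \<phi> x))"

definition W12_Q ::
  "'a::euclidean_space set \<Rightarrow> nat \<Rightarrow> ('a \<Rightarrow> 'b::euclidean_space multiset) set" where
  "W12_Q \<Omega> Q = {f. Q_measurable \<Omega> Q f \<and>
     (\<forall>T\<in>Q_points Q. (\<lambda>x. Q_dist (f x) T) \<in> W12 \<Omega>) \<and>
     (\<forall>b\<in>Basis. \<exists>\<phi>. partial_bound \<Omega> Q f b \<phi>)}"

text \<open>\<open>|\<partial>\<^sub>b f|\<close>, the minimal admissible bound. It is unique up to null sets.\<close>

definition abs_partial ::
  "'a::euclidean_space set \<Rightarrow> nat \<Rightarrow> ('a \<Rightarrow> 'b::euclidean_space multiset) \<Rightarrow> 'a \<Rightarrow> 'a \<Rightarrow> real" where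
  "abs_partial \<Omega> Q f b = (SOME \<phi>. partial_bound \<Omega> Q f b \<phi> \<and>
     (\<forall>\<psi>. partial_bound \<Omega> Q f b \<psi> \<longrightarrow> (AE x in lebesgue_on \<Omega>. \<phi> x \<le> \<psi> x)))"

definition abs_D ::
  "'a::euclidean_space set \<Rightarrow> nat \<Rightarrow> ('a \<Rightarrow> 'b::euclidean_space multiset) \<Rightarrow> 'a \<Rightarrow> real" where
  "abs_D \<Omega> Q f x = sqrt (\<Sum>b\<in>Basis. (abs_partial \<Omega> Q f b x)\<^sup>2)"

definition Dir ::
  "'a::euclidean_space set \<Rightarrow> nat \<Rightarrow> ('a \<Rightarrow> 'b::euclidean_space multiset) \<Rightarrow> real" where
  "Dir \<Omega> Q f = (LINT x|lebesgue_on \<Omega>. (abs_D \<Omega> Q f x)\<^sup>2)"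

definition Dir_minimizing ::
  "'a::euclidean_space set \<Rightarrow> 'a measure \<Rightarrow> nat \<Rightarrow> ('a \<Rightarrow> 'b::euclidean_space multiset) \<Rightarrow> bool" where
  "Dir_minimizing \<Omega> S Q u \<longleftrightarrow> u \<in> W12_Q \<Omega> Q \<and>
     (\<forall>v\<in>W12_Q \<Omega> Q.
        (\<forall>T\<in>Q_points Q. sobolev_trace \<Omega> S (\<lambda>x. Q_dist (u x) T)
                         = sobolev_trace \<Omega> S (\<lambda>x. Q_dist (v x) T))
        \<longrightarrow> Dir \<Omega> Q u \<le> Dir \<Omega> Q v)"


section \<open>The singular set\<close>

text \<open>
  Real analyticity: near every point, \<open>f\<close> is the sum of a power series. A multi-index is an
  extensional function from the basis to the naturals.
\<close>

definition real_analytic_on ::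
  "('a::euclidean_space \<Rightarrow> 'b::euclidean_space) \<Rightarrow> 'a set \<Rightarrow> bool" where
  "real_analytic_on f U \<longleftrightarrow> (\<forall>x\<in>U. \<exists>c. \<exists>r>0. \<forall>y\<in>ball x r.
     ((\<lambda>\<alpha>. (\<Prod>b\<in>Basis. ((y - x) \<bullet> b) ^ \<alpha> b) *\<^sub>R c \<alpha>) has_sum f y)
       (Basis \<rightarrow>\<^sub>E (UNIV :: nat set)))"

definition Q_regular_at ::
  "'a::euclidean_space set \<Rightarrow> nat \<Rightarrow> ('a \<Rightarrow> 'b::euclidean_space multiset) \<Rightarrow> 'a \<Rightarrow> bool" where
  "Q_regular_at \<Omega> Q f x \<longleftrightarrow> (\<exists>U F. open U \<and> x \<in> U \<and> U \<subseteq> \<Omega> \<and>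
     (\<forall>i<Q. real_analytic_on (F i) U) \<and>
     (\<forall>y\<in>U. f y = image_mset (\<lambda>i. F i y) (mset_set {..<Q})) \<and>
     (\<forall>i<Q. \<forall>j<Q. (\<forall>y\<in>U. F i y \<noteq> F j y) \<or> (\<forall>y\<in>U. F i y = F j y)))"

definition singular_set ::
  "'a::euclidean_space set \<Rightarrow> nat \<Rightarrow> ('a \<Rightarrow> 'b::euclidean_space multiset) \<Rightarrow> 'a set" where
  "singular_set \<Omega> Q f = {x \<in> \<Omega>. \<not> Q_regular_at \<Omega> Q f x}"

end

theory Submission
  imports Defs "HOL-Complex_Analysis.Conformal_Mappings"
begin

text \<open>
  Away from the origin a minimizer \<open>u\<close> is locally a superposition of \<open>Q\<close> harmonic sheets. The
  theorem is a growth estimate: on the punctured unit disk the first derivatives of all sheets are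
  bounded by \<open>C |x| powr (1 / Q - 1)\<close>. The \<open>p\<close>-th power of this bound is integrable in the plane
  exactly if \<open>p (1 - 1 / Q) < 2\<close>, that is, if \<open>p < 2 Q / (Q - 1)\<close>.

  The growth estimate comes from an algebraic function. Identify the plane with the complex numbers
  and fix a direction \<open>e\<close> of the target. For a harmonic sheet \<open>f\<close> the function
  \<open>g = \<partial>\<^sub>1 (f \<bullet> e) - \<i> \<partial>\<^sub>2 (f \<bullet> e)\<close> is holomorphic. Going around the origin permutes the sheets, but
  the polynomial with roots \<open>z g(z)\<close>, one for each sheet, is symmetric in them, and so it is a
  single-valued holomorphic function of \<open>z\<close> in the punctured disk (lemma \<open>char_poly_holomorphic\<close>).
  The roots are bounded and tend to 0 at the origin. Indeed, over a disk of radius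
  \<open>|z| / 8\<close> around \<open>z\<close> the sheets are single-valued, because the graph of \<open>u\<close> is a covering of the
  punctured disk (\<open>sheets_covering_space\<close>, \<open>sheet_lift\<close>). Their oscillation tends to 0 by continuity
  of \<open>u\<close> at the origin (\<open>small_oscillation\<close>), and a gradient estimate for harmonic functions
  (\<open>gradient_estimate\<close>) bounds \<open>|z g(z)|\<close> by a multiple of the oscillation. Hence the polynomial extends to the origin
  with value \<open>t ^ Q\<close>, and the Schwarz lemma bounds its deviation from \<open>t ^ Q\<close> by \<open>C |z|\<close>. Inserting a
  root for \<open>t\<close> gives \<open>|z g(z)| ^ Q \<le> C |z|\<close> (\<open>weighted_grad_growth\<close>), which is the claimed growth.

  It remains to connect the metric definition of the Dirichlet energy with the sheets. Near a regular
  point the distance of \<open>u\<close> to a fixed Q-point is a finite minimum of Euclidean norms of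
  differentiable maps. Such functions are differentiable almost everywhere by an elementary argument
  about isolated zeros (\<open>AE_not_isolated_zero_along\<close>), and the minimal bound \<open>abs_partial\<close> agrees almost
  everywhere with the Euclidean norm of the derivatives of the sheets
  (\<open>abs_partial_le_sheet_energy\<close>, \<open>sheet_energy_le_partial_bound\<close>). With this, moving a single sheet by
  a test function changes the energy in the classical way. The moved function has the same trace
  (\<open>sobolev_trace_add\<close>), so minimality makes every sheet weakly harmonic
  (\<open>minimizer_sheet_weakly_harmonic\<close>), and being analytic it is harmonic
  (\<open>weakly_harmonic_laplacian\<close>).
\<close>

section \<open>Smooth functions\<close>

lemma Ck_imp_continuous: "Ck k f \<Longrightarrow> continuous_on UNIV f"
  by (cases k)
    (auto intro!: differentiable_imp_continuous_on simp: differentiable_on_def differentiable_at_withinI)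

lemma Ck_SucI:
  assumes "\<And>x. (f has_derivative D x) (at x)" and "\<And>b. b \<in> Basis \<Longrightarrow> Ck k (\<lambda>x. D x b)"
  shows "Ck (Suc k) f"
proof -
  have "D x = frechet_derivative f (at x)" for x
    using frechet_derivative_at[OF assms(1)] .
  then show ?thesis using assms by (auto simp: differentiable_def)
qed

lemma Ck_SucD:
  assumes "Ck (Suc k) f"
  shows "(f has_derivative frechet_derivative f (at x)) (at x)"
    and "b \<in> Basis \<Longrightarrow> Ck k (\<lambda>x. frechet_derivative f (at x) b)"
  using assms by (auto simp: frechet_derivative_works[symmetric])

lemma Ck_lower: "Ck (Suc k) f \<Longrightarrow> Ck k f"
proof (induction k arbitrary: f)
  case 0
  show ?case using Ck_imp_continuous[OF 0] by simp
next
  case (Suc k)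
  show ?case
    by (rule Ck_SucI[OF Ck_SucD(1)[OF Suc.prems]])
      (rule Suc.IH[OF Ck_SucD(2)[OF Suc.prems]])
qed

lemma Ck_const: "Ck k (\<lambda>x. c)"
  by (induction k arbitrary: c) (simp, rule Ck_SucI[where D = "\<lambda>_ _. 0"], auto)

lemma Ck_inner: "Ck k (\<lambda>x. x \<bullet> c)"
proof (cases k)
  case (Suc j)
  show ?thesis unfolding Suc
    by (rule Ck_SucI[where D = "\<lambda>_ h. h \<bullet> c"]) (auto intro!: derivative_eq_intros Ck_const)
qed (auto intro!: continuous_intros)

lemma Ck_add: "Ck k f \<Longrightarrow> Ck k g \<Longrightarrow> Ck k (\<lambda>x. f x + g x)"
proof (induction k arbitrary: f g)
  case 0
  then show ?case by (auto intro!: continuous_intros)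
next
  case (Suc k)
  show ?case
    by (rule Ck_SucI[OF has_derivative_add[OF Ck_SucD(1)[OF Suc.prems(1)] Ck_SucD(1)[OF Suc.prems(2)]]])
      (intro Suc.IH Ck_SucD(2)[OF Suc.prems(1)] Ck_SucD(2)[OF Suc.prems(2)])
qed

lemma Ck_mult: "Ck k f \<Longrightarrow> Ck k g \<Longrightarrow> Ck k (\<lambda>x. f x * g x)"
proof (induction k arbitrary: f g)
  case 0
  then show ?case by (auto intro!: continuous_intros)
next
  case (Suc k)
  show ?case
    by (rule Ck_SucI[OF has_derivative_mult[OF Ck_SucD(1)[OF Suc.prems(1)] Ck_SucD(1)[OF Suc.prems(2)]]])
      (intro Ck_add Suc.IH Ck_SucD(2)[OF Suc.prems(1)] Ck_SucD(2)[OF Suc.prems(2)]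
        Ck_lower[OF Suc.prems(1)] Ck_lower[OF Suc.prems(2)])
qed

lemma Ck_sum: "(\<And>i. i \<in> I \<Longrightarrow> Ck k (f i)) \<Longrightarrow> Ck k (\<lambda>x. \<Sum>i\<in>I. f i x)"
  by (induction I rule: infinite_finite_induct) (auto intro!: Ck_const Ck_add)

lemma Ck_prod: "(\<And>i. i \<in> I \<Longrightarrow> Ck k (f i)) \<Longrightarrow> Ck k (\<lambda>x. \<Prod>i\<in>I. f i x)"
  by (induction I rule: infinite_finite_induct) (auto intro!: Ck_const Ck_mult)

lemma Ck_compose: "Ck k (\<beta> :: real \<Rightarrow> real) \<Longrightarrow> Ck k p \<Longrightarrow> Ck k (\<lambda>x. \<beta> (p x))"
proof (induction k arbitrary: \<beta> p)
  case 0
  then show ?case by (auto intro: continuous_on_compose2)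
next
  case (Suc k)
  have lin: "frechet_derivative \<beta> (at t) s = s * frechet_derivative \<beta> (at t) 1" for s t
    using linear_scale[OF has_derivative_linear[OF Ck_SucD(1)[OF Suc.prems(1)]], of t s 1]
    by simp
  show ?case
  proof (rule Ck_SucI)
    show "((\<lambda>x. \<beta> (p x)) has_derivative
        (\<lambda>h. frechet_derivative p (at x) h * frechet_derivative \<beta> (at (p x)) 1)) (at x)" for x
      using has_derivative_compose[OF Ck_SucD(1)[OF Suc.prems(2)] Ck_SucD(1)[OF Suc.prems(1)], of x]
      by (subst (asm) lin)
    show "Ck k (\<lambda>x. frechet_derivative p (at x) b * frechet_derivative \<beta> (at (p x)) 1)"
      if "b \<in> Basis" for b
      by (rule Ck_mult[OF Ck_SucD(2)[OF Suc.prems(2) that]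
            Suc.IH[OF Ck_SucD(2)[OF Suc.prems(1)] Ck_lower[OF Suc.prems(2)]]]) simp
  qed
qed

lemma smoothD:
  assumes "smooth f"
  shows "(f has_derivative frechet_derivative f (at x)) (at x)"
    and "b \<in> Basis \<Longrightarrow> smooth (\<lambda>x. frechet_derivative f (at x) b)"
    and "continuous_on S f"
proof -
  have C: "Ck k f" for k using assms by (simp add: smooth_def)
  show "(f has_derivative frechet_derivative f (at x)) (at x)"
    by (rule Ck_SucD(1)[OF C[of "Suc 0"]])
  show "smooth (\<lambda>x. frechet_derivative f (at x) b)" if "b \<in> Basis"
    unfolding smooth_def using Ck_SucD(2)[OF C that] by blast
  show "continuous_on S f"
    by (rule continuous_on_subset[OF Ck_imp_continuous[OF C[of 0]]]) simp
qed

lemma smooth_add: "smooth f \<Longrightarrow> smooth g \<Longrightarrow> smooth (\<lambda>x. f x + g x)"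
  and smooth_mult: "smooth f \<Longrightarrow> smooth g \<Longrightarrow> smooth (\<lambda>x. f x * g x)"
  and smooth_const: "smooth (\<lambda>x. c)"
  by (auto simp: smooth_def Ck_add Ck_mult Ck_const)

text \<open>
  The family is closed under differentiation (up to linear combinations), so its smoothness can be
  proved by one induction that treats all exponents at once. The case \<open>n = 0\<close> is the usual smooth
  function that is flat at the origin.
\<close>

definition flat_exp :: "nat \<Rightarrow> real \<Rightarrow> real" where
  "flat_exp n t = (if t > 0 then exp (- (1 / t)) * (1 / t) ^ n else 0)"

text \<open>
  The quadratic bound gives differentiability at the origin. It is the inequality
  \<open>s ^ k / k! \<le> exp s\<close> for \<open>s = 1 / t\<close> and \<open>k = n + 2\<close>.
\<close>

lemma flat_exp_bounds:
  shows "0 \<le> flat_exp n t" and "flat_exp n t \<le> fact (n + 2) * t\<^sup>2"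
proof -
  show "0 \<le> flat_exp n t" by (simp add: flat_exp_def)
  show "flat_exp n t \<le> fact (n + 2) * t\<^sup>2"
  proof (cases "t > 0")
    case True
    define s where "s = 1 / t"
    have s: "s > 0" using True by (simp add: s_def)
    obtain r where r: "exp s = (\<Sum>m<n + 3. s ^ m / fact m) + (exp r / fact (n + 3)) * s ^ (n + 3)"
      using Maclaurin_exp_le[of s "n + 3"] by blast
    have "s ^ (n + 2) / fact (n + 2) \<le> (\<Sum>m<n + 3. s ^ m / fact m)"
      by (rule member_le_sum[of "n + 2"]) (use s in auto)
    also have "\<dots> \<le> exp s"
    proof -
      have "0 \<le> (exp r / fact (n + 3)) * s ^ (n + 3)" using s by simp
      with r show ?thesis by linarith
    qed
    finally have "s ^ (n + 2) \<le> exp s * fact (n + 2)"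
      using pos_divide_le_eq[OF fact_gt_zero] by blast
    then have "exp (- s) * (s ^ n * s\<^sup>2) \<le> exp (- s) * (exp s * fact (n + 2))"
      unfolding power_add by (rule mult_left_mono) simp
    also have "\<dots> = fact (n + 2)"
      unfolding mult.assoc[symmetric] exp_minus_inverse[of "- s", simplified] by simp
    finally have "exp (- s) * s ^ n * s\<^sup>2 \<le> fact (n + 2)"
      unfolding mult.assoc .
    moreover have "s\<^sup>2 * t\<^sup>2 = 1"
      using True by (simp add: s_def power_divide)
    ultimately have "exp (- s) * s ^ n * (s\<^sup>2 * t\<^sup>2) \<le> fact (n + 2) * t\<^sup>2"
      unfolding mult.assoc[symmetric] by (intro mult_right_mono) auto
    with \<open>s\<^sup>2 * t\<^sup>2 = 1\<close> have "exp (- s) * s ^ n \<le> fact (n + 2) * t\<^sup>2"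
      by (simp del: fact_Suc)
    then show ?thesis using True by (simp add: flat_exp_def s_def del: fact_Suc)
  qed (simp add: flat_exp_def)
qed

lemma flat_exp_deriv:
  "(flat_exp n has_real_derivative (flat_exp (n + 2) t - n * flat_exp (n + 1) t)) (at t)"
proof -
  consider "t > 0" | "t < 0" | "t = 0" by linarith
  then show ?thesis
  proof cases
    case 1
    have inv: "((\<lambda>t. 1 / t) has_real_derivative - ((1 / t)\<^sup>2)) (at t)"
      using DERIV_inverse[of t UNIV] 1 by (simp add: field_simps power2_eq_square)
    have e: "((\<lambda>t. exp (- (1 / t))) has_real_derivative exp (- (1 / t)) * (1 / t)\<^sup>2) (at t)"
      using DERIV_fun_exp[OF DERIV_minus[OF inv]] by simp
    have pw: "((\<lambda>t. (1 / t) ^ n) has_real_derivative - (real n * (1 / t) ^ (n + 1))) (at t)"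
    proof (cases n)
      case (Suc m)
      show ?thesis
        using DERIV_power[OF inv, of n] by (simp add: Suc power2_eq_square mult_ac)
    qed simp
    have "((\<lambda>t. exp (- (1 / t)) * (1 / t) ^ n) has_real_derivative
        (flat_exp (n + 2) t - n * flat_exp (n + 1) t)) (at t)"
      by (rule DERIV_cong[OF DERIV_mult[OF e pw]])
        (use 1 in \<open>simp add: flat_exp_def power_add power2_eq_square algebra_simps\<close>)
    then show ?thesis
      by (rule has_field_derivative_transform_within_open[where S = "{0<..}"])
        (use 1 in \<open>auto simp: flat_exp_def\<close>)
  next
    case 2
    have "((\<lambda>t. 0) has_real_derivative 0) (at t)" by simp
    then have "(flat_exp n has_real_derivative 0) (at t)"
      by (rule has_field_derivative_transform_within_open[where S = "{..<0}"])
        (use 2 in \<open>auto simp: flat_exp_def\<close>)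
    then show ?thesis using 2 by (simp add: flat_exp_def)
  next
    case 3
    have "((\<lambda>h. flat_exp n h / h) \<longlongrightarrow> 0) (at 0)"
    proof (rule Lim_null_comparison)
      show "((\<lambda>h::real. fact (n + 2) * \<bar>h\<bar>) \<longlongrightarrow> 0) (at 0)"
        by (auto intro!: tendsto_eq_intros)
      show "\<forall>\<^sub>F h in at 0. norm (flat_exp n h / h) \<le> fact (n + 2) * \<bar>h\<bar>"
        unfolding eventually_at_filter
      proof (intro always_eventually allI impI)
        fix h :: real assume "h \<noteq> 0"
        then show "norm (flat_exp n h / h) \<le> fact (n + 2) * \<bar>h\<bar>"
          using flat_exp_bounds[of n h]
          by (simp add: abs_mult divide_le_eq power2_eq_square mult.assoc)
      qed
    qed
    then show ?thesis using 3 by (simp add: DERIV_def flat_exp_def)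
  qed
qed

lemma Ck_flat_exp: "Ck k (flat_exp n)"
proof (induction k arbitrary: n)
  case 0
  have "isCont (flat_exp n) t" for t
    using flat_exp_deriv DERIV_isCont by blast
  then show ?case by (simp add: continuous_at_imp_continuous_on)
next
  case (Suc k)
  show ?case
  proof (rule Ck_SucI)
    show "(flat_exp n has_derivative
        (\<lambda>h. (flat_exp (n + 2) t + (- real n) * flat_exp (n + 1) t) * h)) (at t)" for t
      using flat_exp_deriv[of n t] unfolding has_field_derivative_def by simp
    show "Ck k (\<lambda>t. (flat_exp (n + 2) t + (- real n) * flat_exp (n + 1) t) * b)" for b
      by (intro Ck_mult Ck_add Ck_const Suc.IH)
  qed
qed

lemma smooth_flat_exp_compose: "smooth p \<Longrightarrow> smooth (\<lambda>x. flat_exp 0 (p x))"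
  unfolding smooth_def using Ck_compose[OF Ck_flat_exp] by blast

section \<open>Test functions\<close>

lemma smooth_inner: "smooth (\<lambda>x. x \<bullet> c)"
  by (simp add: smooth_def Ck_inner)

lemma smooth_prod: "(\<And>i. i \<in> I \<Longrightarrow> smooth (f i)) \<Longrightarrow> smooth (\<lambda>x. \<Prod>i\<in>I. f i x)"
  and smooth_sum: "(\<And>i. i \<in> I \<Longrightarrow> smooth (f i)) \<Longrightarrow> smooth (\<lambda>x. \<Sum>i\<in>I. f i x)"
  by (auto simp: smooth_def intro: Ck_prod Ck_sum)

lemma smooth_diff: "smooth f \<Longrightarrow> smooth g \<Longrightarrow> smooth (\<lambda>x. f x - g x)"
  using smooth_add[OF _ smooth_mult[OF smooth_const[of "-1"]], of f g] by simp

lemma smooth_measurable[measurable]: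
  "smooth f \<Longrightarrow> f \<in> borel_measurable borel"
  by (intro borel_measurable_continuous_onI smoothD)

lemma test_functionD:
  assumes "\<phi> \<in> test_functions \<Omega>"
  shows "smooth \<phi>" and "compact (closure {x. \<phi> x \<noteq> 0})" and "closure {x. \<phi> x \<noteq> 0} \<subseteq> \<Omega>"
  using assms by (auto simp: test_functions_def)

lemma test_function_subset: "\<phi> \<in> test_functions \<Omega> \<Longrightarrow> \<Omega> \<subseteq> \<Omega>' \<Longrightarrow> \<phi> \<in> test_functions \<Omega>'"
  by (auto simp: test_functions_def)

lemma frechet_derivative_outside_support:
  assumes "x \<notin> closure {x. \<phi> x \<noteq> (0::real)}"
  shows "frechet_derivative \<phi> (at x) = (\<lambda>_. 0)"
proof -
  have "((\<lambda>_. 0) has_derivative (\<lambda>_. 0)) (at x)" by simp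
  then have "(\<phi> has_derivative (\<lambda>_. 0)) (at x)"
    by (rule has_derivative_transform_within_open[where s = "- closure {x. \<phi> x \<noteq> 0}"])
      (use assms closure_subset[of "{x. \<phi> x \<noteq> 0}"] in auto)
  then show ?thesis using frechet_derivative_at by metis
qed

lemma partial_test_function:
  assumes "\<phi> \<in> test_functions \<Omega>" and "b \<in> Basis"
  shows "(\<lambda>x. frechet_derivative \<phi> (at x) b) \<in> test_functions \<Omega>"
proof -
  have sub: "{x. frechet_derivative \<phi> (at x) b \<noteq> 0} \<subseteq> closure {x. \<phi> x \<noteq> 0}"
    using frechet_derivative_outside_support by fastforce
  from sub have "closure {x. frechet_derivative \<phi> (at x) b \<noteq> 0} \<subseteq> closure {x. \<phi> x \<noteq> 0}"
    by (simp add: closure_minimal)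
  moreover have "bounded {x. frechet_derivative \<phi> (at x) b \<noteq> 0}"
    using test_functionD(2)[OF assms(1)] sub
    by (meson bounded_subset compact_imp_bounded)
  ultimately show ?thesis
    using test_functionD(3)[OF assms(1)] smoothD(2)[OF test_functionD(1)[OF assms(1)] assms(2)]
    unfolding test_functions_def by auto
qed

lemma test_function_bounded:
  assumes "\<phi> \<in> test_functions \<Omega>"
  obtains C where "C \<ge> 0" "\<And>x. \<bar>\<phi> x\<bar> \<le> C"
proof -
  have "compact (\<phi> ` closure {x. \<phi> x \<noteq> 0})"
    by (intro compact_continuous_image smoothD(3) test_functionD[OF assms])
  then obtain C where C: "\<And>y. y \<in> \<phi> ` closure {x. \<phi> x \<noteq> 0} \<Longrightarrow> norm y \<le> C"
    using compact_imp_bounded bounded_iff by metis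
  have "\<bar>\<phi> x\<bar> \<le> \<bar>C\<bar>" for x
  proof (cases "\<phi> x = 0")
    case False
    then have "x \<in> closure {x. \<phi> x \<noteq> 0}" using closure_subset by fastforce
    then show ?thesis using C[of "\<phi> x"] by force
  qed simp
  then show ?thesis using that[of "\<bar>C\<bar>"] by simp
qed

text \<open>
  Positive exactly on the open box, with values below 1 that tend to 1 there as \<open>k\<close> grows: test
  functions that approximate the indicator of a box.
\<close>

definition box_bump :: "'a::euclidean_space \<Rightarrow> 'a \<Rightarrow> nat \<Rightarrow> 'a \<Rightarrow> real" where
  "box_bump a c k x = (\<Prod>b\<in>Basis. flat_exp 0 (real (Suc k) * (x \<bullet> b - a \<bullet> b))
      * flat_exp 0 (real (Suc k) * (c \<bullet> b - x \<bullet> b)))"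

lemma smooth_box_bump: "smooth (box_bump a c k)"
  unfolding box_bump_def
  by (intro smooth_prod smooth_mult smooth_flat_exp_compose smooth_diff smooth_const smooth_inner)

lemma flat_exp_0: "flat_exp 0 t \<noteq> 0 \<longleftrightarrow> t > 0" "0 \<le> flat_exp 0 t" "flat_exp 0 t \<le> 1"
  by (auto simp: flat_exp_def)

lemma box_bump_nonzero: "box_bump a c k x \<noteq> 0 \<longleftrightarrow> x \<in> box a c"
proof -
  have "flat_exp 0 (real (Suc k) * t) \<noteq> 0 \<longleftrightarrow> t > 0" for t
    by (subst flat_exp_0) (simp add: zero_less_mult_iff)
  then show ?thesis
    unfolding box_bump_def mem_box by (auto simp del: of_nat_Suc)
qed

lemma box_bump_bounds: "0 \<le> box_bump a c k x" "box_bump a c k x \<le> 1"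
  unfolding box_bump_def
  by (auto intro!: prod_nonneg prod_le_1 mult_le_one mult_nonneg_nonneg flat_exp_0)

lemma box_bump_test:
  assumes "cbox a c \<subseteq> \<Omega>"
  shows "box_bump a c k \<in> test_functions \<Omega>"
proof -
  have "closure {x. box_bump a c k x \<noteq> 0} \<subseteq> cbox a c"
    unfolding box_bump_nonzero by (rule closure_minimal) (auto simp: box_subset_cbox)
  then show ?thesis
    unfolding test_functions_def using assms smooth_box_bump
    by (auto simp: box_bump_nonzero)
qed

lemma box_bump_tendsto: "(\<lambda>k. box_bump a c k x) \<longlonglongrightarrow> indicator (box a c) x"
proof (cases "x \<in> box a c")
  case False
  then have "box_bump a c k x = 0" for k using box_bump_nonzero by metis
  then show ?thesis using False by simp
next
  case True
  have lim: "(\<lambda>k. flat_exp 0 (real (Suc k) * t)) \<longlonglongrightarrow> 1" if "t > 0" for t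
  proof -
    have eq: "flat_exp 0 (real (Suc k) * t) = exp (- ((1 / real (Suc k)) * (1 / t)))" for k
      using that by (simp add: flat_exp_def zero_less_mult_iff del: of_nat_Suc)
    have "(\<lambda>k. exp (- ((1 / real (Suc k)) * (1 / t)))) \<longlonglongrightarrow> exp (- (0 * (1 / t)))"
      by (intro tendsto_intros LIMSEQ_Suc[OF lim_1_over_n])
    then show ?thesis unfolding eq by simp
  qed
  have "(\<lambda>k. box_bump a c k x) \<longlonglongrightarrow> (\<Prod>b\<in>(Basis::'a set). 1 * 1)"
    unfolding box_bump_def using True
    by (intro tendsto_prod tendsto_mult lim) (auto simp: mem_box)
  then show ?thesis using True by simp
qed

section \<open>The fundamental lemma of the calculus of variations\<close>

text \<open>
  By Lindelof, countably many of the neighbourhoods cover \<open>\<Omega>\<close>. Many statements below are first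
  proved near each point; this passes to almost every point.
\<close>

lemma AE_on_open_locally:
  fixes \<Omega> :: "'a::second_countable_topology set"
  assumes "\<And>x. x \<in> \<Omega> \<Longrightarrow> \<exists>V. open V \<and> x \<in> V \<and> (AE y in M. y \<in> V \<longrightarrow> P y)"
  shows "AE y in M. y \<in> \<Omega> \<longrightarrow> P y"
proof -
  obtain V where V: "\<And>x. x \<in> \<Omega> \<Longrightarrow> open (V x) \<and> x \<in> V x \<and> (AE y in M. y \<in> V x \<longrightarrow> P y)"
    using assms by metis
  then have "\<And>S. S \<in> V ` \<Omega> \<Longrightarrow> open S" by auto
  then obtain F where F: "F \<subseteq> V ` \<Omega>" "countable F" "\<Union>F = \<Union>(V ` \<Omega>)"
    by (rule Lindelof)
  have "AE y in M. \<forall>S\<in>F. y \<in> S \<longrightarrow> P y"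
    using F V by (subst AE_ball_countable) auto
  then show ?thesis
  proof eventually_elim
    case (elim y)
    show ?case
    proof
      assume "y \<in> \<Omega>"
      then have "y \<in> \<Union>F" using V F(3) by auto
      then show "P y" using elim by blast
    qed
  qed
qed

lemma Lp_2_iff: "g \<in> Lp M 2 \<longleftrightarrow> g \<in> borel_measurable M \<and> integrable M (\<lambda>x. (g x)\<^sup>2)"
  by (simp add: Lp_def)

text \<open>
  Boxes form an intersection-stable generator of the Borel sets, so vanishing of the integral
  passes from boxes to all Borel sets; the bounding box serves for complements.
\<close>

lemma AE_lborel_zero_if_box_integrals_zero:
  fixes q :: "'a::euclidean_space \<Rightarrow> real"
  assumes q: "integrable lborel q"
    and box: "\<And>a c. (LINT x|lborel. indicator (box a c) x * q x) = 0"
    and supp: "\<And>x. x \<notin> box a0 c0 \<Longrightarrow> q x = 0"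
  shows "AE x in lborel. q x = 0"
proof (rule density_unique_real[OF q integrable_zero])
  fix A :: "'a set" assume "A \<in> sets lborel"
  then have A: "A \<in> sigma_sets UNIV (range (\<lambda>(a, c). box a c))"
    by (simp add: borel_eq_box)
  have stable: "Int_stable (range (\<lambda>(a, c). box a c :: 'a set))"
  proof (rule Int_stableI)
    fix A B :: "'a set"
    assume "A \<in> range (\<lambda>(a, c). box a c)" "B \<in> range (\<lambda>(a, c). box a c)"
    then obtain a c a' c' where "A = box a c" "B = box a' c'" by auto
    then show "A \<inter> B \<in> range (\<lambda>(a, c). box a c)" by (auto simp: box_Int_box)
  qed
  have "A \<in> sets borel \<and> set_lebesgue_integral lborel A q = 0"
    using stable subset_UNIV[of "range (\<lambda>(a, c). box a c)", folded Pow_UNIV] A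
  proof (induction rule: sigma_sets_induct_disjoint)
    case (basic A)
    then show ?case using box by (auto simp: set_lebesgue_integral_def)
  next
    case empty
    then show ?case by (simp add: set_lebesgue_integral_def)
  next
    case (compl A)
    have "(LINT x|lborel. q x) = (LINT x|lborel. indicator (box a0 c0) x * q x)"
      by (rule Bochner_Integration.integral_cong) (auto simp: indicator_def supp)
    then have 0: "(LINT x|lborel. q x) = 0" using box by simp
    have "set_lebesgue_integral lborel (UNIV - A) q = (LINT x|lborel. q x - indicator A x * q x)"
      unfolding set_lebesgue_integral_def
      by (rule Bochner_Integration.integral_cong) (auto simp: indicator_def)
    also have "\<dots> = 0"
      using compl 0 q integrable_mult_indicator[of A lborel q]
      by (subst Bochner_Integration.integral_diff) (auto simp: set_lebesgue_integral_def)
    finally show ?case using compl by auto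
  next
    case (union A)
    have "set_integrable lborel (\<Union>i. A i) q"
      using q union by (intro integrable_mult_indicator[folded set_integrable_def]) auto
    then have "set_lebesgue_integral lborel (\<Union>i. A i) q = (\<Sum>i. set_lebesgue_integral lborel (A i) q)"
      using union by (intro lebesgue_integral_countable_add) (auto simp: disjoint_family_on_def)
    then show ?case using union by auto
  qed
  then show "set_lebesgue_integral lborel A q = set_lebesgue_integral lborel A (\<lambda>_. 0)"
    by (simp add: set_lebesgue_integral_def)
qed

lemma integral_lebesgue_on:
  fixes f :: "'a::euclidean_space \<Rightarrow> real"
  assumes "\<Omega> \<in> sets lebesgue"
  shows "(LINT x|lebesgue_on \<Omega>. f x) = (LINT x|lebesgue. indicator \<Omega> x * f x)"
  using assms by (simp add: integral_restrict_space)

text \<open>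
  Locally \<open>q\<close> is integrable, and the box bumps turn the hypothesis on test functions into vanishing
  integrals over all small boxes.
\<close>

lemma fundamental_lemma:
  fixes q :: "'a::euclidean_space \<Rightarrow> real"
  assumes "open \<Omega>" and q: "q \<in> Lp (lebesgue_on \<Omega>) 2"
    and zero: "\<And>\<phi>. \<phi> \<in> test_functions \<Omega> \<Longrightarrow> (LINT x|lebesgue_on \<Omega>. q x * \<phi> x) = 0"
  shows "AE x in lebesgue. x \<in> \<Omega> \<longrightarrow> q x = 0"
proof (rule AE_on_open_locally)
  fix x assume "x \<in> \<Omega>"
  then obtain a c where ac: "x \<in> box a c" "cbox a c \<subseteq> \<Omega>"
    using open_contains_cbox[of \<Omega>] \<open>open \<Omega>\<close> by (metis)
  have \<Omega>: "\<Omega> \<in> sets lebesgue" using \<open>open \<Omega>\<close> by simp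
  have "(\<lambda>x. indicator \<Omega> x * q x) \<in> borel_measurable lebesgue"
    using q \<Omega> borel_measurable_restrict_space_iff[of \<Omega> lebesgue q]
    by (simp add: Lp_2_iff)
  then obtain r where r: "r \<in> borel_measurable lborel" "AE x in lborel. indicator \<Omega> x * q x = r x"
    using completion_ex_borel_measurable_real[of "\<lambda>x. indicator \<Omega> x * q x" lborel] by auto
  then have r': "AE x in lebesgue. indicator \<Omega> x * q x = r x"
    by (simp add: AE_completion)
  \<comment> \<open>A Borel representative of the restriction to one box with closure inside the domain.\<close>
  define p where "p x = indicator (box a c) x * r x" for x
  have [measurable]: "r \<in> borel_measurable borel" using r by simp
  have [measurable]: "p \<in> borel_measurable borel" unfolding p_def by measurable
  have q2: "integrable lebesgue (\<lambda>x. indicator \<Omega> x * (q x)\<^sup>2)"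
    using q \<Omega> by (simp add: Lp_2_iff integrable_restrict_space)
  have "integrable lebesgue (\<lambda>x. (r x)\<^sup>2)"
  proof (rule integrable_cong_AE_imp[OF q2])
    show "(\<lambda>x. (r x)\<^sup>2) \<in> borel_measurable lebesgue"
      by (intro measurable_completion) simp
    show "AE x in lebesgue. indicator \<Omega> x * (q x)\<^sup>2 = (r x)\<^sup>2"
      using r'
    proof eventually_elim
      case (elim x)
      show ?case unfolding elim[symmetric] by (simp add: indicator_def)
    qed
  qed
  then have r2: "integrable lborel (\<lambda>x. (r x)\<^sup>2)"
    by (subst (asm) integrable_completion) auto
  have int_p: "integrable lborel p"
  proof (rule Bochner_Integration.integrable_bound)
    show "integrable lborel (\<lambda>x. indicator (box a c) x + (r x)\<^sup>2)"
      by (intro Bochner_Integration.integrable_add r2 integrable_real_indicator)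
         (auto simp: emeasure_lborel_box_eq)
    have "\<bar>t\<bar> \<le> 1 + t\<^sup>2" for t :: real
      using zero_le_power2[of "\<bar>t\<bar> - 1"] by (simp add: power2_diff)
    then show "AE x in lborel. norm (p x) \<le> norm (indicator (box a c) x + (r x)\<^sup>2)"
      by (intro AE_I2) (auto simp: p_def indicator_def)
  qed measurable
  have "AE x in lborel. p x = 0"
  proof (rule AE_lborel_zero_if_box_integrals_zero[OF int_p])
    show "p x = 0" if "x \<notin> box a c" for x using that by (simp add: p_def)
    fix a' c'
    obtain d e where de: "box a c \<inter> box a' c' = box d e"
      by (rule that) (rule box_Int_box)
    show "(LINT x|lborel. indicator (box a' c') x * p x) = 0"
    proof (cases "box d e = {}")
      case True
      then have "x \<notin> box a c \<or> x \<notin> box a' c'" for x using de by blast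
      then have "indicator (box a' c') x * p x = 0" for x
        unfolding p_def by (metis indicator_simps(2) mult_zero_left mult_zero_right)
      then show ?thesis by (simp only: integral_zero)
    next
      case False
      have sub: "cbox d e \<subseteq> \<Omega>"
      proof -
        have "closure (box d e) \<subseteq> closure (box a c)"
          unfolding de[symmetric] by (rule closure_mono) (rule Int_lower1)
        moreover have ne: "box a c \<noteq> {}" using ac(1) by blast
        ultimately have "cbox d e \<subseteq> cbox a c"
          unfolding closure_box[OF False] closure_box[OF ne] by blast
        then show ?thesis using ac(2) by (rule order_trans)
      qed
      have "(\<lambda>k. LINT x|lborel. box_bump d e k x * p x)
          \<longlonglongrightarrow> (LINT x|lborel. indicator (box d e) x * p x)"
      proof (rule integral_dominated_convergence[where w = "\<lambda>x. norm (p x)"])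
        show "AE x in lborel. (\<lambda>k. box_bump d e k x * p x) \<longlonglongrightarrow> indicator (box d e) x * p x"
          by (intro AE_I2 tendsto_mult box_bump_tendsto tendsto_const)
        show "AE x in lborel. norm (box_bump d e k x * p x) \<le> norm (p x)" for k
          using box_bump_bounds[of d e k] by (intro AE_I2) (simp add: abs_mult mult_left_le_one_le)
      qed (use int_p smooth_measurable[OF smooth_box_bump] in \<open>auto intro!: borel_measurable_times\<close>)
      moreover have "(LINT x|lborel. box_bump d e k x * p x) = 0" for k
      proof -
        have "(LINT x|lborel. box_bump d e k x * p x) = (LINT x|lebesgue. box_bump d e k x * p x)"
          using smooth_measurable[OF smooth_box_bump[of d e k]]
          by (intro integral_completion[symmetric]) simp
        also have "\<dots> = (LINT x|lebesgue. indicator \<Omega> x * (q x * box_bump d e k x))"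
        proof (rule integral_cong_AE)
          show "AE x in lebesgue. box_bump d e k x * p x = indicator \<Omega> x * (q x * box_bump d e k x)"
            using r'
          proof eventually_elim
            case (elim x)
            show ?case
            proof (cases "x \<in> box d e")
              case True
              then have "x \<in> box a c" using de by blast
              moreover have "x \<in> \<Omega>" using True sub box_subset_cbox by blast
              ultimately show ?thesis using elim by (simp add: p_def)
            next
              case False
              then have "box_bump d e k x = 0" using box_bump_nonzero by blast
              then show ?thesis by simp
            qed
          qed
          show "(\<lambda>x. box_bump d e k x * p x) \<in> borel_measurable lebesgue"
            using smooth_measurable[OF smooth_box_bump[of d e k]]
            by (intro measurable_completion) simp
          show "(\<lambda>x. indicator \<Omega> x * (q x * box_bump d e k x)) \<in> borel_measurable lebesgue"
            using borel_measurable_times[OF \<open>(\<lambda>x. indicator \<Omega> x * q x) \<in> borel_measurable lebesgue\<close>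
              measurable_completion[of "box_bump d e k" lborel borel]]
              smooth_measurable[OF smooth_box_bump[of d e k]]
            by (simp add: mult.assoc)
        qed
        also have "\<dots> = 0"
          using zero[OF box_bump_test[OF sub]] by (simp add: integral_lebesgue_on[OF \<Omega>])
        finally show ?thesis .
      qed
      ultimately have "(LINT x|lborel. indicator (box d e) x * p x) = 0"
        by (simp add: LIMSEQ_const_iff)
      moreover have "indicator (box d e) x * p x = indicator (box a' c') x * p x" for x
        unfolding de[symmetric] by (simp add: p_def indicator_def)
      ultimately show ?thesis by simp
    qed
  qed
  then have "AE x in lebesgue. p x = 0" by (simp add: AE_completion)
  with r' have "AE y in lebesgue. y \<in> box a c \<longrightarrow> q y = 0"
  proof eventually_elim
    case (elim y)
    show ?case using elim ac box_subset_cbox[of a c] by (auto simp: p_def indicator_def)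
  qed
  then show "\<exists>V. open V \<and> x \<in> V \<and> (AE y in lebesgue. y \<in> V \<longrightarrow> q y = 0)"
    using ac by (intro exI[of _ "box a c"]) auto
qed

section \<open>Convolution\<close>

text \<open>
  Differentiation under the integral sign, with the derivative falling on the kernel; this is why
  convolution inherits the smoothness of the kernel.
\<close>

lemma has_derivative_convolution:
  fixes w :: "'a::euclidean_space \<Rightarrow> real"
  assumes w: "continuous_on (cbox a c) w" and \<kappa>: "Ck (Suc 0) \<kappa>"
  shows "((\<lambda>x. integral (cbox a c) (\<lambda>t. w t * \<kappa> (x - t))) has_derivative
    (\<lambda>h. integral (cbox a c) (\<lambda>t. w t * frechet_derivative \<kappa> (at (x - t)) h))) (at x)"
proof -
  define fx where "fx x t = (\<Sum>b\<in>Basis. (w t * frechet_derivative \<kappa> (at (x - t)) b) *\<^sub>R blinfun_inner_left b)"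
    for x t :: 'a
  have fx: "blinfun_apply (fx x t) h = w t * frechet_derivative \<kappa> (at (x - t)) h" for x t h
  proof -
    have lin: "linear (frechet_derivative \<kappa> (at (x - t)))"
      by (rule has_derivative_linear[OF Ck_SucD(1)[OF \<kappa>]])
    have "frechet_derivative \<kappa> (at (x - t)) h
        = frechet_derivative \<kappa> (at (x - t)) (\<Sum>b\<in>Basis. (h \<bullet> b) *\<^sub>R b)"
      by (simp add: euclidean_representation)
    also have "\<dots> = (\<Sum>b\<in>Basis. (h \<bullet> b) * frechet_derivative \<kappa> (at (x - t)) b)"
      using lin by (simp add: linear_sum linear_scale)
    finally show ?thesis
      by (simp add: fx_def blinfun.sum_left blinfun.scaleR_left sum_distrib_left inner_commute mult_ac)
  qed
  have cont1: "continuous_on UNIV (\<lambda>x. frechet_derivative \<kappa> (at x) b)" if "b \<in> Basis" for b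
    using Ck_SucD(2)[OF \<kappa> that] by simp
  have cont2: "continuous_on (UNIV \<times> cbox a c) (\<lambda>(x, t). fx x t)"
    unfolding fx_def split_beta
    by (intro continuous_intros continuous_on_compose2[OF w] continuous_on_compose2[OF cont1]) auto
  have int: "(\<lambda>t. w t * \<kappa> (x - t)) integrable_on cbox a c" for x
    by (intro integrable_continuous continuous_intros w
        continuous_on_compose2[OF Ck_imp_continuous[OF \<kappa>]]) auto
  have "((\<lambda>x. integral (cbox a c) (\<lambda>t. w t * \<kappa> (x - t))) has_derivative
      blinfun_apply (integral (cbox a c) (fx x))) (at x within UNIV)"
  proof (rule leibniz_rule)
    show "((\<lambda>x. w t * \<kappa> (x - t)) has_derivative blinfun_apply (fx x t)) (at x within UNIV)" for x t
    proof -
      have "((\<lambda>x. \<kappa> (x - t)) has_derivative frechet_derivative \<kappa> (at (x - t))) (at x)"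
        using has_derivative_compose[OF has_derivative_diff[OF has_derivative_ident has_derivative_const]
            Ck_SucD(1)[OF \<kappa>], of t x] by simp
      then show ?thesis unfolding fx[abs_def] by (intro has_derivative_mult_right) simp
    qed
  qed (use int cont2 in auto)
  moreover have "blinfun_apply (integral (cbox a c) (fx x))
      = (\<lambda>h. integral (cbox a c) (\<lambda>t. w t * frechet_derivative \<kappa> (at (x - t)) h))"
  proof
    fix h
    have "fx x integrable_on cbox a c"
      by (intro integrable_continuous continuous_on_compose2[OF cont2, of _ "\<lambda>t. (x, t)", simplified])
         (auto intro!: continuous_intros)
    then have "integral (cbox a c) ((\<lambda>B. blinfun_apply B h) \<circ> fx x)
        = blinfun_apply (integral (cbox a c) (fx x)) h"
      by (rule integral_linear) (rule blinfun.bounded_linear_left)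
    then show "blinfun_apply (integral (cbox a c) (fx x)) h
        = integral (cbox a c) (\<lambda>t. w t * frechet_derivative \<kappa> (at (x - t)) h)"
      by (simp add: o_def fx)
  qed
  ultimately show ?thesis by simp
qed

lemma Ck_convolution:
  fixes w :: "'a::euclidean_space \<Rightarrow> real"
  assumes w: "continuous_on (cbox a c) w" and "Ck k \<kappa>"
  shows "Ck k (\<lambda>x. integral (cbox a c) (\<lambda>t. w t * \<kappa> (x - t)))"
  using assms(2)
proof (induction k arbitrary: \<kappa>)
  case 0
  then have \<kappa>: "continuous_on UNIV \<kappa>" by simp
  have "continuous_on (UNIV \<times> cbox a c) (\<lambda>(x, t). w t * \<kappa> (x - t))"
    unfolding split_beta
    by (intro continuous_intros continuous_on_compose2[OF w] continuous_on_compose2[OF \<kappa>]) auto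
  then show ?case by (simp add: integral_continuous_on_param)
next
  case (Suc k)
  have C1: "Ck (Suc 0) \<kappa>"
    by (rule Ck_SucI[OF Ck_SucD(1)[OF Suc.prems]])
      (simp add: Ck_imp_continuous[OF Ck_SucD(2)[OF Suc.prems]])
  show ?case
    by (rule Ck_SucI[OF has_derivative_convolution[OF w C1] Suc.IH[OF Ck_SucD(2)[OF Suc.prems]]])
qed

lemma lborel_integral_translate:
  fixes f :: "'a::euclidean_space \<Rightarrow> real"
  assumes [measurable]: "f \<in> borel_measurable borel"
  shows "(LINT x|lborel. f (c + x)) = (LINT x|lborel. f x)"
proof -
  have "(LINT x|lborel. f x) = (LINT x|distr lborel borel ((+) c). f x)"
    by (simp add: lborel_distr_plus)
  also have "\<dots> = (LINT x|lborel. f (c + x))" by (subst integral_distr) auto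
  finally show ?thesis by simp
qed

section \<open>Almost everywhere differentiability of minima and distances\<close>

text \<open>
  A zero that is isolated in direction \<open>b\<close> is a rare event. The set of such zeros for which the
  isolation radius is controlled by \<open>n\<close> has infinitely many pairwise disjoint translates in
  direction \<open>b\<close> inside one ball, so it is null. This elementary fact takes the place of
  Rademacher's theorem below: all Lipschitz functions that occur are built from differentiable ones
  by minima and Euclidean norms, and can only fail to be differentiable at such isolated zeros.
\<close>

lemma AE_not_isolated_zero_along:
  fixes g :: "'a::euclidean_space \<Rightarrow> real"
  assumes [measurable]: "g \<in> borel_measurable borel" and "b \<noteq> 0"
  shows "AE x in lborel. g x = 0 \<longrightarrow> \<not> (\<exists>\<delta>>0. \<forall>t. 0 < \<bar>t\<bar> \<and> \<bar>t\<bar> < \<delta> \<longrightarrow> g (x + t *\<^sub>R b) \<noteq> 0)"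
proof -
  define s where "s j = 1 / real (Suc j)" for j
  define E where "E n = {x. norm x \<le> real n \<and> g x = 0 \<and>
      (\<forall>j\<ge>n. \<forall>k\<ge>n. j \<noteq> k \<longrightarrow> g (x + (s j - s k) *\<^sub>R b) \<noteq> 0)}" for n
  have E_meas[measurable]: "E n \<in> sets borel" for n
    unfolding E_def by measurable
  have "emeasure lborel (E n) = 0" for n
  proof -
    \<comment> \<open>The translates by the numbers \<open>s j\<close>; a common point of two of them would be a zero that violates isolation.\<close>
    define A where "A j = (+) (- (s j *\<^sub>R b)) -` E n" for j
    have A_meas: "A j \<in> sets borel" for j
      unfolding A_def using measurable_sets_borel[of "(+) (- (s j *\<^sub>R b))" borel "E n"] by simp
    have A_emeasure: "emeasure lborel (A j) = emeasure lborel (E n)" for j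
    proof -
      have "emeasure lborel (E n) = emeasure (distr lborel borel ((+) (- (s j *\<^sub>R b)))) (E n)"
        by (simp add: lborel_distr_plus)
      also have "\<dots> = emeasure lborel (A j)"
        by (subst emeasure_distr) (auto simp: A_def)
      finally show ?thesis by simp
    qed
    have disj: "disjoint_family_on A {n..<n + N}" for N
      unfolding disjoint_family_on_def
    proof (intro ballI impI)
      fix j k assume jk: "j \<in> {n..<n + N}" "k \<in> {n..<n + N}" "j \<noteq> k"
      show "A j \<inter> A k = {}"
      proof (rule ccontr)
        assume "A j \<inter> A k \<noteq> {}"
        then obtain y where y: "y - s j *\<^sub>R b \<in> E n" "y - s k *\<^sub>R b \<in> E n"
          by (auto simp: A_def)
        have "g ((y - s j *\<^sub>R b) + (s j - s k) *\<^sub>R b) \<noteq> 0"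
          using y(1) jk unfolding E_def by auto
        moreover have "(y - s j *\<^sub>R b) + (s j - s k) *\<^sub>R b = y - s k *\<^sub>R b"
          by (simp add: algebra_simps)
        ultimately show False using y(2) by (simp add: E_def)
      qed
    qed
    have sub: "(\<Union>j\<in>{n..<n + N}. A j) \<subseteq> cball 0 (real n + norm b)" for N
    proof safe
      fix j y assume "y \<in> A j"
      then have "norm (y - s j *\<^sub>R b) \<le> real n" by (simp add: A_def E_def)
      moreover have "norm (s j *\<^sub>R b) \<le> norm b"
      proof -
        have "0 \<le> s j" "s j \<le> 1" by (simp_all add: s_def)
        then show ?thesis by (simp add: mult_left_le_one_le)
      qed
      ultimately have "norm y \<le> real n + norm b"
        using norm_triangle_sub[of y "s j *\<^sub>R b"] by simp
      then show "y \<in> cball 0 (real n + norm b)" by simp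
    qed
    define M where "M = measure lborel (cball (0::'a) (real n + norm b))"
    have fin: "emeasure lborel (cball (0::'a) (real n + norm b)) = ennreal M"
      unfolding M_def by (rule emeasure_eq_ennreal_measure) (rule less_imp_neq[OF emeasure_lborel_cball_finite, unfolded infinity_ennreal_def])
    have bd: "of_nat N * emeasure lborel (E n) \<le> ennreal M" for N
    proof -
      have "of_nat N * emeasure lborel (E n) = (\<Sum>j\<in>{n..<n + N}. emeasure lborel (A j))"
        by (simp add: A_emeasure)
      also have "\<dots> = emeasure lborel (\<Union>j\<in>{n..<n + N}. A j)"
        by (rule sum_emeasure) (use A_meas disj in auto)
      also have "\<dots> \<le> ennreal M"
        unfolding fin[symmetric] by (rule emeasure_mono[OF sub]) simp
      finally show ?thesis .
    qed
    obtain e where e: "emeasure lborel (E n) = ennreal e" "e \<ge> 0"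
      using bd[of 1] by (cases "emeasure lborel (E n)") (auto simp: top_unique)
    \<comment> \<open>Arbitrarily many disjoint copies of the same measure fit into a set of measure \<open>M\<close>.\<close>
    have "real N * e \<le> M" for N
      using bd[of N] e
      by (simp add: ennreal_of_nat_eq_real_of_nat ennreal_mult[symmetric] M_def)
    then have "e = 0"
      using e(2) reals_Archimedean3[of e] by (metis less_le_not_le linorder_neqE_linordered_idom not_less)
    then show ?thesis using e by simp
  qed
  then have "AE x in lborel. \<forall>n. x \<notin> E n"
    by (subst AE_all_countable) (auto intro!: AE_not_in simp: null_sets_def)
  then show ?thesis
  proof eventually_elim
    case (elim x)
    show ?case
    proof (intro impI notI)
      assume g0: "g x = 0" and "\<exists>\<delta>>0. \<forall>t. 0 < \<bar>t\<bar> \<and> \<bar>t\<bar> < \<delta> \<longrightarrow> g (x + t *\<^sub>R b) \<noteq> 0"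
      then obtain \<delta> where \<delta>: "\<delta> > 0" "\<And>t. 0 < \<bar>t\<bar> \<Longrightarrow> \<bar>t\<bar> < \<delta> \<Longrightarrow> g (x + t *\<^sub>R b) \<noteq> 0" by blast
      obtain n1 where n1: "norm x \<le> real n1" using real_arch_simple by blast
      obtain n2 where n2: "s n2 < \<delta>" "0 < s n2"
        using reals_Archimedean[OF \<delta>(1)] by (auto simp: s_def inverse_eq_divide)
      define n where "n = max n1 n2"
      have small: "0 < s j \<and> s j < \<delta>" if "j \<ge> n" for j
      proof -
        have "s j \<le> s n2" using that by (simp add: s_def n_def frac_le)
        then show ?thesis using n2 by (simp add: s_def)
      qed
      have "g (x + (s j - s k) *\<^sub>R b) \<noteq> 0" if "j \<ge> n" "k \<ge> n" "j \<noteq> k" for j k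
      proof (rule \<delta>(2))
        show "0 < \<bar>s j - s k\<bar>" using that by (simp add: s_def)
        show "\<bar>s j - s k\<bar> < \<delta>" using small[OF that(1)] small[OF that(2)] by auto
      qed
      then have "x \<in> E n" using g0 n1 by (simp add: E_def n_def)
      with elim show False by blast
    qed
  qed
qed

definition isolated_zero :: "('a::real_normed_vector \<Rightarrow> real) \<Rightarrow> 'a \<Rightarrow> 'a \<Rightarrow> bool" where
  "isolated_zero g b x \<longleftrightarrow> g x = 0 \<and> (\<exists>\<delta>>0. \<forall>t. 0 < \<bar>t\<bar> \<and> \<bar>t\<bar> < \<delta> \<longrightarrow> g (x + t *\<^sub>R b) \<noteq> 0)"

lemma AE_not_isolated_zero:
  fixes g :: "'a::euclidean_space \<Rightarrow> real"
  assumes "g \<in> borel_measurable borel"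
  shows "AE x in lborel. \<forall>b\<in>Basis. \<not> isolated_zero g b x"
proof -
  have "AE x in lborel. \<not> isolated_zero g b x" if "b \<in> Basis" for b
    using AE_not_isolated_zero_along[OF assms nonzero_Basis[OF that]]
    unfolding isolated_zero_def by eventually_elim blast
  then show ?thesis
    unfolding AE_ball_countable[OF countable_finite[OF finite_Basis]] by blast
qed

text \<open>
  To first order \<open>f (x + t b) - f x\<close> is \<open>t D b\<close>, which does not vanish for \<open>t \<noteq> 0\<close>.
\<close>

lemma nonzero_derivative_isolates_zero:
  fixes f :: "'a::real_normed_vector \<Rightarrow> 'b::real_normed_vector"
  assumes f: "(f has_derivative D) (at x)" and "D b \<noteq> 0"
  shows "\<exists>\<delta>>0. \<forall>t. 0 < \<bar>t\<bar> \<and> \<bar>t\<bar> < \<delta> \<longrightarrow> f (x + t *\<^sub>R b) \<noteq> f x"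
proof -
  have lin: "linear D" using f by (rule has_derivative_linear)
  have "b \<noteq> 0" using assms(2) linear_0[OF lin] by auto
  define e where "e = norm (D b) / (2 * norm b)"
  have "e > 0" using assms(2) \<open>b \<noteq> 0\<close> by (simp add: e_def)
  then obtain d where d: "d > 0"
    "\<And>y. norm (y - x) < d \<Longrightarrow> norm (f y - f x - D (y - x)) \<le> e * norm (y - x)"
    using f unfolding has_derivative_at_alt by meson
  show ?thesis
  proof (intro exI[of _ "d / norm b"] conjI allI impI notI)
    show "0 < d / norm b" using d(1) \<open>b \<noteq> 0\<close> by simp
    fix t assume t: "0 < \<bar>t\<bar> \<and> \<bar>t\<bar> < d / norm b" and eq: "f (x + t *\<^sub>R b) = f x"
    have "norm ((x + t *\<^sub>R b) - x) < d" using t \<open>b \<noteq> 0\<close> by (simp add: pos_less_divide_eq)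
    from d(2)[OF this] eq have "\<bar>t\<bar> * norm (D b) \<le> e * (\<bar>t\<bar> * norm b)"
      by (simp add: linear_scale[OF lin])
    also have "\<dots> = \<bar>t\<bar> * (norm (D b) / 2)" using \<open>b \<noteq> 0\<close> by (simp add: e_def)
    finally show False using t assms(2) by (simp add: mult_le_0_iff)
  qed
qed

lemma has_derivative_min_same:
  fixes f g :: "'a::real_normed_vector \<Rightarrow> real"
  assumes "(f has_derivative D) (at x)" "(g has_derivative D) (at x)" "f x = g x"
  shows "((\<lambda>y. min (f y) (g y)) has_derivative D) (at x)"
  unfolding has_derivative_at_alt
proof (intro conjI allI impI)
  show "bounded_linear D" using assms(1) by (rule has_derivative_bounded_linear)
  fix e :: real assume "e > 0"
  obtain d1 where d1: "d1 > 0"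
    "\<And>y. norm (y - x) < d1 \<Longrightarrow> norm (f y - f x - D (y - x)) \<le> e * norm (y - x)"
    using assms(1)[unfolded has_derivative_at_alt] \<open>e > 0\<close> by blast
  obtain d2 where d2: "d2 > 0"
    "\<And>y. norm (y - x) < d2 \<Longrightarrow> norm (g y - g x - D (y - x)) \<le> e * norm (y - x)"
    using assms(2)[unfolded has_derivative_at_alt] \<open>e > 0\<close> by blast
  have "norm (min (f y) (g y) - min (f x) (g x) - D (y - x)) \<le> e * norm (y - x)"
    if "norm (y - x) < min d1 d2" for y
  proof -
    have "min (f y) (g y) - min (f x) (g x) = f y - f x \<or> min (f y) (g y) - min (f x) (g x) = g y - g x"
      using assms(3) by linarith
    then show ?thesis using d1(2)[of y] d2(2)[of y] that by fastforce
  qed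
  then show "\<exists>d>0. \<forall>y. norm (y - x) < d \<longrightarrow>
      norm (min (f y) (g y) - min (f x) (g x) - D (y - x)) \<le> e * norm (y - x)"
    using d1(1) d2(1) by (intro exI[of _ "min d1 d2"]) simp
qed

lemma borel_measurable_extend_by:
  fixes f :: "'a::topological_space \<Rightarrow> real"
  assumes "open V" "continuous_on V f"
  shows "(\<lambda>x. if x \<in> V then f x else c) \<in> borel_measurable borel"
  using assms by (intro borel_measurable_continuous_on_if) auto

text \<open>
  The minimum can only fail to be differentiable where \<open>f = g\<close> while the two derivatives differ. In
  some basis direction the difference \<open>f - g\<close> then has an isolated zero, and such points form a null
  set.
\<close>

lemma AE_differentiable_min:
  fixes f g :: "'a::euclidean_space \<Rightarrow> real"
  assumes V: "open V" and f: "continuous_on V f" "AE x in lborel. x \<in> V \<longrightarrow> f differentiable (at x)"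
    and g: "continuous_on V g" "AE x in lborel. x \<in> V \<longrightarrow> g differentiable (at x)"
  shows "AE x in lborel. x \<in> V \<longrightarrow> (\<lambda>x. min (f x) (g x)) differentiable (at x)"
proof -
  define h where "h x = (if x \<in> V then f x - g x else 0)" for x
  have h: "h \<in> borel_measurable borel"
    unfolding h_def by (intro borel_measurable_extend_by V continuous_on_diff f g)
  have "AE x in lborel. \<forall>b\<in>Basis. \<not> isolated_zero h b x"
    by (rule AE_not_isolated_zero[OF h])
  with f(2) g(2) show ?thesis
  proof eventually_elim
    case (elim x)
    show ?case
    proof
      assume x: "x \<in> V"
      obtain F where F: "(f has_derivative F) (at x)" using elim x by (auto simp: differentiable_def)
      obtain G where G: "(g has_derivative G) (at x)" using elim x by (auto simp: differentiable_def)
      have op: "open {y \<in> V. f y < g y}" "open {y \<in> V. g y < f y}"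
      proof -
        have "{y \<in> V. f y < g y} = V \<inter> (\<lambda>y. g y - f y) -` {0<..}"
          "{y \<in> V. g y < f y} = V \<inter> (\<lambda>y. f y - g y) -` {0<..}" by auto
        then show "open {y \<in> V. f y < g y}" "open {y \<in> V. g y < f y}"
          using V f(1) g(1)
          by (simp_all add: continuous_open_preimage[OF continuous_on_diff _ open_greaterThan])
      qed
      consider "f x < g x" | "g x < f x" | "f x = g x" by linarith
      then show "(\<lambda>x. min (f x) (g x)) differentiable (at x)"
      proof cases
        case 1
        have "((\<lambda>x. min (f x) (g x)) has_derivative F) (at x)"
          by (rule has_derivative_transform_within_open[OF F op(1)]) (use 1 x in auto)
        then show ?thesis by (auto simp: differentiable_def)
      next
        case 2
        have "((\<lambda>x. min (f x) (g x)) has_derivative G) (at x)"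
          by (rule has_derivative_transform_within_open[OF G op(2)]) (use 2 x in auto)
        then show ?thesis by (auto simp: differentiable_def)
      next
        case 3
        have "F = G"
        proof (rule linear_eq_stdbasis)
          show "linear F" "linear G" using F G has_derivative_linear by auto
          fix b :: 'a assume b: "b \<in> Basis"
          show "F b = G b"
          proof (rule ccontr)
            assume "F b \<noteq> G b"
            have "((\<lambda>x. f x - g x) has_derivative (\<lambda>h. F h - G h)) (at x)"
              using F G by (rule has_derivative_diff)
            then have "(h has_derivative (\<lambda>h. F h - G h)) (at x)"
              by (rule has_derivative_transform_within_open[OF _ V x]) (auto simp: h_def)
            from nonzero_derivative_isolates_zero[OF this, of b] \<open>F b \<noteq> G b\<close>
            have "isolated_zero h b x"
              using 3 x by (simp add: h_def isolated_zero_def)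
            then show False using elim b by blast
          qed
        qed
        then have "((\<lambda>x. min (f x) (g x)) has_derivative F) (at x)"
          using F G 3 by (intro has_derivative_min_same) auto
        then show ?thesis by (auto simp: differentiable_def)
      qed
    qed
  qed
qed

lemma AE_differentiable_Min:
  fixes f :: "'i \<Rightarrow> 'a::euclidean_space \<Rightarrow> real"
  assumes V: "open V" and I: "finite I" "I \<noteq> {}"
    and f: "\<And>i. i \<in> I \<Longrightarrow> continuous_on V (f i)"
      "\<And>i. i \<in> I \<Longrightarrow> AE x in lborel. x \<in> V \<longrightarrow> f i differentiable (at x)"
  shows "continuous_on V (\<lambda>x. Min ((\<lambda>i. f i x) ` I)) \<and>
    (AE x in lborel. x \<in> V \<longrightarrow> (\<lambda>x. Min ((\<lambda>i. f i x) ` I)) differentiable (at x))"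
  using I f
proof (induction I rule: finite_ne_induct)
  case (insert i I)
  have eq: "(\<lambda>x. Min ((\<lambda>i. f i x) ` insert i I)) = (\<lambda>x. min (f i x) (Min ((\<lambda>i. f i x) ` I)))"
    using insert by (intro ext) simp
  show ?case unfolding eq
    using insert by (intro conjI AE_differentiable_min V continuous_on_min) auto
qed auto

text \<open>
  Away from its zeros the Euclidean norm is smooth. At a zero, either some derivative is nonzero in
  a basis direction, and then the zero is isolated in that direction, or all derivatives
  vanish, and then the norm is differentiable with derivative zero.
\<close>

lemma AE_differentiable_L2_set:
  fixes F :: "'i \<Rightarrow> 'a::euclidean_space \<Rightarrow> 'b::euclidean_space"
  assumes V: "open V" and I: "finite I"
    and F: "\<And>i x. i \<in> I \<Longrightarrow> x \<in> V \<Longrightarrow> (F i has_derivative F' i x) (at x)"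
  shows "continuous_on V (\<lambda>x. L2_set (\<lambda>i. dist (F i x) (P i)) I)"
    and "AE x in lborel. x \<in> V \<longrightarrow> (\<lambda>x. L2_set (\<lambda>i. dist (F i x) (P i)) I) differentiable (at x)"
proof -
  have cF: "continuous_on V (F i)" if "i \<in> I" for i
    using F[OF that] by (meson continuous_at_imp_continuous_on has_derivative_continuous)
  define q where "q x = (\<Sum>i\<in>I. (dist (F i x) (P i))\<^sup>2)" for x
  have a: "L2_set (\<lambda>i. dist (F i x) (P i)) I = sqrt (q x)" for x
    by (simp add: L2_set_def q_def)
  have cq: "continuous_on V q"
    unfolding q_def by (intro continuous_intros cF)
  then show "continuous_on V (\<lambda>x. L2_set (\<lambda>i. dist (F i x) (P i)) I)"
    unfolding a by (rule continuous_on_real_sqrt)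
  have q0: "q x = 0 \<longleftrightarrow> (\<forall>i\<in>I. F i x = P i)" for x
    unfolding q_def using I by (subst sum_nonneg_eq_0_iff) auto
  define h where "h x = (if x \<in> V then q x else 0)" for x
  have h: "h \<in> borel_measurable borel"
    unfolding h_def by (intro borel_measurable_extend_by V cq)
  have "AE x in lborel. \<forall>b\<in>Basis. \<not> isolated_zero h b x"
    by (rule AE_not_isolated_zero[OF h])
  then show "AE x in lborel. x \<in> V \<longrightarrow>
      (\<lambda>x. L2_set (\<lambda>i. dist (F i x) (P i)) I) differentiable (at x)"
  proof eventually_elim
    case (elim x)
    show ?case
    proof
      assume x: "x \<in> V"
      show "(\<lambda>x. L2_set (\<lambda>i. dist (F i x) (P i)) I) differentiable (at x)"
      proof (cases "q x = 0")
        case False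
        have "q x > 0" using False unfolding q_def by (simp add: sum_nonneg less_le)
        have "q differentiable (at x)"
          unfolding q_def dist_norm power2_norm_eq_inner
        proof (intro differentiable_sum I ballI)
          fix i assume "i \<in> I"
          from has_derivative_diff[OF F[OF this x] has_derivative_const[of "P i"]]
          have "((\<lambda>x. F i x - P i) has_derivative F' i x) (at x)" by simp
          from has_derivative_inner[OF this this]
          show "(\<lambda>x. (F i x - P i) \<bullet> (F i x - P i)) differentiable (at x)"
            by (auto simp: differentiable_def)
        qed
        then obtain D where "(q has_derivative D) (at x)" by (auto simp: differentiable_def)
        from has_derivative_real_sqrt[OF \<open>q x > 0\<close> this]
        show ?thesis unfolding a differentiable_def by blast
      next
        case True
        \<comment> \<open>Outside the null set of isolated zeros all first derivatives vanish at a zero.\<close>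
        have D0: "F' i x b = 0" if "i \<in> I" "b \<in> Basis" for i b
        proof (rule ccontr)
          assume "F' i x b \<noteq> 0"
          then have nz: "F' i x b \<noteq> 0" .
          have P: "F i x = P i" using True that(1) by (simp add: q0)
          from nonzero_derivative_isolates_zero[OF F[OF that(1) x] nz, unfolded P]
          obtain \<delta> where \<delta>: "\<delta> > 0" "\<And>t. 0 < \<bar>t\<bar> \<Longrightarrow> \<bar>t\<bar> < \<delta> \<Longrightarrow> F i (x + t *\<^sub>R b) \<noteq> P i"
            by blast
          obtain e where e: "e > 0" "ball x e \<subseteq> V" using V x openE by blast
          have "h (x + t *\<^sub>R b) \<noteq> 0" if t: "0 < \<bar>t\<bar>" "\<bar>t\<bar> < min \<delta> e" for t
          proof -
            have "x + t *\<^sub>R b \<in> V"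
              using e t \<open>b \<in> Basis\<close> by (intro subsetD[OF e(2)]) (simp add: dist_norm)
            then show ?thesis using \<delta>(2)[of t] t \<open>i \<in> I\<close> by (auto simp: h_def q0)
          qed
          then have "isolated_zero h b x"
            unfolding isolated_zero_def using \<delta>(1) e(1) True x
            by (intro conjI exI[of _ "min \<delta> e"]) (auto simp: h_def)
          then show False using elim that(2) by blast
        qed
        have Fz: "(F i has_derivative (\<lambda>_. 0)) (at x)" if "i \<in> I" for i
        proof -
          have "F' i x = (\<lambda>_. 0)"
            by (rule linear_eq_stdbasis[OF has_derivative_linear[OF F[OF that x]]])
              (auto simp: D0[OF that] intro: linear_zero)
          then show ?thesis using F[OF that x] by simp
        qed
        have "((\<lambda>x. L2_set (\<lambda>i. dist (F i x) (P i)) I) has_derivative (\<lambda>_. 0)) (at x)"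
          unfolding has_derivative_at_within
        proof
          show "((\<lambda>y. (L2_set (\<lambda>i. dist (F i y) (P i)) I - L2_set (\<lambda>i. dist (F i x) (P i)) I - 0)
              /\<^sub>R norm (y - x)) \<longlongrightarrow> 0) (at x)"
          proof (rule Lim_null_comparison)
            show "((\<lambda>y. \<Sum>i\<in>I. norm ((F i y - F i x - 0) /\<^sub>R norm (y - x))) \<longlongrightarrow> 0) (at x)"
              using Fz unfolding has_derivative_at_within
              by (intro tendsto_null_sum tendsto_norm_zero) blast
            have "norm ((L2_set (\<lambda>i. dist (F i y) (P i)) I - L2_set (\<lambda>i. dist (F i x) (P i)) I - 0)
              /\<^sub>R norm (y - x)) \<le> (\<Sum>i\<in>I. norm ((F i y - F i x - 0) /\<^sub>R norm (y - x)))" for y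
            proof -
              have "L2_set (\<lambda>i. dist (F i x) (P i)) I = 0" using True a by simp
              moreover have "L2_set (\<lambda>i. dist (F i y) (P i)) I \<le> (\<Sum>i\<in>I. dist (F i y) (P i))"
                by (rule L2_set_le_sum) simp
              moreover have "(\<Sum>i\<in>I. dist (F i y) (P i)) = (\<Sum>i\<in>I. norm (F i y - F i x))"
                using True by (intro sum.cong) (auto simp: q0 dist_norm)
              moreover have "(\<Sum>i\<in>I. norm ((F i y - F i x - 0) /\<^sub>R norm (y - x)))
                  = inverse (norm (y - x)) * (\<Sum>i\<in>I. norm (F i y - F i x))"
                by (simp add: sum_distrib_left)
              moreover have "norm ((L - 0 - 0) /\<^sub>R norm (y - x)) \<le> inverse (norm (y - x)) * R"
                if "0 \<le> L" "L \<le> R" for L R :: real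
                using that by (simp add: mult_left_mono)
              ultimately show ?thesis by (metis L2_set_nonneg)
            qed
            then show "\<forall>\<^sub>F y in at x. norm ((L2_set (\<lambda>i. dist (F i y) (P i)) I
                - L2_set (\<lambda>i. dist (F i x) (P i)) I - 0) /\<^sub>R norm (y - x))
              \<le> (\<Sum>i\<in>I. norm ((F i y - F i x - 0) /\<^sub>R norm (y - x)))"
              by simp
          qed
        qed (rule bounded_linear_zero)
        then show ?thesis by (auto simp: differentiable_def)
      qed
    qed
  qed
qed

section \<open>Weak derivatives of Lipschitz functions\<close>

lemma DERIV_along_line:
  fixes g :: "'a::real_normed_vector \<Rightarrow> real"
  assumes g: "(g has_derivative D) (at (x + t *\<^sub>R b))"
  shows "((\<lambda>t. g (x + t *\<^sub>R b)) has_real_derivative D b) (at t)"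
proof -
  have "((\<lambda>t. x + t *\<^sub>R b) has_derivative (\<lambda>h. h *\<^sub>R b)) (at t)"
    by (auto intro!: derivative_eq_intros)
  from has_derivative_compose[OF this g]
  have "((\<lambda>t. g (x + t *\<^sub>R b)) has_derivative (\<lambda>h. D (h *\<^sub>R b))) (at t)" .
  moreover have "(\<lambda>h. D (h *\<^sub>R b)) = (*) (D b)"
    by (rule ext) (simp add: linear_scale[OF has_derivative_linear[OF g]])
  ultimately show ?thesis unfolding has_field_derivative_def by simp
qed

lemma difference_quotient_tendsto:
  fixes g :: "'a::real_normed_vector \<Rightarrow> real"
  assumes g: "(g has_derivative D) (at x)" and s: "s \<longlonglongrightarrow> 0" "\<And>k. s k \<noteq> 0"
  shows "(\<lambda>k. (g (x + s k *\<^sub>R b) - g x) / s k) \<longlonglongrightarrow> D b"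
proof -
  have "((\<lambda>t. g (x + t *\<^sub>R b)) has_real_derivative D b) (at 0)"
    by (rule DERIV_along_line) (simp add: g)
  then have "((\<lambda>h. (g (x + h *\<^sub>R b) - g x) / h) \<longlongrightarrow> D b) (at 0)"
    by (simp add: DERIV_def)
  moreover have "filterlim s (at 0) sequentially"
    using s by (simp add: filterlim_at)
  ultimately show ?thesis by (rule filterlim_compose)
qed

lemma Lipschitz_derivative_bound:
  fixes g :: "'a::real_normed_vector \<Rightarrow> real"
  assumes "open V" "L-lipschitz_on V g" "x \<in> V" "(g has_derivative D) (at x)"
  shows "\<bar>D b\<bar> \<le> L * norm b"
proof (rule LIMSEQ_le_const2)
  define s where "s k = 1 / real (Suc k)" for k
  have s: "s \<longlonglongrightarrow> 0" unfolding s_def by (rule LIMSEQ_Suc[OF lim_1_over_n])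
  have s0: "s k > 0" for k by (simp add: s_def)
  show "(\<lambda>k. \<bar>(g (x + s k *\<^sub>R b) - g x) / s k\<bar>) \<longlonglongrightarrow> \<bar>D b\<bar>"
    by (intro tendsto_rabs difference_quotient_tendsto assms s) (metis s0 less_irrefl)
  have "(\<lambda>k. x + s k *\<^sub>R b) \<longlonglongrightarrow> x + 0 *\<^sub>R b"
    by (intro tendsto_intros s)
  then have "\<forall>\<^sub>F k in sequentially. x + s k *\<^sub>R b \<in> V"
    using assms(1,3) by (intro topological_tendstoD) auto
  then show "\<exists>N. \<forall>n\<ge>N. \<bar>(g (x + s n *\<^sub>R b) - g x) / s n\<bar> \<le> L * norm b"
    unfolding eventually_sequentially
  proof (elim exE, intro exI allI impI)
    fix N n assume N: "\<forall>n\<ge>N. x + s n *\<^sub>R b \<in> V" and "N \<le> n"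
    then have "\<bar>g (x + s n *\<^sub>R b) - g x\<bar> \<le> L * (s n * norm b)"
      using lipschitz_onD[OF assms(2), of "x + s n *\<^sub>R b" x] assms(3) s0[of n]
      by (simp add: dist_real_def dist_norm)
    then show "\<bar>(g (x + s n *\<^sub>R b) - g x) / s n\<bar> \<le> L * norm b"
      using s0[of n] by (simp add: pos_divide_le_eq mult_ac)
  qed
qed

text \<open>
  A limit of difference quotients is a Borel function. Truncating it at the Lipschitz constant, and
  setting it to zero outside \<open>V\<close>, gives bounds at every point and not only almost everywhere.
\<close>

lemma borel_partial_derivative:
  fixes g :: "'a::euclidean_space \<Rightarrow> real"
  assumes "open V" "L-lipschitz_on V g" and diff: "AE x in lborel. x \<in> V \<longrightarrow> g differentiable (at x)"
    and b: "b \<in> Basis"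
  obtains d where "d \<in> borel_measurable borel" "\<And>x. \<bar>d x\<bar> \<le> L" "\<And>x. x \<notin> V \<Longrightarrow> d x = 0"
    "AE x in lborel. x \<in> V \<longrightarrow> d x = frechet_derivative g (at x) b"
proof -
  define s where "s k = 1 / real (Suc k)" for k
  have s: "s \<longlonglongrightarrow> 0" unfolding s_def by (rule LIMSEQ_Suc[OF lim_1_over_n])
  have s0: "s k \<noteq> 0" for k by (simp add: s_def)
  have L: "0 \<le> L" using assms(2) by (rule lipschitz_on_nonneg)
  define g0 where "g0 x = (if x \<in> V then g x else 0)" for x
  have [measurable]: "g0 \<in> borel_measurable borel"
    unfolding g0_def by (intro borel_measurable_extend_by assms lipschitz_on_continuous_on[OF assms(2)])
  have [measurable]: "V \<in> sets borel" using assms(1) by simp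
  define d where "d x = (if x \<in> V then max (- L) (min L (lim (\<lambda>k. (g0 (x + s k *\<^sub>R b) - g0 x) / s k))) else 0)" for x
  have dm: "d \<in> borel_measurable borel" unfolding d_def by measurable
  have "AE x in lborel. x \<in> V \<longrightarrow> d x = frechet_derivative g (at x) b"
    using diff
  proof eventually_elim
    case (elim x)
    show ?case
    proof
      assume x: "x \<in> V"
      have D: "(g has_derivative frechet_derivative g (at x)) (at x)"
        using elim x frechet_derivative_works by blast
      then have "(g0 has_derivative frechet_derivative g (at x)) (at x)"
        by (rule has_derivative_transform_within_open[OF _ assms(1) x]) (simp add: g0_def)
      then have "lim (\<lambda>k. (g0 (x + s k *\<^sub>R b) - g0 x) / s k) = frechet_derivative g (at x) b"
        by (intro limI difference_quotient_tendsto s s0)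
      moreover have "\<bar>frechet_derivative g (at x) b\<bar> \<le> L"
        using Lipschitz_derivative_bound[OF assms(1,2) x D, of b] b by simp
      ultimately show "d x = frechet_derivative g (at x) b" using x by (simp add: d_def)
    qed
  qed
  moreover have "\<bar>d x\<bar> \<le> L" for x using L by (auto simp: d_def abs_le_iff max_def min_def)
  ultimately show ?thesis using dm by (intro that[of d]) (auto simp: d_def)
qed

lemma test_function_lipschitz_along:
  assumes "\<phi> \<in> test_functions \<Omega>" "b \<in> Basis"
  obtains C where "C \<ge> 0" "\<And>x t. \<bar>\<phi> (x + t *\<^sub>R b) - \<phi> x\<bar> \<le> C * \<bar>t\<bar>"
proof -
  obtain C where C: "C \<ge> 0" "\<And>x. \<bar>frechet_derivative \<phi> (at x) b\<bar> \<le> C"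
    using test_function_bounded[OF partial_test_function[OF assms]] by metis
  have der: "((\<lambda>t. \<phi> (x + t *\<^sub>R b)) has_real_derivative frechet_derivative \<phi> (at (x + t *\<^sub>R b)) b) (at t)"
    for x t by (intro DERIV_along_line smoothD test_functionD[OF assms(1)])
  have "\<bar>\<phi> (x + t *\<^sub>R b) - \<phi> x\<bar> \<le> C * \<bar>t\<bar>" for x t
    using field_differentiable_bound[of UNIV "\<lambda>t. \<phi> (x + t *\<^sub>R b)"
        "\<lambda>t. frechet_derivative \<phi> (at (x + t *\<^sub>R b)) b" C t 0] der C(2) by simp
  then show ?thesis using that C(1) by blast
qed

lemma integrable_lborel_cball:
  "integrable lborel (\<lambda>x. C * indicator (cball (0::'a::euclidean_space) R) x :: real)"
  by (intro integrable_mult_right integrable_real_indicator)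
    (auto simp: emeasure_lborel_cball_finite[unfolded infinity_ennreal_def])

lemma integrable_lborel_bounded:
  fixes f :: "'a::euclidean_space \<Rightarrow> real"
  assumes "f \<in> borel_measurable borel" "\<And>x. \<bar>f x\<bar> \<le> C" "\<And>x. x \<notin> S \<Longrightarrow> f x = 0" "bounded S"
  shows "integrable lborel f"
proof -
  obtain R where R: "S \<subseteq> cball 0 R" using \<open>bounded S\<close> by (auto simp: bounded_iff subset_eq)
  show ?thesis
  proof (rule Bochner_Integration.integrable_bound)
    show "integrable lborel (\<lambda>x. C * indicator (cball 0 R) x :: real)"
      by (rule integrable_lborel_cball)
    show "AE x in lborel. norm (f x) \<le> norm (C * indicator (cball 0 R) x :: real)"
    proof (intro AE_I2)
      fix x show "norm (f x) \<le> norm (C * indicator (cball 0 R) x :: real)"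
      proof (cases "x \<in> S")
        case True
        then have "x \<in> cball 0 R" using R by blast
        then show ?thesis using assms(2)[of x] by (simp add: indicator_def)
      qed (simp add: assms(3))
    qed
  qed (use assms in simp)
qed

text \<open>
  Discrete integration by parts: translation invariance moves the difference quotient from the test
  function to \<open>g\<close>, and dominated convergence applies on both sides, the Lipschitz constant being
  the dominating bound for the quotients of \<open>g\<close>.
\<close>

lemma integration_by_parts_lipschitz:
  fixes g :: "'a::euclidean_space \<Rightarrow> real"
  assumes V: "open V" and g[measurable]: "g \<in> borel_measurable borel"
    and lip: "L-lipschitz_on V g" and M: "\<And>x. x \<in> V \<Longrightarrow> \<bar>g x\<bar> \<le> M"
    and diff: "AE x in lborel. x \<in> V \<longrightarrow> g differentiable (at x)"
    and d[measurable]: "d \<in> borel_measurable borel"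
      "AE x in lborel. x \<in> V \<longrightarrow> d x = frechet_derivative g (at x) b"
    and \<phi>: "\<phi> \<in> test_functions V" and b: "b \<in> Basis"
  shows "(LINT x|lborel. g x * frechet_derivative \<phi> (at x) b) = - (LINT x|lborel. d x * \<phi> x)"
proof -
  define K where "K = closure {x. \<phi> x \<noteq> 0}"
  have K: "compact K" "K \<subseteq> V" unfolding K_def by (rule test_functionD[OF \<phi>])+
  have \<phi>0: "\<phi> x = 0" if "x \<notin> K" for x
    using that closure_subset[of "{x. \<phi> x \<noteq> 0}"] unfolding K_def by blast
  obtain \<delta> where \<delta>: "\<delta> > 0" "(\<Union>x\<in>K. cball x \<delta>) \<subseteq> V"
    using compact_subset_open_imp_cball_epsilon_subset[OF K(1) V K(2)] by blast
  \<comment> \<open>A neighbourhood of the support that contains all translates used below and still lies in \<open>V\<close>.\<close>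
  define K' where "K' = (\<Union>x\<in>K. cball x \<delta>)"
  have K'V: "K' \<subseteq> V" using \<delta> by (simp add: K'_def)
  have KK': "K \<subseteq> K'"
  proof
    fix x assume "x \<in> K"
    moreover have "x \<in> cball x \<delta>" using \<delta>(1) by simp
    ultimately show "x \<in> K'" unfolding K'_def by blast
  qed
  obtain R where R: "\<And>x. x \<in> K \<Longrightarrow> norm x \<le> R"
    using compact_imp_bounded[OF K(1)] by (auto simp: bounded_iff)
  have R': "norm x \<le> R + \<delta>" if xK': "x \<in> K'" for x
  proof -
    obtain y where "y \<in> K" "dist y x \<le> \<delta>" using xK' by (auto simp: K'_def)
    then show ?thesis using R[of y] norm_triangle_sub[of x y] by (simp add: dist_norm norm_minus_commute)
  qed
  have bK': "bounded K'" using R' by (auto simp: bounded_iff)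
  obtain C where C: "C \<ge> 0" "\<And>x. \<bar>\<phi> x\<bar> \<le> C" using test_function_bounded[OF \<phi>] by blast
  obtain C' where C': "C' \<ge> 0" "\<And>x t. \<bar>\<phi> (x + t *\<^sub>R b) - \<phi> x\<bar> \<le> C' * \<bar>t\<bar>"
    using test_function_lipschitz_along[OF \<phi> b] by blast
  have sm: "smooth \<phi>" using \<phi> by (rule test_functionD)
  have [measurable]: "\<phi> \<in> borel_measurable borel"
    using sm by (rule smooth_measurable)
  have [measurable]: "(\<lambda>x. frechet_derivative \<phi> (at x) b) \<in> borel_measurable borel"
    using smoothD(2)[OF sm b] by (rule smooth_measurable)
  \<comment> \<open>Step sizes at most \<open>\<delta>\<close>, so that shifted points of the support stay in \<open>K'\<close>.\<close>
  define s where "s k = \<delta> / real (Suc k)" for k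
  have s: "s \<longlonglongrightarrow> 0" unfolding s_def
    by (rule LIMSEQ_Suc[OF lim_const_over_n])
  have s0: "s k > 0" "s k \<le> \<delta>" for k using \<delta>(1) by (simp_all add: s_def divide_le_eq)
  have s0': "s k \<noteq> 0" for k using s0(1)[of k] by simp
  have shift: "x \<in> K'" if "x + s k *\<^sub>R b \<in> K" for x k
  proof -
    have "x \<in> cball (x + s k *\<^sub>R b) \<delta>" using s0[of k] b by (simp add: dist_norm)
    with that show ?thesis unfolding K'_def by blast
  qed
  have shift': "x - s k *\<^sub>R b \<in> K'" if "x \<in> K" for x k
  proof -
    have "x - s k *\<^sub>R b \<in> cball x \<delta>" using s0[of k] b by (simp add: dist_norm)
    with that show ?thesis unfolding K'_def by blast
  qed
  have M0: "M \<ge> 0" if "x \<in> V" for x using M[OF that] by linarith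
  define F where "F k x = g x * ((\<phi> (x + s k *\<^sub>R b) - \<phi> x) / s k)" for k x
  define G where "G k x = \<phi> x * ((g (x - s k *\<^sub>R b) - g x) / s k)" for k x
  have F_lim: "(\<lambda>k. LINT x|lborel. F k x) \<longlonglongrightarrow> (LINT x|lborel. g x * frechet_derivative \<phi> (at x) b)"
  proof (rule integral_dominated_convergence[where w = "\<lambda>x. \<bar>M\<bar> * C' * indicator (cball 0 (R + \<delta>)) x"])
    show "integrable lborel (\<lambda>x. \<bar>M\<bar> * C' * indicator (cball (0::'a) (R + \<delta>)) x)"
      by (rule integrable_lborel_cball)
    show "AE x in lborel. (\<lambda>k. F k x) \<longlonglongrightarrow> g x * frechet_derivative \<phi> (at x) b"
      unfolding F_def
      by (intro AE_I2 tendsto_mult tendsto_const difference_quotient_tendsto smoothD sm s s0')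
    show "AE x in lborel. norm (F k x) \<le> \<bar>M\<bar> * C' * indicator (cball 0 (R + \<delta>)) x" for k
    proof (intro AE_I2)
      fix x
      show "norm (F k x) \<le> \<bar>M\<bar> * C' * indicator (cball 0 (R + \<delta>)) x"
      proof (cases "x \<in> K'")
        case True
        have "\<bar>(\<phi> (x + s k *\<^sub>R b) - \<phi> x) / s k\<bar> \<le> C'"
          using C'(2)[of x "s k"] s0[of k] by (simp add: pos_divide_le_eq)
        moreover have "\<bar>g x\<bar> \<le> \<bar>M\<bar>" using M[of x] K'V True by fastforce
        ultimately have "\<bar>F k x\<bar> \<le> \<bar>M\<bar> * C'" unfolding F_def abs_mult
          using C'(1) by (intro mult_mono) auto
        then show ?thesis using R'[OF True] by simp
      next
        case False
        then have "\<phi> x = 0" "\<phi> (x + s k *\<^sub>R b) = 0"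
          using \<phi>0 KK' shift[of x k] by blast+
        then show ?thesis using C'(1) by (simp add: F_def)
      qed
    qed
  qed (auto simp: F_def)
  have G_lim: "(\<lambda>k. LINT x|lborel. G k x) \<longlonglongrightarrow> (LINT x|lborel. - (d x * \<phi> x))"
  proof (rule integral_dominated_convergence[where w = "\<lambda>x. C * L * indicator (cball 0 (R + \<delta>)) x"])
    show "integrable lborel (\<lambda>x. C * L * indicator (cball (0::'a) (R + \<delta>)) x)"
      by (rule integrable_lborel_cball)
    show "AE x in lborel. (\<lambda>k. G k x) \<longlonglongrightarrow> - (d x * \<phi> x)"
      using diff d(2)
    proof eventually_elim
      case (elim x)
      show ?case
      proof (cases "x \<in> K")
        case True
        then have x: "x \<in> V" using K by blast
        have D: "(g has_derivative frechet_derivative g (at x)) (at x)"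
          using elim x frechet_derivative_works by blast
        have "(\<lambda>k. (g (x + (- s k) *\<^sub>R b) - g x) / (- s k)) \<longlonglongrightarrow> frechet_derivative g (at x) b"
          by (intro difference_quotient_tendsto D) (use s s0' in \<open>auto intro: tendsto_eq_intros\<close>)
        then have "(\<lambda>k. - \<phi> x * ((g (x + (- s k) *\<^sub>R b) - g x) / (- s k))) \<longlonglongrightarrow> - \<phi> x * d x"
          using elim x by (intro tendsto_mult tendsto_const) simp
        then show ?thesis by (simp add: G_def mult.commute)
      next
        case False
        then show ?thesis using \<phi>0 by (simp add: G_def)
      qed
    qed
    show "AE x in lborel. norm (G k x) \<le> C * L * indicator (cball 0 (R + \<delta>)) x" for k
    proof (intro AE_I2)
      fix x
      show "norm (G k x) \<le> C * L * indicator (cball 0 (R + \<delta>)) x"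
      proof (cases "x \<in> K")
        case True
        have "\<bar>g (x - s k *\<^sub>R b) - g x\<bar> \<le> L * s k"
          using lipschitz_onD[OF lip, of "x - s k *\<^sub>R b" x] shift'[OF True, of k] K'V K(2) True s0[of k] b
          by (auto simp: dist_norm)
        then have "\<bar>(g (x - s k *\<^sub>R b) - g x) / s k\<bar> \<le> L"
          using s0[of k] by (simp add: pos_divide_le_eq)
        then have "\<bar>G k x\<bar> \<le> C * L" unfolding G_def abs_mult
          using C by (intro mult_mono) auto
        then show ?thesis using R'[of x] KK' True by auto
      next
        case False
        then show ?thesis using \<phi>0 C(1) lipschitz_on_nonneg[OF lip] by (simp add: G_def)
      qed
    qed
  qed (auto simp: G_def)
  have "(LINT x|lborel. F k x) = (LINT x|lborel. G k x)" for k
  proof -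
    have bd: "\<bar>g x * \<phi> y\<bar> \<le> \<bar>M\<bar> * C" if "x \<in> K'" for x y
      unfolding abs_mult using M[of x] K'V that C(2)[of y] C(1) by (intro mult_mono) fastforce+
    have pos: "0 \<le> \<bar>M\<bar> * C" using C(1) by simp
    have z1: "g x * \<phi> (x + s k *\<^sub>R b) = 0" if "x \<notin> K'" for x
      using that shift[of x k] \<phi>0[of "x + s k *\<^sub>R b"] by (metis mult_zero_right)
    have z2: "g x * \<phi> x = 0" if "x \<notin> K'" for x
      using that KK' \<phi>0[of x] by (metis mult_zero_right subsetD)
    have bd1: "\<bar>g x * \<phi> (x + s k *\<^sub>R b)\<bar> \<le> \<bar>M\<bar> * C" for x
    proof (cases "x \<in> K'")
      case False
      show ?thesis unfolding z1[OF False] using pos by simp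
    qed (rule bd)
    have bd2: "\<bar>g x * \<phi> x\<bar> \<le> \<bar>M\<bar> * C" for x
    proof (cases "x \<in> K'")
      case False
      show ?thesis unfolding z2[OF False] using pos by simp
    qed (rule bd)
    have i1: "integrable lborel (\<lambda>x. g x * \<phi> (x + s k *\<^sub>R b))"
      by (rule integrable_lborel_bounded[OF _ bd1 z1 bK']) measurable
    have i2: "integrable lborel (\<lambda>x. g x * \<phi> x)"
      by (rule integrable_lborel_bounded[OF _ bd2 z2 bK']) measurable
    define H where "H x = g (x - s k *\<^sub>R b) * \<phi> x" for x
    have Hm[measurable]: "H \<in> borel_measurable borel" unfolding H_def by measurable
    have Hs: "H (s k *\<^sub>R b + x) = g x * \<phi> (x + s k *\<^sub>R b)" for x
      by (simp add: H_def add.commute)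
    have H0: "H x = 0" if "x \<notin> K" for x
      unfolding H_def \<phi>0[OF that] by simp
    have H_bd: "\<bar>H x\<bar> \<le> \<bar>M\<bar> * C" for x
    proof (cases "x \<in> K")
      case True
      show ?thesis unfolding H_def by (rule bd[OF shift'[OF True]])
    next
      case False
      show ?thesis unfolding H0[OF False] using pos by simp
    qed
    have i3: "integrable lborel H"
      by (rule integrable_lborel_bounded[OF Hm H_bd H0 compact_imp_bounded[OF K(1)]])
    have "(LINT x|lborel. F k x) = (LINT x|lborel. (g x * \<phi> (x + s k *\<^sub>R b) - g x * \<phi> x) / s k)"
      by (intro Bochner_Integration.integral_cong) (auto simp: F_def algebra_simps diff_divide_distrib)
    also have "\<dots> = ((LINT x|lborel. H (s k *\<^sub>R b + x)) - (LINT x|lborel. g x * \<phi> x)) / s k"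
      using i1 i2 by (simp add: Hs)
    also have "(LINT x|lborel. H (s k *\<^sub>R b + x)) = (LINT x|lborel. H x)"
      by (rule lborel_integral_translate) measurable
    also have "((LINT x|lborel. H x) - (LINT x|lborel. g x * \<phi> x)) / s k
        = (LINT x|lborel. (H x - g x * \<phi> x) / s k)"
      using i2 i3 by simp
    also have "\<dots> = (LINT x|lborel. G k x)"
      by (intro Bochner_Integration.integral_cong) (auto simp: G_def H_def algebra_simps diff_divide_distrib)
    finally show ?thesis .
  qed
  with F_lim G_lim have "(LINT x|lborel. g x * frechet_derivative \<phi> (at x) b) = (LINT x|lborel. - (d x * \<phi> x))"
    using LIMSEQ_unique by simp
  then show ?thesis by simp
qed

lemma Lp_2_mult:
  assumes "f \<in> Lp M 2" "g \<in> Lp M 2"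
  shows "integrable M (\<lambda>x. f x * g x)"
proof (rule Bochner_Integration.integrable_bound)
  show "integrable M (\<lambda>x. (f x)\<^sup>2 + (g x)\<^sup>2)" using assms by (simp add: Lp_2_iff)
  show "(\<lambda>x. f x * g x) \<in> borel_measurable M"
    using assms by (intro borel_measurable_times) (simp_all add: Lp_2_iff)
  have "\<bar>s * t\<bar> \<le> s\<^sup>2 + t\<^sup>2" for s t :: real
  proof -
    have "2 * (\<bar>s\<bar> * \<bar>t\<bar>) \<le> s\<^sup>2 + t\<^sup>2"
      using zero_le_power2[of "\<bar>s\<bar> - \<bar>t\<bar>"] by (simp add: power2_diff)
    moreover have "0 \<le> \<bar>s\<bar> * \<bar>t\<bar>" by simp
    ultimately show ?thesis unfolding abs_mult by linarith
  qed
  then show "AE x in M. norm (f x * g x) \<le> norm ((f x)\<^sup>2 + (g x)\<^sup>2)"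
    by (intro AE_I2) simp
qed

lemma Lp_2_add:
  assumes "f \<in> Lp M 2" "g \<in> Lp M 2"
  shows "(\<lambda>x. f x + g x) \<in> Lp M 2"
proof -
  have "integrable M (\<lambda>x. (f x)\<^sup>2 + (g x)\<^sup>2 + 2 * (f x * g x))"
    using assms Lp_2_mult[OF assms] by (simp add: Lp_2_iff)
  moreover have "(\<lambda>x. f x + g x) \<in> borel_measurable M"
    using assms by (intro borel_measurable_add) (simp_all add: Lp_2_iff)
  ultimately show ?thesis by (simp add: Lp_2_iff power2_sum mult.assoc)
qed

lemma Lp_2_uminus: "f \<in> Lp M 2 \<Longrightarrow> (\<lambda>x. - f x) \<in> Lp M 2"
  by (simp add: Lp_2_iff)

lemma Lp_2_diff: "f \<in> Lp M 2 \<Longrightarrow> g \<in> Lp M 2 \<Longrightarrow> (\<lambda>x. f x - g x) \<in> Lp M 2"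
  using Lp_2_add[OF _ Lp_2_uminus, of f M g] by simp

lemma Lp_2_dominated:
  assumes "f \<in> Lp M 2" "g \<in> borel_measurable M" "AE x in M. \<bar>g x\<bar> \<le> \<bar>f x\<bar>"
  shows "g \<in> Lp M 2"
  unfolding Lp_2_iff
proof
  show "integrable M (\<lambda>x. (g x)\<^sup>2)"
  proof (rule Bochner_Integration.integrable_bound)
    show "integrable M (\<lambda>x. (f x)\<^sup>2)" using assms(1) by (simp add: Lp_2_iff)
    show "AE x in M. norm ((g x)\<^sup>2) \<le> norm ((f x)\<^sup>2)"
      using assms(3) by eventually_elim (simp add: abs_le_square_iff)
  qed (use assms(2) in simp)
qed (rule assms)

lemma integrable_lebesgue_on:
  fixes f :: "'a::euclidean_space \<Rightarrow> real"
  assumes "\<Omega> \<in> sets lebesgue"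
  shows "integrable (lebesgue_on \<Omega>) f \<longleftrightarrow> integrable lebesgue (\<lambda>x. indicator \<Omega> x * f x)"
  using assms by (simp add: integrable_restrict_space)

lemma borel_measurable_lebesgue_on:
  fixes f :: "'a::euclidean_space \<Rightarrow> real"
  assumes "\<Omega> \<in> sets lebesgue"
  shows "f \<in> borel_measurable (lebesgue_on \<Omega>) \<longleftrightarrow> (\<lambda>x. indicator \<Omega> x * f x) \<in> borel_measurable lebesgue"
  using assms borel_measurable_restrict_space_iff[of \<Omega> lebesgue f] by simp

lemma AE_lebesgue_on:
  assumes "\<Omega> \<in> sets lebesgue"
  shows "(AE x in lebesgue_on \<Omega>. P x) \<longleftrightarrow> (AE x in lebesgue. x \<in> \<Omega> \<longrightarrow> P x)"
  using assms by (simp add: AE_restrict_space_iff)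

lemma Lp_2_subset:
  fixes f :: "'a::euclidean_space \<Rightarrow> real"
  assumes "f \<in> Lp (lebesgue_on \<Omega>) 2" "V \<subseteq> \<Omega>" "V \<in> sets lebesgue" "\<Omega> \<in> sets lebesgue"
  shows "f \<in> Lp (lebesgue_on V) 2"
proof -
  have eq: "indicator V x * f x = indicator V x * (indicator \<Omega> x * f x)"
    "indicator V x * (f x)\<^sup>2 = indicator V x * (indicator \<Omega> x * (f x)\<^sup>2)" for x
    using assms(2) by (auto simp: indicator_def)
  have "(\<lambda>x. indicator V x * (indicator \<Omega> x * f x)) \<in> borel_measurable lebesgue"
  proof (rule borel_measurable_times)
    show "(\<lambda>x. indicator \<Omega> x * f x) \<in> borel_measurable lebesgue"
      using assms(1) unfolding Lp_2_iff borel_measurable_lebesgue_on[OF assms(4)] by blast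
  qed (use assms(3) in simp)
  moreover have "integrable lebesgue (\<lambda>x. indicator V x * (indicator \<Omega> x * (f x)\<^sup>2))"
    using assms(1) integrable_mult_indicator[OF assms(3), of "\<lambda>x. indicator \<Omega> x * (f x)\<^sup>2"]
    unfolding Lp_2_iff integrable_lebesgue_on[OF assms(4)] by simp
  ultimately show ?thesis
    unfolding Lp_2_iff integrable_lebesgue_on[OF assms(3)] borel_measurable_lebesgue_on[OF assms(3)] eq
    by blast
qed

lemma measurable_lebesgue_on_if_borel:
  fixes f :: "'a::euclidean_space \<Rightarrow> real"
  assumes "f \<in> borel_measurable borel"
  shows "f \<in> borel_measurable (lebesgue_on \<Omega>)"
  using assms by (intro measurable_restrict_space1 measurable_completion) simp

lemma Lp_2_bounded:
  fixes f :: "'a::euclidean_space \<Rightarrow> real"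
  assumes f: "f \<in> borel_measurable (lebesgue_on V)" "\<And>x. x \<in> V \<Longrightarrow> \<bar>f x\<bar> \<le> C" and V: "bounded V" "V \<in> sets lebesgue"
  shows "f \<in> Lp (lebesgue_on V) 2"
  unfolding Lp_2_iff
proof
  have fin: "emeasure (lebesgue_on V) (space (lebesgue_on V)) < \<infinity>"
    using bounded_set_imp_lmeasurable[OF V] V(2)
    by (simp add: emeasure_restrict_space fmeasurable_def)
  show "integrable (lebesgue_on V) (\<lambda>x. (f x)\<^sup>2)"
  proof (rule Bochner_Integration.integrable_bound)
    show "integrable (lebesgue_on V) (\<lambda>_. C\<^sup>2)"
      by (rule finite_measure.integrable_const) (rule finite_measureI, use fin in simp)
    show "AE x in lebesgue_on V. norm ((f x)\<^sup>2) \<le> norm (C\<^sup>2)"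
    proof (rule AE_I2)
      fix x assume "x \<in> space (lebesgue_on V)"
      then have "x \<in> V" by (simp add: space_restrict_space)
      from f(2)[OF this] have "\<bar>f x\<bar> \<le> \<bar>C\<bar>" by linarith
      then show "norm ((f x)\<^sup>2) \<le> norm (C\<^sup>2)" by (simp add: abs_le_square_iff)
    qed
  qed (use f(1) in simp)
qed (rule f)

lemma test_function_Lp_2:
  assumes "\<phi> \<in> test_functions V" "\<Omega> \<in> sets lebesgue"
  shows "\<phi> \<in> Lp (lebesgue_on \<Omega>) 2"
proof -
  obtain C where C: "\<And>x. \<bar>\<phi> x\<bar> \<le> C" using test_function_bounded[OF assms(1)] by metis
  have m: "\<phi> \<in> borel_measurable borel" by (rule smooth_measurable[OF test_functionD(1)[OF assms(1)]])
  have b: "bounded {x. \<phi> x \<noteq> 0}"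
    using test_functionD(2)[OF assms(1)] by simp
  have "integrable lborel (\<lambda>x. (\<phi> x)\<^sup>2)"
  proof (rule integrable_lborel_bounded[OF _ _ _ b])
    show "\<bar>(\<phi> x)\<^sup>2\<bar> \<le> C\<^sup>2" for x
    proof -
      have "\<bar>\<phi> x\<bar> \<le> \<bar>C\<bar>" using C[of x] by linarith
      then show ?thesis by (simp add: abs_le_square_iff)
    qed
  qed (use m in auto)
  then have "integrable lebesgue (\<lambda>x. (\<phi> x)\<^sup>2)"
    using m by (subst integrable_completion) auto
  then have "integrable (lebesgue_on \<Omega>) (\<lambda>x. (\<phi> x)\<^sup>2)"
    using integrable_mult_indicator[OF assms(2), of "\<lambda>x. (\<phi> x)\<^sup>2"]
    by (simp add: integrable_lebesgue_on[OF assms(2)])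
  then show ?thesis using measurable_lebesgue_on_if_borel[OF m] by (simp add: Lp_2_iff)
qed

lemma integral_lebesgue_on_restrict:
  fixes f :: "'a::euclidean_space \<Rightarrow> real"
  assumes "\<And>x. x \<notin> V \<Longrightarrow> f x = 0" "V \<subseteq> \<Omega>" "V \<in> sets lebesgue" "\<Omega> \<in> sets lebesgue"
  shows "(LINT x|lebesgue_on \<Omega>. f x) = (LINT x|lebesgue_on V. f x)"
proof -
  have "indicator \<Omega> x * f x = indicator V x * f x" for x
    using assms(1,2) by (cases "x \<in> V") (auto simp: indicator_def)
  then show ?thesis unfolding integral_lebesgue_on[OF assms(3)] integral_lebesgue_on[OF assms(4)]
    by (simp only:)
qed

lemma integral_lebesgue_on_lborel:
  fixes f :: "'a::euclidean_space \<Rightarrow> real"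
  assumes "\<And>x. x \<notin> V \<Longrightarrow> f x = 0" "V \<in> sets lebesgue" "f \<in> borel_measurable borel"
  shows "(LINT x|lebesgue_on V. f x) = (LINT x|lborel. f x)"
proof -
  have "indicator V x * f x = f x" for x
    using assms(1) by (auto simp: indicator_def)
  then have "(LINT x|lebesgue_on V. f x) = (LINT x|lebesgue. f x)"
    unfolding integral_lebesgue_on[OF assms(2)] by (simp only:)
  then show ?thesis using integral_completion[of f lborel] assms(3) by simp
qed

lemma test_function_zero:
  assumes "\<phi> \<in> test_functions V" "x \<notin> V"
  shows "\<phi> x = 0" and "frechet_derivative \<phi> (at x) b = 0"
proof -
  have x: "x \<notin> closure {x. \<phi> x \<noteq> 0}" using test_functionD(3)[OF assms(1)] assms(2) by blast
  then show "\<phi> x = 0" using closure_subset[of "{x. \<phi> x \<noteq> 0}"] by blast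
  show "frechet_derivative \<phi> (at x) b = 0"
    using frechet_derivative_outside_support[OF x] by simp
qed

text \<open>
  The difference of two weak derivatives is orthogonal to all test functions.
\<close>

lemma weak_partial_unique:
  assumes \<Omega>: "open \<Omega>" and "weak_partial \<Omega> b g h" "weak_partial \<Omega> b g h'"
  shows "AE x in lebesgue_on \<Omega>. h x = h' x"
proof -
  have \<Omega>m: "\<Omega> \<in> sets lebesgue" using \<Omega> by simp
  have h: "h \<in> Lp (lebesgue_on \<Omega>) 2" "h' \<in> Lp (lebesgue_on \<Omega>) 2"
    using assms(2,3) by (auto simp: weak_partial_def)
  have "AE x in lebesgue. x \<in> \<Omega> \<longrightarrow> h x - h' x = 0"
  proof (rule fundamental_lemma[OF \<Omega> Lp_2_diff[OF h]])
    fix \<phi> assume \<phi>: "\<phi> \<in> test_functions \<Omega>"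
    have "(LINT x|lebesgue_on \<Omega>. h x * \<phi> x) = (LINT x|lebesgue_on \<Omega>. h' x * \<phi> x)"
      using assms(2,3) \<phi> unfolding weak_partial_def by (metis neg_equal_iff_equal)
    moreover note Lp_2_mult[OF h(1) test_function_Lp_2[OF \<phi> \<Omega>m]]
      Lp_2_mult[OF h(2) test_function_Lp_2[OF \<phi> \<Omega>m]]
    ultimately show "(LINT x|lebesgue_on \<Omega>. (h x - h' x) * \<phi> x) = 0"
      by (simp add: left_diff_distrib)
  qed
  then show ?thesis by (simp add: AE_lebesgue_on[OF \<Omega>m])
qed

text \<open>
  On \<open>V\<close> the classical derivative satisfies the defining identity of the weak derivative, by
  integration by parts, so the fundamental lemma identifies the two. This makes weak derivatives of
  the functions \<open>Q_dist (f, T)\<close> computable near regular points.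
\<close>

lemma weak_partial_eq_derivative:
  fixes g :: "'a::euclidean_space \<Rightarrow> real"
  assumes \<Omega>: "open \<Omega>" and h: "weak_partial \<Omega> b g h" and b: "b \<in> Basis"
    and V: "open V" "bounded V" "V \<subseteq> \<Omega>" and lip: "L-lipschitz_on V g"
    and diff: "AE x in lborel. x \<in> V \<longrightarrow> g differentiable (at x)"
  shows "AE x in lebesgue. x \<in> V \<longrightarrow> h x = frechet_derivative g (at x) b"
proof -
  have m: "\<Omega> \<in> sets lebesgue" "V \<in> sets lebesgue" using \<Omega> V by auto
  obtain d where d: "d \<in> borel_measurable borel" "\<And>x. \<bar>d x\<bar> \<le> L"
    "AE x in lborel. x \<in> V \<longrightarrow> d x = frechet_derivative g (at x) b"
    using borel_partial_derivative[OF V(1) lip diff b] by metis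
  define g0 where "g0 x = (if x \<in> V then g x else 0)" for x
  have g0: "g0 \<in> borel_measurable borel"
    unfolding g0_def by (intro borel_measurable_extend_by V lipschitz_on_continuous_on[OF lip])
  have lip0: "L-lipschitz_on V g0"
    using lip unfolding lipschitz_on_def g0_def by auto
  obtain M where M: "\<And>x. x \<in> V \<Longrightarrow> \<bar>g0 x\<bar> \<le> M"
  proof (cases "V = {}")
    case False
    then obtain x0 where x0: "x0 \<in> V" by blast
    obtain R where R: "\<And>x. x \<in> V \<Longrightarrow> dist x x0 \<le> R"
      using V(2) by (metis bounded_any_center dist_commute)
    have "\<bar>g0 x\<bar> \<le> \<bar>g0 x0\<bar> + L * R" if "x \<in> V" for x
    proof -
      have "\<bar>g0 x - g0 x0\<bar> \<le> L * dist x x0"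
        using lipschitz_onD[OF lip0 that x0] by (simp add: dist_real_def)
      also have "\<dots> \<le> L * R" using R[OF that] lipschitz_on_nonneg[OF lip] by (rule mult_left_mono)
      finally show ?thesis by linarith
    qed
    then show ?thesis by (rule that)
  qed (use that in auto)
  have eq: "g0 differentiable (at x) \<and> frechet_derivative g0 (at x) = frechet_derivative g (at x)"
    if xV: "x \<in> V" and gx: "g differentiable (at x)" for x
  proof -
    obtain D where D: "(g has_derivative D) (at x)" using gx by (auto simp: differentiable_def)
    have D0: "(g0 has_derivative D) (at x)"
      by (rule has_derivative_transform_within_open[OF D V(1) xV]) (simp add: g0_def)
    show ?thesis using frechet_derivative_at[OF D] frechet_derivative_at[OF D0] D0
      by (auto simp: differentiable_def)
  qed
  have diff0: "AE x in lborel. x \<in> V \<longrightarrow> g0 differentiable (at x)"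
    using diff by eventually_elim (use eq in blast)
  have d0: "AE x in lborel. x \<in> V \<longrightarrow> d x = frechet_derivative g0 (at x) b"
    using diff d(3)
  proof eventually_elim
    case (elim x)
    then show ?case using eq[of x] by simp
  qed
  have hL: "h \<in> Lp (lebesgue_on V) 2"
    by (rule Lp_2_subset[OF _ V(3) m(2,1)]) (use h in \<open>simp add: weak_partial_def\<close>)
  have dL: "d \<in> Lp (lebesgue_on V) 2"
    by (rule Lp_2_bounded[OF measurable_lebesgue_on_if_borel[OF d(1)] _ V(2) m(2)]) (rule d(2))
  have "AE x in lebesgue. x \<in> V \<longrightarrow> h x - d x = 0"
  proof (rule fundamental_lemma[OF V(1) Lp_2_diff[OF hL dL]])
    fix \<phi> assume \<phi>: "\<phi> \<in> test_functions V"
    have \<phi>m: "\<phi> \<in> borel_measurable borel" by (rule smooth_measurable[OF test_functionD(1)[OF \<phi>]])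
    have \<phi>bm: "(\<lambda>x. frechet_derivative \<phi> (at x) b) \<in> borel_measurable borel"
      by (rule smooth_measurable[OF smoothD(2)[OF test_functionD(1)[OF \<phi>] b]])
    have "(LINT x|lebesgue_on V. h x * \<phi> x) = (LINT x|lebesgue_on \<Omega>. h x * \<phi> x)"
      by (rule integral_lebesgue_on_restrict[OF _ V(3) m(2,1), symmetric])
        (simp add: test_function_zero[OF \<phi>])
    also have "\<dots> = - (LINT x|lebesgue_on \<Omega>. g x * frechet_derivative \<phi> (at x) b)"
      using h test_function_subset[OF \<phi> V(3)] by (simp add: weak_partial_def)
    also have "(LINT x|lebesgue_on \<Omega>. g x * frechet_derivative \<phi> (at x) b)
        = (LINT x|lebesgue_on \<Omega>. g0 x * frechet_derivative \<phi> (at x) b)"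
      by (rule arg_cong[where f = "integral\<^sup>L _"]) (auto simp: fun_eq_iff g0_def test_function_zero(2)[OF \<phi>])
    also have "\<dots> = (LINT x|lborel. g0 x * frechet_derivative \<phi> (at x) b)"
      by (rule integral_lebesgue_on_lborel[OF _ m(1) borel_measurable_times[OF g0 \<phi>bm]])
        (use V(3) in \<open>auto simp: g0_def\<close>)
    also have "\<dots> = - (LINT x|lborel. d x * \<phi> x)"
      by (rule integration_by_parts_lipschitz[OF V(1) g0 lip0 M diff0 d(1) d0 \<phi> b])
    also have "(LINT x|lborel. d x * \<phi> x) = (LINT x|lebesgue_on V. d x * \<phi> x)"
      using m(2) d(1) \<phi>m
      by (intro integral_lebesgue_on_lborel[symmetric]) (auto simp: test_function_zero(1)[OF \<phi>])
    finally have "(LINT x|lebesgue_on V. h x * \<phi> x) = (LINT x|lebesgue_on V. d x * \<phi> x)" by simp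
    moreover note Lp_2_mult[OF hL test_function_Lp_2[OF \<phi> m(2)]]
      Lp_2_mult[OF dL test_function_Lp_2[OF \<phi> m(2)]]
    ultimately show "(LINT x|lebesgue_on V. (h x - d x) * \<phi> x) = 0"
      by (simp add: left_diff_distrib)
  qed
  moreover have "AE x in lebesgue. x \<in> V \<longrightarrow> d x = frechet_derivative g (at x) b"
    using d(3) by (rule AE_completion)
  ultimately show ?thesis by eventually_elim auto
qed

section \<open>The minimal bound\<close>

text \<open>
  Weak derivatives are unique up to null sets, so one and the same derivative obeys both bounds.
\<close>

lemma partial_bound_min:
  assumes "open \<Omega>" "partial_bound \<Omega> Q f b \<phi>" "partial_bound \<Omega> Q f b \<psi>"
  shows "partial_bound \<Omega> Q f b (\<lambda>x. min (\<phi> x) (\<psi> x))"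
  unfolding partial_bound_def
proof (intro conjI ballI)
  have p: "\<And>x. x \<in> \<Omega> \<Longrightarrow> 0 \<le> \<phi> x" "\<And>x. x \<in> \<Omega> \<Longrightarrow> 0 \<le> \<psi> x"
    and L: "\<phi> \<in> Lp (lebesgue_on \<Omega>) 2" "\<psi> \<in> Lp (lebesgue_on \<Omega>) 2"
    using assms by (auto simp: partial_bound_def)
  show "0 \<le> min (\<phi> x) (\<psi> x)" if "x \<in> \<Omega>" for x using p[OF that] by simp
  show "(\<lambda>x. min (\<phi> x) (\<psi> x)) \<in> Lp (lebesgue_on \<Omega>) 2"
  proof (rule Lp_2_dominated[OF L(1)])
    show "(\<lambda>x. min (\<phi> x) (\<psi> x)) \<in> borel_measurable (lebesgue_on \<Omega>)"
      using L by (intro borel_measurable_min) (auto simp: Lp_2_iff)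
    show "AE x in lebesgue_on \<Omega>. \<bar>min (\<phi> x) (\<psi> x)\<bar> \<le> \<bar>\<phi> x\<bar>"
      using p by (intro AE_I2) (auto simp: space_restrict_space)
  qed
  fix T :: "'b multiset" assume T: "T \<in> Q_points Q"
  from assms(2) T obtain h
    where h: "weak_partial \<Omega> b (\<lambda>x. Q_dist (f x) T) h" "AE x in lebesgue_on \<Omega>. \<bar>h x\<bar> \<le> \<phi> x"
    unfolding partial_bound_def by blast
  from assms(3) T obtain h'
    where h': "weak_partial \<Omega> b (\<lambda>x. Q_dist (f x) T) h'" "AE x in lebesgue_on \<Omega>. \<bar>h' x\<bar> \<le> \<psi> x"
    unfolding partial_bound_def by blast
  have "AE x in lebesgue_on \<Omega>. \<bar>h x\<bar> \<le> min (\<phi> x) (\<psi> x)"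
    using weak_partial_unique[OF assms(1) h(1) h'(1)] h(2) h'(2) by eventually_elim simp
  with h(1) show "\<exists>h. weak_partial \<Omega> b (\<lambda>x. Q_dist (f x) T) h
      \<and> (AE x in lebesgue_on \<Omega>. \<bar>h x\<bar> \<le> min (\<phi> x) (\<psi> x))" by blast
qed

text \<open>
  Take a sequence of admissible bounds whose \<open>L\<^sup>2\<close> norms approach the infimum. Their pointwise infimum
  \<open>m\<close> is admissible and attains it. For any other admissible \<open>\<psi>\<close>, also \<open>min m \<psi>\<close> is
  admissible, and it cannot have a smaller norm, so it agrees with \<open>m\<close> almost everywhere.
\<close>

lemma minimal_partial_bound_exists:
  assumes \<Omega>: "open \<Omega>" and ex: "partial_bound \<Omega> Q f b \<phi>0"
  shows "\<exists>\<phi>. partial_bound \<Omega> Q f b \<phi> \<and>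
    (\<forall>\<psi>. partial_bound \<Omega> Q f b \<psi> \<longrightarrow> (AE x in lebesgue_on \<Omega>. \<phi> x \<le> \<psi> x))"
proof -
  define M where "M = lebesgue_on \<Omega>"
  define E where "E \<phi> = (LINT x|M. (\<phi> x)\<^sup>2)" for \<phi> :: "'a \<Rightarrow> real"
  define P where "P = partial_bound \<Omega> Q f b"
  define I where "I = Inf (E ` Collect P)"
  have space: "space M = \<Omega>" by (simp add: M_def space_restrict_space)
  have int: "integrable M (\<lambda>x. (\<phi> x)\<^sup>2)" and meas: "\<phi> \<in> borel_measurable M" if "P \<phi>" for \<phi>
    using that by (auto simp: P_def partial_bound_def Lp_2_iff M_def)
  have pos: "0 \<le> \<phi> x" if "P \<phi>" "x \<in> \<Omega>" for \<phi> x
    using that by (auto simp: P_def partial_bound_def)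
  have E0: "0 \<le> E \<phi>" for \<phi> by (simp add: E_def)
  have bdd: "bdd_below (E ` Collect P)" by (rule bdd_belowI2[where m = 0]) (rule E0)
  have I_le: "I \<le> E \<phi>" if "P \<phi>" for \<phi>
    unfolding I_def by (rule cInf_lower[OF _ bdd]) (use that in simp)
  have "\<exists>\<phi>. P \<phi> \<and> E \<phi> < I + 1 / real (Suc k)" for k
  proof -
    have ne: "E ` Collect P \<noteq> {}" using ex by (auto simp: P_def)
    have "Inf (E ` Collect P) < I + 1 / real (Suc k)" by (simp add: I_def)
    from cInf_lessD[OF ne this] obtain e where "e \<in> E ` Collect P" "e < I + 1 / real (Suc k)" by blast
    then show ?thesis by auto
  qed
  then have "\<forall>k. \<exists>\<phi>. P \<phi> \<and> E \<phi> < I + 1 / real (Suc k)" by blast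
  from choice[OF this] obtain \<Phi> where \<Phi>: "\<And>k. P (\<Phi> k)" "\<And>k. E (\<Phi> k) < I + 1 / real (Suc k)"
    by blast
  define m where "m x = (INF k. \<Phi> k x)" for x
  have bddx: "bdd_below (range (\<lambda>k. \<Phi> k x))" if "x \<in> \<Omega>" for x
    by (rule bdd_belowI2[where m = 0]) (rule pos[OF \<Phi>(1) that])
  have m_le: "m x \<le> \<Phi> k x" if "x \<in> \<Omega>" for x k
    unfolding m_def by (rule cINF_lower[OF bddx[OF that]]) simp
  have m0: "0 \<le> m x" if "x \<in> \<Omega>" for x
    unfolding m_def by (rule cINF_greatest) (auto simp: pos[OF \<Phi>(1) that])
  have m_meas: "m \<in> borel_measurable M"
    unfolding m_def by (rule borel_measurable_cINF) (use meas[OF \<Phi>(1)] bddx space in auto)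
  have Pm: "P m"
    unfolding P_def partial_bound_def
  proof (intro conjI ballI)
    show "m \<in> Lp (lebesgue_on \<Omega>) 2"
    proof (rule Lp_2_dominated)
      show "\<Phi> 0 \<in> Lp (lebesgue_on \<Omega>) 2" using \<Phi>(1)[of 0] by (simp add: P_def partial_bound_def)
      show "m \<in> borel_measurable (lebesgue_on \<Omega>)" using m_meas by (simp add: M_def)
      show "AE x in lebesgue_on \<Omega>. \<bar>m x\<bar> \<le> \<bar>\<Phi> 0 x\<bar>"
      proof (rule AE_I2)
        fix x assume "x \<in> space (lebesgue_on \<Omega>)"
        then have "x \<in> \<Omega>" by (simp add: space_restrict_space)
        then show "\<bar>m x\<bar> \<le> \<bar>\<Phi> 0 x\<bar>" using m0[of x] m_le[of x 0] by linarith
      qed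
    qed
    show "0 \<le> m x" if "x \<in> \<Omega>" for x using that by (rule m0)
    fix T :: "'b multiset" assume T: "T \<in> Q_points Q"
    have "\<exists>h. weak_partial \<Omega> b (\<lambda>x. Q_dist (f x) T) h \<and> (AE x in lebesgue_on \<Omega>. \<bar>h x\<bar> \<le> \<Phi> k x)" for k
      using \<Phi>(1)[of k] T unfolding P_def partial_bound_def by blast
    then obtain H where H: "\<And>k. weak_partial \<Omega> b (\<lambda>x. Q_dist (f x) T) (H k)"
      "\<And>k. AE x in lebesgue_on \<Omega>. \<bar>H k x\<bar> \<le> \<Phi> k x"
      using choice[of "\<lambda>k h. weak_partial \<Omega> b (\<lambda>x. Q_dist (f x) T) h
        \<and> (AE x in lebesgue_on \<Omega>. \<bar>h x\<bar> \<le> \<Phi> k x)"] by blast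
    have "AE x in lebesgue_on \<Omega>. \<bar>H 0 x\<bar> \<le> \<Phi> k x" for k
      using weak_partial_unique[OF \<Omega> H(1)[of 0] H(1)[of k]] H(2)[of k] by eventually_elim simp
    then have "AE x in lebesgue_on \<Omega>. \<forall>k. \<bar>H 0 x\<bar> \<le> \<Phi> k x" by (subst AE_all_countable) blast
    then have "AE x in lebesgue_on \<Omega>. \<bar>H 0 x\<bar> \<le> m x"
      unfolding m_def by eventually_elim (intro cINF_greatest, auto)
    then show "\<exists>h. weak_partial \<Omega> b (\<lambda>x. Q_dist (f x) T) h \<and> (AE x in lebesgue_on \<Omega>. \<bar>h x\<bar> \<le> m x)"
      using H(1) by blast
  qed
  have Em: "E m \<le> I"
  proof (rule LIMSEQ_le_const)
    show "(\<lambda>k. I + 1 / real (Suc k)) \<longlonglongrightarrow> I"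
      using tendsto_add[OF tendsto_const LIMSEQ_Suc[OF lim_1_over_n], of I] by simp
    have "E m \<le> E (\<Phi> k)" for k
      unfolding E_def
      by (rule integral_mono[OF int[OF Pm] int[OF \<Phi>(1)]])
        (use m0 m_le space in \<open>auto intro: power_mono\<close>)
    then show "\<exists>N. \<forall>n\<ge>N. E m \<le> I + 1 / real (Suc n)"
      using order_trans[OF _ less_imp_le[OF \<Phi>(2)]] by blast
  qed
  have "AE x in M. m x \<le> \<psi> x" if \<psi>: "P \<psi>" for \<psi>
  proof -
    define n where "n x = min (m x) (\<psi> x)" for x
    have Pn: "P n"
      using partial_bound_min[OF \<Omega> Pm[unfolded P_def] \<psi>[unfolded P_def]] by (simp add: P_def n_def[abs_def])
    have le: "n x \<le> m x" for x by (simp add: n_def)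
    have ge: "0 \<le> (m x)\<^sup>2 - (n x)\<^sup>2" if "x \<in> \<Omega>" for x
      using power_mono[OF le pos[OF Pn that], of 2] by simp
    have "(LINT x|M. (m x)\<^sup>2 - (n x)\<^sup>2) = E m - E n"
      unfolding E_def using int[OF Pm] int[OF Pn] by simp
    also have "\<dots> \<le> 0" using Em I_le[OF Pn] by simp
    finally have "(LINT x|M. (m x)\<^sup>2 - (n x)\<^sup>2) = 0"
      using ge space by (intro antisym Bochner_Integration.integral_nonneg) auto
    then have "AE x in M. (m x)\<^sup>2 - (n x)\<^sup>2 = 0"
      using int[OF Pm] int[OF Pn] ge space
      by (subst (asm) integral_nonneg_eq_0_iff_AE) auto
    then show ?thesis
    proof (rule AE_mp, intro AE_I2 impI)
      fix x assume x: "x \<in> space M" "(m x)\<^sup>2 - (n x)\<^sup>2 = 0"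
      then have "x \<in> \<Omega>" "(m x)\<^sup>2 = (n x)\<^sup>2" by (auto simp: space)
      then have "m x = n x" using m0[of x] pos[OF Pn, of x] by (simp add: power2_eq_iff_nonneg)
      then show "m x \<le> \<psi> x" by (simp add: n_def)
    qed
  qed
  then show ?thesis using Pm unfolding P_def M_def by blast
qed

text \<open>
  The description by a choice operator is meaningful because a minimal bound exists.
\<close>

lemma abs_partial_minimal:
  assumes "open \<Omega>" "partial_bound \<Omega> Q f b \<phi>"
  shows "partial_bound \<Omega> Q f b (abs_partial \<Omega> Q f b)"
    and "AE x in lebesgue_on \<Omega>. abs_partial \<Omega> Q f b x \<le> \<phi> x"
proof -
  have "partial_bound \<Omega> Q f b (abs_partial \<Omega> Q f b) \<and> (\<forall>\<psi>. partial_bound \<Omega> Q f b \<psi> \<longrightarrow>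
      (AE x in lebesgue_on \<Omega>. abs_partial \<Omega> Q f b x \<le> \<psi> x))"
    unfolding abs_partial_def by (rule someI_ex[OF minimal_partial_bound_exists[OF assms]])
  then show "partial_bound \<Omega> Q f b (abs_partial \<Omega> Q f b)"
    "AE x in lebesgue_on \<Omega>. abs_partial \<Omega> Q f b x \<le> \<phi> x"
    using assms(2) by auto
qed

section \<open>Mollification\<close>

lemma frechet_derivative_apply:
  assumes "(f has_derivative D) (at x)"
  shows "frechet_derivative f (at x) h = D h"
  unfolding frechet_derivative_at[OF assms, symmetric] ..

lemma lborel_integral_affine:
  fixes f :: "'a::euclidean_space \<Rightarrow> real"
  assumes "f \<in> borel_measurable borel" "c \<noteq> 0"
  shows "(LINT y|lborel. f y) = \<bar>c\<bar> ^ DIM('a) * (LINT z|lborel. f (t + c *\<^sub>R z))"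
proof -
  have "(LINT y|lborel. f y)
      = (LINT y|density (distr lborel borel (\<lambda>x. t + c *\<^sub>R x)) (\<lambda>_. ennreal (\<bar>c\<bar> ^ DIM('a))). f y)"
    using lborel_affine[OF assms(2), of t] by simp
  also have "\<dots> = (LINT y|distr lborel borel (\<lambda>x. t + c *\<^sub>R x). \<bar>c\<bar> ^ DIM('a) *\<^sub>R f y)"
    by (rule integral_density) (use assms in auto)
  also have "\<dots> = (LINT z|lborel. \<bar>c\<bar> ^ DIM('a) *\<^sub>R f (t + c *\<^sub>R z))"
    by (rule integral_distr) (use assms in auto)
  finally show ?thesis by simp
qed

lemma integral_cbox_eq_lborel:
  fixes f :: "'a::euclidean_space \<Rightarrow> real"
  assumes "continuous_on (cbox a c) f" "\<And>x. x \<notin> cbox a c \<Longrightarrow> f x = 0"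
  shows "integral (cbox a c) f = (LINT x|lborel. f x)"
proof -
  have "set_integrable lborel (cbox a c) f"
    unfolding set_integrable_def by (rule borel_integrable_compact[OF compact_cbox assms(1)])
  from set_borel_integral_eq_integral(2)[OF this]
  have "integral (cbox a c) f = (LINT x|lborel. indicator (cbox a c) x *\<^sub>R f x)"
    by (simp add: set_lebesgue_integral_def)
  also have "\<dots> = (LINT x|lborel. f x)"
    by (rule Bochner_Integration.integral_cong) (auto simp: indicator_def assms(2))
  finally show ?thesis .
qed

definition bump :: "real \<Rightarrow> 'a::euclidean_space \<Rightarrow> real" where
  "bump s x = flat_exp 0 (1 - (1 / s\<^sup>2) * (x \<bullet> x))"

lemma smooth_bump: "smooth (bump s :: 'a::euclidean_space \<Rightarrow> real)"
proof -
  have "(\<lambda>x::'a. x \<bullet> x) = (\<lambda>x. \<Sum>b\<in>Basis. (x \<bullet> b) * (x \<bullet> b))"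
    by (rule ext) (rule euclidean_inner)
  moreover have "smooth (\<lambda>x::'a. \<Sum>b\<in>Basis. (x \<bullet> b) * (x \<bullet> b))"
    by (rule smooth_sum) (rule smooth_mult[OF smooth_inner smooth_inner])
  ultimately have "smooth (\<lambda>x::'a. x \<bullet> x)" by simp
  from smooth_flat_exp_compose[OF smooth_diff[OF smooth_const smooth_mult[OF smooth_const this]]]
  show ?thesis unfolding bump_def[abs_def] .
qed

lemma bump_scale: "s \<noteq> 0 \<Longrightarrow> bump s (s *\<^sub>R x) = bump 1 x"
  by (simp add: bump_def power2_eq_square)

lemma bump_nonzero: "bump 1 x \<noteq> 0 \<longleftrightarrow> norm x < 1"
proof -
  have "bump 1 x \<noteq> 0 \<longleftrightarrow> x \<bullet> x < 1" unfolding bump_def flat_exp_0 by simp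
  also have "\<dots> \<longleftrightarrow> (norm x)\<^sup>2 < 1\<^sup>2" by (simp add: power2_norm_eq_inner)
  also have "\<dots> \<longleftrightarrow> norm x < 1" by (metis abs_norm_cancel abs_square_less_1 one_power2)
  finally show ?thesis .
qed

lemma bump_nonneg: "0 \<le> bump s x"
  by (simp add: bump_def flat_exp_0)

lemma bump_test: "bump 1 \<in> test_functions (ball (0::'a::euclidean_space) 2)"
proof -
  have sub: "closure {x::'a. bump 1 x \<noteq> 0} \<subseteq> cball 0 1"
    by (rule closure_minimal) (auto simp: bump_nonzero)
  have "bounded {x::'a. bump 1 x \<noteq> 0}"
    by (rule bounded_subset[OF bounded_cball[of 0 1]]) (auto simp: bump_nonzero)
  then show ?thesis
    unfolding test_functions_def using smooth_bump sub by (auto simp: compact_closure)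
qed

lemma test_function_integrable:
  assumes "\<phi> \<in> test_functions V"
  shows "integrable lborel \<phi>"
proof -
  obtain C where C: "\<And>x. \<bar>\<phi> x\<bar> \<le> C" using test_function_bounded[OF assms] by blast
  show ?thesis
    by (rule integrable_lborel_bounded[OF smooth_measurable[OF test_functionD(1)[OF assms]] C, of "{x. \<phi> x \<noteq> 0}"])
      (use test_functionD(2)[OF assms] in auto)
qed

lemma integral_bump_pos: "0 < (LINT x|lborel. bump 1 (x::'a::euclidean_space))"
proof -
  have i: "integrable lborel (bump 1 :: 'a \<Rightarrow> real)" by (rule test_function_integrable[OF bump_test])
  have "(LINT x|lborel. bump 1 (x::'a)) \<noteq> 0"
  proof
    assume "(LINT x|lborel. bump 1 (x::'a)) = 0"
    then have "AE x in lborel. bump 1 (x::'a) = 0"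
      using i by (subst (asm) integral_nonneg_eq_0_iff_AE) (auto simp: bump_nonneg)
    then have "AE x in lborel. (x::'a) \<notin> ball 0 1"
      by eventually_elim (use bump_nonzero in force)
    then have "emeasure lborel (ball (0::'a) 1) = 0"
      by (subst (asm) AE_iff_measurable[of "ball 0 1"]) auto
    then show False using content_ball_pos[of 1 "0::'a"] by (simp add: measure_def)
  qed
  moreover have "0 \<le> (LINT x|lborel. bump 1 (x::'a))"
    by (intro Bochner_Integration.integral_nonneg bump_nonneg)
  ultimately show ?thesis by simp
qed

text \<open>
  The case \<open>D = 0\<close> says that derivatives of the mollifier have mean zero; the general case evaluates
  the limit of the derivatives of the mollified function.
\<close>

lemma linear_functional_by_parts:
  fixes D :: "'a::euclidean_space \<Rightarrow> real"
  assumes "bounded_linear D" and \<phi>: "\<phi> \<in> test_functions (ball 0 2)" and b: "b \<in> Basis"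
  shows "(LINT x|lborel. (D x + c) * frechet_derivative \<phi> (at x) b) = - (D b * (LINT x|lborel. \<phi> x))"
proof -
  interpret bounded_linear D by fact
  obtain K where K: "\<And>x. norm (D x) \<le> norm x * K" "K > 0" using pos_bounded by blast
  have der: "((\<lambda>x. D x + c) has_derivative D) (at x)" for x
    using has_derivative_add[OF has_derivative[OF has_derivative_ident] has_derivative_const] by simp
  have "(LINT x|lborel. (D x + c) * frechet_derivative \<phi> (at x) b) = - (LINT x|lborel. D b * \<phi> x)"
  proof (rule integration_by_parts_lipschitz[where V = "ball 0 2" and L = K and M = "2 * K + \<bar>c\<bar>"])
    show "(\<lambda>x. D x + c) \<in> borel_measurable borel"
      by (intro borel_measurable_continuous_onI continuous_intros continuous_on)
    show "K-lipschitz_on (ball 0 2) (\<lambda>x. D x + c)"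
      using K by (intro lipschitz_onI) (auto simp: dist_norm diff[symmetric] mult.commute)
    show "\<bar>D x + c\<bar> \<le> 2 * K + \<bar>c\<bar>" if "x \<in> ball 0 2" for x
    proof -
      have "norm x * K \<le> 2 * K" using that K(2) by (intro mult_right_mono) auto
      then show ?thesis using K(1)[of x] unfolding real_norm_def by linarith
    qed
    show "AE x in lborel. x \<in> ball 0 2 \<longrightarrow> (\<lambda>x. D x + c) differentiable (at x)"
      using der by (auto simp: differentiable_def)
    show "AE x in lborel. x \<in> ball 0 2 \<longrightarrow> D b = frechet_derivative (\<lambda>x. D x + c) (at x) b"
      by (simp add: frechet_derivative_apply[OF der])
  qed (use \<phi> b in auto)
  then show ?thesis by simp
qed

text \<open>
  Convolution with a rescaled bump. After the change of variables \<open>y = x - s n z\<close> the derivative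
  of the mollified function is an average of difference quotients of \<open>w\<close>, which the Lipschitz constant
  bounds. Where \<open>w\<close> is differentiable they converge, hence so do the averages. The last clause keeps track of supports.
\<close>

lemma mollification:
  fixes w :: "'a::euclidean_space \<Rightarrow> real"
  assumes lip: "L-lipschitz_on UNIV w" and K: "compact K" "\<And>x. x \<notin> K \<Longrightarrow> w x = 0"
  obtains \<psi> :: "nat \<Rightarrow> 'a \<Rightarrow> real" and C
  where "\<And>n. smooth (\<psi> n)"
    "\<And>n x. \<bar>\<psi> n x - w x\<bar> \<le> L / real (Suc n)"
    "\<And>n x b. b \<in> Basis \<Longrightarrow> \<bar>frechet_derivative (\<psi> n) (at x) b\<bar> \<le> C"
    "\<And>x b. b \<in> Basis \<Longrightarrow> w differentiable (at x) \<Longrightarrow>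
      (\<lambda>n. frechet_derivative (\<psi> n) (at x) b) \<longlonglongrightarrow> frechet_derivative w (at x) b"
    "\<And>n x. (\<And>y. y \<in> K \<Longrightarrow> 1 / real (Suc n) \<le> dist x y) \<Longrightarrow> \<psi> n x = 0"
proof -
  obtain a c where ac: "K \<subseteq> cbox a c" using compact_imp_bounded[OF K(1)] bounded_subset_cbox_symmetric by blast
  have w0: "w x = 0" if "x \<notin> cbox a c" for x using K(2) ac that by blast
  have wc: "continuous_on S w" for S
    using lipschitz_on_continuous_on[OF lip] by (rule continuous_on_subset) simp
  have wm[measurable]: "w \<in> borel_measurable borel"
    by (rule borel_measurable_continuous_onI[OF wc])
  have L0: "0 \<le> L" by (rule lipschitz_on_nonneg[OF lip])
  have wL: "\<bar>w x - w y\<bar> \<le> L * dist x y" for x y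
    using lipschitz_onD[OF lip, of x y] by (simp add: dist_real_def)
  define I where "I = (LINT x|lborel. bump 1 (x::'a))"
  have I: "I > 0" unfolding I_def by (rule integral_bump_pos)
  have b1: "(bump 1 :: 'a \<Rightarrow> real) \<in> test_functions (ball 0 2)" by (rule bump_test)
  note sm = smooth_bump[of 1, where 'a='a]
  have bm[measurable]: "(bump 1 :: 'a \<Rightarrow> real) \<in> borel_measurable borel" by (rule smooth_measurable[OF sm])
  have dbm: "(\<lambda>x::'a. frechet_derivative (bump 1) (at x) b) \<in> borel_measurable borel" if "b \<in> Basis" for b
    by (rule smooth_measurable[OF smoothD(2)[OF sm that]])
  have supp: "norm z \<le> 1" if "bump 1 z \<noteq> 0" for z :: 'a using that bump_nonzero[of z] by simp
  have dsupp: "norm z \<le> 1" if "frechet_derivative (bump 1) (at z) b \<noteq> 0" for z b :: 'a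
  proof (rule ccontr)
    assume "\<not> norm z \<le> 1"
    moreover have "closure {x::'a. bump 1 x \<noteq> 0} \<subseteq> cball 0 1"
      by (rule closure_minimal) (auto simp: bump_nonzero)
    ultimately have "z \<notin> closure {x. bump 1 x \<noteq> 0}" by auto
    from frechet_derivative_outside_support[OF this] that show False by simp
  qed
  have bi: "integrable lborel (bump 1 :: 'a \<Rightarrow> real)" by (rule test_function_integrable[OF b1])
  have dbi: "integrable lborel (\<lambda>x::'a. frechet_derivative (bump 1) (at x) b)" if "b \<in> Basis" for b
    by (rule test_function_integrable[OF partial_test_function[OF b1 that]])
  define s where "s n = 1 / real (Suc n)" for n
  have s0: "s n > 0" for n by (simp add: s_def)
  define N where "N n = inverse (I * s n ^ DIM('a))" for n
  define \<psi> where "\<psi> n x = N n * integral (cbox a c) (\<lambda>y. w y * bump (s n) (x - y))" for n x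
  have sm_conv: "smooth (\<lambda>x. integral (cbox a c) (\<lambda>y. w y * bump (s n) (x - y)))" for n
    unfolding smooth_def
    by (intro allI Ck_convolution[OF wc]) (rule smooth_bump[unfolded smooth_def, rule_format])
  have smooth_\<psi>: "smooth (\<psi> n)" for n
    unfolding \<psi>_def[abs_def] by (rule smooth_mult[OF smooth_const sm_conv])
  \<comment> \<open>Substitution of variables for an arbitrary continuous kernel; it is used for the bump and for its derivatives.\<close>
  have change: "integral (cbox a c) (\<lambda>y. w y * k (x - y)) = s n ^ DIM('a) * (LINT z|lborel. w (x - s n *\<^sub>R z) * k (s n *\<^sub>R z))"
    if k: "continuous_on UNIV k" for k x n
  proof -
    have kc: "continuous_on S (\<lambda>y. k (x - y))" for S
      by (rule continuous_on_compose2[OF k]) (auto intro!: continuous_intros)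
    have "integral (cbox a c) (\<lambda>y. w y * k (x - y)) = (LINT y|lborel. w y * k (x - y))"
      by (rule integral_cbox_eq_lborel[OF continuous_on_mult[OF wc kc]]) (simp add: w0)
    also have "\<dots> = \<bar>- s n\<bar> ^ DIM('a) * (LINT z|lborel. w (x + (- s n) *\<^sub>R z) * k (x - (x + (- s n) *\<^sub>R z)))"
      by (rule lborel_integral_affine[OF borel_measurable_continuous_onI[OF continuous_on_mult[OF wc kc]]])
        (use s0[of n] in simp)
    finally show ?thesis using s0[of n] by simp
  qed
  have \<psi>_eq: "\<psi> n x = (LINT z|lborel. w (x - s n *\<^sub>R z) * bump 1 z) / I" for n x
    unfolding \<psi>_def change[OF smoothD(3)[OF smooth_bump], where n = n] N_def
    using s0[of n] by (simp add: bump_scale divide_inverse)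
  have d_bump: "frechet_derivative (bump (s n)) (at (s n *\<^sub>R z)) b = frechet_derivative (bump 1) (at z) b / s n"
    for n and z b :: 'a
  proof -
    have eq: "bump (s n) = (\<lambda>v::'a. bump 1 ((1 / s n) *\<^sub>R v))"
      using bump_scale[of "s n" "(1 / s n) *\<^sub>R v" for v :: 'a] s0[of n] by (intro ext) simp
    have z: "(1 / s n) *\<^sub>R (s n *\<^sub>R z) = z" using s0[of n] by simp
    have "((\<lambda>v::'a. (1 / s n) *\<^sub>R v) has_derivative (\<lambda>h. (1 / s n) *\<^sub>R h)) (at (s n *\<^sub>R z))"
      by (auto intro!: derivative_eq_intros)
    from has_derivative_compose[OF this, of "bump 1" "frechet_derivative (bump 1) (at z)"]
    have "(bump (s n) has_derivative (\<lambda>h. frechet_derivative (bump 1) (at z) ((1 / s n) *\<^sub>R h))) (at (s n *\<^sub>R z))"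
      unfolding eq z using smoothD(1)[OF sm, of z] by simp
    from frechet_derivative_apply[OF this]
    have "frechet_derivative (bump (s n)) (at (s n *\<^sub>R z)) b = frechet_derivative (bump 1) (at z) ((1 / s n) *\<^sub>R b)" .
    also have "\<dots> = (1 / s n) * frechet_derivative (bump 1) (at z) b"
      using linear_scale[OF has_derivative_linear[OF smoothD(1)[OF sm]]] by simp
    finally show ?thesis by simp
  qed
  have D\<psi>: "frechet_derivative (\<psi> n) (at x) b
      = (LINT z|lborel. ((w (x - s n *\<^sub>R z) - w x) / s n) * frechet_derivative (bump 1) (at z) b) / I"
    if b: "b \<in> Basis" for n x b
  proof -
    have C1: "Ck (Suc 0) (bump (s n) :: 'a \<Rightarrow> real)"
      by (rule smooth_bump[unfolded smooth_def, rule_format])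
    have "(\<psi> n has_derivative (\<lambda>h. N n * integral (cbox a c) (\<lambda>t. w t * frechet_derivative (bump (s n)) (at (x - t)) h))) (at x)"
      unfolding \<psi>_def[abs_def] by (rule has_derivative_mult_right[OF has_derivative_convolution[OF wc C1]])
    from frechet_derivative_apply[OF this]
    have "frechet_derivative (\<psi> n) (at x) b = N n * integral (cbox a c) (\<lambda>t. w t * frechet_derivative (bump (s n)) (at (x - t)) b)" .
    also have "\<dots> = (N n * s n ^ DIM('a)) * (LINT z|lborel. w (x - s n *\<^sub>R z) * frechet_derivative (bump (s n)) (at (s n *\<^sub>R z)) b)"
      unfolding change[OF smoothD(3)[OF smoothD(2)[OF smooth_bump b]], where n = n] by simp
    also have "N n * s n ^ DIM('a) = inverse I" using s0[of n] by (simp add: N_def)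
    also have "(LINT z|lborel. w (x - s n *\<^sub>R z) * frechet_derivative (bump (s n)) (at (s n *\<^sub>R z)) b)
        = (LINT z|lborel. ((w (x - s n *\<^sub>R z) - w x) / s n) * frechet_derivative (bump 1) (at z) b
            + (w x / s n) * frechet_derivative (bump 1) (at z) b)"
      unfolding d_bump
      by (rule Bochner_Integration.integral_cong) (auto simp: diff_divide_distrib algebra_simps)
    also have "\<dots> = (LINT z|lborel. ((w (x - s n *\<^sub>R z) - w x) / s n) * frechet_derivative (bump 1) (at z) b)
        + (LINT z|lborel. (w x / s n) * frechet_derivative (bump 1) (at z) b)"
    proof (rule Bochner_Integration.integral_add)
      obtain C where C: "C \<ge> 0" "\<And>z. \<bar>frechet_derivative (bump 1) (at z) b\<bar> \<le> C"
        using test_function_bounded[OF partial_test_function[OF b1 b]] by blast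
      show "integrable lborel (\<lambda>z. (w (x - s n *\<^sub>R z) - w x) / s n * frechet_derivative (bump 1) (at z) b)"
      proof (rule integrable_lborel_bounded[where C = "L * C" and S = "cball 0 1"])
        show "(\<lambda>z. (w (x - s n *\<^sub>R z) - w x) / s n * frechet_derivative (bump 1) (at z) b) \<in> borel_measurable borel"
          using dbm[OF b] by measurable
        show "(w (x - s n *\<^sub>R z) - w x) / s n * frechet_derivative (bump 1) (at z) b = 0"
          if "z \<notin> cball 0 1" for z using dsupp[of z b] that by auto
        show "\<bar>(w (x - s n *\<^sub>R z) - w x) / s n * frechet_derivative (bump 1) (at z) b\<bar> \<le> L * C" for z
        proof (cases "frechet_derivative (bump 1) (at z) b = 0")
          case False
          have "\<bar>w (x - s n *\<^sub>R z) - w x\<bar> \<le> L * (s n * norm z)"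
            using wL[of "x - s n *\<^sub>R z" x] s0[of n] by (simp add: dist_norm)
          also have "\<dots> \<le> L * (s n * 1)"
            using dsupp[OF False] s0[of n] L0 by (intro mult_left_mono) auto
          finally have "\<bar>(w (x - s n *\<^sub>R z) - w x) / s n\<bar> \<le> L"
            using s0[of n] by (simp add: pos_divide_le_eq)
          then show ?thesis unfolding abs_mult using C L0 by (intro mult_mono) auto
        qed (use C L0 in simp)
      qed simp
      show "integrable lborel (\<lambda>z. w x / s n * frechet_derivative (bump 1) (at z) b)"
        by (rule integrable_mult_right[OF dbi[OF b]])
    qed
    \<comment> \<open>Subtracting the constant \<open>w x\<close> inside the integral is free, since the derivative of the bump has mean zero.\<close>
    also have "(LINT z|lborel. (w x / s n) * frechet_derivative (bump 1) (at z) b) = 0"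
      using linear_functional_by_parts[OF bounded_linear_zero b1 b, of "w x / s n"] by simp
    finally show ?thesis by (simp add: divide_inverse mult.commute)
  qed
  have quot: "\<bar>(w (x - s n *\<^sub>R z) - w x) / s n\<bar> \<le> L * norm z" for n x z
  proof -
    have "\<bar>w (x - s n *\<^sub>R z) - w x\<bar> \<le> L * (s n * norm z)"
      using wL[of "x - s n *\<^sub>R z" x] s0[of n] by (simp add: dist_norm)
    then show ?thesis using s0[of n] by (simp add: pos_divide_le_eq mult_ac)
  qed
  define B where "B b = (LINT z|lborel. L * \<bar>frechet_derivative (bump 1) (at (z::'a)) b\<bar>)" for b :: 'a
  have Bi: "integrable lborel (\<lambda>z::'a. L * \<bar>frechet_derivative (bump 1) (at z) b\<bar>)" if "b \<in> Basis" for b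
    using dbi[OF that] by (intro integrable_mult_right integrable_abs)
  have dom: "\<bar>((w (x - s n *\<^sub>R z) - w x) / s n) * frechet_derivative (bump 1) (at z) b\<bar>
      \<le> L * \<bar>frechet_derivative (bump 1) (at z) b\<bar>" for n x z b
  proof (cases "frechet_derivative (bump 1) (at z) b = 0")
    case False
    have "\<bar>(w (x - s n *\<^sub>R z) - w x) / s n\<bar> \<le> L"
      using quot[where n=n and x=x and z=z] mult_left_mono[OF dsupp[OF False] L0] by simp
    then show ?thesis unfolding abs_mult by (intro mult_right_mono) auto
  qed simp
  have B_le: "\<bar>frechet_derivative (\<psi> n) (at x) b\<bar> \<le> B b / I" if b: "b \<in> Basis" for n x b
  proof -
    have "\<bar>LINT z|lborel. ((w (x - s n *\<^sub>R z) - w x) / s n) * frechet_derivative (bump 1) (at z) b\<bar> \<le> B b"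
    proof -
      have meas: "(\<lambda>z. ((w (x - s n *\<^sub>R z) - w x) / s n) * frechet_derivative (bump 1) (at z) b) \<in> borel_measurable lborel"
        using dbm[OF b] by measurable
      have "integrable lborel (\<lambda>z. ((w (x - s n *\<^sub>R z) - w x) / s n) * frechet_derivative (bump 1) (at z) b)"
      proof (rule Bochner_Integration.integrable_bound[OF Bi[OF b] meas], rule AE_I2)
        fix z
        show "norm (((w (x - s n *\<^sub>R z) - w x) / s n) * frechet_derivative (bump 1) (at z) b)
            \<le> norm (L * \<bar>frechet_derivative (bump 1) (at z) b\<bar>)"
          unfolding real_norm_def by (rule order_trans[OF dom abs_ge_self])
      qed
      then show ?thesis unfolding B_def
        by (rule Bochner_Integration.integral_abs_bound_integral[OF _ Bi[OF b] dom])
    qed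
    then show ?thesis unfolding D\<psi>[OF b] abs_divide abs_of_pos[OF I]
      by (rule divide_right_mono) (use I in simp)
  qed
  define C where "C = (\<Sum>b\<in>(Basis::'a set). B b / I)"
  have B0: "0 \<le> B b / I" for b
    unfolding B_def using I L0 by (intro divide_nonneg_pos Bochner_Integration.integral_nonneg) auto
  have bound: "\<bar>frechet_derivative (\<psi> n) (at x) b\<bar> \<le> C" if "b \<in> Basis" for n x b
    using B_le[OF that, of n x] member_le_sum[OF that, of "\<lambda>b. B b / I"] B0 unfolding C_def
    using B0 by fastforce
  have close: "\<bar>\<psi> n x - w x\<bar> \<le> L / real (Suc n)" for n x
  proof -
    have Lb: "\<bar>(w (x - s n *\<^sub>R z) - w x) * bump 1 z\<bar> \<le> L * s n * bump 1 z" for z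
    proof (cases "bump 1 z = 0")
      case False
      have "\<bar>w (x - s n *\<^sub>R z) - w x\<bar> \<le> L * (s n * norm z)"
        using wL[of "x - s n *\<^sub>R z" x] s0[of n] by (simp add: dist_norm)
      also have "\<dots> \<le> L * (s n * 1)"
        using supp[OF False] s0[of n] L0 by (intro mult_left_mono) auto
      finally show ?thesis unfolding abs_mult using bump_nonneg[of 1 z] by (simp add: mult_right_mono)
    qed simp
    have i1: "integrable lborel (\<lambda>z::'a. L * s n * bump 1 z)" by (rule integrable_mult_right[OF bi])
    have i2: "integrable lborel (\<lambda>z. (w (x - s n *\<^sub>R z) - w x) * bump 1 z)"
    proof (rule Bochner_Integration.integrable_bound[OF i1])
      show "AE z in lborel. norm ((w (x - s n *\<^sub>R z) - w x) * bump 1 z) \<le> norm (L * s n * bump 1 z)"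
        unfolding real_norm_def by (intro AE_I2 order_trans[OF Lb] abs_ge_self)
    qed measurable
    have "(LINT z|lborel. w (x - s n *\<^sub>R z) * bump 1 z)
        = (LINT z|lborel. (w (x - s n *\<^sub>R z) - w x) * bump 1 z + w x * bump 1 z)"
      by (rule Bochner_Integration.integral_cong) (auto simp: algebra_simps)
    also have "\<dots> = (LINT z|lborel. (w (x - s n *\<^sub>R z) - w x) * bump 1 z) + w x * I"
      unfolding I_def using i2 bi by simp
    finally have eq: "\<psi> n x - w x = (LINT z|lborel. (w (x - s n *\<^sub>R z) - w x) * bump 1 z) / I"
      using I by (simp add: \<psi>_eq field_simps)
    have "\<bar>LINT z|lborel. (w (x - s n *\<^sub>R z) - w x) * bump 1 z\<bar> \<le> (LINT z|lborel. L * s n * bump 1 (z::'a))"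
      by (rule Bochner_Integration.integral_abs_bound_integral[OF i2 i1 Lb])
    also have "(LINT z|lborel. L * s n * bump 1 (z::'a)) = L * s n * I" by (simp add: I_def)
    finally have "\<bar>LINT z|lborel. (w (x - s n *\<^sub>R z) - w x) * bump 1 z\<bar> / I \<le> L * s n * I / I"
      by (rule divide_right_mono) (use I in simp)
    also have "\<dots> = L / real (Suc n)" using I by (simp add: s_def)
    finally show ?thesis unfolding eq abs_divide abs_of_pos[OF I] .
  qed
  have lim: "(\<lambda>n. frechet_derivative (\<psi> n) (at x) b) \<longlonglongrightarrow> frechet_derivative w (at x) b"
    if b: "b \<in> Basis" and "w differentiable (at x)" for x b
  proof -
    define D where "D = frechet_derivative w (at x)"
    have D: "(w has_derivative D) (at x)"
      using that(2) frechet_derivative_works unfolding D_def by blast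
    have lin: "linear D" by (rule has_derivative_linear[OF D])
    have s_lim: "s \<longlonglongrightarrow> 0" unfolding s_def by (rule LIMSEQ_Suc[OF lim_1_over_n])
    have "(\<lambda>n. LINT z|lborel. ((w (x - s n *\<^sub>R z) - w x) / s n) * frechet_derivative (bump 1) (at z) b)
        \<longlonglongrightarrow> (LINT z|lborel. (- D z) * frechet_derivative (bump 1) (at z) b)"
    proof (rule integral_dominated_convergence[OF _ _ Bi[OF b]])
      show "AE z in lborel. (\<lambda>n. ((w (x - s n *\<^sub>R z) - w x) / s n) * frechet_derivative (bump 1) (at z) b)
          \<longlonglongrightarrow> (- D z) * frechet_derivative (bump 1) (at z) b"
      proof (intro AE_I2 tendsto_mult tendsto_const)
        fix z
        have "(\<lambda>n. (w (x + s n *\<^sub>R (- z)) - w x) / s n) \<longlonglongrightarrow> D (- z)"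
          by (rule difference_quotient_tendsto[OF D s_lim less_imp_neq[OF s0, symmetric]])
        then show "(\<lambda>n. (w (x - s n *\<^sub>R z) - w x) / s n) \<longlonglongrightarrow> - D z"
          using linear_neg[OF lin] by simp
      qed
      show "AE z in lborel. norm (((w (x - s n *\<^sub>R z) - w x) / s n) * frechet_derivative (bump 1) (at z) b)
          \<le> L * \<bar>frechet_derivative (bump 1) (at z) b\<bar>" for n
        using dom by (intro AE_I2) simp
      have "D \<in> borel_measurable borel"
        using has_derivative_bounded_linear[OF D]
        by (intro borel_measurable_continuous_onI linear_continuous_on)
      then show "(\<lambda>z. (- D z) * frechet_derivative (bump 1) (at z) b) \<in> borel_measurable lborel"
        using dbm[OF b] by measurable
      show "(\<lambda>z. ((w (x - s n *\<^sub>R z) - w x) / s n) * frechet_derivative (bump 1) (at z) b) \<in> borel_measurable lborel" for n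
        using dbm[OF b] by measurable
    qed
    also have "(LINT z|lborel. (- D z) * frechet_derivative (bump 1) (at z) b) = D b * I"
      using linear_functional_by_parts[OF has_derivative_bounded_linear[OF D] b1 b, of 0]
      by (simp add: I_def)
    finally have "(\<lambda>n. frechet_derivative (\<psi> n) (at x) b) \<longlonglongrightarrow> D b * I / I"
      unfolding D\<psi>[OF b] by (intro tendsto_divide tendsto_const) (use I in auto)
    then show ?thesis using I by (simp add: D_def)
  qed
  have zero: "\<psi> n x = 0" if far: "\<And>y. y \<in> K \<Longrightarrow> 1 / real (Suc n) \<le> dist x y" for n x
  proof -
    have "w (x - s n *\<^sub>R z) * bump 1 z = 0" for z
    proof (cases "bump 1 z = 0")
      case False
      then have "dist x (x - s n *\<^sub>R z) < 1 / real (Suc n)"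
        using s0[of n] bump_nonzero[of z] by (simp add: dist_norm s_def divide_strict_right_mono)
      then have "x - s n *\<^sub>R z \<notin> K" using far by force
      then show ?thesis using K(2) by simp
    qed simp
    then have "(\<lambda>z. w (x - s n *\<^sub>R z) * bump 1 z) = (\<lambda>_. 0)" by (rule ext)
    then show ?thesis unfolding \<psi>_eq by simp
  qed
  show ?thesis by (rule that[OF smooth_\<psi> close bound lim zero])
qed

section \<open>Traces\<close>

lemma finite_measure_lebesgue_on:
  assumes "bounded V" "V \<in> sets lebesgue"
  shows "finite_measure (lebesgue_on V)"
  by (rule finite_measureI)
    (use bounded_set_imp_lmeasurable[OF assms] assms(2) in
      \<open>simp add: emeasure_restrict_space fmeasurable_def less_top[symmetric]\<close>)

lemma nn_integral_square_add_tendsto_zero: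
  fixes f g :: "nat \<Rightarrow> 'a \<Rightarrow> real"
  assumes [measurable]: "\<And>k. f k \<in> borel_measurable M" "\<And>k. g k \<in> borel_measurable M"
    and f: "(\<lambda>k. \<integral>\<^sup>+x. ennreal ((f k x)\<^sup>2) \<partial>M) \<longlonglongrightarrow> 0"
    and g: "(\<lambda>k. \<integral>\<^sup>+x. ennreal ((g k x)\<^sup>2) \<partial>M) \<longlonglongrightarrow> 0"
  shows "(\<lambda>k. \<integral>\<^sup>+x. ennreal ((f k x + g k x)\<^sup>2) \<partial>M) \<longlonglongrightarrow> 0"
proof (rule tendsto_sandwich[where f = "\<lambda>_. 0"
      and h = "\<lambda>k. 2 * (\<integral>\<^sup>+x. ennreal ((f k x)\<^sup>2) \<partial>M) + 2 * (\<integral>\<^sup>+x. ennreal ((g k x)\<^sup>2) \<partial>M)"])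
  show "(\<lambda>k. 2 * (\<integral>\<^sup>+x. ennreal ((f k x)\<^sup>2) \<partial>M) + 2 * (\<integral>\<^sup>+x. ennreal ((g k x)\<^sup>2) \<partial>M)) \<longlonglongrightarrow> 0"
    using tendsto_add[OF tendsto_mult_ennreal[OF tendsto_const[of "2::ennreal"] f] tendsto_mult_ennreal[OF tendsto_const[of "2::ennreal"] g]]
    by simp
  have "(\<integral>\<^sup>+x. ennreal ((f k x + g k x)\<^sup>2) \<partial>M)
      \<le> 2 * (\<integral>\<^sup>+x. ennreal ((f k x)\<^sup>2) \<partial>M) + 2 * (\<integral>\<^sup>+x. ennreal ((g k x)\<^sup>2) \<partial>M)" for k
  proof -
    have "ennreal ((s + t)\<^sup>2) \<le> 2 * ennreal (s\<^sup>2) + 2 * ennreal (t\<^sup>2)" for s t :: real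
    proof -
      have "(s + t)\<^sup>2 \<le> 2 * s\<^sup>2 + 2 * t\<^sup>2"
        using zero_le_power2[of "s - t"] by (simp add: power2_diff power2_sum)
      then have "ennreal ((s + t)\<^sup>2) \<le> ennreal (2 * s\<^sup>2 + 2 * t\<^sup>2)" by (rule ennreal_leI)
      also have "\<dots> = 2 * ennreal (s\<^sup>2) + 2 * ennreal (t\<^sup>2)"
        by (simp add: ennreal_plus ennreal_mult)
      finally show ?thesis .
    qed
    then have "(\<integral>\<^sup>+x. ennreal ((f k x + g k x)\<^sup>2) \<partial>M)
        \<le> (\<integral>\<^sup>+x. 2 * ennreal ((f k x)\<^sup>2) + 2 * ennreal ((g k x)\<^sup>2) \<partial>M)"
      by (intro nn_integral_mono)
    also have "\<dots> = 2 * (\<integral>\<^sup>+x. ennreal ((f k x)\<^sup>2) \<partial>M) + 2 * (\<integral>\<^sup>+x. ennreal ((g k x)\<^sup>2) \<partial>M)"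
      by (simp add: nn_integral_add nn_integral_cmult)
    finally show ?thesis .
  qed
  then show "\<forall>\<^sub>F k in sequentially. (\<integral>\<^sup>+x. ennreal ((f k x + g k x)\<^sup>2) \<partial>M)
      \<le> 2 * (\<integral>\<^sup>+x. ennreal ((f k x)\<^sup>2) \<partial>M) + 2 * (\<integral>\<^sup>+x. ennreal ((g k x)\<^sup>2) \<partial>M)"
    by simp
qed auto

lemma bounded_convergence_square:
  fixes f :: "nat \<Rightarrow> 'a \<Rightarrow> real"
  assumes "finite_measure M" and [measurable]: "\<And>k. f k \<in> borel_measurable M"
    and bd: "\<And>k. AE x in M. \<bar>f k x\<bar> \<le> C" and lim: "AE x in M. (\<lambda>k. f k x) \<longlonglongrightarrow> 0"
  shows "(\<lambda>k. \<integral>\<^sup>+x. ennreal ((f k x)\<^sup>2) \<partial>M) \<longlonglongrightarrow> 0"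
proof -
  interpret finite_measure M by fact
  have "(\<lambda>k. \<integral>\<^sup>+x. ennreal ((f k x)\<^sup>2) \<partial>M) \<longlonglongrightarrow> (\<integral>\<^sup>+x. 0 \<partial>M)"
  proof (rule nn_integral_dominated_convergence[where w = "\<lambda>_. ennreal (C\<^sup>2)"])
    show "(\<integral>\<^sup>+x. ennreal (C\<^sup>2) \<partial>M) < \<infinity>"
      using emeasure_finite by (simp add: ennreal_mult_eq_top_iff less_top[symmetric])
    show "AE x in M. ennreal ((f k x)\<^sup>2) \<le> ennreal (C\<^sup>2)" for k
      using bd[of k]
    proof eventually_elim
      case (elim x)
      then have "\<bar>f k x\<bar> \<le> \<bar>C\<bar>" by linarith
      then show ?case by (intro ennreal_leI) (simp add: abs_le_square_iff)
    qed
    show "AE x in M. (\<lambda>k. ennreal ((f k x)\<^sup>2)) \<longlonglongrightarrow> 0"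
      using lim
    proof eventually_elim
      case (elim x)
      then have "(\<lambda>k. ennreal ((f k x)\<^sup>2)) \<longlonglongrightarrow> ennreal (0\<^sup>2)"
        by (intro tendsto_ennrealI tendsto_power)
      then show ?case by simp
    qed
  qed auto
  then show ?thesis by simp
qed

lemma weak_partial_add:
  assumes \<Omega>: "\<Omega> \<in> sets lebesgue" and b: "b \<in> Basis"
    and "weak_partial \<Omega> b f f'" "weak_partial \<Omega> b g g'"
  shows "weak_partial \<Omega> b (\<lambda>x. f x + g x) (\<lambda>x. f' x + g' x)"
  unfolding weak_partial_def
proof (intro conjI ballI)
  have L: "f \<in> Lp (lebesgue_on \<Omega>) 2" "f' \<in> Lp (lebesgue_on \<Omega>) 2"
    "g \<in> Lp (lebesgue_on \<Omega>) 2" "g' \<in> Lp (lebesgue_on \<Omega>) 2"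
    using assms(3,4) by (auto simp: weak_partial_def)
  then show "(\<lambda>x. f x + g x) \<in> Lp (lebesgue_on \<Omega>) 2" "(\<lambda>x. f' x + g' x) \<in> Lp (lebesgue_on \<Omega>) 2"
    by (auto intro: Lp_2_add)
  fix \<phi> assume \<phi>: "\<phi> \<in> test_functions \<Omega>"
  note t = test_function_Lp_2[OF \<phi> \<Omega>] test_function_Lp_2[OF partial_test_function[OF \<phi> b] \<Omega>]
  show "(LINT x|lebesgue_on \<Omega>. (f x + g x) * frechet_derivative \<phi> (at x) b)
      = - (LINT x|lebesgue_on \<Omega>. (f' x + g' x) * \<phi> x)"
    using assms(3,4) \<phi> Lp_2_mult[OF L(1) t(2)] Lp_2_mult[OF L(3) t(2)] Lp_2_mult[OF L(2) t(1)]
      Lp_2_mult[OF L(4) t(1)]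
    by (simp add: weak_partial_def distrib_right)
qed

lemma compactly_supported_bounded:
  fixes w :: "'a::euclidean_space \<Rightarrow> real"
  assumes lip: "L-lipschitz_on UNIV w" and K: "compact K" "\<And>x. x \<notin> K \<Longrightarrow> w x = 0"
  obtains M where "\<And>x. \<bar>w x\<bar> \<le> M"
proof -
  have "compact (w ` K)"
    by (intro compact_continuous_image K continuous_on_subset[OF lipschitz_on_continuous_on[OF lip]]) simp
  then obtain M where M: "\<And>y. y \<in> w ` K \<Longrightarrow> norm y \<le> M"
    using compact_imp_bounded bounded_iff by metis
  have "\<bar>w x\<bar> \<le> \<bar>M\<bar>" for x
  proof (cases "x \<in> K")
    case True
    then have "norm (w x) \<le> M" by (intro M imageI)
    then show ?thesis by simp
  qed (simp add: K(2))
  then show ?thesis by (rule that)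
qed

lemma weak_partial_lipschitz:
  fixes w :: "'a::euclidean_space \<Rightarrow> real"
  assumes \<Omega>: "open \<Omega>" "bounded \<Omega>" and b: "b \<in> Basis"
    and lip: "L-lipschitz_on UNIV w" and K: "compact K" "\<And>x. x \<notin> K \<Longrightarrow> w x = 0"
    and diff: "AE x in lborel. w differentiable (at x)"
    and d: "d \<in> borel_measurable borel" "\<And>x. \<bar>d x\<bar> \<le> L"
      "AE x in lborel. d x = frechet_derivative w (at x) b"
  shows "weak_partial \<Omega> b w d"
proof -
  have m: "\<Omega> \<in> sets lebesgue" using \<Omega> by simp
  have wm: "w \<in> borel_measurable borel"
    by (rule borel_measurable_continuous_onI[OF lipschitz_on_continuous_on[OF lip]])
  obtain M where M: "\<And>x. \<bar>w x\<bar> \<le> M" using compactly_supported_bounded[OF lip K] by blast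
  show ?thesis
    unfolding weak_partial_def
  proof (intro conjI ballI)
    show "w \<in> Lp (lebesgue_on \<Omega>) 2"
      by (rule Lp_2_bounded[OF measurable_lebesgue_on_if_borel[OF wm] M \<Omega>(2) m])
    show "d \<in> Lp (lebesgue_on \<Omega>) 2"
      by (rule Lp_2_bounded[OF measurable_lebesgue_on_if_borel[OF d(1)] d(2) \<Omega>(2) m])
    fix \<phi> assume \<phi>: "\<phi> \<in> test_functions \<Omega>"
    note sm = test_functionD(1)[OF \<phi>]
    have "(LINT x|lebesgue_on \<Omega>. w x * frechet_derivative \<phi> (at x) b) = (LINT x|lborel. w x * frechet_derivative \<phi> (at x) b)"
      by (rule integral_lebesgue_on_lborel[OF _ m borel_measurable_times[OF wm smooth_measurable[OF smoothD(2)[OF sm b]]]])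
        (simp add: test_function_zero[OF \<phi>])
    also have "\<dots> = - (LINT x|lborel. d x * \<phi> x)"
      by (rule integration_by_parts_lipschitz[OF open_UNIV wm lip M _ d(1) _ test_function_subset[OF \<phi> subset_UNIV] b])
        (use diff d(3) in auto)
    also have "(LINT x|lborel. d x * \<phi> x) = (LINT x|lebesgue_on \<Omega>. d x * \<phi> x)"
      by (rule integral_lebesgue_on_lborel[OF _ m borel_measurable_times[OF d(1) smooth_measurable[OF sm]], symmetric])
        (simp add: test_function_zero[OF \<phi>])
    finally show "(LINT x|lebesgue_on \<Omega>. w x * frechet_derivative \<phi> (at x) b) = - (LINT x|lebesgue_on \<Omega>. d x * \<phi> x)" .
  qed
qed

text \<open>
  Mollifications of \<open>w\<close> converge to \<open>w\<close> in the Sobolev norm and eventually vanish outside \<open>\<Omega>\<close>, so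
  adding them to an approximating sequence for \<open>g\<close> gives one for \<open>g + w\<close> with unchanged values
  almost everywhere with respect to \<open>S\<close>.
\<close>

lemma sobolev_trace_add_subset:
  fixes w :: "'a::euclidean_space \<Rightarrow> real"
  assumes \<Omega>: "open \<Omega>" "bounded \<Omega>" and S: "sets S = sets borel" "AE x in S. x \<notin> \<Omega>"
    and lip: "L-lipschitz_on UNIV w" and K: "compact K" "K \<subseteq> \<Omega>" "\<And>x. x \<notin> K \<Longrightarrow> w x = 0"
    and diff: "AE x in lborel. w differentiable (at x)"
  shows "sobolev_trace \<Omega> S g \<subseteq> sobolev_trace \<Omega> S (\<lambda>x. g x + w x)"
proof
  fix h assume "h \<in> sobolev_trace \<Omega> S g"
  then obtain D \<psi> where h: "h \<in> Lp S 2" and D: "\<And>b. b \<in> Basis \<Longrightarrow> weak_partial \<Omega> b g (D b)"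
    and sm: "\<And>k. smooth (\<psi> k)"
    and l1: "(\<lambda>k. \<integral>\<^sup>+x. ennreal ((\<psi> k x - g x)\<^sup>2) \<partial>lebesgue_on \<Omega>) \<longlonglongrightarrow> 0"
    and l2: "\<And>b. b \<in> Basis \<Longrightarrow> (\<lambda>k. \<integral>\<^sup>+x. ennreal ((frechet_derivative (\<psi> k) (at x) b - D b x)\<^sup>2)
                   \<partial>lebesgue_on \<Omega>) \<longlonglongrightarrow> 0"
    and l3: "(\<lambda>k. \<integral>\<^sup>+x. ennreal ((\<psi> k x - h x)\<^sup>2) \<partial>S) \<longlonglongrightarrow> 0"
    unfolding sobolev_trace_def by blast
  have m: "\<Omega> \<in> sets lebesgue" using \<Omega> by simp
  have fin: "finite_measure (lebesgue_on \<Omega>)" by (rule finite_measure_lebesgue_on[OF \<Omega>(2) m])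
  have L0: "0 \<le> L" by (rule lipschitz_on_nonneg[OF lip])
  have wm: "w \<in> borel_measurable borel"
    by (rule borel_measurable_continuous_onI[OF lipschitz_on_continuous_on[OF lip]])
  have "\<exists>d. d \<in> borel_measurable borel \<and> (\<forall>x. \<bar>d x\<bar> \<le> L) \<and> (AE x in lborel. d x = frechet_derivative w (at x) b)"
    if "b \<in> Basis" for b
  proof -
    have ae: "AE x in lborel. x \<in> UNIV \<longrightarrow> w differentiable (at x)" using diff by simp
    show ?thesis
    proof (rule borel_partial_derivative[OF open_UNIV lip ae that])
      fix d
      assume "d \<in> borel_measurable borel" "\<And>x. \<bar>d x\<bar> \<le> L"
        "AE x in lborel. x \<in> UNIV \<longrightarrow> d x = frechet_derivative w (at x) b"
      then show ?thesis by (intro exI[of _ d]) simp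
    qed
  qed
  then have "\<forall>b\<in>Basis. \<exists>d. d \<in> borel_measurable borel \<and> (\<forall>x. \<bar>d x\<bar> \<le> L) \<and>
      (AE x in lborel. d x = frechet_derivative w (at x) b)" by (rule ballI)
  from bchoice[OF this] obtain d where d': "\<forall>b\<in>Basis. d b \<in> borel_measurable borel \<and>
      (\<forall>x. \<bar>d b x\<bar> \<le> L) \<and> (AE x in lborel. d b x = frechet_derivative w (at x) b)" ..
  have d: "b \<in> Basis \<Longrightarrow> d b \<in> borel_measurable borel"
    "b \<in> Basis \<Longrightarrow> \<bar>d b x\<bar> \<le> L"
    "b \<in> Basis \<Longrightarrow> AE x in lborel. d b x = frechet_derivative w (at x) b" for b x
    using bspec[OF d'] by simp_all
  obtain \<omega> C where \<omega>: "\<And>n. smooth (\<omega> n)" "\<And>n x. \<bar>\<omega> n x - w x\<bar> \<le> L / real (Suc n)"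
    "\<And>n x b. b \<in> Basis \<Longrightarrow> \<bar>frechet_derivative (\<omega> n) (at x) b\<bar> \<le> C"
    "\<And>x b. b \<in> Basis \<Longrightarrow> w differentiable (at x) \<Longrightarrow>
      (\<lambda>n. frechet_derivative (\<omega> n) (at x) b) \<longlonglongrightarrow> frechet_derivative w (at x) b"
    "\<And>n x. (\<And>y. y \<in> K \<Longrightarrow> 1 / real (Suc n) \<le> dist x y) \<Longrightarrow> \<omega> n x = 0"
  proof (rule mollification[OF lip K(1,3)])
    fix \<omega> :: "nat \<Rightarrow> 'a \<Rightarrow> real" and C
    assume *: "\<And>n. smooth (\<omega> n)" "\<And>n x. \<bar>\<omega> n x - w x\<bar> \<le> L / real (Suc n)"
      "\<And>n x b. b \<in> Basis \<Longrightarrow> \<bar>frechet_derivative (\<omega> n) (at x) b\<bar> \<le> C"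
      "\<And>x b. b \<in> Basis \<Longrightarrow> w differentiable (at x) \<Longrightarrow>
        (\<lambda>n. frechet_derivative (\<omega> n) (at x) b) \<longlonglongrightarrow> frechet_derivative w (at x) b"
      "\<And>n x. (\<And>y. y \<in> K \<Longrightarrow> 1 / real (Suc n) \<le> dist x y) \<Longrightarrow> \<omega> n x = 0"
    show thesis by (rule that[OF *])
  qed
  obtain \<epsilon> where \<epsilon>: "\<epsilon> > 0" "(\<Union>x\<in>K. cball x \<epsilon>) \<subseteq> \<Omega>"
    using compact_subset_open_imp_cball_epsilon_subset[OF K(1) \<Omega>(1) K(2)] by blast
  \<comment> \<open>From index \<open>N\<close> on, the mollified functions are supported inside \<open>\<Omega>\<close>.\<close>
  obtain N where N: "1 / real (Suc N) < \<epsilon>" using nat_approx_posE[OF \<epsilon>(1)] by blast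
  have outside: "\<omega> (k + N) x = 0" if "x \<notin> \<Omega>" for k x
  proof (rule \<omega>(5))
    fix y assume "y \<in> K"
    then have "x \<notin> cball y \<epsilon>" using \<epsilon>(2) that by blast
    then have "\<epsilon> < dist x y" by (simp add: dist_commute)
    moreover have "1 / real (Suc (k + N)) \<le> 1 / real (Suc N)" by (simp add: frac_le)
    ultimately show "1 / real (Suc (k + N)) \<le> dist x y" using N by linarith
  qed
  define \<psi>' where "\<psi>' k x = \<psi> k x + \<omega> (k + N) x" for k x
  have d\<psi>': "frechet_derivative (\<psi>' k) (at x) b
      = frechet_derivative (\<psi> k) (at x) b + frechet_derivative (\<omega> (k + N)) (at x) b" for k x b
    unfolding \<psi>'_def[abs_def]
    by (rule frechet_derivative_apply[OF has_derivative_add[OF smoothD(1)[OF sm] smoothD(1)[OF \<omega>(1)]]])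
  have gm: "g \<in> borel_measurable (lebesgue_on \<Omega>)"
    using D[OF SOME_Basis] by (simp add: weak_partial_def Lp_2_iff)
  note mb = measurable_lebesgue_on_if_borel[where \<Omega> = \<Omega>]
  show "h \<in> sobolev_trace \<Omega> S (\<lambda>x. g x + w x)"
    unfolding sobolev_trace_def
  proof (intro CollectI conjI exI[of _ "\<lambda>b x. D b x + d b x"] exI[of _ \<psi>'] ballI allI)
    show "h \<in> Lp S 2" by (rule h)
    show "weak_partial \<Omega> b (\<lambda>x. g x + w x) (\<lambda>x. D b x + d b x)" if b: "b \<in> Basis" for b
      by (rule weak_partial_add[OF m b D[OF b]
            weak_partial_lipschitz[OF \<Omega> b lip K(1,3) diff d(1)[OF b] d(2)[OF b] d(3)[OF b]]])
    show "smooth (\<psi>' k)" for k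
      unfolding \<psi>'_def[abs_def] by (rule smooth_add[OF sm \<omega>(1)])
    have "(\<lambda>k. \<integral>\<^sup>+x. ennreal ((\<psi> k x - g x + (\<omega> (k + N) x - w x))\<^sup>2) \<partial>lebesgue_on \<Omega>) \<longlonglongrightarrow> 0"
    proof (rule nn_integral_square_add_tendsto_zero[OF _ _ l1 bounded_convergence_square[OF fin]])
      show "(\<lambda>x. \<psi> k x - g x) \<in> borel_measurable (lebesgue_on \<Omega>)" for k
        by (rule borel_measurable_diff[OF mb[OF smooth_measurable[OF sm]] gm])
      show wm': "(\<lambda>x. \<omega> (k + N) x - w x) \<in> borel_measurable (lebesgue_on \<Omega>)"
        "(\<lambda>x. \<omega> (k + N) x - w x) \<in> borel_measurable (lebesgue_on \<Omega>)" for k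
        by (rule borel_measurable_diff[OF mb[OF smooth_measurable[OF \<omega>(1)]] mb[OF wm]])+
      have le: "\<bar>\<omega> (k + N) x - w x\<bar> \<le> L / real (Suc k)" for k x
      proof -
        have "L / real (Suc (k + N)) \<le> L / real (Suc k)" using L0 by (intro divide_left_mono) auto
        then show ?thesis using \<omega>(2)[of "k + N" x] by linarith
      qed
      have "L / real (Suc k) \<le> L" for k using L0 by (simp add: divide_le_eq mult_le_cancel_left1 not_less)
      then have "\<bar>\<omega> (k + N) x - w x\<bar> \<le> L" for k x using le order_trans by blast
      then show "AE x in lebesgue_on \<Omega>. \<bar>\<omega> (k + N) x - w x\<bar> \<le> L" for k by simp
      have lim: "(\<lambda>k. L / real (Suc k)) \<longlonglongrightarrow> 0" by (rule LIMSEQ_Suc[OF lim_const_over_n])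
      have "(\<lambda>k. \<omega> (k + N) x - w x) \<longlonglongrightarrow> 0" for x
        by (rule Lim_null_comparison[OF _ lim]) (use le in simp)
      then show "AE x in lebesgue_on \<Omega>. (\<lambda>k. \<omega> (k + N) x - w x) \<longlonglongrightarrow> 0" by simp
    qed
    then show "(\<lambda>k. \<integral>\<^sup>+x. ennreal ((\<psi>' k x - (g x + w x))\<^sup>2) \<partial>lebesgue_on \<Omega>) \<longlonglongrightarrow> 0"
      by (simp add: \<psi>'_def algebra_simps)
    show "(\<lambda>k. \<integral>\<^sup>+x. ennreal ((frechet_derivative (\<psi>' k) (at x) b - (D b x + d b x))\<^sup>2) \<partial>lebesgue_on \<Omega>) \<longlonglongrightarrow> 0"
      if b: "b \<in> Basis" for b
    proof -
      have "(\<lambda>k. \<integral>\<^sup>+x. ennreal ((frechet_derivative (\<psi> k) (at x) b - D b x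
          + (frechet_derivative (\<omega> (k + N)) (at x) b - d b x))\<^sup>2) \<partial>lebesgue_on \<Omega>) \<longlonglongrightarrow> 0"
      proof (rule nn_integral_square_add_tendsto_zero[OF _ _ l2[OF b] bounded_convergence_square[OF fin]])
        have "D b \<in> borel_measurable (lebesgue_on \<Omega>)"
          using D[OF b] by (simp add: weak_partial_def Lp_2_iff)
        then show "(\<lambda>x. frechet_derivative (\<psi> k) (at x) b - D b x) \<in> borel_measurable (lebesgue_on \<Omega>)" for k
          by (rule borel_measurable_diff[OF mb[OF smooth_measurable[OF smoothD(2)[OF sm b]]]])
        show "(\<lambda>x. frechet_derivative (\<omega> (k + N)) (at x) b - d b x) \<in> borel_measurable (lebesgue_on \<Omega>)"
          "(\<lambda>x. frechet_derivative (\<omega> (k + N)) (at x) b - d b x) \<in> borel_measurable (lebesgue_on \<Omega>)" for k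
          by (rule borel_measurable_diff[OF mb[OF smooth_measurable[OF smoothD(2)[OF \<omega>(1) b]]] mb[OF d(1)[OF b]]])+
        have "\<bar>frechet_derivative (\<omega> (k + N)) (at x) b - d b x\<bar> \<le> C + L" for k x
          using \<omega>(3)[OF b, of "k + N" x] d(2)[OF b, of x] by linarith
        then show "AE x in lebesgue_on \<Omega>. \<bar>frechet_derivative (\<omega> (k + N)) (at x) b - d b x\<bar> \<le> C + L" for k by simp
        have "AE x in lborel. (\<lambda>k. frechet_derivative (\<omega> (k + N)) (at x) b - d b x) \<longlonglongrightarrow> 0"
          using diff d(3)[OF b]
        proof eventually_elim
          case (elim x)
          have "(\<lambda>k. frechet_derivative (\<omega> (k + N)) (at x) b) \<longlonglongrightarrow> d b x"
            using LIMSEQ_ignore_initial_segment[OF \<omega>(4)[OF b elim(1)], of N] elim(2) by simp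
          then show ?case using LIM_zero by blast
        qed
        then show "AE x in lebesgue_on \<Omega>. (\<lambda>k. frechet_derivative (\<omega> (k + N)) (at x) b - d b x) \<longlonglongrightarrow> 0"
          unfolding AE_lebesgue_on[OF m] by (rule AE_mp[OF AE_completion]) simp
      qed
      moreover have "frechet_derivative (\<psi>' k) (at x) b - (D b x + d b x) = frechet_derivative (\<psi> k) (at x) b - D b x
          + (frechet_derivative (\<omega> (k + N)) (at x) b - d b x)" for k x
        by (simp add: d\<psi>')
      ultimately show ?thesis by (simp only:)
    qed
    have "(\<integral>\<^sup>+x. ennreal ((\<psi>' k x - h x)\<^sup>2) \<partial>S) = (\<integral>\<^sup>+x. ennreal ((\<psi> k x - h x)\<^sup>2) \<partial>S)" for k
      by (rule nn_integral_cong_AE) (use S(2) in \<open>eventually_elim, simp add: \<psi>'_def outside\<close>)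
    then show "(\<lambda>k. \<integral>\<^sup>+x. ennreal ((\<psi>' k x - h x)\<^sup>2) \<partial>S) \<longlonglongrightarrow> 0" using l3 by simp
  qed
qed

text \<open>
  Perturbations with compact support do not change the trace. This is what makes the perturbed
  function below a competitor.
\<close>

lemma sobolev_trace_add:
  fixes w :: "'a::euclidean_space \<Rightarrow> real"
  assumes "open \<Omega>" "bounded \<Omega>" and "sets S = sets borel" "AE x in S. x \<notin> \<Omega>"
    and lip: "L-lipschitz_on UNIV w" and K: "compact K" "K \<subseteq> \<Omega>" "\<And>x. x \<notin> K \<Longrightarrow> w x = 0"
    and diff: "AE x in lborel. w differentiable (at x)"
  shows "sobolev_trace \<Omega> S (\<lambda>x. g x + w x) = sobolev_trace \<Omega> S g"
proof
  show "sobolev_trace \<Omega> S g \<subseteq> sobolev_trace \<Omega> S (\<lambda>x. g x + w x)"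
    by (rule sobolev_trace_add_subset[OF assms])
  have "L-lipschitz_on UNIV (\<lambda>x. - w x)" using lip by (simp add: lipschitz_on_def dist_real_def abs_minus_commute)
  moreover have "AE x in lborel. (\<lambda>x. - w x) differentiable (at x)"
    using diff by eventually_elim (rule differentiable_minus)
  ultimately have "sobolev_trace \<Omega> S (\<lambda>x. g x + w x) \<subseteq> sobolev_trace \<Omega> S (\<lambda>x. (g x + w x) + - w x)"
    using K by (intro sobolev_trace_add_subset[OF assms(1-4), where K = K]) auto
  then show "sobolev_trace \<Omega> S (\<lambda>x. g x + w x) \<subseteq> sobolev_trace \<Omega> S g" by simp
qed

lemma circle_measure_outside_ball:
  shows "sets (circle_measure r) = sets borel" and "0 \<le> r \<Longrightarrow> AE x in circle_measure r. x \<notin> ball 0 r"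
proof -
  show s: "sets (circle_measure r) = sets borel" by (simp add: circle_measure_def)
  assume r: "0 \<le> r"
  define c :: "real \<Rightarrow> real^2" where "c t = vector [r * cos t, r * sin t]" for t
  have "continuous_on UNIV (\<lambda>t. if i = 1 then r * cos t else r * sin t)" for i :: 2
    by (cases "i = 1") (auto intro!: continuous_intros)
  then have "continuous_on UNIV (\<lambda>t. (\<chi> i::2. if i = 1 then r * cos t else r * sin t))"
    by (rule continuous_on_vec_lambda)
  moreover have "c t = (\<chi> i. if i = 1 then r * cos t else r * sin t)" for t
    unfolding c_def vec_eq_iff forall_2 by (simp add: vector_2)
  ultimately have c_cont: "continuous_on UNIV c" by simp
  have norm: "norm (c t) = r" for t
  proof -
    have "(norm (c t))\<^sup>2 = (r * cos t)\<^sup>2 + (r * sin t)\<^sup>2"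
      unfolding power2_norm_eq_inner inner_vec_def c_def
      by (simp add: sum_2 vector_2 power2_eq_square)
    also have "\<dots> = r\<^sup>2 * ((cos t)\<^sup>2 + (sin t)\<^sup>2)"
      by (simp only: power_mult_distrib distrib_left)
    finally have "(norm (c t))\<^sup>2 = r\<^sup>2" by simp
    then show ?thesis using r by (simp add: power2_eq_iff_nonneg)
  qed
  have "emeasure (circle_measure r) (ball 0 r) = 0"
  proof -
    have cm: "c \<in> measurable (restrict_space lborel {0..<2*pi}) borel"
      using borel_measurable_continuous_onI[OF c_cont] by (intro measurable_restrict_space1) simp
    have "c -` ball 0 r = {}" using norm by (auto simp: dist_norm)
    then show ?thesis
      unfolding circle_measure_def c_def[symmetric, abs_def] emeasure_scale_measure
      using cm by (simp add: emeasure_distr)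
  qed
  then have "ball 0 r \<in> null_sets (circle_measure r)" using s by (auto simp: null_sets_def)
  then show "AE x in circle_measure r. x \<notin> ball 0 r" by (rule AE_not_in)
qed

section \<open>The distance to a fixed Q-point\<close>

definition Q_of :: "nat \<Rightarrow> (nat \<Rightarrow> 'b) \<Rightarrow> 'b multiset" where
  "Q_of Q F = image_mset F (mset_set {..<Q})"

lemma mset_map_upt: "mset (map F [0..<Q]) = Q_of Q F"
  by (simp add: Q_of_def mset_upt atLeast0LessThan)

lemma size_Q_of [simp]: "size (Q_of Q F) = Q"
  by (simp add: Q_of_def)

lemma Q_of_in_Q_points: "Q_of Q F \<in> Q_points Q"
  by (simp add: Q_points_def)

text \<open>
  Fixing one enumeration and varying only the other one already gives the minimum, because a
  permutation can be applied to both simultaneously. As a function of the family, the distance to a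
  fixed Q-point is thus a finite minimum of Euclidean norms.
\<close>

lemma Q_dist_family:
  assumes T: "size T = Q"
  shows "Q_dist (Q_of Q F) T = Min ((\<lambda>qs. L2_set (\<lambda>i. dist (F i) (qs ! i)) {..<Q}) ` {qs. mset qs = T})"
proof (rule antisym)
  let ?S = "(\<lambda>qs. L2_set (\<lambda>i. dist (F i) (qs ! i)) {..<Q}) ` {qs. mset qs = T}"
  have fin: "finite ?S" by (intro finite_imageI finite_enumerations)
  have ne: "?S \<noteq> {}" using ex_mset[of T] by auto
  show "Q_dist (Q_of Q F) T \<le> Min ?S"
  proof (rule Min.boundedI[OF fin ne])
    fix r assume "r \<in> ?S"
    then obtain qs where qs: "mset qs = T" "r = L2_set (\<lambda>i. dist (F i) (qs ! i)) {..<Q}" by auto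
    have "Q_dist (Q_of Q F) T \<le> L2_set (\<lambda>i. dist (map F [0..<Q] ! i) (qs ! i)) {..<Q}"
      using Q_dist_le[OF mset_map_upt[of F Q] qs(1)] T by simp
    also have "\<dots> = r" unfolding qs(2) by (rule L2_set_cong) auto
    finally show "Q_dist (Q_of Q F) T \<le> r" .
  qed
  obtain ps qs where pq: "mset ps = Q_of Q F" "mset qs = T"
    "Q_dist (Q_of Q F) T = L2_set (\<lambda>i. dist (ps ! i) (qs ! i)) {..<size (Q_of Q F)}"
    using Q_dist_attained[of "Q_of Q F" T] T by (metis size_Q_of)
  have len: "length qs = Q" "length ps = Q" using pq T by (metis size_mset size_Q_of)+
  have "mset (map F [0..<Q]) = mset ps" using pq(1) by (simp only: mset_map_upt)
  from mset_eq_permutation[OF this] len obtain \<pi>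
    where \<pi>: "\<pi> permutes {..<Q}" "permute_list \<pi> ps = map F [0..<Q]" by metis
  have "(\<Sum>i<Q. (dist (ps ! i) (qs ! i))\<^sup>2) = (\<Sum>i<Q. (dist (ps ! \<pi> i) (qs ! \<pi> i))\<^sup>2)"
    using sum.permute[OF \<pi>(1), of "\<lambda>i. (dist (ps ! i) (qs ! i))\<^sup>2"] by simp
  also have "\<dots> = (\<Sum>i<Q. (dist (F i) (permute_list \<pi> qs ! i))\<^sup>2)"
  proof (rule sum.cong)
    fix i assume i: "i \<in> {..<Q}"
    have "ps ! \<pi> i = permute_list \<pi> ps ! i" using \<pi>(1) len i by (simp add: permute_list_nth)
    also have "\<dots> = F i" using i by (simp add: \<pi>(2))
    finally show "(dist (ps ! \<pi> i) (qs ! \<pi> i))\<^sup>2 = (dist (F i) (permute_list \<pi> qs ! i))\<^sup>2"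
      using \<pi>(1) len i by (simp add: permute_list_nth)
  qed simp
  finally have eq: "Q_dist (Q_of Q F) T = L2_set (\<lambda>i. dist (F i) (permute_list \<pi> qs ! i)) {..<Q}"
    by (simp add: pq(3) L2_set_def)
  have "mset (permute_list \<pi> qs) = T" using pq(2) \<pi>(1) len by simp
  then have "Q_dist (Q_of Q F) T \<in> ?S" unfolding eq by blast
  then show "Min ?S \<le> Q_dist (Q_of Q F) T" by (rule Min_le[OF fin])
qed

lemma Q_dist_Q_of_le: "Q_dist (Q_of Q F) (Q_of Q G) \<le> L2_set (\<lambda>i. dist (F i) (G i)) {..<Q}"
proof -
  have "Q_dist (Q_of Q F) (Q_of Q G) \<le> L2_set (\<lambda>i. dist (map F [0..<Q] ! i) (map G [0..<Q] ! i)) {..<size (Q_of Q F)}"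
    by (rule Q_dist_le) (simp_all only: mset_map_upt size_Q_of)
  also have "\<dots> = L2_set (\<lambda>i. dist (F i) (G i)) {..<Q}" by (rule L2_set_cong) auto
  finally show ?thesis .
qed

lemma Q_dist_diff_le:
  fixes A :: "'b::euclidean_space multiset"
  assumes "A \<in> Q_points Q" "B \<in> Q_points Q" "T \<in> Q_points Q"
  shows "\<bar>Q_dist A T - Q_dist B T\<bar> \<le> Q_dist A B"
proof -
  interpret Metric_space "Q_points Q :: 'b multiset set" Q_dist by (rule Metric_space_Q_points)
  show ?thesis
    using triangle[OF assms(1,2,3)] triangle[OF assms(2,1,3)] commute[of A B] by linarith
qed

section \<open>Sheets\<close>

text \<open>
  Here \<open>F i\<close> are the sheets and \<open>F' i b\<close> is the partial derivative of \<open>F i\<close> in direction \<open>b\<close>, with a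
  bound that is uniform on \<open>V\<close>. The uniform bound and convexity yield Lipschitz estimates.
\<close>

definition C1_sheets :: "'a::euclidean_space set \<Rightarrow> nat \<Rightarrow> (nat \<Rightarrow> 'a \<Rightarrow> 'b::euclidean_space) \<Rightarrow>
    (nat \<Rightarrow> 'a \<Rightarrow> 'a \<Rightarrow> 'b) \<Rightarrow> bool" where
  "C1_sheets V Q F F' \<longleftrightarrow> open V \<and> convex V \<and> bounded V \<and>
    (\<forall>i<Q. \<forall>y\<in>V. (F i has_derivative (\<lambda>h. \<Sum>b\<in>Basis. (h \<bullet> b) *\<^sub>R F' i b y)) (at y)) \<and>
    (\<forall>i<Q. \<forall>b\<in>Basis. continuous_on V (F' i b)) \<and>
    (\<exists>C. \<forall>i<Q. \<forall>b\<in>Basis. \<forall>y\<in>V. norm (F' i b y) \<le> C)"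

text \<open>
  The classical value of the modulus of the partial derivative in direction \<open>b\<close>. The next lemmas
  show that it agrees almost everywhere with the minimal bound of the metric definition.
\<close>

definition sheet_energy :: "nat \<Rightarrow> (nat \<Rightarrow> 'a \<Rightarrow> 'a \<Rightarrow> 'b::real_normed_vector) \<Rightarrow> 'a \<Rightarrow> 'a \<Rightarrow> real" where
  "sheet_energy Q F' b y = L2_set (\<lambda>i. norm (F' i b y)) {..<Q}"

lemma C1_sheetsD:
  assumes "C1_sheets V Q F F'"
  shows "open V" "convex V" "bounded V"
    "i < Q \<Longrightarrow> y \<in> V \<Longrightarrow> (F i has_derivative (\<lambda>h. \<Sum>b\<in>Basis. (h \<bullet> b) *\<^sub>R F' i b y)) (at y)"
    "i < Q \<Longrightarrow> b \<in> Basis \<Longrightarrow> continuous_on V (F' i b)"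
    "i < Q \<Longrightarrow> continuous_on V (F i)"
proof -
  show d: "(F i has_derivative (\<lambda>h. \<Sum>b\<in>Basis. (h \<bullet> b) *\<^sub>R F' i b y)) (at y)" if "i < Q" "y \<in> V" for i y
    using assms that unfolding C1_sheets_def by blast
  show "continuous_on V (F i)" if "i < Q"
    by (rule continuous_at_imp_continuous_on) (use has_derivative_continuous[OF d[OF that]] in blast)
qed (use assms in \<open>auto simp: C1_sheets_def\<close>)

lemma C1_sheets_subset:
  "C1_sheets V Q F F' \<Longrightarrow> open W \<Longrightarrow> convex W \<Longrightarrow> W \<subseteq> V \<Longrightarrow> C1_sheets W Q F F'"
  unfolding C1_sheets_def by (meson bounded_subset continuous_on_subset subsetD)

lemma Basis_derivative_apply:
  fixes F :: "'a::euclidean_space \<Rightarrow> 'b::real_vector"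
  assumes "b \<in> Basis"
  shows "(\<Sum>j\<in>Basis. (b \<bullet> j) *\<^sub>R F j) = F b"
proof -
  have "(\<Sum>j\<in>Basis. (b \<bullet> j) *\<^sub>R F j) = (\<Sum>j\<in>Basis. if j = b then F j else 0)"
    by (rule sum.cong) (auto simp: inner_Basis assms)
  then show ?thesis using assms by simp
qed

lemma L2_set_le_card_mult:
  assumes "\<And>i. i \<in> I \<Longrightarrow> \<bar>f i\<bar> \<le> C"
  shows "L2_set f I \<le> real (card I) * C"
proof -
  have "L2_set f I \<le> (\<Sum>i\<in>I. \<bar>f i\<bar>)" by (rule L2_set_le_sum_abs)
  also have "\<dots> \<le> (\<Sum>i\<in>I. C)" by (rule sum_mono) (rule assms)
  finally show ?thesis by simp
qed

lemma sheets_dist_lipschitz: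
  fixes F :: "nat \<Rightarrow> 'a::euclidean_space \<Rightarrow> 'b::euclidean_space"
  assumes sh: "C1_sheets V Q F F'"
  obtains L where "0 \<le> L" "\<And>x y. x \<in> V \<Longrightarrow> y \<in> V \<Longrightarrow> L2_set (\<lambda>i. dist (F i x) (F i y)) {..<Q} \<le> L * dist x y"
proof -
  obtain C where C: "\<And>i b y. i < Q \<Longrightarrow> b \<in> Basis \<Longrightarrow> y \<in> V \<Longrightarrow> norm (F' i b y) \<le> C"
    using sh unfolding C1_sheets_def by blast
  define K where "K = real (DIM('a)) * \<bar>C\<bar>"
  have "norm (F i x - F i y) \<le> K * norm (x - y)" if "i < Q" "x \<in> V" "y \<in> V" for i x y
  proof (rule differentiable_bound[OF C1_sheetsD(2)[OF sh] _ _ that(2,3)])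
    fix z assume z: "z \<in> V"
    show "(F i has_derivative (\<lambda>h. \<Sum>b\<in>Basis. (h \<bullet> b) *\<^sub>R F' i b z)) (at z within V)"
      by (rule has_derivative_at_withinI[OF C1_sheetsD(4)[OF sh that(1) z]])
    show "onorm (\<lambda>h. \<Sum>b\<in>Basis. (h \<bullet> b) *\<^sub>R F' i b z) \<le> K"
    proof (rule onorm_le)
      fix h :: 'a
      have "norm (\<Sum>b\<in>Basis. (h \<bullet> b) *\<^sub>R F' i b z) \<le> (\<Sum>b\<in>(Basis::'a set). norm h * \<bar>C\<bar>)"
      proof (rule sum_norm_le)
        fix b :: 'a assume b: "b \<in> Basis"
        have "norm (F' i b z) \<le> \<bar>C\<bar>" using C[OF that(1) b z] by linarith
        then show "norm ((h \<bullet> b) *\<^sub>R F' i b z) \<le> norm h * \<bar>C\<bar>"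
          unfolding norm_scaleR using Basis_le_norm[OF b, of h] by (intro mult_mono) auto
      qed
      then show "norm (\<Sum>b\<in>Basis. (h \<bullet> b) *\<^sub>R F' i b z) \<le> K * norm h" by (simp add: K_def mult_ac)
    qed
  qed
  then have "L2_set (\<lambda>i. dist (F i x) (F i y)) {..<Q} \<le> real Q * (K * dist x y)" if "x \<in> V" "y \<in> V" for x y
    using L2_set_le_card_mult[of "{..<Q}" "\<lambda>i. dist (F i x) (F i y)" "K * dist x y"] that
    by (simp add: dist_norm)
  moreover have "0 \<le> real Q * K" by (simp add: K_def)
  ultimately show ?thesis using that[of "real Q * K"] by (simp add: mult.assoc)
qed

lemma sheets_Q_dist_lipschitz:
  fixes F :: "nat \<Rightarrow> 'a::euclidean_space \<Rightarrow> 'b::euclidean_space"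
  assumes sh: "C1_sheets V Q F F'" and rep: "\<forall>y\<in>V. f y = Q_of Q (\<lambda>i. F i y)"
  obtains L where "\<And>T. T \<in> Q_points Q \<Longrightarrow> L-lipschitz_on V (\<lambda>x. Q_dist (f x) T)"
proof -
  note f = rep[rule_format]
  obtain L where L: "0 \<le> L" "\<And>x y. x \<in> V \<Longrightarrow> y \<in> V \<Longrightarrow> L2_set (\<lambda>i. dist (F i x) (F i y)) {..<Q} \<le> L * dist x y"
    by (rule sheets_dist_lipschitz[OF sh]) blast
  have "L-lipschitz_on V (\<lambda>x. Q_dist (f x) T)" if T: "T \<in> Q_points Q" for T
  proof (rule lipschitz_onI[OF _ L(1)])
    fix x y assume xy: "x \<in> V" "y \<in> V"
    have "\<bar>Q_dist (f x) T - Q_dist (f y) T\<bar> \<le> Q_dist (f x) (f y)"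
      unfolding f[OF xy(1)] f[OF xy(2)] by (rule Q_dist_diff_le[OF Q_of_in_Q_points Q_of_in_Q_points T])
    also have "\<dots> \<le> L2_set (\<lambda>i. dist (F i x) (F i y)) {..<Q}"
      unfolding f[OF xy(1)] f[OF xy(2)] by (rule Q_dist_Q_of_le)
    also have "\<dots> \<le> L * dist x y" by (rule L(2)[OF xy])
    finally show "dist (Q_dist (f x) T) (Q_dist (f y) T) \<le> L * dist x y" by (simp add: dist_real_def)
  qed
  then show ?thesis by (rule that)
qed

lemma sheets_Q_dist_AE_differentiable:
  fixes F :: "nat \<Rightarrow> 'a::euclidean_space \<Rightarrow> 'b::euclidean_space"
  assumes sh: "C1_sheets V Q F F'" and rep: "\<forall>y\<in>V. f y = Q_of Q (\<lambda>i. F i y)"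
    and T: "T \<in> Q_points Q"
  shows "AE x in lborel. x \<in> V \<longrightarrow> (\<lambda>x. Q_dist (f x) T) differentiable (at x)"
proof -
  note f = rep[rule_format]
  let ?I = "{qs. mset qs = T}"
  let ?a = "\<lambda>qs x. L2_set (\<lambda>i. dist (F i x) (qs ! i)) {..<Q}"
  have sz: "size T = Q" using T by (simp add: Q_points_def)
  note oV = C1_sheetsD(1)[OF sh]
  have "AE x in lborel. x \<in> V \<longrightarrow> (\<lambda>x. Min ((\<lambda>qs. ?a qs x) ` ?I)) differentiable (at x)"
  proof (rule conjunct2[OF AE_differentiable_Min[OF oV finite_enumerations]])
    show "?I \<noteq> {}" using ex_mset[of T] by auto
    show "continuous_on V (?a qs)" for qs
      by (rule AE_differentiable_L2_set(1)[OF oV finite_lessThan]) (rule C1_sheetsD(4)[OF sh], auto)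
    show "AE x in lborel. x \<in> V \<longrightarrow> ?a qs differentiable (at x)" for qs
      by (rule AE_differentiable_L2_set(2)[OF oV finite_lessThan]) (rule C1_sheetsD(4)[OF sh], auto)
  qed
  then show ?thesis
  proof eventually_elim
    case (elim x)
    show ?case
    proof
      assume x: "x \<in> V"
      from elim x obtain D where D: "((\<lambda>x. Min ((\<lambda>qs. ?a qs x) ` ?I)) has_derivative D) (at x)"
        by (auto simp: differentiable_def)
      have "((\<lambda>x. Q_dist (f x) T) has_derivative D) (at x)"
        by (rule has_derivative_transform_within_open[OF D oV x]) (simp add: f Q_dist_family[OF sz])
      then show "(\<lambda>x. Q_dist (f x) T) differentiable (at x)" by (auto simp: differentiable_def)
    qed
  qed
qed

text \<open>
  Difference quotients of \<open>Q_dist (f x) T\<close> are bounded by those of \<open>f\<close> itself, and matching each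
  sheet with itself bounds the distance of \<open>f (x + s b)\<close> and \<open>f x\<close> by the sheetwise differences.
\<close>

lemma sheets_Q_dist_derivative_le:
  fixes F :: "nat \<Rightarrow> 'a::euclidean_space \<Rightarrow> 'b::euclidean_space"
  assumes sh: "C1_sheets V Q F F'" and rep: "\<forall>y\<in>V. f y = Q_of Q (\<lambda>i. F i y)"
    and T: "T \<in> Q_points Q" and x: "x \<in> V" and b: "b \<in> Basis"
    and D: "((\<lambda>x. Q_dist (f x) T) has_derivative D) (at x)"
  shows "\<bar>D b\<bar> \<le> sheet_energy Q F' b x"
proof (rule field_le_epsilon)
  note f = rep[rule_format]
  fix e :: real assume e: "e > 0"
  define e' where "e' = e / real (Suc Q)"
  have e': "e' > 0" using e by (simp add: e'_def)
  have "\<exists>d>0. \<forall>t. \<bar>t\<bar> < d \<longrightarrow> norm (F i (x + t *\<^sub>R b) - F i x) \<le> \<bar>t\<bar> * (norm (F' i b x) + e')" if "i < Q" for i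
  proof -
    from C1_sheetsD(4)[OF sh that x, unfolded has_derivative_at_alt] e' obtain d where d: "d > 0"
      "\<And>y. norm (y - x) < d \<Longrightarrow> norm (F i y - F i x - (\<Sum>j\<in>Basis. ((y - x) \<bullet> j) *\<^sub>R F' i j x)) \<le> e' * norm (y - x)"
      by blast
    have "norm (F i (x + t *\<^sub>R b) - F i x) \<le> \<bar>t\<bar> * (norm (F' i b x) + e')" if "\<bar>t\<bar> < d" for t
    proof -
      have "(\<Sum>j\<in>Basis. ((x + t *\<^sub>R b - x) \<bullet> j) *\<^sub>R F' i j x) = t *\<^sub>R F' i b x"
        using Basis_derivative_apply[OF b, of "\<lambda>j. t *\<^sub>R F' i j x"] by (simp add: mult.commute)
      note A = this
      have nb: "norm (x + t *\<^sub>R b - x) = \<bar>t\<bar>" using norm_Basis[OF b] by simp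
      from d(2)[of "x + t *\<^sub>R b"] that
      have "norm (F i (x + t *\<^sub>R b) - F i x - t *\<^sub>R F' i b x) \<le> e' * \<bar>t\<bar>"
        unfolding A nb by blast
      then have "norm (F i (x + t *\<^sub>R b) - F i x) \<le> norm (t *\<^sub>R F' i b x) + e' * \<bar>t\<bar>"
        using norm_triangle_sub[of "F i (x + t *\<^sub>R b) - F i x" "t *\<^sub>R F' i b x"] by linarith
      then show ?thesis by (simp add: distrib_left mult.commute)
    qed
    then show ?thesis using d(1) by blast
  qed
  then have "\<forall>i\<in>{..<Q}. \<exists>d>0. \<forall>t. \<bar>t\<bar> < d \<longrightarrow> norm (F i (x + t *\<^sub>R b) - F i x) \<le> \<bar>t\<bar> * (norm (F' i b x) + e')" by blast
  from bchoice[OF this] obtain d where d: "\<forall>i\<in>{..<Q}. d i > 0 \<and> (\<forall>t. \<bar>t\<bar> < d i \<longrightarrow> norm (F i (x + t *\<^sub>R b) - F i x) \<le> \<bar>t\<bar> * (norm (F' i b x) + e'))" ..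
  obtain r where r: "r > 0" "ball x r \<subseteq> V" using C1_sheetsD(1)[OF sh] x openE by blast
  define \<delta> where "\<delta> = Min (insert r (d ` {..<Q}))"
  have \<delta>: "\<delta> > 0" "\<delta> \<le> r" "\<And>i. i < Q \<Longrightarrow> \<delta> \<le> d i"
    unfolding \<delta>_def using d r(1) by (auto simp: Min_gr_iff)
  define s where "s k = \<delta> / 2 / real (Suc k)" for k
  have s: "s \<longlonglongrightarrow> 0" unfolding s_def by (rule LIMSEQ_Suc[OF lim_const_over_n])
  have s0: "0 < s k" "s k < \<delta>" for k
  proof -
    show "0 < s k" using \<delta>(1) by (simp add: s_def)
    have "s k \<le> \<delta> / 2" unfolding s_def using \<delta>(1) by (simp add: pos_divide_le_eq mult_le_cancel_left1)
    then show "s k < \<delta>" using \<delta>(1) by linarith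
  qed
  have "\<bar>(Q_dist (f (x + s k *\<^sub>R b)) T - Q_dist (f x) T) / s k\<bar> \<le> sheet_energy Q F' b x + real Q * e'" for k
  proof -
    have xk: "x + s k *\<^sub>R b \<in> V"
      using s0[of k] \<delta>(2) b by (intro subsetD[OF r(2)]) (simp add: dist_norm)
    have "\<bar>Q_dist (f (x + s k *\<^sub>R b)) T - Q_dist (f x) T\<bar> \<le> Q_dist (f (x + s k *\<^sub>R b)) (f x)"
      unfolding f[OF xk] f[OF x] by (rule Q_dist_diff_le[OF Q_of_in_Q_points Q_of_in_Q_points T])
    also have "\<dots> \<le> L2_set (\<lambda>i. dist (F i (x + s k *\<^sub>R b)) (F i x)) {..<Q}"
      unfolding f[OF xk] f[OF x] by (rule Q_dist_Q_of_le)
    also have "\<dots> \<le> L2_set (\<lambda>i. s k * (norm (F' i b x) + e')) {..<Q}"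
    proof (rule L2_set_mono)
      fix i assume i: "i \<in> {..<Q}"
      have "\<bar>s k\<bar> < d i" using s0[of k] \<delta>(3)[of i] i by simp
      then have "norm (F i (x + s k *\<^sub>R b) - F i x) \<le> \<bar>s k\<bar> * (norm (F' i b x) + e')"
        using d i by blast
      then show "dist (F i (x + s k *\<^sub>R b)) (F i x) \<le> s k * (norm (F' i b x) + e')"
        using s0(1)[of k] by (simp only: dist_norm abs_of_pos)
    qed simp
    also have "\<dots> = s k * L2_set (\<lambda>i. norm (F' i b x) + e') {..<Q}"
      using s0[of k] by (subst L2_set_right_distrib) auto
    also have "\<dots> \<le> s k * (sheet_energy Q F' b x + real Q * e')"
    proof (rule mult_left_mono)
      have "L2_set (\<lambda>i. norm (F' i b x) + e') {..<Q} \<le> sheet_energy Q F' b x + L2_set (\<lambda>i. e') {..<Q}"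
        unfolding sheet_energy_def by (rule L2_set_triangle_ineq)
      also have "L2_set (\<lambda>i. e') {..<Q} \<le> real Q * e'"
        using L2_set_le_card_mult[of "{..<Q}" "\<lambda>i. e'" e'] e' by simp
      finally show "L2_set (\<lambda>i. norm (F' i b x) + e') {..<Q} \<le> sheet_energy Q F' b x + real Q * e'" by simp
    qed (use s0[of k] in simp)
    finally show ?thesis using s0[of k] by (simp add: pos_divide_le_eq mult.commute)
  qed
  moreover have "(\<lambda>k. \<bar>(Q_dist (f (x + s k *\<^sub>R b)) T - Q_dist (f x) T) / s k\<bar>) \<longlonglongrightarrow> \<bar>D b\<bar>"
    by (intro tendsto_rabs difference_quotient_tendsto[OF D s]) (use s0 in \<open>simp add: less_imp_neq[symmetric]\<close>)
  ultimately have "\<bar>D b\<bar> \<le> sheet_energy Q F' b x + real Q * e'"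
    by (intro LIMSEQ_le_const2) auto
  also have "real Q * e' \<le> e" using e by (simp add: e'_def pos_divide_le_eq)
  finally show "\<bar>D b\<bar> \<le> sheet_energy Q F' b x + e" by simp
qed

lemma weak_partial_le_sheet_energy:
  fixes F :: "nat \<Rightarrow> 'a::euclidean_space \<Rightarrow> 'b::euclidean_space"
  assumes "open \<Omega>" "V \<subseteq> \<Omega>" and sh: "C1_sheets V Q F F'" and rep: "\<forall>y\<in>V. f y = Q_of Q (\<lambda>i. F i y)"
    and T: "T \<in> Q_points Q" and b: "b \<in> Basis" and h: "weak_partial \<Omega> b (\<lambda>x. Q_dist (f x) T) h"
  shows "AE x in lebesgue. x \<in> V \<longrightarrow> \<bar>h x\<bar> \<le> sheet_energy Q F' b x"
proof -
  note f = rep[rule_format]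
  obtain L where L: "\<And>T. T \<in> Q_points Q \<Longrightarrow> L-lipschitz_on V (\<lambda>x. Q_dist (f x) T)"
    by (rule sheets_Q_dist_lipschitz[OF sh rep]) blast
  note ae = sheets_Q_dist_AE_differentiable[OF sh rep T]
  have "AE x in lebesgue. x \<in> V \<longrightarrow> h x = frechet_derivative (\<lambda>x. Q_dist (f x) T) (at x) b"
    by (rule weak_partial_eq_derivative[OF assms(1) h b C1_sheetsD(1)[OF sh] C1_sheetsD(3)[OF sh] assms(2) L[OF T] ae])
  moreover have "AE x in lebesgue. x \<in> V \<longrightarrow> (\<lambda>x. Q_dist (f x) T) differentiable (at x)"
    using ae by (rule AE_completion)
  ultimately show ?thesis
  proof eventually_elim
    case (elim x)
    show ?case
    proof
      assume x: "x \<in> V"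
      have "((\<lambda>x. Q_dist (f x) T) has_derivative frechet_derivative (\<lambda>x. Q_dist (f x) T) (at x)) (at x)"
        using elim(2) x frechet_derivative_works by blast
      from sheets_Q_dist_derivative_le[OF sh rep T x b this] elim(1) x
      show "\<bar>h x\<bar> \<le> sheet_energy Q F' b x" by simp
    qed
  qed
qed

lemma continuous_on_sheet_energy:
  assumes sh: "C1_sheets V Q F F'" and b: "b \<in> Basis"
  shows "continuous_on V (sheet_energy Q F' b)"
  unfolding sheet_energy_def[abs_def] L2_set_def
  by (intro continuous_intros C1_sheetsD(5)[OF sh _ b]) auto

text \<open>
  Lowering an admissible bound to the sheet energy on \<open>V\<close> keeps it admissible, so the minimal bound
  lies below.
\<close>

lemma abs_partial_le_sheet_energy:
  fixes F :: "nat \<Rightarrow> 'a::euclidean_space \<Rightarrow> 'b::euclidean_space"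
  assumes \<Omega>: "open \<Omega>" "V \<subseteq> \<Omega>" and sh: "C1_sheets V Q F F'" and rep: "\<forall>y\<in>V. f y = Q_of Q (\<lambda>i. F i y)"
    and b: "b \<in> Basis" and \<phi>: "partial_bound \<Omega> Q f b \<phi>"
  shows "AE x in lebesgue. x \<in> V \<longrightarrow> abs_partial \<Omega> Q f b x \<le> sheet_energy Q F' b x"
proof -
  note f = rep[rule_format]
  define \<psi> where "\<psi> x = min (\<phi> x) (if x \<in> V then sheet_energy Q F' b x else \<phi> x)" for x
  have m: "\<Omega> \<in> sets lebesgue" "V \<in> sets lebesgue" using \<Omega>(1) C1_sheetsD(1)[OF sh] by auto
  have L: "\<phi> \<in> Lp (lebesgue_on \<Omega>) 2" and pos: "\<And>x. x \<in> \<Omega> \<Longrightarrow> 0 \<le> \<phi> x"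
    using \<phi> by (auto simp: partial_bound_def)
  have E0: "0 \<le> sheet_energy Q F' b x" for x by (simp add: sheet_energy_def)
  have \<phi>m: "\<phi> \<in> borel_measurable (lebesgue_on \<Omega>)" using L by (simp add: Lp_2_iff)
  have em: "(\<lambda>x. if x \<in> V then sheet_energy Q F' b x else 0) \<in> borel_measurable (lebesgue_on \<Omega>)"
    by (intro measurable_lebesgue_on_if_borel borel_measurable_extend_by C1_sheetsD(1)[OF sh] continuous_on_sheet_energy[OF sh b])
  have "(\<lambda>x. min (\<phi> x) (if x \<in> V then (if x \<in> V then sheet_energy Q F' b x else 0) else \<phi> x)) \<in> borel_measurable (lebesgue_on \<Omega>)"
  proof (rule borel_measurable_min[OF measurable_If[OF em \<phi>m] \<phi>m])
    have "V \<inter> \<Omega> \<in> sets (lebesgue_on \<Omega>)" using m by (auto simp: sets_restrict_space)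
    moreover have "{x \<in> space (lebesgue_on \<Omega>). x \<in> V} = V \<inter> \<Omega>" by (auto simp: space_restrict_space)
    ultimately show "{x \<in> space (lebesgue_on \<Omega>). x \<in> V} \<in> sets (lebesgue_on \<Omega>)" by simp
  qed
  moreover have "(\<lambda>x. min (\<phi> x) (if x \<in> V then (if x \<in> V then sheet_energy Q F' b x else 0) else \<phi> x)) = \<psi>"
    by (rule ext) (simp add: \<psi>_def)
  ultimately have \<psi>m: "\<psi> \<in> borel_measurable (lebesgue_on \<Omega>)" by simp
  have "partial_bound \<Omega> Q f b \<psi>"
    unfolding partial_bound_def
  proof (intro conjI ballI)
    show "\<psi> \<in> Lp (lebesgue_on \<Omega>) 2"
    proof (rule Lp_2_dominated[OF L \<psi>m], rule AE_I2)
      fix x assume "x \<in> space (lebesgue_on \<Omega>)"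
      then have "0 \<le> \<phi> x" using pos by (simp add: space_restrict_space)
      then show "\<bar>\<psi> x\<bar> \<le> \<bar>\<phi> x\<bar>" using E0[of x] by (simp add: \<psi>_def)
    qed
    show "0 \<le> \<psi> x" if "x \<in> \<Omega>" for x using pos[OF that] E0[of x] by (simp add: \<psi>_def)
    fix T :: "'b multiset" assume T: "T \<in> Q_points Q"
    from \<phi> T obtain h where h: "weak_partial \<Omega> b (\<lambda>x. Q_dist (f x) T) h" "AE x in lebesgue_on \<Omega>. \<bar>h x\<bar> \<le> \<phi> x"
      unfolding partial_bound_def by blast
    have "AE x in lebesgue. x \<in> \<Omega> \<longrightarrow> \<bar>h x\<bar> \<le> \<psi> x"
      using weak_partial_le_sheet_energy[OF \<Omega> sh rep T b h(1)] h(2)[unfolded AE_lebesgue_on[OF m(1)]]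
      by eventually_elim (auto simp: \<psi>_def)
    then show "\<exists>h. weak_partial \<Omega> b (\<lambda>x. Q_dist (f x) T) h \<and> (AE x in lebesgue_on \<Omega>. \<bar>h x\<bar> \<le> \<psi> x)"
      unfolding AE_lebesgue_on[OF m(1)] using h(1) by blast
  qed
  from abs_partial_minimal(2)[OF \<Omega>(1) this]
  have "AE x in lebesgue. x \<in> \<Omega> \<longrightarrow> abs_partial \<Omega> Q f b x \<le> \<psi> x"
    by (simp add: AE_lebesgue_on[OF m(1)])
  then show ?thesis
  proof eventually_elim
    case (elim x)
    then show ?case using \<Omega>(2) by (auto simp: \<psi>_def)
  qed
qed

text \<open>
  The converse inequality: one good Q-point \<open>T\<close> suffices near each point. Near \<open>x0\<close> take \<open>T\<close> to consist
  of the points \<open>F i x0 - s F' i b x0\<close>, displaced from the sheets against their derivatives. For small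
  \<open>s\<close> the optimal matching of \<open>f y\<close> with \<open>T\<close> is the obvious one, because the sheets with different
  values at \<open>x0\<close> are far apart and the others coincide on \<open>V\<close>. Then \<open>Q_dist (f y) T\<close> is a
  differentiable Euclidean norm, and its derivative in direction \<open>b\<close> at \<open>x0\<close> equals the full energy; by continuity it
  is at least the energy minus \<open>e\<close> nearby.
\<close>

lemma sheet_energy_le_partial_bound:
  fixes F :: "nat \<Rightarrow> 'a::euclidean_space \<Rightarrow> 'b::euclidean_space"
  assumes \<Omega>: "open \<Omega>" "V \<subseteq> \<Omega>" and sh: "C1_sheets V Q F F'" and rep: "\<forall>y\<in>V. f y = Q_of Q (\<lambda>i. F i y)"
    and sep0: "\<forall>i<Q. \<forall>j<Q. \<forall>y\<in>V. F i y = F j y \<longrightarrow> (\<forall>z\<in>V. F i z = F j z)"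
    and b: "b \<in> Basis" and \<phi>: "partial_bound \<Omega> Q f b \<phi>"
  shows "AE x in lebesgue. x \<in> V \<longrightarrow> sheet_energy Q F' b x \<le> \<phi> x"
proof -
  note f = rep[rule_format]
  note sep = sep0[rule_format]
  let ?E = "sheet_energy Q F' b"
  note oV = C1_sheetsD(1)[OF sh]
  have E0: "0 \<le> ?E x" for x by (simp add: sheet_energy_def)
  have cE: "continuous_on V ?E" by (rule continuous_on_sheet_energy[OF sh b])
  have m: "\<Omega> \<in> sets lebesgue" using \<Omega>(1) by simp
  obtain L where L: "\<And>T. T \<in> Q_points Q \<Longrightarrow> L-lipschitz_on V (\<lambda>x. Q_dist (f x) T)"
    by (rule sheets_Q_dist_lipschitz[OF sh rep]) blast
  have local: "\<exists>W. open W \<and> x0 \<in> W \<and> (AE y in lebesgue. y \<in> W \<longrightarrow> ?E y - e \<le> \<phi> y)"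
    if x0: "x0 \<in> V" and e: "e > 0" for x0 e
  proof (cases "?E x0 = 0")
    case True
    have "open (V \<inter> (\<lambda>y. e - ?E y) -` {0<..})"
      by (rule continuous_open_preimage[OF continuous_on_diff[OF continuous_on_const cE] oV open_greaterThan])
    moreover have "?E y - e \<le> \<phi> y" if "y \<in> V \<inter> (\<lambda>y. e - ?E y) -` {0<..}" for y
    proof -
      have "0 \<le> \<phi> y" using \<phi> that \<Omega>(2) by (auto simp: partial_bound_def)
      then show ?thesis using that by auto
    qed
    ultimately show ?thesis using x0 True e by (intro exI[of _ "V \<inter> (\<lambda>y. e - ?E y) -` {0<..}"]) auto
  next
    case False
    define e0 where "e0 = ?E x0"
    have e0: "e0 > 0" using False E0[of x0] by (simp add: e0_def)
    define S where "S = {dist (F i x0) (F j x0) | i j. i < Q \<and> j < Q \<and> F i x0 \<noteq> F j x0}"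
    have finS: "finite S"
    proof (rule finite_subset)
      show "S \<subseteq> (\<lambda>(i, j). dist (F i x0) (F j x0)) ` ({..<Q} \<times> {..<Q})" unfolding S_def by auto
    qed simp
    \<comment> \<open>Lower bound for the separation of the distinct values at \<open>x0\<close>.\<close>
    define \<kappa> where "\<kappa> = Min (insert 1 S)"
    have \<kappa>: "\<kappa> > 0" "\<And>i j. i < Q \<Longrightarrow> j < Q \<Longrightarrow> F i x0 \<noteq> F j x0 \<Longrightarrow> \<kappa> \<le> dist (F i x0) (F j x0)"
    proof -
      show "\<kappa> > 0" unfolding \<kappa>_def using finS by (subst Min_gr_iff) (auto simp: S_def)
      show "\<kappa> \<le> dist (F i x0) (F j x0)" if "i < Q" "j < Q" "F i x0 \<noteq> F j x0" for i j
        unfolding \<kappa>_def by (rule Min_le) (use finS that in \<open>auto simp: S_def\<close>)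
    qed
    \<comment> \<open>Chosen so that \<open>T\<close> has distance \<open>\<kappa> / 8\<close> from the values at \<open>x0\<close>: positive, but small compared with \<open>\<kappa>\<close>.\<close>
    define s where "s = \<kappa> / (8 * e0)"
    have s: "s > 0" "s * e0 = \<kappa> / 8" using \<kappa>(1) e0 by (simp_all add: s_def)
    define T where "T i = F i x0 - s *\<^sub>R F' i b x0" for i
    define q where "q y = (\<Sum>i<Q. (F i y - T i) \<bullet> (F i y - T i))" for y
    define N where "N y = L2_set (\<lambda>i. dist (F i y) (T i)) {..<Q}" for y
    have Nq: "N y = sqrt (q y)" for y
      by (simp add: N_def q_def L2_set_def dist_norm power2_norm_eq_inner)
    have cN: "continuous_on V N"
      unfolding N_def[abs_def] L2_set_def by (intro continuous_intros C1_sheetsD(6)[OF sh]) auto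
    have N0: "N x0 = \<kappa> / 8"
    proof -
      have "N x0 = L2_set (\<lambda>i. s * norm (F' i b x0)) {..<Q}"
        unfolding N_def by (rule L2_set_cong) (use s(1) in \<open>auto simp: T_def dist_norm\<close>)
      also have "\<dots> = s * e0" unfolding e0_def sheet_energy_def using s(1) by (subst L2_set_right_distrib) auto
      finally show ?thesis using s(2) by simp
    qed
    have Di: "s * norm (F' i b x0) \<le> \<kappa> / 8" if "i < Q" for i
    proof -
      have "norm (F' i b x0) \<le> e0" unfolding e0_def sheet_energy_def by (rule member_le_L2_set) (use that in auto)
      then have "s * norm (F' i b x0) \<le> s * e0" using s(1) by (intro mult_left_mono) auto
      then show ?thesis using s(2) by simp
    qed
    \<comment> \<open>While \<open>N y < \<kappa> / 4\<close>, no other matching is shorter than the obvious one.\<close>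
    have g_eq: "Q_dist (f y) (Q_of Q T) = N y" if y: "y \<in> V" and Ny: "N y < \<kappa> / 4" for y
    proof (rule antisym)
      show "Q_dist (f y) (Q_of Q T) \<le> N y" unfolding f[OF y] N_def by (rule Q_dist_Q_of_le)
      have "N y \<le> r" if r: "r \<in> (\<lambda>qs. L2_set (\<lambda>i. dist (F i y) (qs ! i)) {..<Q}) ` {qs. mset qs = Q_of Q T}" for r
      proof -
        obtain qs where qs: "mset qs = Q_of Q T" "r = L2_set (\<lambda>i. dist (F i y) (qs ! i)) {..<Q}" using r by auto
        have "mset qs = mset (map T [0..<Q])" using qs(1) by (simp only: mset_map_upt)
        from mset_eq_permutation[OF this] obtain \<sigma> where \<sigma>: "\<sigma> permutes {..<Q}" "permute_list \<sigma> (map T [0..<Q]) = qs"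
          by (metis length_map length_upt minus_nat.diff_0)
        have \<sigma>Q: "\<sigma> i < Q" if "i < Q" for i using permutes_in_image[OF \<sigma>(1), of i] that by simp
        have nth: "qs ! i = T (\<sigma> i)" if "i < Q" for i
          using \<sigma>Q[OF that] that \<sigma>(1) unfolding \<sigma>(2)[symmetric] by (simp add: permute_list_nth)
        show ?thesis
        proof (cases "\<forall>i<Q. F (\<sigma> i) x0 = F i x0")
          case True
          have "r = L2_set (\<lambda>i. dist (F (\<sigma> i) y) (T (\<sigma> i))) {..<Q}"
            unfolding qs(2)
          proof (rule L2_set_cong)
            fix i assume "i \<in> {..<Q}"
            then have i: "i < Q" by simp
            have "F (\<sigma> i) y = F i y" using sep[OF \<sigma>Q[OF i] i x0] True i y by blast
            then show "dist (F i y) (qs ! i) = dist (F (\<sigma> i) y) (T (\<sigma> i))" using nth[OF i] by simp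
          qed simp
          also have "\<dots> = N y"
            unfolding N_def L2_set_def
            using sum.permute[OF \<sigma>(1), of "\<lambda>i. (dist (F i y) (T i))\<^sup>2"] by (simp add: o_def)
          finally show ?thesis by simp
        next
          case False
          then obtain i where i: "i < Q" "F i x0 \<noteq> F (\<sigma> i) x0" by metis
          have 1: "dist (F i y) (T i) \<le> N y"
            unfolding N_def by (rule member_le_L2_set) (use i in auto)
          have 2: "dist (F i y) (T (\<sigma> i)) \<le> r"
            unfolding qs(2) nth[OF i(1), symmetric] by (rule member_le_L2_set) (use i in auto)
          have 3: "dist (F j x0) (T j) \<le> \<kappa> / 8" if "j < Q" for j
            using Di[OF that] s(1) by (simp add: T_def dist_norm)
          have "\<kappa> \<le> dist (F i x0) (F (\<sigma> i) x0)" by (rule \<kappa>(2)[OF i(1) \<sigma>Q[OF i(1)] i(2)])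
          also have "\<dots> \<le> dist (F i x0) (T i) + dist (F i y) (T i) + dist (F i y) (T (\<sigma> i)) + dist (F (\<sigma> i) x0) (T (\<sigma> i))"
            by metric
          finally show ?thesis using 1 2 3[OF i(1)] 3[OF \<sigma>Q[OF i(1)]] Ny \<kappa>(1) by linarith
        qed
      qed
      moreover have "Q_dist (f y) (Q_of Q T) \<in> (\<lambda>qs. L2_set (\<lambda>i. dist (F i y) (qs ! i)) {..<Q}) ` {qs. mset qs = Q_of Q T}"
        unfolding f[OF y] Q_dist_family[OF size_Q_of]
        by (rule Min_in[OF finite_imageI[OF finite_enumerations]]) (use ex_mset[of "Q_of Q T"] in auto)
      ultimately show "N y \<le> Q_dist (f y) (Q_of Q T)" by blast
    qed
    \<comment> \<open>The directional derivative of \<open>N\<close>, as computed in \<open>derN\<close> below.\<close>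
    define M where "M y = (\<Sum>i<Q. (F i y - T i) \<bullet> F' i b y) / N y" for y
    define W1 where "W1 = V \<inter> N -` {\<kappa> / 16 <..< \<kappa> / 4}"
    have oW1: "open W1" unfolding W1_def by (rule continuous_open_preimage[OF cN oV open_greaterThanLessThan])
    have x0W1: "x0 \<in> W1" using x0 N0 \<kappa>(1) by (simp add: W1_def)
    have Npos: "N y > 0" if "y \<in> W1" for y using that \<kappa>(1) by (auto simp: W1_def)
    have cM: "continuous_on W1 M"
      unfolding M_def[abs_def]
    proof (intro continuous_intros)
      show "continuous_on W1 (F i)" "continuous_on W1 (F' i b)" if "i \<in> {..<Q}" for i
        using that C1_sheetsD(6)[OF sh, of i] C1_sheetsD(5)[OF sh _ b, of i]
        by (auto simp: W1_def intro: continuous_on_subset)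
      show "continuous_on W1 N" using cN by (rule continuous_on_subset) (simp add: W1_def)
      show "\<forall>y\<in>W1. N y \<noteq> 0" using Npos by fastforce
    qed
    have M0: "M x0 = e0"
    proof -
      have "(\<Sum>i<Q. (F i x0 - T i) \<bullet> F' i b x0) = s * (\<Sum>i<Q. (norm (F' i b x0))\<^sup>2)"
        unfolding sum_distrib_left by (rule sum.cong) (auto simp: T_def power2_norm_eq_inner)
      also have "(\<Sum>i<Q. (norm (F' i b x0))\<^sup>2) = e0\<^sup>2"
        unfolding e0_def sheet_energy_def L2_set_def by (simp add: sum_nonneg)
      also have "s * e0\<^sup>2 = (\<kappa> / 8) * e0" using s(2) by (simp add: power2_eq_square)
      finally show ?thesis unfolding M_def N0 using \<kappa>(1) by simp
    qed
    have derN: "((\<lambda>x. Q_dist (f x) (Q_of Q T)) has_derivative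
        (\<lambda>h. (\<Sum>i<Q. 2 * ((F i y - T i) \<bullet> (\<Sum>j\<in>Basis. (h \<bullet> j) *\<^sub>R F' i j y))) * (inverse (sqrt (q y)) / 2))) (at y)"
      if y: "y \<in> W1" for y
    proof -
      have yV: "y \<in> V" using y by (simp add: W1_def)
      have "((\<lambda>x. (F i x - T i) \<bullet> (F i x - T i)) has_derivative
          (\<lambda>h. 2 * ((F i y - T i) \<bullet> (\<Sum>j\<in>Basis. (h \<bullet> j) *\<^sub>R F' i j y)))) (at y)" if i: "i < Q" for i
      proof -
        from has_derivative_diff[OF C1_sheetsD(4)[OF sh i yV] has_derivative_const[of "T i"]]
        have "((\<lambda>x. F i x - T i) has_derivative (\<lambda>h. \<Sum>j\<in>Basis. (h \<bullet> j) *\<^sub>R F' i j y)) (at y)" by simp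
        from has_derivative_inner[OF this this] show ?thesis by (simp add: inner_commute)
      qed
      then have "(q has_derivative (\<lambda>h. \<Sum>i<Q. 2 * ((F i y - T i) \<bullet> (\<Sum>j\<in>Basis. (h \<bullet> j) *\<^sub>R F' i j y)))) (at y)"
        unfolding q_def[abs_def] by (intro has_derivative_sum) auto
      moreover have "q y > 0" using Npos[OF y] by (simp add: Nq)
      ultimately have "(N has_derivative
          (\<lambda>h. (\<Sum>i<Q. 2 * ((F i y - T i) \<bullet> (\<Sum>j\<in>Basis. (h \<bullet> j) *\<^sub>R F' i j y))) * (inverse (sqrt (q y)) / 2))) (at y)"
        unfolding Nq[abs_def] by (rule has_derivative_real_sqrt[rotated])
      then show ?thesis
        by (rule has_derivative_transform_within_open[OF _ oW1 y]) (use g_eq in \<open>auto simp: W1_def\<close>)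
    qed
    define W2 where "W2 = W1 \<inter> (\<lambda>y. M y - (?E y - e)) -` {0<..}"
    have oW2: "open W2" unfolding W2_def
    proof (rule continuous_open_preimage[OF _ oW1 open_greaterThan])
      show "continuous_on W1 (\<lambda>y. M y - (?E y - e))"
        by (intro continuous_intros cM continuous_on_subset[OF cE]) (simp add: W1_def)
    qed
    have x0W2: "x0 \<in> W2" using x0W1 M0 e by (simp add: W2_def e0_def)
    have W2V: "W2 \<subseteq> V" by (auto simp: W2_def W1_def)
    from \<phi> Q_of_in_Q_points[of Q T] obtain h where h: "weak_partial \<Omega> b (\<lambda>x. Q_dist (f x) (Q_of Q T)) h"
      "AE x in lebesgue_on \<Omega>. \<bar>h x\<bar> \<le> \<phi> x" unfolding partial_bound_def by blast
    have "AE x in lebesgue. x \<in> W2 \<longrightarrow> h x = frechet_derivative (\<lambda>x. Q_dist (f x) (Q_of Q T)) (at x) b"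
    proof (rule weak_partial_eq_derivative[OF \<Omega>(1) h(1) b oW2])
      show "bounded W2" by (rule bounded_subset[OF C1_sheetsD(3)[OF sh] W2V])
      show "W2 \<subseteq> \<Omega>" using W2V \<Omega>(2) by blast
      show "L-lipschitz_on W2 (\<lambda>x. Q_dist (f x) (Q_of Q T))"
        by (rule lipschitz_on_subset[OF L[OF Q_of_in_Q_points] W2V])
      show "AE x in lborel. x \<in> W2 \<longrightarrow> (\<lambda>x. Q_dist (f x) (Q_of Q T)) differentiable (at x)"
        using derN by (intro AE_I2) (auto simp: W2_def differentiable_def)
    qed
    then have "AE x in lebesgue. x \<in> W2 \<longrightarrow> ?E x - e \<le> \<phi> x"
      using h(2)[unfolded AE_lebesgue_on[OF m]]
    proof eventually_elim
      case (elim x)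
      show ?case
      proof
        assume x: "x \<in> W2"
        then have xW1: "x \<in> W1" by (simp add: W2_def)
        have "frechet_derivative (\<lambda>x. Q_dist (f x) (Q_of Q T)) (at x) b
            = (\<Sum>i<Q. 2 * ((F i x - T i) \<bullet> (\<Sum>j\<in>Basis. (b \<bullet> j) *\<^sub>R F' i j x))) * (inverse (sqrt (q x)) / 2)"
          unfolding frechet_derivative_at[OF derN[OF xW1], symmetric] ..
        also have "\<dots> = (2 * (\<Sum>i<Q. (F i x - T i) \<bullet> F' i b x)) * (inverse (sqrt (q x)) / 2)"
          unfolding Basis_derivative_apply[OF b] by (simp only: sum_distrib_left)
        also have "\<dots> = M x" unfolding M_def Nq divide_inverse by simp
        finally have "h x = M x" using elim(1) x by simp
        moreover have "?E x - e < M x" using x by (simp add: W2_def)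
        moreover have "\<bar>h x\<bar> \<le> \<phi> x" using elim(2) x W2V \<Omega>(2) by blast
        ultimately show "?E x - e \<le> \<phi> x" by linarith
      qed
    qed
    then show ?thesis using oW2 x0W2 by (intro exI[of _ W2] conjI)
  qed
  have "AE y in lebesgue. y \<in> V \<longrightarrow> ?E y - 1 / real (Suc n) \<le> \<phi> y" for n
    by (rule AE_on_open_locally[OF local]) simp_all
  then have "AE y in lebesgue. \<forall>n. y \<in> V \<longrightarrow> ?E y - 1 / real (Suc n) \<le> \<phi> y"
    unfolding AE_all_countable by (rule allI)
  then show ?thesis
  proof eventually_elim
    case (elim y)
    show ?case
    proof
      assume y: "y \<in> V"
      have lim: "(\<lambda>n. ?E y - 1 / real (Suc n)) \<longlonglongrightarrow> ?E y - 0"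
        by (intro tendsto_diff tendsto_const LIMSEQ_Suc[OF lim_1_over_n])
      show "?E y \<le> \<phi> y"
        using LIMSEQ_le_const2[OF lim, of "\<phi> y"] elim y by auto
    qed
  qed
qed

section \<open>Perturbing one sheet of a minimizer\<close>

text \<open>
  Points at distance at most \<open>\<delta>\<close> from the support lie in \<open>V\<close>; for points further apart than \<open>\<delta>\<close> the
  bound on the values suffices.
\<close>

lemma lipschitz_on_extend_by_zero:
  fixes w :: "'a::euclidean_space \<Rightarrow> real"
  assumes V: "open V" and lip: "L-lipschitz_on V w" and K: "compact K" "K \<subseteq> V" "\<And>x. x \<notin> K \<Longrightarrow> w x = 0"
  obtains L' where "L'-lipschitz_on UNIV w"
proof -
  obtain \<delta> where \<delta>: "\<delta> > 0" "(\<Union>x\<in>K. cball x \<delta>) \<subseteq> V"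
    using compact_subset_open_imp_cball_epsilon_subset[OF K(1) V K(2)] by blast
  have "compact (w ` K)"
    by (rule compact_continuous_image[OF continuous_on_subset[OF lipschitz_on_continuous_on[OF lip] K(2)] K(1)])
  from compact_imp_bounded[OF this] obtain M0 where M0: "\<forall>y\<in>w ` K. norm y \<le> M0"
    unfolding bounded_iff ..
  define M where "M = \<bar>M0\<bar>"
  have M: "\<bar>w x\<bar> \<le> M" for x
  proof (cases "x \<in> K")
    case True
    then have "norm (w x) \<le> M0" by (intro M0[rule_format] imageI)
    then show ?thesis by (simp add: M_def)
  qed (simp add: K(3) M_def)
  have L0: "0 \<le> L" by (rule lipschitz_on_nonneg[OF lip])
  define L' where "L' = L + 2 * M / \<delta>"
  have M0': "0 \<le> M" by (simp add: M_def)
  have "\<bar>w x - w y\<bar> \<le> L' * dist x y" for x y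
  proof (cases "dist x y \<le> \<delta>")
    case True
    show ?thesis
    proof (cases "x \<in> K \<or> y \<in> K")
      case True
      then have "x \<in> V \<and> y \<in> V"
      proof
        assume "x \<in> K"
        moreover have "y \<in> cball x \<delta>" using \<open>dist x y \<le> \<delta>\<close> by simp
        ultimately show ?thesis using \<delta>(2) K(2) by blast
      next
        assume "y \<in> K"
        moreover have "x \<in> cball y \<delta>" using \<open>dist x y \<le> \<delta>\<close> by (simp add: dist_commute)
        ultimately show ?thesis using \<delta>(2) K(2) by blast
      qed
      then have "\<bar>w x - w y\<bar> \<le> L * dist x y" using lipschitz_onD[OF lip, of x y] by (simp add: dist_real_def)
      also have "\<dots> \<le> L' * dist x y" unfolding L'_def using M0' \<delta>(1) by (intro mult_right_mono) auto
      finally show ?thesis .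
    next
      case False
      then have "w x = 0" "w y = 0" using K(3) by blast+
      then show ?thesis using L0 M0' \<delta>(1) by (simp add: L'_def)
    qed
  next
    case False
    have "\<bar>w x - w y\<bar> \<le> 2 * M" using M[of x] M[of y] by linarith
    also have "\<dots> = (2 * M / \<delta>) * \<delta>" using \<delta>(1) by simp
    also have "\<dots> \<le> (2 * M / \<delta>) * dist x y" using False M0' \<delta>(1) by (intro mult_left_mono) auto
    also have "\<dots> \<le> L' * dist x y" unfolding L'_def using L0 by (intro mult_right_mono) auto
    finally show ?thesis .
  qed
  then have "L'-lipschitz_on UNIV w"
    using L0 M0' \<delta>(1) by (intro lipschitz_onI) (auto simp: dist_real_def L'_def)
  then show ?thesis by (rule that)
qed

lemma linear_term_zero:
  fixes A B :: real
  assumes "\<And>\<epsilon>. 0 \<le> 2 * \<epsilon> * A + \<epsilon>\<^sup>2 * B"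
  shows "A = 0"
proof (rule ccontr)
  assume "A \<noteq> 0"
  define c where "c = \<bar>B\<bar> + 1"
  have c: "c > 0" "B \<le> c" by (auto simp: c_def)
  have "0 \<le> 2 * (- A / c) * A + (- A / c)\<^sup>2 * B" by (rule assms)
  also have "\<dots> \<le> 2 * (- A / c) * A + (- A / c)\<^sup>2 * c"
    using c(2) by (intro add_left_mono mult_left_mono) auto
  also have "\<dots> = - (A\<^sup>2 / c)" using c(1) by (simp add: power2_eq_square)
  finally show False using c(1) \<open>A \<noteq> 0\<close> by (simp add: divide_le_0_iff)
qed

lemma Q_measurable_if_open_preimages:
  assumes \<Omega>: "open \<Omega>" and f: "\<And>x. x \<in> \<Omega> \<Longrightarrow> f x \<in> Q_points Q"
    and op: "\<And>U. openin (Q_topology Q) U \<Longrightarrow> open {x \<in> \<Omega>. f x \<in> U}"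
  shows "Q_measurable \<Omega> Q f"
  unfolding Q_measurable_def
proof (rule measurable_measure_of)
  interpret Metric_space "Q_points Q :: 'b multiset set" Q_dist by (rule Metric_space_Q_points)
  show "{U. openin (Q_topology Q) U} \<subseteq> Pow (Q_points Q :: 'b multiset set)"
    using openin_subset[of "Q_topology Q :: 'b multiset topology"] by auto
  show "f \<in> space (lebesgue_on \<Omega>) \<rightarrow> Q_points Q" using f by (auto simp: space_restrict_space)
  fix U :: "'b multiset set" assume "U \<in> {U. openin (Q_topology Q) U}"
  then have "open {x \<in> \<Omega>. f x \<in> U}" using op by simp
  moreover have "f -` U \<inter> space (lebesgue_on \<Omega>) = {x \<in> \<Omega>. f x \<in> U}" by (auto simp: space_restrict_space)
  ultimately show "f -` U \<inter> space (lebesgue_on \<Omega>) \<in> sets (lebesgue_on \<Omega>)"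
    using \<Omega> by (auto simp: sets_restrict_space intro!: image_eqI[of _ _ "{x \<in> \<Omega>. f x \<in> U}"])
qed

text \<open>
  Together with the continuity of a minimizer this gives the measurability of a function obtained by
  replacing the minimizer by other sheets on \<open>V\<close>.
\<close>

lemma sheets_open_preimage:
  fixes F :: "nat \<Rightarrow> 'a::euclidean_space \<Rightarrow> 'b::euclidean_space"
  assumes sh: "C1_sheets V Q F F'" and U: "openin (Q_topology Q) U"
  shows "open {x \<in> V. Q_of Q (\<lambda>i. F i x) \<in> U}"
proof (rule openI)
  interpret Metric_space "Q_points Q :: 'b multiset set" Q_dist by (rule Metric_space_Q_points)
  fix x assume x: "x \<in> {x \<in> V. Q_of Q (\<lambda>i. F i x) \<in> U}"
  then obtain r where r: "r > 0" "mball (Q_of Q (\<lambda>i. F i x)) r \<subseteq> U"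
    using U unfolding openin_mtopology by blast
  obtain L where L: "0 \<le> L" "\<And>x y. x \<in> V \<Longrightarrow> y \<in> V \<Longrightarrow> L2_set (\<lambda>i. dist (F i x) (F i y)) {..<Q} \<le> L * dist x y"
    by (rule sheets_dist_lipschitz[OF sh]) blast
  obtain d where d: "d > 0" "ball x d \<subseteq> V" using C1_sheetsD(1)[OF sh] x openE by blast
  define e where "e = min d (r / (L + 1))"
  have e: "e > 0" using d(1) r(1) L(1) by (simp add: e_def)
  have "Q_of Q (\<lambda>i. F i y) \<in> U" if y: "y \<in> ball x e" for y
  proof -
    have yV: "y \<in> V" using y d(2) by (auto simp: e_def)
    have "Q_dist (Q_of Q (\<lambda>i. F i x)) (Q_of Q (\<lambda>i. F i y)) \<le> L * dist x y"
      by (rule order_trans[OF Q_dist_Q_of_le L(2)]) (use x yV in auto)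
    also have "\<dots> \<le> (L + 1) * dist x y" by (intro mult_right_mono) auto
    also have "\<dots> < (L + 1) * (r / (L + 1))"
      using y L(1) by (intro mult_strict_left_mono) (auto simp: e_def)
    also have "\<dots> = r" using L(1) by simp
    finally have "Q_of Q (\<lambda>i. F i y) \<in> mball (Q_of Q (\<lambda>i. F i x)) r"
      by (simp add: in_mball Q_of_in_Q_points)
    then show ?thesis using r(2) by blast
  qed
  then show "\<exists>e>0. ball x e \<subseteq> {x \<in> V. Q_of Q (\<lambda>i. F i x) \<in> U}"
    using e d(2) by (intro exI[of _ e]) (auto simp: e_def)
qed

text \<open>
  Replace the single sheet \<open>i0\<close> by \<open>F i0 + \<epsilon> \<zeta> e\<close>. The result is a competitor: it differs from \<open>u\<close> only on
  a compact subset of \<open>V\<close>, so all traces agree. The energy of the competitor is at most the energy of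
  its sheets, while the energy of \<open>u\<close> is at least that of its own sheets; hence the change of the
  Dirichlet energy is at most \<open>2 \<epsilon> A + \<epsilon>\<^sup>2 B\<close>, where \<open>A\<close> is the integral in question. As this is
  nonnegative for all \<open>\<epsilon>\<close> of either sign, \<open>A\<close> vanishes. For the competitor the upper
  bound on the energy is used, which holds even where the perturbed sheets intersect.
\<close>

lemma minimizer_sheet_weakly_harmonic:
  fixes u :: "'a::euclidean_space \<Rightarrow> 'b::euclidean_space multiset"
  assumes \<Omega>: "open \<Omega>" "bounded \<Omega>" and S: "sets S = sets borel" "AE x in S. x \<notin> \<Omega>"
    and min: "Dir_minimizing \<Omega> S Q u" and cont: "continuous_map (top_of_set \<Omega>) (Q_topology Q) u"
    and V: "V \<subseteq> \<Omega>" and sh: "C1_sheets V Q F F'" and rep: "\<forall>y\<in>V. u y = Q_of Q (\<lambda>i. F i y)"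
    and sep: "\<forall>i<Q. \<forall>j<Q. \<forall>y\<in>V. F i y = F j y \<longrightarrow> (\<forall>z\<in>V. F i z = F j z)"
    and i0: "i0 < Q" and \<zeta>: "\<zeta> \<in> test_functions V"
  shows "(\<Sum>b\<in>Basis. LINT x|lebesgue_on V. (F' i0 b x \<bullet> e) * frechet_derivative \<zeta> (at x) b) = 0"
proof -
  have m: "\<Omega> \<in> sets lebesgue" "V \<in> sets lebesgue" using \<Omega>(1) C1_sheetsD(1)[OF sh] by auto
  note oV = C1_sheetsD(1)[OF sh]
  have uW: "u \<in> W12_Q \<Omega> Q" using min by (simp add: Dir_minimizing_def)
  define K where "K = closure {x. \<zeta> x \<noteq> 0}"
  have K: "compact K" "K \<subseteq> V" unfolding K_def by (rule test_functionD[OF \<zeta>])+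
  have cK: "closed K" using K(1) by (rule compact_imp_closed)
  have \<zeta>0: "\<zeta> x = 0" if "x \<notin> K" for x
    using that closure_subset[of "{x. \<zeta> x \<noteq> 0}"] unfolding K_def by blast
  define \<zeta>' where "\<zeta>' b x = frechet_derivative \<zeta> (at x) b" for b x
  note sm\<zeta> = test_functionD(1)[OF \<zeta>]
  have c\<zeta>': "continuous_on A (\<zeta>' b)" if "b \<in> Basis" for A b
    unfolding \<zeta>'_def[abs_def] by (rule smoothD(3)[OF smoothD(2)[OF sm\<zeta> that]])
  have der\<zeta>: "(\<zeta> has_derivative (\<lambda>h. \<Sum>b\<in>Basis. (h \<bullet> b) *\<^sub>R \<zeta>' b y)) (at y)" for y
  proof -
    have lin: "linear (frechet_derivative \<zeta> (at y))" by (rule has_derivative_linear[OF smoothD(1)[OF sm\<zeta>]])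
    have "frechet_derivative \<zeta> (at y) h = (\<Sum>b\<in>Basis. (h \<bullet> b) *\<^sub>R \<zeta>' b y)" for h
    proof -
      have "frechet_derivative \<zeta> (at y) h = frechet_derivative \<zeta> (at y) (\<Sum>b\<in>Basis. (h \<bullet> b) *\<^sub>R b)"
        by (simp add: euclidean_representation)
      then show ?thesis by (simp add: \<zeta>'_def linear_sum[OF lin] linear_scale[OF lin])
    qed
    then have "frechet_derivative \<zeta> (at y) = (\<lambda>h. \<Sum>b\<in>Basis. (h \<bullet> b) *\<^sub>R \<zeta>' b y)" by (rule ext)
    then show ?thesis using smoothD(1)[OF sm\<zeta>, of y] by simp
  qed
  obtain CF where CF: "\<forall>i<Q. \<forall>b\<in>Basis. \<forall>y\<in>V. norm (F' i b y) \<le> CF" using sh unfolding C1_sheets_def by blast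
  have "\<exists>C. \<forall>x. \<bar>\<zeta>' b x\<bar> \<le> C" if "b \<in> Basis" for b
    unfolding \<zeta>'_def by (rule test_function_bounded[OF partial_test_function[OF \<zeta> that]]) blast
  then have "\<forall>b\<in>Basis. \<exists>C. \<forall>x. \<bar>\<zeta>' b x\<bar> \<le> C" by (rule ballI)
  from bchoice[OF this] obtain Cz where Cz: "\<forall>b\<in>Basis. \<forall>x. \<bar>\<zeta>' b x\<bar> \<le> Cz b" ..
  define A where "A = (\<Sum>b\<in>Basis. LINT x|lebesgue_on V. (F' i0 b x \<bullet> e) * \<zeta>' b x)"
  define B where "B = (\<Sum>b\<in>Basis. LINT x|lebesgue_on V. (\<zeta>' b x)\<^sup>2 * (e \<bullet> e))"
  have Lz: "\<zeta>' b \<in> Lp (lebesgue_on V) 2" if "b \<in> Basis" for b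
    unfolding \<zeta>'_def[abs_def] by (rule test_function_Lp_2[OF partial_test_function[OF \<zeta> that] m(2)])
  have LF: "(\<lambda>x. F' i0 b x \<bullet> e) \<in> Lp (lebesgue_on V) 2" if b: "b \<in> Basis" for b
  proof (rule Lp_2_bounded[OF _ _ C1_sheetsD(3)[OF sh] m(2)])
    show "(\<lambda>x. F' i0 b x \<bullet> e) \<in> borel_measurable (lebesgue_on V)"
      using continuous_imp_measurable_on_sets_lebesgue[OF continuous_on_inner[OF C1_sheetsD(5)[OF sh i0 b] continuous_on_const] m(2)] .
    show "\<bar>F' i0 b x \<bullet> e\<bar> \<le> CF * norm e" if "x \<in> V" for x
    proof -
      have "norm (F' i0 b x) \<le> CF" using CF i0 b that by blast
      then have "norm (F' i0 b x) * norm e \<le> CF * norm e" by (rule mult_right_mono) simp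
      with Cauchy_Schwarz_ineq2[of "F' i0 b x" e] show ?thesis by (rule order_trans)
    qed
  qed
  have "0 \<le> 2 * \<epsilon> * A + \<epsilon>\<^sup>2 * B" for \<epsilon>
  proof -
    define G where "G i x = F i x + (if i = i0 then (\<epsilon> * \<zeta> x) *\<^sub>R e else 0)" for i x
    define G' where "G' i b x = F' i b x + (if i = i0 then (\<epsilon> * \<zeta>' b x) *\<^sub>R e else 0)" for i b x
    define v where "v x = (if x \<in> V then Q_of Q (\<lambda>i. G i x) else u x)" for x
    have shG: "C1_sheets V Q G G'"
      unfolding C1_sheets_def
    proof (intro conjI allI ballI impI oV C1_sheetsD(2,3)[OF sh])
      fix i y assume i: "i < Q" and y: "y \<in> V"
      show "(G i has_derivative (\<lambda>h. \<Sum>b\<in>Basis. (h \<bullet> b) *\<^sub>R G' i b y)) (at y)"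
      proof (cases "i = i0")
        case True
        have "((\<lambda>x. F i x + (\<epsilon> * \<zeta> x) *\<^sub>R e) has_derivative
            (\<lambda>h. (\<Sum>b\<in>Basis. (h \<bullet> b) *\<^sub>R F' i b y) + (\<epsilon> * (\<Sum>b\<in>Basis. (h \<bullet> b) *\<^sub>R \<zeta>' b y)) *\<^sub>R e)) (at y)"
          by (intro has_derivative_add C1_sheetsD(4)[OF sh i y] has_derivative_scaleR_left has_derivative_mult_right der\<zeta>)
        moreover have "(\<Sum>b\<in>Basis. (h \<bullet> b) *\<^sub>R F' i b y) + (\<epsilon> * (\<Sum>b\<in>Basis. (h \<bullet> b) *\<^sub>R \<zeta>' b y)) *\<^sub>R e
            = (\<Sum>b\<in>Basis. (h \<bullet> b) *\<^sub>R G' i b y)" for h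
          using True by (simp add: G'_def scaleR_add_right sum.distrib sum_distrib_left scaleR_sum_left mult_ac)
        ultimately show ?thesis using True by (simp add: G_def[abs_def])
      next
        case False
        then show ?thesis using C1_sheetsD(4)[OF sh i y] by (simp add: G_def[abs_def] G'_def)
      qed
    next
      fix i and b :: 'a assume i: "i < Q" and b: "b \<in> Basis"
      show "continuous_on V (G' i b)"
        unfolding G'_def[abs_def]
        using C1_sheetsD(5)[OF sh i b] by (cases "i = i0") (auto intro!: continuous_intros c\<zeta>'[OF b])
    next
      show "\<exists>C. \<forall>i<Q. \<forall>b\<in>Basis. \<forall>y\<in>V. norm (G' i b y) \<le> C"
      proof (intro exI allI impI ballI)
        fix i and b y :: 'a assume i: "i < Q" and b: "b \<in> Basis" and y: "y \<in> V"
        have 1: "norm (F' i b y) \<le> CF" using CF i b y by blast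
        have 2: "norm (if i = i0 then (\<epsilon> * \<zeta>' b y) *\<^sub>R e else 0) \<le> (\<Sum>b\<in>Basis. \<bar>\<epsilon>\<bar> * \<bar>Cz b\<bar> * norm e)"
        proof -
          have "\<bar>\<zeta>' b y\<bar> \<le> \<bar>Cz b\<bar>" using Cz[rule_format, OF b, of y] by linarith
          then have "norm (if i = i0 then (\<epsilon> * \<zeta>' b y) *\<^sub>R e else 0) \<le> \<bar>\<epsilon>\<bar> * \<bar>Cz b\<bar> * norm e"
            by (simp add: abs_mult mult_right_mono mult_left_mono)
          also have "\<dots> \<le> (\<Sum>b\<in>Basis. \<bar>\<epsilon>\<bar> * \<bar>Cz b\<bar> * norm e)"
            by (rule member_le_sum[OF b]) auto
          finally show ?thesis .
        qed
        show "norm (G' i b y) \<le> CF + (\<Sum>b\<in>Basis. \<bar>\<epsilon>\<bar> * \<bar>Cz b\<bar> * norm e)"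
          unfolding G'_def using norm_triangle_mono[OF 1 2] .
      qed
    qed
    have repG: "\<forall>y\<in>V. v y = Q_of Q (\<lambda>i. G i y)" by (simp add: v_def)
    have vu: "v x = u x" if "x \<notin> K" for x
    proof (cases "x \<in> V")
      case True
      have "G i x = F i x" for i using \<zeta>0[OF that] by (simp add: G_def)
      then show ?thesis using True rep by (simp add: v_def)
    qed (simp add: v_def)
    have uQ: "u x \<in> Q_points Q" if "x \<in> \<Omega>" for x
    proof -
      interpret Metric_space "Q_points Q :: 'b multiset set" Q_dist by (rule Metric_space_Q_points)
      show ?thesis using continuous_map_funspace[OF cont] that by (auto simp: Pi_iff)
    qed
    have vQ: "v x \<in> Q_points Q" if "x \<in> \<Omega>" for x
      using uQ[OF that] by (simp add: v_def Q_of_in_Q_points)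
    have "Q_measurable \<Omega> Q v"
    proof (rule Q_measurable_if_open_preimages[OF \<Omega>(1) vQ])
      fix U :: "'b multiset set" assume U: "openin (Q_topology Q) U"
      have "openin (top_of_set \<Omega>) {x \<in> \<Omega>. u x \<in> U}"
        using openin_continuous_map_preimage[OF cont U] by simp
      then have "open {x \<in> \<Omega>. u x \<in> U}" using openin_open_eq[OF \<Omega>(1)] by blast
      then have "open ({x \<in> \<Omega>. u x \<in> U} - K)" using K(1) by (intro open_Diff compact_imp_closed)
      moreover have "open {x \<in> V. Q_of Q (\<lambda>i. G i x) \<in> U}" by (rule sheets_open_preimage[OF shG U])
      moreover have "{x \<in> \<Omega>. v x \<in> U} = ({x \<in> \<Omega>. u x \<in> U} - K) \<union> {x \<in> V. Q_of Q (\<lambda>i. G i x) \<in> U}"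
      proof (intro equalityI subsetI)
        fix x assume x: "x \<in> {x \<in> \<Omega>. v x \<in> U}"
        show "x \<in> ({x \<in> \<Omega>. u x \<in> U} - K) \<union> {x \<in> V. Q_of Q (\<lambda>i. G i x) \<in> U}"
        proof (cases "x \<in> K")
          case True
          then show ?thesis using x K(2) by (auto simp: v_def)
        next
          case False
          then show ?thesis using x vu[OF False] by auto
        qed
      next
        fix x assume "x \<in> ({x \<in> \<Omega>. u x \<in> U} - K) \<union> {x \<in> V. Q_of Q (\<lambda>i. G i x) \<in> U}"
        then show "x \<in> {x \<in> \<Omega>. v x \<in> U}" using vu[of x] V by (auto simp: v_def)
      qed
      ultimately show "open {x \<in> \<Omega>. v x \<in> U}" by (simp only: open_Un)
    qed
    \<comment> \<open>The change of the distance to \<open>T\<close>: compactly supported, Lipschitz and almost everywhere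
        differentiable, so that the results on weak derivatives and traces apply to it.\<close>
    define w where "w T x = Q_dist (v x) T - Q_dist (u x) T" for T x
    have w0: "w T x = 0" if "x \<notin> K" for T x using vu[OF that] by (simp add: w_def)
    have vw: "(\<lambda>x. Q_dist (v x) T) = (\<lambda>x. Q_dist (u x) T + w T x)" for T by (simp add: w_def)
    have w_lip: "\<exists>L. L-lipschitz_on UNIV (w T)" if T: "T \<in> Q_points Q" for T
    proof -
      obtain L1 where L1: "\<And>T. T \<in> Q_points Q \<Longrightarrow> L1-lipschitz_on V (\<lambda>x. Q_dist (v x) T)"
        by (rule sheets_Q_dist_lipschitz[OF shG repG]) blast
      obtain L2 where L2: "\<And>T. T \<in> Q_points Q \<Longrightarrow> L2-lipschitz_on V (\<lambda>x. Q_dist (u x) T)"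
        by (rule sheets_Q_dist_lipschitz[OF sh rep]) blast
      have "(L1 + L2)-lipschitz_on V (w T)"
        unfolding w_def[abs_def] by (rule lipschitz_on_diff[OF L1[OF T] L2[OF T]])
      then show ?thesis by (rule lipschitz_on_extend_by_zero[OF oV _ K w0]) (assumption, rule exI)
    qed
    have w_diff: "AE x in lborel. w T differentiable (at x)" if T: "T \<in> Q_points Q" for T
      using sheets_Q_dist_AE_differentiable[OF shG repG T] sheets_Q_dist_AE_differentiable[OF sh rep T]
    proof eventually_elim
      case (elim x)
      show ?case
      proof (cases "x \<in> V")
        case True
        then show ?thesis unfolding w_def[abs_def] using elim by (intro differentiable_diff) auto
      next
        case False
        have "((\<lambda>_. 0) has_derivative (\<lambda>_. 0)) (at x)" by simp
        then have "(w T has_derivative (\<lambda>_. 0)) (at x)"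
          by (rule has_derivative_transform_within_open[where s = "- K"])
            (use False K w0 cK in \<open>auto simp: open_Compl\<close>)
        then show ?thesis by (auto simp: differentiable_def)
      qed
    qed
    have shift: "\<exists>d. weak_partial \<Omega> b (\<lambda>x. Q_dist (v x) T) (\<lambda>x. h x + d x) \<and> (\<forall>x. x \<notin> V \<longrightarrow> d x = 0)"
      if b: "b \<in> Basis" and T: "T \<in> Q_points Q" and h: "weak_partial \<Omega> b (\<lambda>x. Q_dist (u x) T) h" for b T h
    proof -
      obtain L where L: "L-lipschitz_on UNIV (w T)" using w_lip[OF T] ..
      have ae: "AE x in lborel. x \<in> UNIV \<longrightarrow> w T differentiable (at x)" using w_diff[OF T] by simp
      obtain d0 where d0: "d0 \<in> borel_measurable borel" "\<And>x. \<bar>d0 x\<bar> \<le> L"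
        "AE x in lborel. x \<in> UNIV \<longrightarrow> d0 x = frechet_derivative (w T) (at x) b"
        by (rule borel_partial_derivative[OF open_UNIV L ae b]) blast
      define d where "d x = (if x \<in> V then d0 x else 0)" for x
      have "d \<in> borel_measurable borel"
        unfolding d_def[abs_def] by (rule measurable_If) (use d0(1) oV in auto)
      moreover have "\<bar>d x\<bar> \<le> L" for x using d0(2)[of x] lipschitz_on_nonneg[OF L] by (simp add: d_def)
      moreover have "AE x in lborel. d x = frechet_derivative (w T) (at x) b"
        using d0(3)
      proof eventually_elim
        case (elim x)
        show ?case
        proof (cases "x \<in> V")
          case False
          have "x \<notin> closure {x. w T x \<noteq> 0}"
            using closure_minimal[of "{x. w T x \<noteq> 0}" K] w0 K False cK by blast
          then show ?thesis using False by (simp add: d_def frechet_derivative_outside_support)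
        qed (use elim in \<open>simp add: d_def\<close>)
      qed
      ultimately have "weak_partial \<Omega> b (w T) d"
        by (intro weak_partial_lipschitz[OF \<Omega> b L K(1) w0 w_diff[OF T]])
      from weak_partial_add[OF m(1) b h this] show ?thesis
        unfolding vw by (intro exI[of _ d]) (auto simp: d_def)
    qed
    define a where "a b = abs_partial \<Omega> Q u b" for b
    have ex_a: "\<exists>\<phi>. partial_bound \<Omega> Q u b \<phi>" if "b \<in> Basis" for b
      using uW that by (auto simp: W12_Q_def)
    have pa: "partial_bound \<Omega> Q u b (a b)" if "b \<in> Basis" for b
      using ex_a[OF that] abs_partial_minimal(1)[OF \<Omega>(1)] unfolding a_def by blast
    \<comment> \<open>Admissible for the competitor: the energy of the new sheets on \<open>V\<close>, the old bound elsewhere.\<close>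
    define \<phi> where "\<phi> b x = (if x \<in> V then sheet_energy Q G' b x else a b x)" for b x
    have EG0: "0 \<le> sheet_energy Q G' b x" for b x by (simp add: sheet_energy_def)
    have Lphi: "\<phi> b \<in> Lp (lebesgue_on \<Omega>) 2" if b: "b \<in> Basis" for b
    proof -
      have La: "a b \<in> Lp (lebesgue_on \<Omega>) 2" and posa: "\<forall>x\<in>\<Omega>. 0 \<le> a b x"
        using pa[OF b] by (auto simp: partial_bound_def)
      obtain CG where CG: "\<forall>i<Q. \<forall>b\<in>Basis. \<forall>y\<in>V. norm (G' i b y) \<le> CG" using shG unfolding C1_sheets_def by blast
      define C where "C = real Q * \<bar>CG\<bar>"
      have C0: "0 \<le> C" by (simp add: C_def)
      have EC: "sheet_energy Q G' b x \<le> C" if "x \<in> V" for x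
      proof -
        have "\<bar>norm (G' i b x)\<bar> \<le> \<bar>CG\<bar>" if "i \<in> {..<Q}" for i
        proof -
          have "norm (G' i b x) \<le> CG" using CG that b \<open>x \<in> V\<close> by blast
          then show ?thesis unfolding abs_norm_cancel by linarith
        qed
        from L2_set_le_card_mult[of "{..<Q}" "\<lambda>i. norm (G' i b x)", OF this] show ?thesis
          by (simp add: sheet_energy_def C_def)
      qed
      have "(\<lambda>x. a b x + C) \<in> Lp (lebesgue_on \<Omega>) 2"
        by (rule Lp_2_add[OF La Lp_2_bounded[OF _ _ \<Omega>(2) m(1)]]) (auto simp: C0)
      moreover have "\<phi> b \<in> borel_measurable (lebesgue_on \<Omega>)"
      proof -
        have em: "(\<lambda>x. if x \<in> V then sheet_energy Q G' b x else 0) \<in> borel_measurable (lebesgue_on \<Omega>)"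
          by (intro measurable_lebesgue_on_if_borel borel_measurable_extend_by oV continuous_on_sheet_energy[OF shG b])
        have am: "a b \<in> borel_measurable (lebesgue_on \<Omega>)" using La by (simp add: Lp_2_iff)
        have "V \<inter> \<Omega> \<in> sets (lebesgue_on \<Omega>)" using m by (auto simp: sets_restrict_space)
        moreover have "{x \<in> space (lebesgue_on \<Omega>). x \<in> V} = V \<inter> \<Omega>" by (auto simp: space_restrict_space)
        ultimately have "{x \<in> space (lebesgue_on \<Omega>). x \<in> V} \<in> sets (lebesgue_on \<Omega>)" by simp
        from measurable_If[OF em am this]
        have "(\<lambda>x. if x \<in> V then if x \<in> V then sheet_energy Q G' b x else 0 else a b x) \<in> borel_measurable (lebesgue_on \<Omega>)" .
        moreover have "(\<lambda>x. if x \<in> V then if x \<in> V then sheet_energy Q G' b x else 0 else a b x) = \<phi> b"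
          by (rule ext) (simp add: \<phi>_def)
        ultimately show ?thesis by simp
      qed
      moreover have "AE x in lebesgue_on \<Omega>. \<bar>\<phi> b x\<bar> \<le> \<bar>a b x + C\<bar>"
      proof (rule AE_I2)
        fix x assume "x \<in> space (lebesgue_on \<Omega>)"
        then have "0 \<le> a b x" using posa by (simp add: space_restrict_space)
        then show "\<bar>\<phi> b x\<bar> \<le> \<bar>a b x + C\<bar>" using C0 EC[of x] EG0[of b x] by (cases "x \<in> V") (auto simp: \<phi>_def)
      qed
      ultimately show ?thesis by (rule Lp_2_dominated)
    qed
    have p\<phi>: "partial_bound \<Omega> Q v b (\<phi> b)" if b: "b \<in> Basis" for b
      unfolding partial_bound_def
    proof (intro conjI ballI Lphi[OF b])
      show "0 \<le> \<phi> b x" if "x \<in> \<Omega>" for x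
        using pa[OF b] that EG0 by (auto simp: partial_bound_def \<phi>_def)
      fix T :: "'b multiset" assume T: "T \<in> Q_points Q"
      from pa[OF b] T obtain h where h: "weak_partial \<Omega> b (\<lambda>x. Q_dist (u x) T) h" "AE x in lebesgue_on \<Omega>. \<bar>h x\<bar> \<le> a b x"
        unfolding partial_bound_def by blast
      obtain d where d: "weak_partial \<Omega> b (\<lambda>x. Q_dist (v x) T) (\<lambda>x. h x + d x)" "\<forall>x. x \<notin> V \<longrightarrow> d x = 0"
        using shift[OF b T h(1)] by blast
      have "AE x in lebesgue. x \<in> \<Omega> \<longrightarrow> \<bar>h x + d x\<bar> \<le> \<phi> b x"
        using weak_partial_le_sheet_energy[OF \<Omega>(1) V shG repG T b d(1)] h(2)[unfolded AE_lebesgue_on[OF m(1)]]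
        by eventually_elim (auto simp: \<phi>_def d(2))
      then show "\<exists>h. weak_partial \<Omega> b (\<lambda>x. Q_dist (v x) T) h \<and> (AE x in lebesgue_on \<Omega>. \<bar>h x\<bar> \<le> \<phi> b x)"
        unfolding AE_lebesgue_on[OF m(1)] using d(1) by blast
    qed
    have vW: "v \<in> W12_Q \<Omega> Q"
      unfolding W12_Q_def W12_def
    proof (intro CollectI conjI ballI)
      show "Q_measurable \<Omega> Q v" by fact
      fix T :: "'b multiset" assume T: "T \<in> Q_points Q"
      show "\<exists>h. weak_partial \<Omega> b (\<lambda>x. Q_dist (v x) T) h" if "b \<in> Basis" for b
        using p\<phi>[OF that] T unfolding partial_bound_def by blast
      from p\<phi>[OF SOME_Basis] T show "(\<lambda>x. Q_dist (v x) T) \<in> Lp (lebesgue_on \<Omega>) 2"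
        unfolding partial_bound_def weak_partial_def by blast
    next
      show "\<exists>\<phi>. partial_bound \<Omega> Q v b \<phi>" if "b \<in> Basis" for b using p\<phi>[OF that] by blast
    qed
    have "sobolev_trace \<Omega> S (\<lambda>x. Q_dist (u x) T) = sobolev_trace \<Omega> S (\<lambda>x. Q_dist (v x) T)"
      if T: "T \<in> Q_points Q" for T
    proof -
      obtain L where L: "L-lipschitz_on UNIV (w T)" using w_lip[OF T] ..
      have "K \<subseteq> \<Omega>" using K(2) V by blast
      have "sobolev_trace \<Omega> S (\<lambda>x. Q_dist (u x) T + w T x) = sobolev_trace \<Omega> S (\<lambda>x. Q_dist (u x) T)"
        by (rule sobolev_trace_add[OF \<Omega> S L K(1) \<open>K \<subseteq> \<Omega>\<close> w0 w_diff[OF T]])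
      then show ?thesis unfolding vw by (rule sym)
    qed
    then have Dir_le: "Dir \<Omega> Q u \<le> Dir \<Omega> Q v"
      using min vW unfolding Dir_minimizing_def by blast
    define c where "c b = abs_partial \<Omega> Q v b" for b
    have pc: "partial_bound \<Omega> Q v b (c b)" "AE x in lebesgue_on \<Omega>. c b x \<le> \<phi> b x" if "b \<in> Basis" for b
      using abs_partial_minimal[OF \<Omega>(1) p\<phi>[OF that]] by (simp_all add: c_def)
    have i_a: "integrable (lebesgue_on \<Omega>) (\<lambda>x. (a b x)\<^sup>2)" and i_c: "integrable (lebesgue_on \<Omega>) (\<lambda>x. (c b x)\<^sup>2)"
      and i_\<phi>: "integrable (lebesgue_on \<Omega>) (\<lambda>x. (\<phi> b x)\<^sup>2)" if "b \<in> Basis" for b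
      using pa[OF that] pc(1)[OF that] Lphi[OF that] by (simp_all add: partial_bound_def Lp_2_iff)
    have Du: "Dir \<Omega> Q u = (\<Sum>b\<in>Basis. LINT x|lebesgue_on \<Omega>. (a b x)\<^sup>2)"
      unfolding Dir_def abs_D_def a_def[symmetric]
      using i_a by (simp add: sum_nonneg)
    have Dv: "Dir \<Omega> Q v = (\<Sum>b\<in>Basis. LINT x|lebesgue_on \<Omega>. (c b x)\<^sup>2)"
      unfolding Dir_def abs_D_def c_def[symmetric]
      using i_c by (simp add: sum_nonneg)
    have "(LINT x|lebesgue_on \<Omega>. (c b x)\<^sup>2) - (LINT x|lebesgue_on \<Omega>. (a b x)\<^sup>2)
        \<le> (LINT x|lebesgue_on V. 2 * \<epsilon> * ((F' i0 b x \<bullet> e) * \<zeta>' b x) + \<epsilon>\<^sup>2 * ((\<zeta>' b x)\<^sup>2 * (e \<bullet> e)))"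
      if b: "b \<in> Basis" for b
    proof -
      define R where "R x = 2 * \<epsilon> * ((F' i0 b x \<bullet> e) * \<zeta>' b x) + \<epsilon>\<^sup>2 * ((\<zeta>' b x)\<^sup>2 * (e \<bullet> e))" for x
      have iR: "integrable (lebesgue_on V) R"
        unfolding R_def[abs_def]
        using Lp_2_mult[OF LF[OF b] Lz[OF b]] Lz[OF b] by (simp add: Lp_2_iff)
      \<comment> \<open>Only the sheet \<open>i0\<close> contributes to the difference of the energies.\<close>
      have RE: "R x = (sheet_energy Q G' b x)\<^sup>2 - (sheet_energy Q F' b x)\<^sup>2" for x
      proof -
        have "(sheet_energy Q G' b x)\<^sup>2 - (sheet_energy Q F' b x)\<^sup>2 = (\<Sum>i<Q. (norm (G' i b x))\<^sup>2 - (norm (F' i b x))\<^sup>2)"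
          by (simp add: sheet_energy_def L2_set_def sum_nonneg sum_subtractf)
        also have "\<dots> = (\<Sum>i<Q. if i = i0 then R x else 0)"
        proof (rule sum.cong)
          fix i show "(norm (G' i b x))\<^sup>2 - (norm (F' i b x))\<^sup>2 = (if i = i0 then R x else 0)"
          proof (cases "i = i0")
            case True
            have sq: "(norm (p + c *\<^sub>R e))\<^sup>2 - (norm p)\<^sup>2 = 2 * c * (p \<bullet> e) + c\<^sup>2 * (e \<bullet> e)" for p c
              unfolding power2_norm_eq_inner
              by (simp add: inner_add_left inner_add_right inner_commute power2_eq_square algebra_simps)
            have "(norm (G' i b x))\<^sup>2 - (norm (F' i b x))\<^sup>2
                = 2 * (\<epsilon> * \<zeta>' b x) * (F' i0 b x \<bullet> e) + (\<epsilon> * \<zeta>' b x)\<^sup>2 * (e \<bullet> e)"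
              unfolding G'_def True if_P[OF refl] by (rule sq)
            also have "\<dots> = R x" by (simp add: R_def power_mult_distrib mult_ac)
            finally show ?thesis using True by simp
          qed (simp add: G'_def)
        qed simp
        also have "\<dots> = R x" using i0 by simp
        finally show ?thesis by simp
      qed
      have iR\<Omega>: "integrable (lebesgue_on \<Omega>) (\<lambda>x. indicator V x * R x)"
      proof -
        have "indicator \<Omega> x * (indicator V x * R x) = indicator V x * R x" for x
          using V by (auto simp: indicator_def)
        then show ?thesis using iR unfolding integrable_lebesgue_on[OF m(1)] integrable_lebesgue_on[OF m(2)] by (simp only:)
      qed
      have "(LINT x|lebesgue_on \<Omega>. (c b x)\<^sup>2) - (LINT x|lebesgue_on \<Omega>. (a b x)\<^sup>2)
          = (LINT x|lebesgue_on \<Omega>. (c b x)\<^sup>2 - (a b x)\<^sup>2)"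
        using i_a[OF b] i_c[OF b] by simp
      also have "\<dots> \<le> (LINT x|lebesgue_on \<Omega>. indicator V x * R x)"
      proof (rule integral_mono_AE)
        show "integrable (lebesgue_on \<Omega>) (\<lambda>x. (c b x)\<^sup>2 - (a b x)\<^sup>2)" using i_a[OF b] i_c[OF b] by simp
        show "integrable (lebesgue_on \<Omega>) (\<lambda>x. indicator V x * R x)" by (rule iR\<Omega>)
        have "AE x in lebesgue. x \<in> \<Omega> \<longrightarrow> (c b x)\<^sup>2 - (a b x)\<^sup>2 \<le> indicator V x * R x"
          using sheet_energy_le_partial_bound[OF \<Omega>(1) V sh rep sep b pa[OF b]] pc(2)[OF b, unfolded AE_lebesgue_on[OF m(1)]]
        proof eventually_elim
          case (elim x)
          show ?case
          proof
            assume x: "x \<in> \<Omega>"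
            have c0: "0 \<le> c b x" using pc(1)[OF b] x by (simp add: partial_bound_def)
            have "(c b x)\<^sup>2 \<le> (\<phi> b x)\<^sup>2" using elim(2) x c0 by (intro power_mono) auto
            moreover have "(sheet_energy Q F' b x)\<^sup>2 \<le> (a b x)\<^sup>2" if "x \<in> V"
              using elim(1) that by (intro power_mono) (auto simp: sheet_energy_def)
            ultimately show "(c b x)\<^sup>2 - (a b x)\<^sup>2 \<le> indicator V x * R x"
              by (cases "x \<in> V") (auto simp: \<phi>_def RE)
          qed
        qed
        then show "AE x in lebesgue_on \<Omega>. (c b x)\<^sup>2 - (a b x)\<^sup>2 \<le> indicator V x * R x"
          by (simp add: AE_lebesgue_on[OF m(1)])
      qed
      also have "\<dots> = (LINT x|lebesgue_on V. R x)"
      proof -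
        have "indicator \<Omega> x * (indicator V x * R x) = indicator V x * R x" for x
          using V by (auto simp: indicator_def)
        then show ?thesis unfolding integral_lebesgue_on[OF m(1)] integral_lebesgue_on[OF m(2)] by (simp only:)
      qed
      finally show ?thesis by (simp add: R_def)
    qed
    then have "(\<Sum>b\<in>Basis. (LINT x|lebesgue_on \<Omega>. (c b x)\<^sup>2) - (LINT x|lebesgue_on \<Omega>. (a b x)\<^sup>2))
        \<le> (\<Sum>b\<in>Basis. LINT x|lebesgue_on V. 2 * \<epsilon> * ((F' i0 b x \<bullet> e) * \<zeta>' b x) + \<epsilon>\<^sup>2 * ((\<zeta>' b x)\<^sup>2 * (e \<bullet> e)))"
      by (rule sum_mono)
    also have "\<dots> = (\<Sum>b\<in>Basis. 2 * \<epsilon> * (LINT x|lebesgue_on V. (F' i0 b x \<bullet> e) * \<zeta>' b x)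
        + \<epsilon>\<^sup>2 * (LINT x|lebesgue_on V. (\<zeta>' b x)\<^sup>2 * (e \<bullet> e)))"
    proof (rule sum.cong)
      fix b :: 'a assume b: "b \<in> Basis"
      have 1: "integrable (lebesgue_on V) (\<lambda>x. (F' i0 b x \<bullet> e) * \<zeta>' b x)" by (rule Lp_2_mult[OF LF[OF b] Lz[OF b]])
      have 2: "integrable (lebesgue_on V) (\<lambda>x. (\<zeta>' b x)\<^sup>2 * (e \<bullet> e))" using Lz[OF b] by (simp add: Lp_2_iff)
      show "(LINT x|lebesgue_on V. 2 * \<epsilon> * ((F' i0 b x \<bullet> e) * \<zeta>' b x) + \<epsilon>\<^sup>2 * ((\<zeta>' b x)\<^sup>2 * (e \<bullet> e)))
          = 2 * \<epsilon> * (LINT x|lebesgue_on V. (F' i0 b x \<bullet> e) * \<zeta>' b x) + \<epsilon>\<^sup>2 * (LINT x|lebesgue_on V. (\<zeta>' b x)\<^sup>2 * (e \<bullet> e))"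
        unfolding Bochner_Integration.integral_add[OF integrable_mult_right[OF 1] integrable_mult_right[OF 2]]
        by (simp only: integral_mult_right_zero)
    qed simp
    also have "\<dots> = 2 * \<epsilon> * A + \<epsilon>\<^sup>2 * B"
      by (simp only: A_def B_def sum.distrib sum_distrib_left)
    finally show ?thesis using Dir_le unfolding Du Dv sum_subtractf by linarith
  qed
  then have "A = 0" by (rule linear_term_zero)
  then show ?thesis by (simp add: A_def \<zeta>'_def)
qed

lemma continuous_AE_zero:
  fixes q :: "'a::euclidean_space \<Rightarrow> real"
  assumes V: "open V" and q: "continuous_on V q" and ae: "AE x in lebesgue. x \<in> V \<longrightarrow> q x = 0" and x: "x \<in> V"
  shows "q x = 0"
proof (rule ccontr)
  assume "q x \<noteq> 0"
  define W where "W = V \<inter> q -` (- {0})"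
  have W: "open W" unfolding W_def by (rule continuous_open_preimage[OF q V]) (simp add: open_Compl)
  have "AE x in lebesgue. x \<notin> W" using ae by eventually_elim (auto simp: W_def)
  then have "W \<in> null_sets lebesgue" using W by (subst (asm) AE_iff_null_sets[symmetric]) auto
  then have "negligible W" by (simp add: negligible_iff_null_sets)
  moreover have "W \<noteq> {}" using x \<open>q x \<noteq> 0\<close> by (auto simp: W_def)
  ultimately show False using open_not_negligible[OF W] by blast
qed

text \<open>
  Integrating by parts once more moves the derivative back onto \<open>F'\<close>. The fundamental lemma then
  gives the Laplace equation almost everywhere, and continuity of \<open>F2\<close> gives it at every point.
\<close>

lemma weakly_harmonic_laplacian:
  fixes F' :: "'a::euclidean_space \<Rightarrow> 'a \<Rightarrow> 'b::euclidean_space"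
  assumes V: "open V" "convex V" "bounded V"
    and F': "\<forall>b\<in>Basis. \<forall>y\<in>V. (F' b has_derivative (\<lambda>h. \<Sum>b'\<in>Basis. (h \<bullet> b') *\<^sub>R F2 b b' y)) (at y)"
    and F2: "\<forall>b\<in>Basis. \<forall>b'\<in>Basis. continuous_on V (F2 b b')" "\<forall>b\<in>Basis. \<forall>b'\<in>Basis. \<forall>y\<in>V. norm (F2 b b' y) \<le> C"
    and F'C: "\<forall>b\<in>Basis. \<forall>y\<in>V. norm (F' b y) \<le> C"
    and weak: "\<And>\<zeta>. \<zeta> \<in> test_functions V \<Longrightarrow> (\<Sum>b\<in>Basis. LINT x|lebesgue_on V. (F' b x \<bullet> e) * frechet_derivative \<zeta> (at x) b) = 0"
    and x: "x \<in> V"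
  shows "(\<Sum>b\<in>Basis. F2 b b x) \<bullet> e = 0"
proof -
  have m: "V \<in> sets lebesgue" using V(1) by simp
  define q where "q y = (\<Sum>b\<in>Basis. F2 b b y \<bullet> e)" for y
  have cq: "continuous_on V q" unfolding q_def[abs_def] using F2(1) by (intro continuous_intros) auto
  have cF2: "continuous_on V (\<lambda>x. F2 b b x \<bullet> e)" if "b \<in> Basis" for b
    using F2(1) that by (intro continuous_intros) auto
  have LF2: "(\<lambda>x. F2 b b x \<bullet> e) \<in> Lp (lebesgue_on V) 2" if b: "b \<in> Basis" for b
  proof (rule Lp_2_bounded[OF continuous_imp_measurable_on_sets_lebesgue[OF cF2[OF b] m] _ V(3) m])
    show "\<bar>F2 b b x \<bullet> e\<bar> \<le> C * norm e" if "x \<in> V" for x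
    proof -
      have "norm (F2 b b x) \<le> C" using F2(2) b that by blast
      then have "norm (F2 b b x) * norm e \<le> C * norm e" by (rule mult_right_mono) simp
      with Cauchy_Schwarz_ineq2[of "F2 b b x" e] show ?thesis by (rule order_trans)
    qed
  qed
  have derg: "((\<lambda>x. F' b x \<bullet> e) has_derivative (\<lambda>h. (\<Sum>b'\<in>Basis. (h \<bullet> b') *\<^sub>R F2 b b' y) \<bullet> e)) (at y)"
    if "b \<in> Basis" "y \<in> V" for b y
    by (rule has_derivative_inner_left) (use F' that in blast)
  have lip: "\<exists>L. L-lipschitz_on V (\<lambda>x. F' b x \<bullet> e)" if b: "b \<in> Basis" for b
  proof (rule exI[of _ "real DIM('a) * \<bar>C\<bar> * norm e"], rule bounded_derivative_imp_lipschitz[OF _ V(2)])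
    let ?L = "real DIM('a) * \<bar>C\<bar> * norm e"
    show "0 \<le> ?L" by simp
    fix y assume y: "y \<in> V"
    show "((\<lambda>x. F' b x \<bullet> e) has_derivative (\<lambda>h. (\<Sum>b'\<in>Basis. (h \<bullet> b') *\<^sub>R F2 b b' y) \<bullet> e)) (at y within V)"
      by (rule has_derivative_at_withinI[OF derg[OF b y]])
    show "onorm (\<lambda>h. (\<Sum>b'\<in>Basis. (h \<bullet> b') *\<^sub>R F2 b b' y) \<bullet> e) \<le> ?L"
    proof (rule onorm_le)
      fix h :: 'a
      have "norm (\<Sum>b'\<in>Basis. (h \<bullet> b') *\<^sub>R F2 b b' y) \<le> (\<Sum>b'\<in>(Basis::'a set). norm h * \<bar>C\<bar>)"
      proof (rule sum_norm_le)
        fix b' :: 'a assume b': "b' \<in> Basis"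
        have "norm (F2 b b' y) \<le> C" using F2(2) b b' y by blast
        then have "norm (F2 b b' y) \<le> \<bar>C\<bar>" by linarith
        then show "norm ((h \<bullet> b') *\<^sub>R F2 b b' y) \<le> norm h * \<bar>C\<bar>"
          unfolding norm_scaleR using Basis_le_norm[OF b', of h] by (intro mult_mono) auto
      qed
      then have "norm (\<Sum>b'\<in>Basis. (h \<bullet> b') *\<^sub>R F2 b b' y) * norm e \<le> (real DIM('a) * (norm h * \<bar>C\<bar>)) * norm e"
        by (intro mult_right_mono) auto
      with Cauchy_Schwarz_ineq2[of "\<Sum>b'\<in>Basis. (h \<bullet> b') *\<^sub>R F2 b b' y" e]
      show "norm ((\<Sum>b'\<in>Basis. (h \<bullet> b') *\<^sub>R F2 b b' y) \<bullet> e) \<le> ?L * norm h"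
        by (simp add: mult_ac)
    qed
  qed
  have "AE x in lebesgue. x \<in> V \<longrightarrow> q x = 0"
  proof (rule fundamental_lemma[OF V(1)])
    show "q \<in> Lp (lebesgue_on V) 2"
    proof (rule Lp_2_bounded[OF continuous_imp_measurable_on_sets_lebesgue[OF cq m] _ V(3) m])
      show "\<bar>q y\<bar> \<le> (\<Sum>b\<in>(Basis::'a set). C * norm e)" if "y \<in> V" for y
        unfolding q_def
      proof (rule order_trans[OF sum_abs sum_mono])
        fix b :: 'a assume b: "b \<in> Basis"
        have "norm (F2 b b y) \<le> C" using F2(2) b that by blast
        then have "norm (F2 b b y) * norm e \<le> C * norm e" by (rule mult_right_mono) simp
        with Cauchy_Schwarz_ineq2[of "F2 b b y" e] show "\<bar>F2 b b y \<bullet> e\<bar> \<le> C * norm e" by (rule order_trans)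
      qed
    qed
    fix \<phi> assume \<phi>: "\<phi> \<in> test_functions V"
    have parts: "(LINT x|lebesgue_on V. (F' b x \<bullet> e) * frechet_derivative \<phi> (at x) b) = - (LINT x|lebesgue_on V. (F2 b b x \<bullet> e) * \<phi> x)"
      if b: "b \<in> Basis" for b
    proof -
      obtain L where L: "L-lipschitz_on V (\<lambda>x. F' b x \<bullet> e)" using lip[OF b] ..
      define g where "g x = (if x \<in> V then F' b x \<bullet> e else 0)" for x
      define d where "d x = (if x \<in> V then F2 b b x \<bullet> e else 0)" for x
      have gm: "g \<in> borel_measurable borel" unfolding g_def[abs_def]
        by (rule borel_measurable_extend_by[OF V(1) lipschitz_on_continuous_on[OF L]])
      have dm: "d \<in> borel_measurable borel" unfolding d_def[abs_def]
        by (rule borel_measurable_extend_by[OF V(1) cF2[OF b]])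
      have gl: "L-lipschitz_on V g" using L by (auto simp: lipschitz_on_def g_def)
      have gd: "(g has_derivative (\<lambda>h. (\<Sum>b'\<in>Basis. (h \<bullet> b') *\<^sub>R F2 b b' y) \<bullet> e)) (at y)" if y: "y \<in> V" for y
        by (rule has_derivative_transform_within_open[OF derg[OF b y] V(1) y]) (simp add: g_def)
      note sm = test_functionD(1)[OF \<phi>]
      have "(LINT x|lebesgue_on V. (F' b x \<bullet> e) * frechet_derivative \<phi> (at x) b) = (LINT x|lebesgue_on V. g x * frechet_derivative \<phi> (at x) b)"
        by (rule Bochner_Integration.integral_cong) (auto simp: g_def space_restrict_space)
      also have "\<dots> = (LINT x|lborel. g x * frechet_derivative \<phi> (at x) b)"
        by (rule integral_lebesgue_on_lborel[OF _ m borel_measurable_times[OF gm smooth_measurable[OF smoothD(2)[OF sm b]]]])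
          (simp add: g_def)
      also have "\<dots> = - (LINT x|lborel. d x * \<phi> x)"
      proof (rule integration_by_parts_lipschitz[OF V(1) gm gl _ _ dm _ \<phi> b])
        show "\<bar>g x\<bar> \<le> C * norm e" if "x \<in> V" for x
        proof -
          have "norm (F' b x) \<le> C" using F'C b that by blast
          then have "norm (F' b x) * norm e \<le> C * norm e" by (rule mult_right_mono) simp
          with Cauchy_Schwarz_ineq2[of "F' b x" e] have "\<bar>F' b x \<bullet> e\<bar> \<le> C * norm e" by (rule order_trans)
          then show ?thesis using that by (simp add: g_def)
        qed
        show "AE x in lborel. x \<in> V \<longrightarrow> g differentiable (at x)"
          using gd by (intro AE_I2) (auto simp: differentiable_def)
        show "AE x in lborel. x \<in> V \<longrightarrow> d x = frechet_derivative g (at x) b"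
        proof (intro AE_I2 impI)
          fix x assume x: "x \<in> V"
          show "d x = frechet_derivative g (at x) b"
            unfolding frechet_derivative_apply[OF gd[OF x]] Basis_derivative_apply[OF b] using x by (simp add: d_def)
        qed
      qed
      also have "(LINT x|lborel. d x * \<phi> x) = (LINT x|lebesgue_on V. d x * \<phi> x)"
        by (rule integral_lebesgue_on_lborel[OF _ m borel_measurable_times[OF dm smooth_measurable[OF sm]], symmetric])
          (simp add: d_def)
      also have "(LINT x|lebesgue_on V. d x * \<phi> x) = (LINT x|lebesgue_on V. (F2 b b x \<bullet> e) * \<phi> x)"
        by (rule Bochner_Integration.integral_cong) (auto simp: d_def space_restrict_space)
      finally show ?thesis .
    qed
    have "(LINT x|lebesgue_on V. q x * \<phi> x) = (\<Sum>b\<in>Basis. LINT x|lebesgue_on V. (F2 b b x \<bullet> e) * \<phi> x)"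
      unfolding q_def sum_distrib_right
      by (rule Bochner_Integration.integral_sum) (rule Lp_2_mult[OF LF2 test_function_Lp_2[OF \<phi> m]])
    also have "\<dots> = - (\<Sum>b\<in>Basis. LINT x|lebesgue_on V. (F' b x \<bullet> e) * frechet_derivative \<phi> (at x) b)"
      unfolding sum_negf[symmetric] by (rule sum.cong) (simp_all add: parts)
    finally show "(LINT x|lebesgue_on V. q x * \<phi> x) = 0" using weak[OF \<phi>] by simp
  qed
  from continuous_AE_zero[OF V(1) cq this x] show ?thesis by (simp add: q_def inner_sum_left)
qed

section \<open>Power series\<close>

text \<open>
  Power series are indexed here by the natural numbers, along an enumeration of the multi-indices,
  so that the theory of ordinary series applies.
\<close>

definition monomial :: "('a::euclidean_space \<Rightarrow> nat) \<Rightarrow> 'a \<Rightarrow> real" where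
  "monomial \<beta> y = (\<Prod>b\<in>Basis. (y \<bullet> b) ^ \<beta> b)"

definition mdegree :: "('a::euclidean_space \<Rightarrow> nat) \<Rightarrow> nat" where
  "mdegree \<beta> = (\<Sum>b\<in>Basis. \<beta> b)"

definition lower :: "'a \<Rightarrow> ('a \<Rightarrow> nat) \<Rightarrow> 'a \<Rightarrow> nat" where
  "lower b \<beta> = \<beta>(b := \<beta> b - 1)"

definition power_series :: "(nat \<Rightarrow> 'a::euclidean_space \<Rightarrow> nat) \<Rightarrow> (nat \<Rightarrow> 'b::euclidean_space) \<Rightarrow> 'a \<Rightarrow> 'b" where
  "power_series \<beta> c y = (\<Sum>n. monomial (\<beta> n) y *\<^sub>R c n)"

text \<open>
  Absolute convergence at the point all of whose coordinates are \<open>\<rho>\<close>.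
\<close>

definition summable_radius :: "(nat \<Rightarrow> 'a::euclidean_space \<Rightarrow> nat) \<Rightarrow> (nat \<Rightarrow> 'b::euclidean_space) \<Rightarrow> real \<Rightarrow> bool" where
  "summable_radius \<beta> c \<rho> \<longleftrightarrow> summable (\<lambda>n. norm (c n) * \<rho> ^ mdegree (\<beta> n))"

lemma abs_monomial_le: "norm y \<le> \<rho> \<Longrightarrow> \<bar>monomial \<beta> y\<bar> \<le> \<rho> ^ mdegree \<beta>"
proof -
  assume y: "norm y \<le> \<rho>"
  have "\<bar>monomial \<beta> y\<bar> = (\<Prod>b\<in>Basis. \<bar>y \<bullet> b\<bar> ^ \<beta> b)"
    unfolding monomial_def by (simp add: abs_prod power_abs)
  also have "\<dots> \<le> (\<Prod>b\<in>(Basis::'a set). \<rho> ^ \<beta> b)"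
  proof (rule prod_mono)
    fix b :: 'a assume "b \<in> Basis"
    then have "\<bar>y \<bullet> b\<bar> \<le> \<rho>" using Basis_le_norm[of b y] y by linarith
    then show "0 \<le> \<bar>y \<bullet> b\<bar> ^ \<beta> b \<and> \<bar>y \<bullet> b\<bar> ^ \<beta> b \<le> \<rho> ^ \<beta> b" by (simp add: power_mono)
  qed
  also have "\<dots> = \<rho> ^ mdegree \<beta>" by (simp add: mdegree_def power_sum)
  finally show ?thesis .
qed

lemma has_derivative_monomial:
  "(monomial \<beta> has_derivative (\<lambda>h. \<Sum>b\<in>Basis. (h \<bullet> b) * (real (\<beta> b) * monomial (lower b \<beta>) y))) (at y)"
proof -
  have "((\<lambda>y. (y \<bullet> b) ^ \<beta> b) has_derivative (\<lambda>h. real (\<beta> b) * (h \<bullet> b) * (y \<bullet> b) ^ (\<beta> b - 1))) (at y)" for b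
    by (auto intro!: derivative_eq_intros simp: mult_ac)
  then have "((\<lambda>y. \<Prod>b\<in>Basis. (y \<bullet> b) ^ \<beta> b) has_derivative
      (\<lambda>h. \<Sum>b\<in>Basis. (real (\<beta> b) * (h \<bullet> b) * (y \<bullet> b) ^ (\<beta> b - 1)) * (\<Prod>j\<in>Basis - {b}. (y \<bullet> j) ^ \<beta> j))) (at y)"
    by (rule has_derivative_prod)
  moreover have "(y \<bullet> b) ^ (\<beta> b - 1) * (\<Prod>j\<in>Basis - {b}. (y \<bullet> j) ^ \<beta> j) = monomial (lower b \<beta>) y"
    if "b \<in> Basis" for b
  proof -
    have "monomial (lower b \<beta>) y = (y \<bullet> b) ^ lower b \<beta> b * (\<Prod>j\<in>Basis - {b}. (y \<bullet> j) ^ lower b \<beta> j)"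
      unfolding monomial_def by (rule prod.remove[OF finite_Basis that])
    also have "(\<Prod>j\<in>Basis - {b}. (y \<bullet> j) ^ lower b \<beta> j) = (\<Prod>j\<in>Basis - {b}. (y \<bullet> j) ^ \<beta> j)"
      by (rule prod.cong) (auto simp: lower_def)
    moreover have "lower b \<beta> b = \<beta> b - 1" by (simp add: lower_def)
    ultimately show ?thesis by (simp only:)
  qed
  then have "(\<Sum>b\<in>Basis. (real (\<beta> b) * (h \<bullet> b) * (y \<bullet> b) ^ (\<beta> b - 1)) * (\<Prod>j\<in>Basis - {b}. (y \<bullet> j) ^ \<beta> j))
      = (\<Sum>b\<in>Basis. (h \<bullet> b) * (real (\<beta> b) * monomial (lower b \<beta>) y))" for h
    by (intro sum.cong refl) (simp add: mult_ac)
  moreover have eq: "monomial \<beta> = (\<lambda>y. \<Prod>b\<in>Basis. (y \<bullet> b) ^ \<beta> b)"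
    by (rule ext) (simp add: monomial_def)
  ultimately show ?thesis unfolding eq by (simp only:)
qed

text \<open>
  The factor \<open>\<beta> n b\<close> from differentiation is absorbed by passing to a smaller radius, because
  \<open>k (\<sigma> / \<rho>) ^ k\<close> is bounded.
\<close>

lemma summable_radius_lower:
  assumes "summable_radius \<beta> c \<rho>" "0 < \<sigma>" "\<sigma> < \<rho>" and b: "b \<in> Basis"
  shows "summable_radius (\<lambda>n. lower b (\<beta> n)) (\<lambda>n. real (\<beta> n b) *\<^sub>R c n) \<sigma>"
proof -
  have "norm (\<sigma> / \<rho>) < 1" using assms by simp
  from powser_times_n_limit_0[OF this]
  have "(\<lambda>k. real k * (\<sigma> / \<rho>) ^ k) \<longlonglongrightarrow> 0" by simp
  then have "Bseq (\<lambda>k. real k * (\<sigma> / \<rho>) ^ k)" using convergentI convergent_imp_Bseq by blast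
  then obtain B where B: "\<And>k. norm (real k * (\<sigma> / \<rho>) ^ k) \<le> B" "B > 0" unfolding Bseq_def by blast
  have k: "real k * \<sigma> ^ (k - 1) \<le> (B / \<sigma>) * \<rho> ^ k" for k
  proof (cases k)
    case (Suc j)
    have "real k * (\<sigma> / \<rho>) ^ k \<le> B" using B(1)[of k] assms(2,3) by simp
    then have "real k * \<sigma> ^ k \<le> B * \<rho> ^ k"
      using assms by (simp add: power_divide pos_divide_le_eq)
    then have "(real k * \<sigma> ^ (k - 1)) * \<sigma> \<le> B * \<rho> ^ k" using Suc by (simp add: mult_ac)
    then show ?thesis using assms(2) by (simp add: pos_le_divide_eq)
  qed (use B assms in simp)
  show ?thesis
    unfolding summable_radius_def
  proof (rule summable_comparison_test')
    show "summable (\<lambda>n. (B / \<sigma>) * (norm (c n) * \<rho> ^ mdegree (\<beta> n)))"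
      using assms(1) unfolding summable_radius_def by (rule summable_mult)
    show "norm (norm (real (\<beta> n b) *\<^sub>R c n) * \<sigma> ^ mdegree (lower b (\<beta> n))) \<le> (B / \<sigma>) * (norm (c n) * \<rho> ^ mdegree (\<beta> n))"
      if "n \<ge> 0" for n
    proof (cases "\<beta> n b = 0")
      case False
      have "mdegree (\<beta> n) = \<beta> n b + (\<Sum>j\<in>Basis - {b}. \<beta> n j)"
        unfolding mdegree_def by (rule sum.remove[OF finite_Basis b])
      moreover have "mdegree (lower b (\<beta> n)) = lower b (\<beta> n) b + (\<Sum>j\<in>Basis - {b}. lower b (\<beta> n) j)"
        unfolding mdegree_def by (rule sum.remove[OF finite_Basis b])
      moreover have "(\<Sum>j\<in>Basis - {b}. lower b (\<beta> n) j) = (\<Sum>j\<in>Basis - {b}. \<beta> n j)"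
        by (rule sum.cong) (auto simp: lower_def)
      ultimately have deg: "mdegree (lower b (\<beta> n)) = mdegree (\<beta> n) - 1" "\<beta> n b \<le> mdegree (\<beta> n)"
        using False by (auto simp: lower_def)
      have "real (\<beta> n b) * \<sigma> ^ (mdegree (\<beta> n) - 1) \<le> real (mdegree (\<beta> n)) * \<sigma> ^ (mdegree (\<beta> n) - 1)"
        using deg(2) assms(2) by (intro mult_right_mono) auto
      also have "\<dots> \<le> (B / \<sigma>) * \<rho> ^ mdegree (\<beta> n)" by (rule k)
      finally have "norm (c n) * (real (\<beta> n b) * \<sigma> ^ (mdegree (\<beta> n) - 1)) \<le> norm (c n) * ((B / \<sigma>) * \<rho> ^ mdegree (\<beta> n))"
        by (rule mult_left_mono) simp
      then show ?thesis using assms(2) by (simp add: deg(1) abs_mult mult_ac)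
    qed (use B assms in simp)
  qed
qed

lemma power_series_sums:
  assumes "summable_radius \<beta> c \<rho>" "norm y \<le> \<rho>"
  shows "(\<lambda>n. monomial (\<beta> n) y *\<^sub>R c n) sums power_series \<beta> c y"
  unfolding power_series_def
proof (rule summable_sums, rule summable_norm_cancel, rule summable_comparison_test')
  show "summable (\<lambda>n. norm (c n) * \<rho> ^ mdegree (\<beta> n))" using assms by (simp add: summable_radius_def)
  show "norm (norm (monomial (\<beta> n) y *\<^sub>R c n)) \<le> norm (c n) * \<rho> ^ mdegree (\<beta> n)" if "n \<ge> 0" for n
    using abs_monomial_le[OF assms(2), of "\<beta> n"] by (simp add: mult.commute mult_left_mono)
qed

text \<open>
  The series of derivatives converges uniformly on smaller balls by the Weierstrass test.
\<close>

lemma has_derivative_power_series: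
  fixes c :: "nat \<Rightarrow> 'b::euclidean_space"
  assumes sm: "summable_radius \<beta> c \<rho>" and y: "norm (y::'a::euclidean_space) < \<rho>"
  shows "(power_series \<beta> c has_derivative
    (\<lambda>h. \<Sum>b\<in>Basis. (h \<bullet> b) *\<^sub>R power_series (\<lambda>n. lower b (\<beta> n)) (\<lambda>n. real (\<beta> n b) *\<^sub>R c n) y)) (at y)"
proof -
  obtain \<sigma> where \<sigma>: "norm y < \<sigma>" "\<sigma> < \<rho>" using dense[OF y] by blast
  have \<sigma>0: "0 < \<sigma>" using \<sigma>(1) norm_ge_zero[of y] by linarith
  define P :: "'a \<Rightarrow> 'a \<Rightarrow> 'b" where "P b = power_series (\<lambda>n. lower b (\<beta> n)) (\<lambda>n. real (\<beta> n b) *\<^sub>R c n)" for b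
  define t where "t b n x = monomial (lower b (\<beta> n)) x *\<^sub>R (real (\<beta> n b) *\<^sub>R c n)" for b n and x :: 'a
  have sl: "summable_radius (\<lambda>n. lower b (\<beta> n)) (\<lambda>n. real (\<beta> n b) *\<^sub>R c n) \<sigma>" if "b \<in> Basis" for b
    by (rule summable_radius_lower[OF sm \<sigma>0 \<sigma>(2) that])
  have unif: "uniform_limit (ball (0::'a) \<sigma>) (\<lambda>n x. \<Sum>i<n. t b i x) (P b) sequentially" if b: "b \<in> Basis" for b
  proof -
    have "uniform_limit (ball (0::'a) \<sigma>) (\<lambda>n x. \<Sum>i<n. t b i x) (\<lambda>x. suminf (\<lambda>i. t b i x)) sequentially"
    proof (rule Weierstrass_m_test)
      show "summable (\<lambda>n. norm (real (\<beta> n b) *\<^sub>R c n) * \<sigma> ^ mdegree (lower b (\<beta> n)))"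
        using sl[OF b] by (simp only: summable_radius_def)
      show "norm (t b n x) \<le> norm (real (\<beta> n b) *\<^sub>R c n) * \<sigma> ^ mdegree (lower b (\<beta> n))"
        if "x \<in> ball 0 \<sigma>" for n and x :: 'a
      proof -
        have "norm x \<le> \<sigma>" using that by simp
        from abs_monomial_le[OF this, of "lower b (\<beta> n)"]
        have "\<bar>monomial (lower b (\<beta> n)) x\<bar> * norm (real (\<beta> n b) *\<^sub>R c n)
            \<le> \<sigma> ^ mdegree (lower b (\<beta> n)) * norm (real (\<beta> n b) *\<^sub>R c n)"
          by (rule mult_right_mono) simp
        then show ?thesis unfolding t_def norm_scaleR[of "monomial _ _"] by (simp only: mult.commute)
      qed
    qed
    moreover have "(\<lambda>x. suminf (\<lambda>i. t b i x)) = P b"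
      by (rule ext) (simp add: P_def power_series_def t_def)
    ultimately show ?thesis by simp
  qed
  define f' where "f' n x h = (\<Sum>b\<in>Basis. (h \<bullet> b) *\<^sub>R t b n x)" for n and x h :: 'a
  define g' where "g' x h = (\<Sum>b\<in>Basis. (h \<bullet> b) *\<^sub>R P b x)" for x h :: 'a
  have "\<exists>g. \<forall>x\<in>ball 0 \<sigma>. (\<lambda>n. monomial (\<beta> n) x *\<^sub>R c n) sums (g x) \<and> (g has_derivative g' x) (at x within ball 0 \<sigma>)"
  proof (rule has_derivative_series)
    show "convex (ball (0::'a) \<sigma>)" by (rule convex_ball)
    show "y \<in> ball 0 \<sigma>" using \<sigma> by simp
    show "(\<lambda>n. monomial (\<beta> n) y *\<^sub>R c n) sums power_series \<beta> c y"
      by (rule power_series_sums[OF sm]) (use y in simp)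
    show "((\<lambda>x. monomial (\<beta> n) x *\<^sub>R c n) has_derivative f' n x) (at x within ball 0 \<sigma>)" for n x
    proof -
      have "((\<lambda>x. monomial (\<beta> n) x *\<^sub>R c n) has_derivative
          (\<lambda>h. (\<Sum>b\<in>Basis. (h \<bullet> b) * (real (\<beta> n b) * monomial (lower b (\<beta> n)) x)) *\<^sub>R c n)) (at x)"
        by (rule has_derivative_scaleR_left[OF has_derivative_monomial])
      moreover have "(\<Sum>b\<in>Basis. (h \<bullet> b) * (real (\<beta> n b) * monomial (lower b (\<beta> n)) x)) *\<^sub>R c n = f' n x h" for h
        unfolding f'_def t_def scaleR_sum_left by (rule sum.cong) (simp_all add: mult_ac)
      ultimately show ?thesis by (simp add: has_derivative_at_withinI)
    qed
    fix e :: real assume e: "e > 0"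
    define e' where "e' = e / real (DIM('a))"
    have e': "e' > 0" using e by (simp add: e'_def)
    have "\<forall>\<^sub>F n in sequentially. \<forall>b\<in>Basis. \<forall>x\<in>ball 0 \<sigma>. dist (\<Sum>i<n. t b i x) (P b x) < e'"
      by (rule eventually_ball_finite[OF finite_Basis]) (use unif e' in \<open>auto simp: uniform_limit_iff\<close>)
    then show "\<forall>\<^sub>F n in sequentially. \<forall>x\<in>ball 0 \<sigma>. \<forall>h. norm (sum (\<lambda>i. f' i x h) {..<n} - g' x h) \<le> e * norm h"
    proof (rule eventually_mono, intro ballI allI)
      fix n x h assume *: "\<forall>b\<in>Basis. \<forall>x\<in>ball 0 \<sigma>. dist (\<Sum>i<n. t b i x) (P b x) < e'" and x: "x \<in> ball (0::'a) \<sigma>"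
      have "(\<Sum>i<n. f' i x h) = (\<Sum>b\<in>Basis. (h \<bullet> b) *\<^sub>R (\<Sum>i<n. t b i x))"
        unfolding f'_def scaleR_sum_right by (rule sum.swap)
      then have "(\<Sum>i<n. f' i x h) - g' x h = (\<Sum>b\<in>Basis. (h \<bullet> b) *\<^sub>R ((\<Sum>i<n. t b i x) - P b x))"
        unfolding g'_def by (simp add: sum_subtractf scaleR_diff_right)
      also have "norm \<dots> \<le> (\<Sum>b\<in>(Basis::'a set). norm h * e')"
      proof (rule sum_norm_le)
        fix b :: 'a assume b: "b \<in> Basis"
        have "norm ((\<Sum>i<n. t b i x) - P b x) \<le> e'" using *[rule_format, OF b x] by (simp add: dist_norm)
        then show "norm ((h \<bullet> b) *\<^sub>R ((\<Sum>i<n. t b i x) - P b x)) \<le> norm h * e'"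
          unfolding norm_scaleR using Basis_le_norm[OF b, of h] by (intro mult_mono) auto
      qed
      also have "\<dots> = e * norm h" by (simp add: e'_def)
      finally show "norm ((\<Sum>i<n. f' i x h) - g' x h) \<le> e * norm h" .
    qed
  qed
  then obtain g where g: "\<And>x. x \<in> ball 0 \<sigma> \<Longrightarrow> (\<lambda>n. monomial (\<beta> n) x *\<^sub>R c n) sums (g x)"
    "\<And>x. x \<in> ball 0 \<sigma> \<Longrightarrow> (g has_derivative g' x) (at x within ball 0 \<sigma>)" by blast
  have yb: "y \<in> ball 0 \<sigma>" using \<sigma> by simp
  have "(g has_derivative g' y) (at y)" using g(2)[OF yb] at_within_open[OF yb open_ball] by simp
  then have "(power_series \<beta> c has_derivative g' y) (at y)"
  proof (rule has_derivative_transform_within_open[OF _ open_ball yb])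
    fix x :: 'a assume x: "x \<in> ball 0 \<sigma>"
    have "norm x \<le> \<rho>" using x \<sigma>(2) by simp
    from power_series_sums[OF sm this] g(1)[OF x] show "g x = power_series \<beta> c x"
      by (rule sums_unique2[symmetric])
  qed
  then show ?thesis unfolding g'_def[abs_def] P_def .
qed

definition second_partial where
  "second_partial \<beta> c b b' = power_series (\<lambda>n. lower b' (lower b (\<beta> n))) (\<lambda>n. real (lower b (\<beta> n) b') *\<^sub>R (real (\<beta> n b) *\<^sub>R c n))"

lemma second_partial_commute: "second_partial \<beta> c b b' = second_partial \<beta> c b' b"
proof (cases "b = b'")
  case False
  then have A: "lower b' (lower b (\<beta> n)) = lower b (lower b' (\<beta> n))"
    "real (lower b (\<beta> n) b') *\<^sub>R (real (\<beta> n b) *\<^sub>R c n) = real (lower b' (\<beta> n) b) *\<^sub>R (real (\<beta> n b') *\<^sub>R c n)" for n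
    by (auto simp: lower_def fun_upd_twist)
  show ?thesis unfolding second_partial_def A(1) A(2) ..
qed simp

text \<open>
  Unconditional convergence at the single point with all coordinates equal to \<open>s\<close> already forces
  absolute convergence there, since in finite dimensions the two notions agree. The factor
  \<open>1 / (2 DIM('a))\<close> in \<open>s\<close> keeps that point inside the ball of convergence.
\<close>

lemma has_sum_power_series_representation:
  fixes c :: "('a::euclidean_space \<Rightarrow> nat) \<Rightarrow> 'b::euclidean_space"
  assumes r: "r > 0" and f: "\<And>y. y \<in> ball x r \<Longrightarrow>
    ((\<lambda>\<alpha>. (\<Prod>b\<in>Basis. ((y - x) \<bullet> b) ^ \<alpha> b) *\<^sub>R c \<alpha>) has_sum f y) (Basis \<rightarrow>\<^sub>E (UNIV :: nat set))"
  obtains \<rho> \<beta> d where "\<rho> > 0" "summable_radius \<beta> d \<rho>"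
    "\<And>y. norm (y - x) < \<rho> \<Longrightarrow> f y = power_series \<beta> d (y - x)"
proof -
  define A where "A = (Basis::'a set) \<rightarrow>\<^sub>E (UNIV :: nat set)"
  have "countable A" unfolding A_def by (rule countable_PiE) auto
  moreover have "infinite A"
  proof
    assume "finite A"
    moreover have "inj (\<lambda>n::nat. restrict (\<lambda>_. n) (Basis::'a set))"
    proof (rule injI)
      fix m n :: nat assume "restrict (\<lambda>_. m) (Basis::'a set) = restrict (\<lambda>_. n) Basis"
      from fun_cong[OF this, of "SOME b. b \<in> Basis"] show "m = n" by (simp add: SOME_Basis)
    qed
    moreover have "range (\<lambda>n::nat. restrict (\<lambda>_. n) (Basis::'a set)) \<subseteq> A" by (auto simp: A_def)
    ultimately show False using finite_subset finite_imageD infinite_UNIV_nat by blast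
  qed
  ultimately have bij: "bij_betw (from_nat_into A) UNIV A" by (rule bij_betw_from_nat_into)
  define \<beta> where "\<beta> = from_nat_into A"
  define s where "s = r / (2 * real (DIM('a)))"
  have s0: "s > 0" using r by (simp add: s_def)
  have hs: "((\<lambda>n. monomial (\<beta> n) (y - x) *\<^sub>R c (\<beta> n)) has_sum f y) UNIV" if "y \<in> ball x r" for y
  proof -
    have "((\<lambda>\<alpha>. monomial \<alpha> (y - x) *\<^sub>R c \<alpha>) has_sum f y) A"
      using f[OF that] unfolding monomial_def A_def .
    then show ?thesis
      using has_sum_reindex_bij_betw[OF bij, of "\<lambda>\<alpha>. monomial \<alpha> (y - x) *\<^sub>R c \<alpha>"] unfolding \<beta>_def by blast
  qed
  define z where "z = (\<Sum>b\<in>(Basis::'a set). s *\<^sub>R b)"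
  have zb: "z \<bullet> b = s" if "b \<in> Basis" for b
    unfolding z_def using that by (simp add: inner_sum_left_Basis)
  have "norm z \<le> (\<Sum>b\<in>(Basis::'a set). s)"
    unfolding z_def using s0 by (intro sum_norm_le) simp
  also have "\<dots> < r" using r by (simp add: s_def)
  finally have "x + z \<in> ball x r" by (simp add: dist_norm)
  from hs[OF this]
  have "(\<lambda>n. monomial (\<beta> n) z *\<^sub>R c (\<beta> n)) summable_on UNIV" by (auto simp: summable_on_def)
  moreover have "monomial (\<beta> n) z = s ^ mdegree (\<beta> n)" for n
    by (simp add: monomial_def mdegree_def zb power_sum)
  ultimately have su: "(\<lambda>n. s ^ mdegree (\<beta> n) *\<^sub>R c (\<beta> n)) summable_on UNIV" by simp
  have "summable (\<lambda>n. \<bar>(s ^ mdegree (\<beta> n) *\<^sub>R c (\<beta> n)) \<bullet> e\<bar>)" for e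
  proof -
    have "(\<lambda>n. (s ^ mdegree (\<beta> n) *\<^sub>R c (\<beta> n)) \<bullet> e) summable_on UNIV"
      using summable_on_bounded_linear[OF bounded_linear_inner_left su] by (simp add: o_def)
    then have "(\<lambda>n. norm ((s ^ mdegree (\<beta> n) *\<^sub>R c (\<beta> n)) \<bullet> e)) summable_on UNIV"
      by (subst (asm) summable_on_iff_abs_summable_on_real)
    then show ?thesis using summable_on_imp_summable by fastforce
  qed
  then have S: "summable (\<lambda>n. \<Sum>e\<in>Basis. \<bar>(s ^ mdegree (\<beta> n) *\<^sub>R c (\<beta> n)) \<bullet> e\<bar>)" by (rule summable_sum)
  have "summable (\<lambda>n. norm (c (\<beta> n)) * s ^ mdegree (\<beta> n))"
  proof (rule summable_comparison_test'[OF S])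
    fix n :: nat assume "n \<ge> 0"
    have "norm (norm (c (\<beta> n)) * s ^ mdegree (\<beta> n)) = norm (s ^ mdegree (\<beta> n) *\<^sub>R c (\<beta> n))"
      using s0 by (simp add: abs_mult)
    also have "\<dots> \<le> (\<Sum>e\<in>Basis. \<bar>(s ^ mdegree (\<beta> n) *\<^sub>R c (\<beta> n)) \<bullet> e\<bar>)" by (rule norm_le_l1)
    finally show "norm (norm (c (\<beta> n)) * s ^ mdegree (\<beta> n)) \<le> (\<Sum>e\<in>Basis. \<bar>(s ^ mdegree (\<beta> n) *\<^sub>R c (\<beta> n)) \<bullet> e\<bar>)" .
  qed
  then have rad: "summable_radius \<beta> (\<lambda>n. c (\<beta> n)) s" by (simp add: summable_radius_def)
  have "s \<le> r"
  proof -
    have "1 \<le> real DIM('a)" using DIM_positive[where 'a='a] by linarith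
    then have ge: "1 \<le> 2 * real DIM('a)" by linarith
    have "s * 1 \<le> s * (2 * real DIM('a))" by (rule mult_left_mono[OF ge]) (use s0 in simp)
    also have "\<dots> = r" by (simp add: s_def)
    finally show ?thesis by simp
  qed
  have "f y = power_series \<beta> (\<lambda>n. c (\<beta> n)) (y - x)" if y: "norm (y - x) < s" for y
  proof -
    have "y \<in> ball x r" using y \<open>s \<le> r\<close> by (simp add: dist_norm norm_minus_commute)
    from has_sum_imp_sums[OF hs[OF this]] power_series_sums[OF rad less_imp_le[OF y]]
    show ?thesis by (rule sums_unique2)
  qed
  then show ?thesis using that[OF s0 rad] by blast
qed

text \<open>
  Differentiate the power series twice, each time giving up part of the radius. Symmetry of the second
  derivatives is visible on the level of coefficients.
\<close>

lemma real_analytic_twice_differentiable: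
  assumes "real_analytic_on f U" "x \<in> U"
  obtains \<rho> F F2 where "\<rho> > 0"
    "\<And>y. y \<in> ball x \<rho> \<Longrightarrow> (f has_derivative (\<lambda>h. \<Sum>b\<in>Basis. (h \<bullet> b) *\<^sub>R F b y)) (at y)"
    "\<And>y b. y \<in> ball x \<rho> \<Longrightarrow> b \<in> Basis \<Longrightarrow>
      (F b has_derivative (\<lambda>h. \<Sum>b'\<in>Basis. (h \<bullet> b') *\<^sub>R F2 b b' y)) (at y)"
    "\<And>b b'. F2 b b' = F2 b' b"
    "\<And>b b'. b \<in> Basis \<Longrightarrow> b' \<in> Basis \<Longrightarrow> continuous_on (ball x \<rho>) (F2 b b')"
proof -
  obtain c r where r: "r > 0" and fs: "\<And>y. y \<in> ball x r \<Longrightarrow>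
    ((\<lambda>\<alpha>. (\<Prod>b\<in>Basis. ((y - x) \<bullet> b) ^ \<alpha> b) *\<^sub>R c \<alpha>) has_sum f y) (Basis \<rightarrow>\<^sub>E (UNIV :: nat set))"
    using assms unfolding real_analytic_on_def by blast
  obtain \<rho> \<beta> d where \<rho>: "\<rho> > 0" and rad: "summable_radius \<beta> d \<rho>"
    and f: "\<And>y. norm (y - x) < \<rho> \<Longrightarrow> f y = power_series \<beta> d (y - x)"
  proof (rule has_sum_power_series_representation[OF r fs])
    fix \<rho> \<beta> d
    assume 1: "0 < \<rho>" "summable_radius \<beta> d \<rho>" and 2: "\<And>y. norm (y - x) < \<rho> \<Longrightarrow> f y = power_series \<beta> d (y - x)"
    show thesis by (rule that[OF 1 2])
  qed
  define F where "F b y = power_series (\<lambda>n. lower b (\<beta> n)) (\<lambda>n. real (\<beta> n b) *\<^sub>R d n) (y - x)" for b y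
  define F2 where "F2 b b' y = second_partial \<beta> d b b' (y - x)" for b b' y
  have shift: "(g has_derivative D) (at (y - x)) \<Longrightarrow> ((\<lambda>y. g (y - x)) has_derivative D) (at y)"
    for g :: "'a \<Rightarrow> 'b" and D y
    using has_derivative_compose[OF has_derivative_diff[OF has_derivative_ident has_derivative_const], of g D y x UNIV]
    by simp
  show ?thesis
  proof
    show "\<rho> / 4 > 0" using \<rho> by simp
    fix y assume y: "y \<in> ball x (\<rho> / 4)"
    then have ny: "norm (y - x) < \<rho> / 4" by (simp add: dist_norm norm_minus_commute)
    have "((\<lambda>y. power_series \<beta> d (y - x)) has_derivative (\<lambda>h. \<Sum>b\<in>Basis. (h \<bullet> b) *\<^sub>R F b y)) (at y)"
      unfolding F_def by (rule shift[OF has_derivative_power_series[OF rad]]) (use ny \<rho> in linarith)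
    then show "(f has_derivative (\<lambda>h. \<Sum>b\<in>Basis. (h \<bullet> b) *\<^sub>R F b y)) (at y)"
    proof (rule has_derivative_transform_within_open[OF _ open_ball y])
      fix z assume "z \<in> ball x (\<rho> / 4)"
      then have "norm (z - x) < \<rho>" using \<rho> by (simp add: dist_norm norm_minus_commute)
      then show "power_series \<beta> d (z - x) = f z" by (rule f[symmetric])
    qed
    fix b :: 'a assume b: "b \<in> Basis"
    have "summable_radius (\<lambda>n. lower b (\<beta> n)) (\<lambda>n. real (\<beta> n b) *\<^sub>R d n) (\<rho> / 2)"
      by (rule summable_radius_lower[OF rad _ _ b]) (use \<rho> in auto)
    from shift[OF has_derivative_power_series[OF this], of y]
    show "(F b has_derivative (\<lambda>h. \<Sum>b'\<in>Basis. (h \<bullet> b') *\<^sub>R F2 b b' y)) (at y)"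
      unfolding F_def[abs_def] F2_def second_partial_def using ny \<rho> by simp
  next
    show "F2 b b' = F2 b' b" for b b' unfolding F2_def[abs_def] by (simp add: second_partial_commute[of \<beta> d b b'])
    fix b b' :: 'a assume b: "b \<in> Basis" "b' \<in> Basis"
    have "summable_radius (\<lambda>n. lower b (\<beta> n)) (\<lambda>n. real (\<beta> n b) *\<^sub>R d n) (\<rho> / 2)"
      by (rule summable_radius_lower[OF rad _ _ b(1)]) (use \<rho> in auto)
    from summable_radius_lower[OF this _ _ b(2), of "\<rho> / 4"]
    have "summable_radius (\<lambda>n. lower b' (lower b (\<beta> n))) (\<lambda>n. real (lower b (\<beta> n) b') *\<^sub>R (real (\<beta> n b) *\<^sub>R d n)) (\<rho> / 4)"
      using \<rho> by simp
    note der = shift[OF has_derivative_power_series[OF this]]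
    have "isCont (F2 b b') y" if "y \<in> ball x (\<rho> / 4)" for y
    proof -
      have "norm (y - x) < \<rho> / 4" using that by (simp add: dist_norm norm_minus_commute)
      from has_derivative_continuous[OF der[OF this]]
      show ?thesis unfolding F2_def[abs_def] second_partial_def .
    qed
    then show "continuous_on (ball x (\<rho> / 4)) (F2 b b')" by (simp add: continuous_at_imp_continuous_on)
  qed
qed

section \<open>Charts around regular points\<close>

text \<open>
  The sheets represent \<open>u\<close> on \<open>V\<close>, two of them either coincide or never meet, and they are harmonic;
  \<open>F2 i b b'\<close> are the second partial derivatives.
\<close>

definition harmonic_chart where
  "harmonic_chart V Q u F F' F2 \<longleftrightarrow> C1_sheets V Q F F' \<and>
    (\<forall>y\<in>V. u y = Q_of Q (\<lambda>i. F i y)) \<and>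
    (\<forall>i<Q. \<forall>j<Q. \<forall>y\<in>V. F i y = F j y \<longrightarrow> (\<forall>z\<in>V. F i z = F j z)) \<and>
    (\<forall>i<Q. \<forall>b\<in>Basis. \<forall>y\<in>V. (F' i b has_derivative (\<lambda>h. \<Sum>b'\<in>Basis. (h \<bullet> b') *\<^sub>R F2 i b b' y)) (at y)) \<and>
    (\<forall>i<Q. \<forall>b b'. F2 i b b' = F2 i b' b) \<and>
    (\<forall>i<Q. \<forall>y\<in>V. (\<Sum>b\<in>Basis. F2 i b b y) = 0)"

text \<open>
  Shrink the neighbourhood from the definition of regularity to a ball with compact closure in the
  common domain of all power series, which makes the first and second derivatives bounded, and apply the first
  variation to each sheet.
\<close>

lemma minimizer_has_harmonic_chart:
  fixes u :: "'a::euclidean_space \<Rightarrow> 'b::euclidean_space multiset"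
  assumes \<Omega>: "open \<Omega>" "bounded \<Omega>" and S: "sets S = sets borel" "AE x in S. x \<notin> \<Omega>"
    and min: "Dir_minimizing \<Omega> S Q u" and cont: "continuous_map (top_of_set \<Omega>) (Q_topology Q) u"
    and reg: "Q_regular_at \<Omega> Q u x"
  shows "\<exists>V F F' F2. x \<in> V \<and> V \<subseteq> \<Omega> \<and> harmonic_chart V Q u F F' F2"
proof -
  from reg obtain U F where U: "open U" "x \<in> U" "U \<subseteq> \<Omega>"
    and an: "\<forall>i<Q. real_analytic_on (F i) U"
    and rep: "\<forall>y\<in>U. u y = image_mset (\<lambda>i. F i y) (mset_set {..<Q})"
    and dich: "\<forall>i<Q. \<forall>j<Q. (\<forall>y\<in>U. F i y \<noteq> F j y) \<or> (\<forall>y\<in>U. F i y = F j y)"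
    unfolding Q_regular_at_def by blast
  define good where "good i \<rho> f' f2 \<longleftrightarrow> \<rho> > 0 \<and>
      (\<forall>y\<in>ball x \<rho>. (F i has_derivative (\<lambda>h. \<Sum>b\<in>Basis. (h \<bullet> b) *\<^sub>R f' b y)) (at y)) \<and>
      (\<forall>y\<in>ball x \<rho>. \<forall>b\<in>Basis. (f' b has_derivative (\<lambda>h. \<Sum>b'\<in>Basis. (h \<bullet> b') *\<^sub>R f2 b b' y)) (at y)) \<and>
      (\<forall>b b'. f2 b b' = f2 b' b) \<and>
      (\<forall>b\<in>Basis. \<forall>b'\<in>Basis. continuous_on (ball x \<rho>) (f2 b b'))" for i \<rho> f' f2
  have "\<exists>t. good i (fst t) (fst (snd t)) (snd (snd t))" if i: "i < Q" for i
  proof (rule real_analytic_twice_differentiable[OF an[rule_format, OF i] U(2)])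
    fix \<rho> f' f2
    assume 1: "\<rho> > 0"
      "\<And>y. y \<in> ball x \<rho> \<Longrightarrow> (F i has_derivative (\<lambda>h. \<Sum>b\<in>Basis. (h \<bullet> b) *\<^sub>R f' b y)) (at y)"
      "\<And>y b. y \<in> ball x \<rho> \<Longrightarrow> b \<in> Basis \<Longrightarrow>
        (f' b has_derivative (\<lambda>h. \<Sum>b'\<in>Basis. (h \<bullet> b') *\<^sub>R f2 b b' y)) (at y)"
      "\<And>b b'. f2 b b' = f2 b' b"
      "\<And>b b'. b \<in> Basis \<Longrightarrow> b' \<in> Basis \<Longrightarrow> continuous_on (ball x \<rho>) (f2 b b')"
    have "good i \<rho> f' f2" unfolding good_def
    proof (intro conjI ballI allI)
      show "f2 b b' = f2 b' b" for b b' by (rule 1(4))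
    qed (use 1(1,2,3,5) in simp_all)
    then show ?thesis by (intro exI[of _ "(\<rho>, f', f2)"]) simp
  qed
  then have "\<forall>i\<in>{..<Q}. \<exists>t. good i (fst t) (fst (snd t)) (snd (snd t))" by simp
  from bchoice[OF this] obtain t where t: "\<forall>i\<in>{..<Q}. good i (fst (t i)) (fst (snd (t i))) (snd (snd (t i)))" ..
  define \<rho> where "\<rho> i = fst (t i)" for i
  define F' where "F' i = fst (snd (t i))" for i
  define F2 where "F2 i = snd (snd (t i))" for i
  have g: "good i (\<rho> i) (F' i) (F2 i)" if "i < Q" for i
    using t that by (simp add: \<rho>_def F'_def F2_def)
  obtain r0 where r0: "r0 > 0" "ball x r0 \<subseteq> U" using U openE by blast
  define r where "r = Min (insert r0 (\<rho> ` {..<Q})) / 2"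
  have r: "r > 0" "r < r0" "\<And>i. i < Q \<Longrightarrow> r < \<rho> i"
  proof -
    have m0: "0 < Min (insert r0 (\<rho> ` {..<Q}))"
      using r0(1) g by (subst Min_gr_iff) (auto simp: good_def)
    then show "r > 0" unfolding r_def by linarith
    have "Min (insert r0 (\<rho> ` {..<Q})) \<le> r0" by (rule Min_le) auto
    then show "r < r0" using m0 unfolding r_def by linarith
    show "r < \<rho> i" if "i < Q" for i
    proof -
      have "Min (insert r0 (\<rho> ` {..<Q})) \<le> \<rho> i" by (rule Min_le) (use that in auto)
      then show ?thesis using m0 unfolding r_def by linarith
    qed
  qed
  define V where "V = ball x r"
  have VU: "V \<subseteq> U" using r(2) r0(2) by (auto simp: V_def)
  have V\<rho>: "cball x r \<subseteq> ball x (\<rho> i)" if "i < Q" for i using r(3)[OF that] by auto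
  have Vc: "V \<subseteq> cball x r" by (auto simp: V_def)
  have F'_der: "(F' i b has_derivative (\<lambda>h. \<Sum>b'\<in>Basis. (h \<bullet> b') *\<^sub>R F2 i b b' y)) (at y)"
    if "i < Q" "b \<in> Basis" "y \<in> cball x r" for i b y
    using g[OF that(1)] V\<rho>[OF that(1)] that(2,3) unfolding good_def by blast
  have F'_cont: "continuous_on (cball x r) (F' i b)" if "i < Q" "b \<in> Basis" for i b
    by (rule continuous_at_imp_continuous_on) (use has_derivative_continuous[OF F'_der[OF that]] in blast)
  have F2_cont: "continuous_on (cball x r) (F2 i b b')" if "i < Q" "b \<in> Basis" "b' \<in> Basis" for i b b'
  proof -
    have "continuous_on (ball x (\<rho> i)) (F2 i b b')" using g[OF that(1)] that unfolding good_def by blast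
    then show ?thesis using V\<rho>[OF that(1)] by (rule continuous_on_subset)
  qed
  have "bounded (\<Union>i\<in>{..<Q}. \<Union>b\<in>Basis. F' i b ` cball x r)"
    by (intro bounded_UN finite_lessThan finite_Basis ballI compact_imp_bounded compact_continuous_image F'_cont compact_cball) auto
  then obtain C1 where C1: "\<forall>y\<in>(\<Union>i\<in>{..<Q}. \<Union>b\<in>Basis. F' i b ` cball x r). norm y \<le> C1" unfolding bounded_iff ..
  have "bounded (\<Union>i\<in>{..<Q}. \<Union>b\<in>Basis. \<Union>b'\<in>Basis. F2 i b b' ` cball x r)"
    by (intro bounded_UN finite_lessThan finite_Basis ballI compact_imp_bounded compact_continuous_image F2_cont compact_cball) auto
  then obtain C2 where C2: "\<forall>y\<in>(\<Union>i\<in>{..<Q}. \<Union>b\<in>Basis. \<Union>b'\<in>Basis. F2 i b b' ` cball x r). norm y \<le> C2" unfolding bounded_iff ..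
  define C where "C = max C1 C2"
  have bd1: "norm (F' i b y) \<le> C" if "i < Q" "b \<in> Basis" "y \<in> V" for i b y
  proof -
    have "F' i b y \<in> (\<Union>i\<in>{..<Q}. \<Union>b\<in>Basis. F' i b ` cball x r)" using that Vc by blast
    from bspec[OF C1 this] show ?thesis by (simp add: C_def)
  qed
  have bd2: "norm (F2 i b b' y) \<le> C" if "i < Q" "b \<in> Basis" "b' \<in> Basis" "y \<in> V" for i b b' y
  proof -
    have "F2 i b b' y \<in> (\<Union>i\<in>{..<Q}. \<Union>b\<in>Basis. \<Union>b'\<in>Basis. F2 i b b' ` cball x r)" using that Vc by blast
    from bspec[OF C2 this] show ?thesis by (simp add: C_def)
  qed
  have oV: "open V" "convex V" "bounded V" by (simp_all add: V_def)
  have sh: "C1_sheets V Q F F'"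
    unfolding C1_sheets_def
  proof (intro conjI allI impI ballI oV)
    show "(F i has_derivative (\<lambda>h. \<Sum>b\<in>Basis. (h \<bullet> b) *\<^sub>R F' i b y)) (at y)" if "i < Q" "y \<in> V" for i y
      using g[OF that(1)] V\<rho>[OF that(1)] Vc that(2) unfolding good_def by blast
    show "continuous_on V (F' i b)" if "i < Q" "b \<in> Basis" for i b
      by (rule continuous_on_subset[OF F'_cont[OF that] Vc])
    show "\<exists>C. \<forall>i<Q. \<forall>b\<in>Basis. \<forall>y\<in>V. norm (F' i b y) \<le> C" using bd1 by blast
  qed
  have repV: "\<forall>y\<in>V. u y = Q_of Q (\<lambda>i. F i y)" using rep VU by (auto simp: Q_of_def)
  have sep: "\<forall>i<Q. \<forall>j<Q. \<forall>y\<in>V. F i y = F j y \<longrightarrow> (\<forall>z\<in>V. F i z = F j z)"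
    using dich VU by blast
  have V\<Omega>: "V \<subseteq> \<Omega>" using VU U(3) by blast
  have lap: "(\<Sum>b\<in>Basis. F2 i b b y) = 0" if i: "i < Q" and y: "y \<in> V" for i y
  proof (rule euclidean_eqI)
    fix e :: 'b assume "e \<in> Basis"
    have 1: "\<forall>b\<in>Basis. \<forall>y\<in>V. (F' i b has_derivative (\<lambda>h. \<Sum>b'\<in>Basis. (h \<bullet> b') *\<^sub>R F2 i b b' y)) (at y)"
      using F'_der[OF i] Vc by blast
    have 2: "\<forall>b\<in>Basis. \<forall>b'\<in>Basis. continuous_on V (F2 i b b')"
      using continuous_on_subset[OF F2_cont[OF i] Vc] by blast
    have 3: "\<forall>b\<in>Basis. \<forall>b'\<in>Basis. \<forall>y\<in>V. norm (F2 i b b' y) \<le> C" using bd2[OF i] by blast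
    have 4: "\<forall>b\<in>Basis. \<forall>y\<in>V. norm (F' i b y) \<le> C" using bd1[OF i] by blast
    have 5: "(\<Sum>b\<in>Basis. LINT x|lebesgue_on V. (F' i b x \<bullet> e) * frechet_derivative \<zeta> (at x) b) = 0"
      if "\<zeta> \<in> test_functions V" for \<zeta>
      by (rule minimizer_sheet_weakly_harmonic[OF \<Omega> S min cont V\<Omega> sh repV sep i that])
    have "(\<Sum>b\<in>Basis. F2 i b b y) \<bullet> e = 0"
      by (rule weakly_harmonic_laplacian[OF oV 1 2 3 4 5 y])
    then show "(\<Sum>b\<in>Basis. F2 i b b y) \<bullet> e = 0 \<bullet> e" by simp
  qed
  have sym: "F2 i b b' = F2 i b' b" if "i < Q" for i b b'
    using g[OF that] unfolding good_def by blast
  have "harmonic_chart V Q u F F' F2"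
    unfolding harmonic_chart_def
  proof (intro conjI sh repV sep allI impI ballI)
    show "(F' i b has_derivative (\<lambda>h. \<Sum>b'\<in>Basis. (h \<bullet> b') *\<^sub>R F2 i b b' y)) (at y)"
      if "i < Q" "b \<in> Basis" "y \<in> V" for i b y using F'_der[OF that(1,2)] Vc that(3) by blast
  qed (simp_all add: sym lap)
  moreover have "x \<in> V" using r(1) by (simp add: V_def)
  ultimately show ?thesis using V\<Omega> by blast
qed

lemma harmonic_chartD:
  assumes "harmonic_chart V Q u F F' F2"
  shows "C1_sheets V Q F F'" "\<forall>y\<in>V. u y = Q_of Q (\<lambda>i. F i y)"
    "\<forall>i<Q. \<forall>j<Q. \<forall>y\<in>V. F i y = F j y \<longrightarrow> (\<forall>z\<in>V. F i z = F j z)"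
    "i < Q \<Longrightarrow> b \<in> Basis \<Longrightarrow> y \<in> V \<Longrightarrow> (F' i b has_derivative (\<lambda>h. \<Sum>b'\<in>Basis. (h \<bullet> b') *\<^sub>R F2 i b b' y)) (at y)"
    "i < Q \<Longrightarrow> F2 i b b' = F2 i b' b"
    "i < Q \<Longrightarrow> y \<in> V \<Longrightarrow> (\<Sum>b\<in>Basis. F2 i b b y) = 0"
proof -
  note * = assms[unfolded harmonic_chart_def]
  show "C1_sheets V Q F F'" using * by (rule conjunct1)
  note * = *[THEN conjunct2]
  show "\<forall>y\<in>V. u y = Q_of Q (\<lambda>i. F i y)" using * by (rule conjunct1)
  note * = *[THEN conjunct2]
  show "\<forall>i<Q. \<forall>j<Q. \<forall>y\<in>V. F i y = F j y \<longrightarrow> (\<forall>z\<in>V. F i z = F j z)" using * by (rule conjunct1)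
  note * = *[THEN conjunct2]
  show "(F' i b has_derivative (\<lambda>h. \<Sum>b'\<in>Basis. (h \<bullet> b') *\<^sub>R F2 i b b' y)) (at y)"
    if "i < Q" "b \<in> Basis" "y \<in> V" by (rule conjunct1[OF *, rule_format, OF that])
  note * = *[THEN conjunct2]
  show "F2 i b b' = F2 i b' b" if "i < Q" by (rule conjunct1[OF *, rule_format, OF that])
  show "(\<Sum>b\<in>Basis. F2 i b b y) = 0" if "i < Q" "y \<in> V" by (rule conjunct2[OF *, rule_format, OF that])
qed

lemma harmonic_chart_subset:
  assumes ch: "harmonic_chart V Q u F F' F2" and W: "open W" "convex W" "W \<subseteq> V"
  shows "harmonic_chart W Q u F F' F2"
  unfolding harmonic_chart_def
proof (intro conjI allI impI ballI)
  show "C1_sheets W Q F F'" by (rule C1_sheets_subset[OF harmonic_chartD(1)[OF ch] W])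
  show "u y = Q_of Q (\<lambda>i. F i y)" if "y \<in> W" for y
    using harmonic_chartD(2)[OF ch] subsetD[OF W(3) that] by (rule bspec)
  show "F i z = F j z" if "i < Q" "j < Q" "y \<in> W" "F i y = F j y" "z \<in> W" for i j y z
    by (rule harmonic_chartD(3)[OF ch, rule_format, OF that(1,2) subsetD[OF W(3) that(3)] that(4) subsetD[OF W(3) that(5)]])
  show "(F' i b has_derivative (\<lambda>h. \<Sum>b'\<in>Basis. (h \<bullet> b') *\<^sub>R F2 i b b' y)) (at y)"
    if "i < Q" "b \<in> Basis" "y \<in> W" for i b y
    by (rule harmonic_chartD(4)[OF ch that(1,2) subsetD[OF W(3) that(3)]])
  show "F2 i b b' = F2 i b' b" if "i < Q" for i b b' by (rule harmonic_chartD(5)[OF ch that])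
  show "(\<Sum>b\<in>Basis. F2 i b b y) = 0" if "i < Q" "y \<in> W" for i y
    by (rule harmonic_chartD(6)[OF ch that(1) subsetD[OF W(3) that(2)]])
qed

lemma in_Q_of: "P \<in># Q_of Q F \<longleftrightarrow> (\<exists>i<Q. P = F i)"
  by (auto simp: Q_of_def)

text \<open>
  Sheets with different values at \<open>z\<close> stay away from a continuous selection near \<open>z\<close>, and sheets with the
  same value at \<open>z\<close> coincide.
\<close>

lemma selection_agrees_with_sheet:
  assumes ch: "harmonic_chart V Q u F F' F2" and z: "z \<in> V" and j: "j < Q"
    and sel: "\<forall>\<^sub>F y in nhds z. f y \<in># u y" and f: "isCont f z" "f z = F j z"
  shows "\<forall>\<^sub>F y in nhds z. f y = F j y"
proof -
  note sh = harmonic_chartD(1)[OF ch]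
  have inV: "\<forall>\<^sub>F y in nhds z. y \<in> V" using C1_sheetsD(1)[OF sh] z by (rule eventually_nhds_in_open)
  have "\<forall>\<^sub>F y in nhds z. \<forall>k\<in>{..<Q}. F k z \<noteq> F j z \<longrightarrow> f y \<noteq> F k y"
  proof (rule eventually_ball_finite[OF finite_lessThan], rule ballI)
    fix k assume k: "k \<in> {..<Q}"
    show "\<forall>\<^sub>F y in nhds z. F k z \<noteq> F j z \<longrightarrow> f y \<noteq> F k y"
    proof (cases "F k z = F j z")
      case False
      have "isCont (F k) z" using k by (intro has_derivative_continuous[OF C1_sheetsD(4)[OF sh _ z]]) simp
      then have "isCont (\<lambda>y. f y - F k y) z" by (intro continuous_diff f(1))
      then have "((\<lambda>y. f y - F k y) \<longlongrightarrow> f z - F k z) (nhds z)"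
        by (simp add: continuous_at tendsto_nhds_iff)
      moreover have "f z - F k z \<noteq> 0" using False f(2) by simp
      ultimately have "\<forall>\<^sub>F y in nhds z. f y - F k y \<noteq> 0" by (rule tendsto_imp_eventually_ne)
      then show ?thesis by eventually_elim simp
    qed simp
  qed
  with sel inV show ?thesis
  proof eventually_elim
    case (elim y)
    have "f y \<in># Q_of Q (\<lambda>i. F i y)" using elim(1,2) harmonic_chartD(2)[OF ch] by simp
    then obtain k where k: "k < Q" "f y = F k y" by (auto simp: in_Q_of)
    then have "F k z = F j z" using elim(3) by blast
    then have "F k y = F j y"
      using harmonic_chartD(3)[OF ch, rule_format, OF k(1) j z _ elim(2)] by simp
    then show ?case using k by simp
  qed
qed

text \<open>
  The derivative of the sheet through the value \<open>P\<close> over \<open>z\<close>. It is defined without reference to a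
  chart, because the continuation of a sheet passes through many charts.
\<close>

definition sheet_deriv where
  "sheet_deriv u z P = (SOME D. \<exists>f. (\<forall>\<^sub>F y in nhds z. f y \<in># u y) \<and> f z = P \<and> (f has_derivative D) (at z))"

lemma sheet_deriv_selection:
  fixes u :: "'a::euclidean_space \<Rightarrow> 'b::euclidean_space multiset"
  assumes ch: "harmonic_chart V Q u F F' F2" and z: "z \<in> V" and i: "i < Q"
  shows "sheet_deriv u z (F i z) = (\<lambda>h. \<Sum>b\<in>Basis. (h \<bullet> b) *\<^sub>R F' i b z)"
    and "(F i has_derivative sheet_deriv u z (F i z)) (at z)"
proof -
  note sh = harmonic_chartD(1)[OF ch]
  have inV: "\<forall>\<^sub>F y in nhds z. y \<in> V" using C1_sheetsD(1)[OF sh] z by (rule eventually_nhds_in_open)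
  have sel: "\<forall>\<^sub>F y in nhds z. F i y \<in># u y"
    using inV by eventually_elim (use harmonic_chartD(2)[OF ch] i in \<open>auto simp: in_Q_of\<close>)
  note der = C1_sheetsD(4)[OF sh i z]
  have "\<exists>D f. (\<forall>\<^sub>F y in nhds z. f y \<in># u y) \<and> f z = F i z \<and> (f has_derivative D) (at z)"
    by (intro exI conjI) (rule sel, rule refl, rule der)
  from someI_ex[OF this] have "\<exists>f. (\<forall>\<^sub>F y in nhds z. f y \<in># u y) \<and> f z = F i z \<and>
      (f has_derivative sheet_deriv u z (F i z)) (at z)" unfolding sheet_deriv_def .
  then obtain f where f: "\<forall>\<^sub>F y in nhds z. f y \<in># u y" "f z = F i z"
    "(f has_derivative sheet_deriv u z (F i z)) (at z)" by (elim exE conjE)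
  have "\<forall>\<^sub>F y in nhds z. f y = F i y"
    by (rule selection_agrees_with_sheet[OF ch z i f(1) has_derivative_continuous[OF f(3)] f(2)])
  then obtain W where W: "open W" "z \<in> W" "\<forall>y\<in>W. f y = F i y" unfolding eventually_nhds by (elim exE conjE)
  have "(F i has_derivative sheet_deriv u z (F i z)) (at z)"
    by (rule has_derivative_transform_within_open[OF f(3) W(1,2)]) (use W(3) in blast)
  from has_derivative_unique[OF this der] show "sheet_deriv u z (F i z) = (\<lambda>h. \<Sum>b\<in>Basis. (h \<bullet> b) *\<^sub>R F' i b z)" .
  then show "(F i has_derivative sheet_deriv u z (F i z)) (at z)" using der by simp
qed

section \<open>Continuous sheets over disks\<close>

text \<open>
  Over a chart, the set of pairs \<open>(z, P)\<close> with \<open>P\<close> a value of \<open>u\<close> at \<open>z\<close> is the disjoint union of the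
  graphs of the distinct sheets. Multiplicities are forgotten here.
\<close>

lemma sheets_covering_space:
  fixes u :: "'a::euclidean_space \<Rightarrow> 'b::euclidean_space multiset"
  assumes Q: "Q \<ge> 1" and G: "open G" and ch: "\<And>x. x \<in> G \<Longrightarrow> \<exists>V F F' F2. x \<in> V \<and> V \<subseteq> G \<and> harmonic_chart V Q u F F' F2"
  shows "covering_space {(z, P). z \<in> G \<and> P \<in># u z} fst G"
  unfolding covering_space_def
proof (intro conjI ballI)
  let ?X = "{(z, P). z \<in> G \<and> P \<in># u z}"
  show "continuous_on ?X fst" by (intro continuous_intros)
  show "fst ` ?X = G"
  proof
    show "G \<subseteq> fst ` ?X"
    proof
      fix z assume z: "z \<in> G"
      from ch[OF z] obtain V F F' F2 where V: "z \<in> V" "harmonic_chart V Q u F F' F2" by blast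
      have "F 0 z \<in># u z" using harmonic_chartD(2)[OF V(2)] V(1) Q by (auto simp: in_Q_of intro!: exI[of _ 0])
      then show "z \<in> fst ` ?X" using z by (intro image_eqI[of _ _ "(z, F 0 z)"]) auto
    qed
  qed auto
  fix x assume x: "x \<in> G"
  from ch[OF x] obtain V F F' F2 where V: "x \<in> V" "V \<subseteq> G" and c: "harmonic_chart V Q u F F' F2" by blast
  note sh = harmonic_chartD(1)[OF c]
  note oV = C1_sheetsD(1)[OF sh]
  have same: "F i z = F j z" if "i < Q" "j < Q" "y \<in> V" "F i y = F j y" "z \<in> V" for i j y z
    by (rule harmonic_chartD(3)[OF c, rule_format, OF that(1,2) that(3,4,5)])
  define gr where "gr i = {(z, P). z \<in> V \<and> P = F i z}" for i
  have uV: "P \<in># u z \<longleftrightarrow> (\<exists>i<Q. P = F i z)" if "z \<in> V" for z P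
    using harmonic_chartD(2)[OF c] that by (simp add: in_Q_of)
  have "openin (top_of_set G) V" using oV V(2) by (simp add: openin_open_eq[OF G])
  moreover have "\<Union>(gr ` {..<Q}) = ?X \<inter> fst -` V" using uV V(2) by (auto simp: gr_def)
  moreover have "openin (top_of_set ?X) (gr i)" if i: "i < Q" for i
  proof -
    define J where "J = {j. j < Q \<and> F j x \<noteq> F i x}"
    \<comment> \<open>The graph of sheet \<open>i\<close> is cut out of the total space by avoiding the finitely many other sheets.\<close>
    define W where "W = (V \<times> UNIV) \<inter> (\<Inter>j\<in>J. (V \<times> UNIV) \<inter> (\<lambda>zP. snd zP - F j (fst zP)) -` (- {0}))"
    have "open W" unfolding W_def
    proof (rule open_Int[OF open_Times[OF oV open_UNIV] open_INT], simp add: J_def, rule ballI)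
      fix j assume j: "j \<in> J"
      have "continuous_on (V \<times> (UNIV :: 'b set)) (\<lambda>zP. snd zP - F j (fst zP))"
        by (intro continuous_intros continuous_on_compose2[OF C1_sheetsD(6)[OF sh]]) (use j in \<open>auto simp: J_def\<close>)
      then show "open (V \<times> (UNIV :: 'b set) \<inter> (\<lambda>zP. snd zP - F j (fst zP)) -` (- {0}))"
        by (rule continuous_open_preimage) (auto intro: open_Times oV)
    qed
    have W_iff: "zP \<in> W \<longleftrightarrow> fst zP \<in> V \<and> (\<forall>j\<in>J. snd zP \<noteq> F j (fst zP))" for zP
      unfolding W_def Int_iff INT_iff vimage_eq mem_Times_iff by auto
    have "gr i = ?X \<inter> W"
    proof (intro equalityI subsetI)
      fix zP assume "zP \<in> gr i"
      then obtain z where z: "z \<in> V" "zP = (z, F i z)" by (auto simp: gr_def)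
      have "F i z \<noteq> F j z" if "j \<in> J" for j
        using same[of i j z x] that z(1) V(1) i by (auto simp: J_def)
      then show "zP \<in> ?X \<inter> W" using z V(2) uV[OF z(1)] i by (auto simp: W_iff)
    next
      fix zP assume zP: "zP \<in> ?X \<inter> W"
      then obtain z P where z: "zP = (z, P)" "z \<in> V" "P \<in># u z" "\<forall>j\<in>J. P \<noteq> F j z" by (auto simp: W_iff)
      then obtain k where k: "k < Q" "P = F k z" using uV by blast
      then have "F k x = F i x" using z(4) by (auto simp: J_def)
      then have "F k z = F i z" using same[OF k(1) i V(1) _ z(2)] by blast
      then show "zP \<in> gr i" using z k by (simp add: gr_def)
    qed
    with \<open>open W\<close> show ?thesis by (simp add: openin_open_Int)
  qed
  moreover have "pairwise disjnt (gr ` {..<Q})"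
  proof (rule pairwiseI)
    fix A B assume AB: "A \<in> gr ` {..<Q}" "B \<in> gr ` {..<Q}" "A \<noteq> B"
    then obtain i j where ij: "i < Q" "j < Q" "A = gr i" "B = gr j" by auto
    show "disjnt A B"
    proof (rule ccontr)
      assume "\<not> disjnt A B"
      then obtain z where z: "z \<in> V" "F i z = F j z" unfolding ij disjnt_def gr_def by auto
      have "F i y = F j y" if "y \<in> V" for y by (rule same[OF ij(1,2) z that])
      then have "gr i = gr j" by (auto simp: gr_def)
      then show False using AB(3) ij by simp
    qed
  qed
  moreover have "\<exists>q. homeomorphism (gr i) V fst q" if i: "i < Q" for i
  proof -
    have "homeomorphism (gr i) V fst (\<lambda>z. (z, F i z))"
    proof (rule homeomorphismI)
      show "continuous_on (gr i) fst" by (intro continuous_intros)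
      show "continuous_on V (\<lambda>z. (z, F i z))" by (intro continuous_intros C1_sheetsD(6)[OF sh i])
    qed (auto simp: gr_def)
    then show ?thesis by (rule exI[of "homeomorphism (gr i) V fst"])
  qed
  ultimately show "\<exists>T. x \<in> T \<and> openin (top_of_set G) T \<and> (\<exists>v. \<Union>v = ?X \<inter> fst -` T \<and>
      (\<forall>u\<in>v. openin (top_of_set ?X) u) \<and> pairwise disjnt v \<and> (\<forall>u\<in>v. \<exists>q. homeomorphism u T fst q))"
    using V(1) by (intro exI[of _ V] conjI exI[of _ "gr ` {..<Q}"]) auto
qed

text \<open>
  A disk is simply connected, so the inclusion of the disk lifts to the covering. Hence every value
  over the centre extends to a differentiable single-valued sheet over the whole disk.
\<close>

lemma sheet_lift:
  fixes u :: "'a::euclidean_space \<Rightarrow> 'b::euclidean_space multiset"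
  assumes Q: "Q \<ge> 1" and G: "open G" and ch: "\<And>x. x \<in> G \<Longrightarrow> \<exists>V F F' F2. x \<in> V \<and> V \<subseteq> G \<and> harmonic_chart V Q u F F' F2"
    and D: "ball z0 r \<subseteq> G" "r > 0" and P: "P \<in># u z0"
  obtains f where "f z0 = P" "\<And>y. y \<in> ball z0 r \<Longrightarrow> f y \<in># u y"
    "\<And>y. y \<in> ball z0 r \<Longrightarrow> (f has_derivative sheet_deriv u y (f y)) (at y)"
proof -
  let ?X = "{(z, P). z \<in> G \<and> P \<in># u z}" and ?D = "ball z0 r"
  note cov = sheets_covering_space[OF Q G ch]
  have z0: "z0 \<in> ?D" using D(2) by simp
  have 1: "(z0, P) \<in> ?X" using P D z0 by auto
  have 2: "simply_connected ?D" by (intro convex_imp_simply_connected convex_ball)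
  have 3: "locally path_connected ?D" by (intro open_imp_locally_path_connected open_ball)
  have 4: "(\<lambda>z. z) \<in> ?D \<rightarrow> G" using D(1) by auto
  have 5: "z0 = fst (z0, P)" by simp
  obtain g where g: "continuous_on ?D g" "g \<in> ?D \<rightarrow> ?X" "g z0 = (z0, P)" "\<And>y. y \<in> ?D \<Longrightarrow> fst (g y) = y"
  proof (rule covering_space_lift_strong[OF cov 1 z0 2 3 continuous_on_id 4 5])
    fix g assume *: "continuous_on ?D g" "g \<in> ?D \<rightarrow> ?X" "g z0 = (z0, P)" "\<And>y. y \<in> ?D \<Longrightarrow> fst (g y) = y"
    show thesis by (rule that[OF *])
  qed
  define f where "f y = snd (g y)" for y
  have f_in: "f y \<in># u y" if "y \<in> ?D" for y
    using g(2) g(4)[OF that] that by (force simp: f_def Pi_iff split_beta)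
  have fc: "continuous_on ?D f" unfolding f_def[abs_def] by (intro continuous_intros g(1))
  have "(f has_derivative sheet_deriv u y (f y)) (at y)" if y: "y \<in> ?D" for y
  proof -
    have yG: "y \<in> G" using y D(1) by blast
    from ch[OF yG] obtain V F F' F2 where V: "y \<in> V" and c: "harmonic_chart V Q u F F' F2" by blast
    have "f y \<in># Q_of Q (\<lambda>i. F i y)" using f_in[OF y] harmonic_chartD(2)[OF c] V by simp
    then obtain i where i: "i < Q" "f y = F i y" by (auto simp: in_Q_of)
    have "\<forall>\<^sub>F w in nhds y. w \<in> ?D" by (rule eventually_nhds_in_open[OF open_ball y])
    then have sel: "\<forall>\<^sub>F w in nhds y. f w \<in># u w" by eventually_elim (rule f_in)
    have "isCont f y" using fc y by (simp add: continuous_on_eq_continuous_at)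
    from selection_agrees_with_sheet[OF c V i(1) sel this i(2)]
    obtain W where W: "open W" "y \<in> W" "\<forall>w\<in>W. f w = F i w" unfolding eventually_nhds by (elim exE conjE)
    have "(f has_derivative sheet_deriv u y (F i y)) (at y)"
      by (rule has_derivative_transform_within_open[OF sheet_deriv_selection(2)[OF c V i(1)] W(1,2)]) (use W(3) in simp)
    then show ?thesis using i(2) by simp
  qed
  then show ?thesis using that[of f] f_in g(3) by (simp add: f_def)
qed

section \<open>The plane as the complex line\<close>

definition to_plane :: "complex \<Rightarrow> real^2" where
  "to_plane z = vector [Re z, Im z]"

definition e1 :: "real^2" where "e1 = axis 1 1"
definition e2 :: "real^2" where "e2 = axis 2 1"

lemma Basis_plane: "Basis = {e1, e2}" "e1 \<noteq> e2"
proof -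
  show "Basis = {e1, e2}" by (auto simp: Basis_vec_def e1_def e2_def UNIV_2)
  show "e1 \<noteq> e2" by (simp add: e1_def e2_def axis_eq_axis)
qed

lemma e_Basis: "e1 \<in> Basis" "e2 \<in> Basis"
  unfolding Basis_plane(1) by simp_all

lemma sum_Basis_plane: "(\<Sum>b\<in>Basis. f b) = f e1 + f e2"
  unfolding Basis_plane(1) using Basis_plane(2) by simp

lemma inner_to_plane: "to_plane z \<bullet> e1 = Re z" "to_plane z \<bullet> e2 = Im z"
  by (simp_all add: to_plane_def e1_def e2_def inner_axis vector_2)

lemma bounded_linear_to_plane: "bounded_linear to_plane"
  unfolding linear_conv_bounded_linear[symmetric]
  by (rule linearI) (simp_all add: to_plane_def vec_eq_iff forall_2 vector_2)

lemma norm_to_plane: "norm (to_plane z) = norm z"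
  by (simp add: norm_eq_sqrt_inner inner_vec_def sum_2 to_plane_def vector_2 inner_complex_def)

lemma dist_to_plane: "dist (to_plane z) (to_plane w) = dist z w"
proof -
  interpret bounded_linear to_plane by (rule bounded_linear_to_plane)
  show ?thesis unfolding dist_norm diff[symmetric] norm_to_plane ..
qed

lemma to_plane_surj: "\<exists>z. to_plane z = x"
  by (rule exI[of _ "Complex (x $ 1) (x $ 2)"]) (simp add: to_plane_def vec_eq_iff forall_2 vector_2)

lemma to_plane_eq_0: "to_plane z = 0 \<longleftrightarrow> z = 0"
  by (metis norm_eq_zero norm_to_plane)

lemma has_derivative_to_plane: "(to_plane has_derivative to_plane) (at z within S)"
  by (rule bounded_linear.has_derivative[OF bounded_linear_to_plane has_derivative_ident])

lemma has_derivative_Complex_pair: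
  assumes "(f has_derivative f') (at z)" "(g has_derivative g') (at z)"
  shows "((\<lambda>z. Complex (f z) (g z)) has_derivative (\<lambda>h. Complex (f' h) (g' h))) (at z)"
proof -
  have "((\<lambda>z. complex_of_real (f z) + \<i> * complex_of_real (g z)) has_derivative
      (\<lambda>h. complex_of_real (f' h) + \<i> * complex_of_real (g' h))) (at z)"
    by (intro has_derivative_add has_derivative_mult_right has_derivative_of_real assms)
  then show ?thesis by (simp add: Complex_eq)
qed

text \<open>
  For \<open>D\<close> the derivative of a map into the target, this is twice the Wirtinger derivative of its
  component in direction \<open>e\<close>. For a harmonic map it is a holomorphic function of the base point.
\<close>

definition complex_gradient :: "(real^2 \<Rightarrow> 'b::real_inner) \<Rightarrow> 'b \<Rightarrow> complex" where
  "complex_gradient D e = Complex (D e1 \<bullet> e) (- (D e2 \<bullet> e))"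

lemma complex_gradient_pair:
  assumes "linear D"
  shows "Re (complex_gradient D e * h) = D (to_plane h) \<bullet> e"
proof -
  have "to_plane h = Re h *\<^sub>R e1 + Im h *\<^sub>R e2"
    using euclidean_representation[of "to_plane h"] by (simp add: sum_Basis_plane inner_to_plane)
  then have "D (to_plane h) = Re h *\<^sub>R D e1 + Im h *\<^sub>R D e2"
    by (simp add: linear_add[OF assms] linear_scale[OF assms])
  then show ?thesis by (simp add: complex_gradient_def inner_add_left)
qed

lemma complex_gradient_sheet:
  "complex_gradient (\<lambda>h. \<Sum>b\<in>Basis. (h \<bullet> b) *\<^sub>R F' b) e = Complex (F' e1 \<bullet> e) (- (F' e2 \<bullet> e))"
  unfolding complex_gradient_def
  using Basis_derivative_apply[OF e_Basis(1), of F'] Basis_derivative_apply[OF e_Basis(2), of F'] by simp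

text \<open>
  The Laplace equation and the symmetry of second derivatives are the Cauchy-Riemann equations of the
  complex gradient.
\<close>

lemma sheet_gradient_holomorphic:
  fixes F :: "nat \<Rightarrow> real^2 \<Rightarrow> 'b::euclidean_space"
  assumes ch: "harmonic_chart V Q u F F' F2" and i: "i < Q" and z: "to_plane z \<in> V"
  shows "((\<lambda>z. Complex (F' i e1 (to_plane z) \<bullet> e) (- (F' i e2 (to_plane z) \<bullet> e))) has_field_derivative
    Complex (F2 i e1 e1 (to_plane z) \<bullet> e) (- (F2 i e1 e2 (to_plane z) \<bullet> e))) (at z)"
proof -
  let ?y = "to_plane z"
  define r where "r = F2 i e1 e1 ?y \<bullet> e"
  define s where "s = F2 i e1 e2 ?y \<bullet> e"
  have s': "F2 i e2 e1 ?y \<bullet> e = s" using harmonic_chartD(5)[OF ch i, of e1 e2] by (simp add: s_def)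
  have "F2 i e1 e1 ?y + F2 i e2 e2 ?y = 0"
    using harmonic_chartD(6)[OF ch i z] by (simp add: sum_Basis_plane)
  then have "F2 i e2 e2 ?y = - F2 i e1 e1 ?y" by (simp add: eq_neg_iff_add_eq_0 add.commute)
  then have r': "F2 i e2 e2 ?y \<bullet> e = - r" by (simp add: r_def)
  have der: "((\<lambda>z. F' i b (to_plane z) \<bullet> e) has_derivative
      (\<lambda>h. Re h * (F2 i b e1 ?y \<bullet> e) + Im h * (F2 i b e2 ?y \<bullet> e))) (at z)" if b: "b \<in> Basis" for b
  proof -
    have "((\<lambda>z. F' i b (to_plane z)) has_derivative
        (\<lambda>h. \<Sum>b'\<in>Basis. (to_plane h \<bullet> b') *\<^sub>R F2 i b b' ?y)) (at z)"
      by (rule has_derivative_compose[OF has_derivative_to_plane harmonic_chartD(4)[OF ch i b z]])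
    from has_derivative_inner_left[OF this, of e] show ?thesis
      by (simp add: sum_Basis_plane inner_to_plane inner_add_left)
  qed
  have "((\<lambda>z. Complex (F' i e1 (to_plane z) \<bullet> e) (- (F' i e2 (to_plane z) \<bullet> e))) has_derivative
      (\<lambda>h. Complex (Re h * r + Im h * s) (- (Re h * s + Im h * (- r))))) (at z)"
    using has_derivative_Complex_pair[OF der[OF e_Basis(1)] has_derivative_minus[OF der[OF e_Basis(2)]]]
    by (simp add: r_def[symmetric] s_def[symmetric] s' r')
  moreover have "(\<lambda>h. Complex (Re h * r + Im h * s) (- (Re h * s + Im h * (- r)))) = (*) (Complex r (- s))"
    by (rule ext) (simp add: complex_eq_iff algebra_simps)
  ultimately show ?thesis unfolding has_field_derivative_def r_def s_def by simp
qed

section \<open>A gradient estimate\<close>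

text \<open>
  The harmonic function \<open>\<phi>\<close> is the real part of a primitive \<open>H\<close> of \<open>g\<close> up to a constant. The function
  \<open>exp ((H - H z0) / \<epsilon>)\<close> is bounded by \<open>exp 1\<close>, as only the real part of the exponent
  matters, and its derivative at \<open>z0\<close> is \<open>g z0 / \<epsilon>\<close>; the Cauchy inequality on the disk of radius \<open>r / 2\<close>,
  with \<open>exp 1 \<le> 3\<close>, gives the bound.
\<close>

lemma gradient_estimate:
  fixes \<phi> :: "complex \<Rightarrow> real"
  assumes r: "r > 0" and g: "g holomorphic_on ball z0 r"
    and der: "\<And>z. z \<in> ball z0 r \<Longrightarrow> (\<phi> has_derivative (\<lambda>h. Re (g z * h))) (at z)"
    and osc: "\<And>z. z \<in> ball z0 r \<Longrightarrow> \<bar>\<phi> z - \<phi> z0\<bar> \<le> \<epsilon>" and \<epsilon>: "\<epsilon> > 0"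
  shows "norm (g z0) \<le> 6 * \<epsilon> / r"
proof -
  have z0: "z0 \<in> ball z0 r" using r by simp
  obtain H where H0: "\<And>z. z \<in> ball z0 r \<Longrightarrow> (H has_field_derivative g z) (at z within ball z0 r)"
    by (rule holomorphic_convex_primitive'[OF convex_ball open_ball g]) blast
  have H: "(H has_field_derivative g z) (at z)" if "z \<in> ball z0 r" for z
    using H0[OF that] at_within_open[OF that open_ball] by simp
  have "\<exists>c. \<forall>z\<in>ball z0 r. Re (H z) - \<phi> z = c"
  proof (rule has_derivative_zero_constant[OF convex_ball])
    fix z assume z: "z \<in> ball z0 r"
    have "((\<lambda>z. Re (H z)) has_derivative (\<lambda>h. Re (g z * h))) (at z)"
      using bounded_linear.has_derivative[OF bounded_linear_Re H[OF z, unfolded has_field_derivative_def]] .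
    from has_derivative_diff[OF this der[OF z]]
    show "((\<lambda>z. Re (H z) - \<phi> z) has_derivative (\<lambda>h. 0)) (at z within ball z0 r)"
      by (simp add: has_derivative_at_withinI)
  qed
  then obtain c where c: "\<And>z. z \<in> ball z0 r \<Longrightarrow> Re (H z) = \<phi> z + c" by (force simp: algebra_simps)
  define E where "E z = exp ((H z - H z0) / of_real \<epsilon>)" for z
  have dE: "(E has_field_derivative (E z * (g z / of_real \<epsilon>))) (at z)" if "z \<in> ball z0 r" for z
    unfolding E_def[abs_def] using \<epsilon> by (auto intro!: derivative_eq_intros H[OF that])
  have E_le: "norm (E z) \<le> exp 1" if "z \<in> ball z0 r" for z
  proof -
    have "Re ((H z - H z0) / of_real \<epsilon>) = (\<phi> z - \<phi> z0) / \<epsilon>"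
      using c[OF that] c[OF z0] by (simp add: Re_divide_of_real)
    also have "\<dots> \<le> 1" using osc[OF that] \<epsilon> by (simp add: pos_divide_le_eq)
    finally show ?thesis by (simp add: E_def)
  qed
  have sub: "cball z0 (r / 2) \<subseteq> ball z0 r" using r by auto
  have holE: "E holomorphic_on ball z0 r"
    unfolding holomorphic_on_open[OF open_ball] by (intro ballI exI) (rule dE)
  have "norm ((deriv ^^ 1) E z0) \<le> fact 1 * exp 1 / (r / 2) ^ 1"
  proof (rule Cauchy_inequality)
    show "E holomorphic_on ball z0 (r / 2)" using holE by (rule holomorphic_on_subset) (use r in auto)
    show "continuous_on (cball z0 (r / 2)) E"
      using holomorphic_on_imp_continuous_on[OF holE] sub by (rule continuous_on_subset)
    show "0 < r / 2" using r by simp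
    show "norm (E x) \<le> exp 1" if "norm (z0 - x) = r / 2" for x
      by (rule E_le) (use that r in \<open>simp add: dist_norm\<close>)
  qed
  moreover have "deriv E z0 = g z0 / of_real \<epsilon>"
    using DERIV_imp_deriv[OF dE[OF z0]] by (simp add: E_def)
  ultimately have "norm (g z0) / \<epsilon> \<le> exp 1 / (r / 2)" using \<epsilon> by (simp add: norm_divide)
  also have "\<dots> \<le> 3 / (r / 2)" using r exp_le by (intro divide_right_mono) auto
  finally show ?thesis using \<epsilon> by (simp add: pos_divide_le_eq mult_ac)
qed

section \<open>Values near the singular point\<close>

lemma Q_dist_near:
  fixes A B :: "'b::euclidean_space multiset"
  assumes "size A = size B" "P \<in># A"
  obtains p where "p \<in># B" "dist P p \<le> Q_dist A B"
proof -
  obtain ps qs where pq: "mset ps = A" "mset qs = B"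
    "Q_dist A B = L2_set (\<lambda>i. dist (ps ! i) (qs ! i)) {..<size A}"
    using Q_dist_attained[OF assms(1)] .
  have len: "length ps = size A" "length qs = size A" using pq assms(1) by (metis size_mset)+
  have "P \<in> set ps" using assms(2) pq(1) by (metis set_mset_mset)
  then obtain i where i: "i < size A" "P = ps ! i" using len by (metis in_set_conv_nth)
  have "qs ! i \<in># B" using i len pq(2) by (metis nth_mem_mset)
  moreover have "dist P (qs ! i) \<le> Q_dist A B"
    unfolding pq(3) i(2) by (rule member_le_L2_set) (use i in auto)
  ultimately show ?thesis by (rule that)
qed

text \<open>
  All that the growth estimate uses of a minimizer with the origin as its only singular point:
  continuity, also at the origin, and harmonic sheets near every other point.
\<close>

locale minimizer_off_origin =
  fixes u :: "real^2 \<Rightarrow> (real^'n) multiset" and Q :: nat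
  assumes Q: "Q \<ge> 1"
    and cont: "continuous_map (top_of_set (ball 0 2)) (Q_topology Q) u"
    and chart: "\<And>x. x \<in> ball 0 2 - {0} \<Longrightarrow>
      \<exists>V F F' F2. x \<in> V \<and> V \<subseteq> ball 0 2 - {0} \<and> harmonic_chart V Q u F F' F2"
begin

lemma u_Q: "x \<in> ball 0 2 \<Longrightarrow> u x \<in> Q_points Q"
proof -
  interpret Metric_space "Q_points Q :: (real^'n) multiset set" Q_dist by (rule Metric_space_Q_points)
  show "x \<in> ball 0 2 \<Longrightarrow> u x \<in> Q_points Q" using continuous_map_funspace[OF cont] by (auto simp: Pi_iff)
qed

lemma open_Q_dist_ball: "open {y \<in> ball 0 2. Q_dist (u 0) (u y) < \<delta>}"
proof -
  interpret Metric_space "Q_points Q :: (real^'n) multiset set" Q_dist by (rule Metric_space_Q_points)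
  have "openin (top_of_set (ball 0 2)) {y \<in> ball 0 2. u y \<in> mball (u 0) \<delta>}"
    using openin_continuous_map_preimage[OF cont openin_mball] by simp
  moreover have "{y \<in> ball 0 2. u y \<in> mball (u 0) \<delta>} = {y \<in> ball 0 2. Q_dist (u 0) (u y) < \<delta>}"
    using u_Q by (auto simp: in_mball)
  ultimately show ?thesis using openin_open_eq[OF open_ball, of "0::real^2" 2] by simp
qed

lemma near_zero_value:
  assumes "y \<in> ball 0 2" "P \<in># u y"
  obtains p where "p \<in># u 0" "dist P p \<le> Q_dist (u 0) (u y)"
proof -
  interpret Metric_space "Q_points Q :: (real^'n) multiset set" Q_dist by (rule Metric_space_Q_points)
  have "size (u y) = size (u 0)" using u_Q[OF assms(1)] u_Q[of 0] by (simp add: Q_points_def)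
  from Q_dist_near[OF this assms(2)] show ?thesis using that unfolding commute[of "u y" "u 0"] .
qed

lemma values_bounded: "\<exists>M>0. \<forall>y\<in>cball 0 (7/4). \<forall>P\<in>#u y. norm P \<le> M"
proof -
  define O' where "O' n = {y \<in> ball 0 2. Q_dist (u 0) (u y) < real n}" for n :: nat
  have cov: "cball (0::real^2) (7/4) \<subseteq> (\<Union>n\<in>UNIV. O' n)"
  proof
    fix y :: "real^2" assume "y \<in> cball 0 (7/4)"
    moreover obtain n where "Q_dist (u 0) (u y) < real n" using reals_Archimedean2 by blast
    ultimately show "y \<in> (\<Union>n\<in>UNIV. O' n)" by (auto simp: O'_def)
  qed
  have op: "open (O' n)" if "n \<in> UNIV" for n unfolding O'_def by (rule open_Q_dist_ball)
  obtain C where C: "finite C" "cball (0::real^2) (7/4) \<subseteq> (\<Union>n\<in>C. O' n)"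
  proof (rule compactE_image[OF compact_cball op cov])
    fix C' assume "finite C'" "cball (0::real^2) (7/4) \<subseteq> (\<Union>n\<in>C'. O' n)"
    then show thesis by (rule that)
  qed
  define N where "N = (\<Sum>n\<in>C. real n)"
  define B where "B = (\<Sum>p\<in>set_mset (u 0). norm p)"
  have "norm P \<le> B + N + 1" if y: "y \<in> cball 0 (7/4)" and P: "P \<in># u y" for y P
  proof -
    obtain n where n: "n \<in> C" "y \<in> O' n" using C(2) y by blast
    have y2: "y \<in> ball 0 2" using n(2) by (simp add: O'_def)
    obtain p where p: "p \<in># u 0" "dist P p \<le> Q_dist (u 0) (u y)" by (rule near_zero_value[OF y2 P])
    have "real n \<le> N" unfolding N_def by (rule member_le_sum) (use n C in auto)
    then have "Q_dist (u 0) (u y) \<le> N" using n(2) unfolding O'_def by simp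
    moreover have "norm p \<le> B" unfolding B_def by (rule member_le_sum) (use p in auto)
    ultimately show ?thesis using p(2) norm_triangle_sub[of P p] by (simp add: dist_norm)
  qed
  moreover have "B + N + 1 > 0" unfolding B_def N_def by (intro add_nonneg_pos add_nonneg_nonneg sum_nonneg) auto
  ultimately show ?thesis by (intro exI[of _ "B + N + 1"] conjI ballI)
qed

text \<open>
  Near the origin every value of \<open>u\<close> lies within \<open>\<delta>\<close> of one of the finitely many values of \<open>u 0\<close>, and these
  are at least \<open>4 \<delta>\<close> apart. A continuous selection over a connected set cannot jump from one of them to
  another.
\<close>

lemma small_oscillation:
  assumes \<epsilon>: "\<epsilon> > 0"
  shows "\<exists>\<eta>>0. \<forall>z r f. ball z r \<subseteq> ball 0 \<eta> \<and> r > 0 \<and> continuous_on (ball z r) f \<and> (\<forall>y\<in>ball z r. f y \<in># u y)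
    \<longrightarrow> (\<forall>y\<in>ball z r. norm (f y - f z) \<le> \<epsilon>)"
proof -
  define S where "S = (\<lambda>(p, q). dist p q) ` {(p, q). p \<in># u 0 \<and> q \<in># u 0 \<and> p \<noteq> q}"
  have finS: "finite S"
  proof -
    have "{(p, q). p \<in># u 0 \<and> q \<in># u 0 \<and> p \<noteq> q} \<subseteq> set_mset (u 0) \<times> set_mset (u 0)" by auto
    then show ?thesis
      unfolding S_def by (rule finite_imageI[OF finite_subset]) simp
  qed
  define \<delta> where "\<delta> = Min (insert \<epsilon> S) / 4"
  have \<delta>: "\<delta> > 0" "4 * \<delta> \<le> \<epsilon>"
  proof -
    show "\<delta> > 0" unfolding \<delta>_def using finS \<epsilon> by (auto simp: S_def Min_gr_iff)
    show "4 * \<delta> \<le> \<epsilon>" unfolding \<delta>_def using finS by (simp add: Min_le)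
  qed
  have sep: "4 * \<delta> \<le> dist p q" if "p \<in># u 0" "q \<in># u 0" "p \<noteq> q" for p q
  proof -
    have "dist p q \<in> S" unfolding S_def using that by force
    then have "Min (insert \<epsilon> S) \<le> dist p q" using finS by (intro Min_le) auto
    then show ?thesis by (simp add: \<delta>_def)
  qed
  have "(0::real^2) \<in> {y \<in> ball 0 2. Q_dist (u 0) (u y) < \<delta>}"
  proof -
    interpret Metric_space "Q_points Q :: (real^'n) multiset set" Q_dist by (rule Metric_space_Q_points)
    have "Q_dist (u 0) (u 0) = 0" using u_Q[of 0] zero[of "u 0" "u 0"] by simp
    then show ?thesis using \<delta>(1) by simp
  qed
  from openE[OF open_Q_dist_ball this] obtain \<eta> where \<eta>: "\<eta> > 0"
    "ball 0 \<eta> \<subseteq> {y \<in> ball 0 2. Q_dist (u 0) (u y) < \<delta>}" .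
  have main: "norm (f y - f z) \<le> \<epsilon>"
    if D: "ball z r \<subseteq> ball 0 \<eta>" "r > 0" and f: "continuous_on (ball z r) f" "\<forall>y\<in>ball z r. f y \<in># u y"
      and y: "y \<in> ball z r" for z r f y
  proof -
    have near: "\<exists>p. p \<in># u 0 \<and> dist (f w) p < \<delta>" if w: "w \<in> ball z r" for w
    proof -
      have w2: "w \<in> ball 0 2" "Q_dist (u 0) (u w) < \<delta>" using w D(1) \<eta>(2) by blast+
      have "f w \<in># u w" using f(2) w by blast
      from near_zero_value[OF w2(1) this] obtain p where "p \<in># u 0" "dist (f w) p \<le> Q_dist (u 0) (u w)" .
      then show ?thesis using w2(2) by (intro exI[of _ p]) simp
    qed
    have zD: "z \<in> ball z r" using D(2) by simp
    obtain p where p: "p \<in># u 0" "dist (f z) p < \<delta>" using near[OF zD] by blast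
    define k where "k w = dist (f w) p" for w
    have dich: "k w < \<delta> \<or> 3 * \<delta> < k w" if w: "w \<in> ball z r" for w
    proof -
      obtain q where q: "q \<in># u 0" "dist (f w) q < \<delta>" using near[OF w] by blast
      show ?thesis
      proof (cases "q = p")
        case False
        have "4 * \<delta> \<le> dist p q" using sep[OF p(1) q(1)] False by simp
        also have "\<dots> \<le> dist (f w) p + dist (f w) q" by (rule dist_triangle3)
        finally show ?thesis using q(2) by (simp add: k_def)
      qed (use q in \<open>simp add: k_def\<close>)
    qed
    have "connected (k ` ball z r)"
      unfolding k_def[abs_def] by (intro connected_continuous_image continuous_intros f(1) connected_ball)
    then have Icc: "{k z..k y} \<subseteq> k ` ball z r"
      by (rule connected_contains_Icc) (use zD y in auto)
    have "k y < \<delta>"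
    proof (rule ccontr)
      assume "\<not> k y < \<delta>"
      then have "3 * \<delta> < k y" using dich[OF y] by blast
      then have "2 * \<delta> \<in> {k z..k y}" using p(2) \<delta>(1) by (simp add: k_def)
      from subsetD[OF Icc this] obtain w where "2 * \<delta> = k w" "w \<in> ball z r" by (rule imageE)
      then show False using dich[of w] \<delta>(1) by auto
    qed
    then have "dist (f y) (f z) < 2 * \<delta>"
      using p(2) dist_triangle2[of "f y" "f z" p] by (simp add: k_def)
    then show ?thesis using \<delta> by (simp add: dist_norm)
  qed
  show ?thesis
    by (intro exI[of _ \<eta>] conjI \<eta>(1) allI impI ballI, elim conjE) (rule main)
qed

definition grad where "grad z P e = complex_gradient (sheet_deriv u (to_plane z) P) e"

lemma grad_chart:
  assumes "harmonic_chart V Q u F F' F2" "to_plane z \<in> V" "i < Q"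
  shows "grad z (F i (to_plane z)) e = Complex (F' i e1 (to_plane z) \<bullet> e) (- (F' i e2 (to_plane z) \<bullet> e))"
  unfolding grad_def sheet_deriv_selection(1)[OF assms] by (rule complex_gradient_sheet)

text \<open>
  The gradient of the sheet through \<open>P\<close>, continued over the disk, is holomorphic, so an oscillation
  bound for continuous selections yields a gradient bound.
\<close>

lemma grad_estimate:
  assumes D: "ball (to_plane z0) r \<subseteq> ball 0 2 - {0}" "r > 0" and P: "P \<in># u (to_plane z0)"
    and e: "e \<in> Basis" and \<epsilon>: "\<epsilon> > 0"
    and osc: "\<And>f. continuous_on (ball (to_plane z0) r) f \<Longrightarrow> \<forall>y\<in>ball (to_plane z0) r. f y \<in># u y \<Longrightarrow>
      f (to_plane z0) = P \<Longrightarrow> \<forall>y\<in>ball (to_plane z0) r. norm (f y - f (to_plane z0)) \<le> \<epsilon>"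
  shows "norm (grad z0 P e) \<le> 6 * \<epsilon> / r"
proof -
  let ?G = "ball 0 2 - {0} :: (real^2) set" and ?D = "ball (to_plane z0) r"
  have G: "open ?G" by (intro open_Diff) auto
  obtain f where f: "f (to_plane z0) = P" "\<And>y. y \<in> ?D \<Longrightarrow> f y \<in># u y"
    "\<And>y. y \<in> ?D \<Longrightarrow> (f has_derivative sheet_deriv u y (f y)) (at y)"
    by (rule sheet_lift[OF Q G chart D P]) blast+
  have fc: "continuous_on ?D f"
    by (rule continuous_at_imp_continuous_on) (use has_derivative_continuous[OF f(3)] in blast)
  have osc': "\<forall>y\<in>?D. norm (f y - f (to_plane z0)) \<le> \<epsilon>"
    by (rule osc[OF fc _ f(1)]) (use f(2) in blast)
  have inD: "to_plane z \<in> ?D" if "z \<in> ball z0 r" for z using that by (simp add: dist_to_plane)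
  define \<phi> where "\<phi> z = f (to_plane z) \<bullet> e" for z
  define g where "g z = grad z (f (to_plane z)) e" for z
  have "norm (g z0) \<le> 6 * \<epsilon> / r"
  proof (rule gradient_estimate[OF D(2), where ?z0.0 = z0 and g = g and \<phi> = \<phi> and \<epsilon> = \<epsilon>])
    fix z assume z: "z \<in> ball z0 r"
    have "((\<lambda>z. f (to_plane z)) has_derivative (\<lambda>h. sheet_deriv u (to_plane z) (f (to_plane z)) (to_plane h))) (at z)"
      by (rule has_derivative_compose[OF has_derivative_to_plane f(3)[OF inD[OF z]]])
    from has_derivative_inner_left[OF this, of e]
    show "(\<phi> has_derivative (\<lambda>h. Re (g z * h))) (at z)"
      unfolding \<phi>_def[abs_def] g_def grad_def complex_gradient_pair[OF has_derivative_linear[OF f(3)[OF inD[OF z]]]] .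
    have "\<bar>\<phi> z - \<phi> z0\<bar> \<le> norm (f (to_plane z) - f (to_plane z0)) * norm e"
      unfolding \<phi>_def inner_diff_left[symmetric] by (rule Cauchy_Schwarz_ineq2)
    also have "\<dots> \<le> \<epsilon>" using osc' inD[OF z] e by simp
    finally show "\<bar>\<phi> z - \<phi> z0\<bar> \<le> \<epsilon>" .
  next
    have "g field_differentiable at z" if z: "z \<in> ball z0 r" for z
    proof -
      let ?y = "to_plane z"
      have "?y \<in> ?G" using inD[OF z] D(1) by blast
      from chart[OF this] obtain V F F' F2 where V: "?y \<in> V" and c: "harmonic_chart V Q u F F' F2" by blast
      have "f ?y \<in># Q_of Q (\<lambda>i. F i ?y)" using f(2)[OF inD[OF z]] harmonic_chartD(2)[OF c] V by simp
      then obtain i where i: "i < Q" "f ?y = F i ?y" by (auto simp: in_Q_of)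
      have "\<forall>\<^sub>F w in nhds ?y. w \<in> ?D" by (rule eventually_nhds_in_open[OF open_ball inD[OF z]])
      then have sel: "\<forall>\<^sub>F w in nhds ?y. f w \<in># u w" by eventually_elim (rule f(2))
      from selection_agrees_with_sheet[OF c V i(1) sel has_derivative_continuous[OF f(3)[OF inD[OF z]]] i(2)]
      obtain W where W: "open W" "?y \<in> W" "\<forall>w\<in>W. f w = F i w" unfolding eventually_nhds by (elim exE conjE)
      have oV: "open V" by (rule C1_sheetsD(1)[OF harmonic_chartD(1)[OF c]])
      define W' where "W' = to_plane -` (W \<inter> V)"
      have "open W'" unfolding W'_def
        by (intro open_vimage open_Int W(1) oV bounded_linear.continuous_on[OF bounded_linear_to_plane] continuous_on_id)
      moreover have "z \<in> W'" using W(2) V by (simp add: W'_def)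
      moreover have "Complex (F' i e1 (to_plane w) \<bullet> e) (- (F' i e2 (to_plane w) \<bullet> e)) = g w" if "w \<in> W'" for w
        using that W(3) grad_chart[OF c _ i(1), of w e] by (simp add: W'_def g_def)
      ultimately have "(g has_field_derivative
          Complex (F2 i e1 e1 (to_plane z) \<bullet> e) (- (F2 i e1 e2 (to_plane z) \<bullet> e))) (at z)"
        by (intro has_field_derivative_transform_within_open[OF sheet_gradient_holomorphic[OF c i(1) V]])
      then show ?thesis by (auto simp: field_differentiable_def)
    qed
    then show "g holomorphic_on ball z0 r"
      by (auto simp: holomorphic_on_def field_differentiable_at_within)
  qed (rule \<epsilon>)
  then show ?thesis by (simp add: g_def f(1))
qed

section \<open>The growth of the gradient\<close>

text \<open>
  The weight \<open>z\<close> makes the gradient estimate on disks of radius proportional to \<open>norm z\<close> scale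
  invariant: the result is bounded, and it tends to 0 at the origin.
\<close>

definition weighted_grad where "weighted_grad z P e = z * grad z P e"

text \<open>
  For \<open>norm z < 1\<close> the disk of radius \<open>norm z / 8\<close> around \<open>z\<close> avoids the origin and stays in a fixed
  compact subset of the domain.
\<close>

lemma ball_eighth_norm_subset:
  assumes "z \<noteq> 0" "norm z < 1"
  shows "ball (to_plane z) (norm z / 8) \<subseteq> ball 0 2 - {0}" "ball (to_plane z) (norm z / 8) \<subseteq> cball 0 (7/4)"
    "ball (to_plane z) (norm z / 8) \<subseteq> ball 0 (2 * norm z)"
proof -
  have *: "norm y < 9/8 * norm z" "y \<noteq> 0" if "y \<in> ball (to_plane z) (norm z / 8)" for y
  proof -
    have d: "norm (to_plane z - y) < norm z / 8" using that by (simp add: dist_norm)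
    show "norm y < 9/8 * norm z"
      using d norm_triangle_sub[of y "to_plane z"] by (simp add: norm_to_plane norm_minus_commute)
    show "y \<noteq> 0" using d assms(1) by (auto simp: norm_to_plane)
  qed
  have "norm z > 0" using assms(1) by simp
  show "ball (to_plane z) (norm z / 8) \<subseteq> ball 0 2 - {0}"
  proof
    fix y assume "y \<in> ball (to_plane z) (norm z / 8)"
    from *[OF this] show "y \<in> ball 0 2 - {0}" using assms(2) by simp
  qed
  show "ball (to_plane z) (norm z / 8) \<subseteq> cball 0 (7/4)"
  proof
    fix y assume "y \<in> ball (to_plane z) (norm z / 8)"
    from *(1)[OF this] show "y \<in> cball 0 (7/4)" using assms(2) by simp
  qed
  show "ball (to_plane z) (norm z / 8) \<subseteq> ball 0 (2 * norm z)"
  proof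
    fix y assume "y \<in> ball (to_plane z) (norm z / 8)"
    then have "norm y < 2 * norm z" using *(1)[of y] \<open>norm z > 0\<close> by linarith
    then show "y \<in> ball 0 (2 * norm z)" by simp
  qed
qed

lemma weighted_grad_bounded: "\<exists>R>0. \<forall>z P e. z \<noteq> 0 \<and> norm z < 1 \<and> P \<in># u (to_plane z) \<and> e \<in> Basis \<longrightarrow> norm (weighted_grad z P e) \<le> R"
proof -
  obtain M where M: "M > 0" "\<forall>y\<in>cball 0 (7/4). \<forall>P\<in>#u y. norm P \<le> M" using values_bounded by (elim exE conjE)
  have "norm (weighted_grad z P e) \<le> 96 * M" if z: "z \<noteq> 0" "norm z < 1" and P: "P \<in># u (to_plane z)" and e: "e \<in> Basis" for z P e
  proof -
    have "norm (grad z P e) \<le> 6 * (2 * M) / (norm z / 8)"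
    proof (rule grad_estimate[OF ball_eighth_norm_subset(1)[OF z] _ P e])
      fix f assume f: "\<forall>y\<in>ball (to_plane z) (norm z / 8). f y \<in># u y"
      have n: "norm (f y) \<le> M" if "y \<in> ball (to_plane z) (norm z / 8)" for y
        using M(2) f ball_eighth_norm_subset(2)[OF z] that by blast
      have zb: "to_plane z \<in> ball (to_plane z) (norm z / 8)" using z by simp
      show "\<forall>y\<in>ball (to_plane z) (norm z / 8). norm (f y - f (to_plane z)) \<le> 2 * M"
      proof
        fix y assume "y \<in> ball (to_plane z) (norm z / 8)"
        then show "norm (f y - f (to_plane z)) \<le> 2 * M"
          using n[of y] n[OF zb] norm_triangle_ineq4[of "f y" "f (to_plane z)"] by linarith
      qed
    qed (use z M in auto)
    then show ?thesis using z by (simp add: weighted_grad_def norm_mult field_simps)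
  qed
  then show ?thesis using M(1) by (intro exI[of _ "96 * M"]) auto
qed

lemma weighted_grad_tendsto_0:
  assumes "\<epsilon> > 0" "e \<in> Basis"
  shows "\<exists>\<eta>>0. \<forall>z P. z \<noteq> 0 \<and> norm z < \<eta> \<and> P \<in># u (to_plane z) \<longrightarrow> norm (weighted_grad z P e) \<le> \<epsilon>"
proof -
  have "\<epsilon> / 48 > 0" using assms by simp
  from small_oscillation[OF this] obtain \<eta> where \<eta>: "\<eta> > 0"
    "\<forall>z r f. ball z r \<subseteq> ball 0 \<eta> \<and> r > 0 \<and> continuous_on (ball z r) f \<and> (\<forall>y\<in>ball z r. f y \<in># u y)
      \<longrightarrow> (\<forall>y\<in>ball z r. norm (f y - f z) \<le> \<epsilon> / 48)" by (elim exE conjE)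
  have "norm (weighted_grad z P e) \<le> \<epsilon>" if z: "z \<noteq> 0" "norm z < min 1 (\<eta> / 2)" and P: "P \<in># u (to_plane z)" for z P
  proof -
    have z1: "norm z < 1" using z(2) by simp
    have sub: "ball (to_plane z) (norm z / 8) \<subseteq> ball 0 \<eta>"
      by (rule order_trans[OF ball_eighth_norm_subset(3)[OF z(1) z1]], rule subset_ball) (use z(2) in simp)
    have "norm (grad z P e) \<le> 6 * (\<epsilon> / 48) / (norm z / 8)"
    proof (rule grad_estimate[OF ball_eighth_norm_subset(1)[OF z(1) z1] _ P assms(2)])
      fix f assume "continuous_on (ball (to_plane z) (norm z / 8)) f"
        "\<forall>y\<in>ball (to_plane z) (norm z / 8). f y \<in># u y"
      then show "\<forall>y\<in>ball (to_plane z) (norm z / 8). norm (f y - f (to_plane z)) \<le> \<epsilon> / 48"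
        using \<eta>(2)[rule_format, of "to_plane z" "norm z / 8" f] sub z(1) by simp
    qed (use z assms in auto)
    then show ?thesis using z by (simp add: weighted_grad_def norm_mult field_simps)
  qed
  then show ?thesis using \<eta>(1) by (intro exI[of _ "min 1 (\<eta> / 2)"]) auto
qed

text \<open>
  The polynomial in \<open>t\<close> whose roots are the weighted gradients of all sheets over \<open>z\<close>. It is
  symmetric in the sheets, so it is single-valued although the sheets are permuted when one goes
  around the origin.
\<close>

definition char_poly where
  "char_poly e t z = (\<Prod>P\<in>#u (to_plane z). t - weighted_grad z P e)"

lemma char_poly_chart:
  assumes "harmonic_chart V Q u F F' F2" "to_plane z \<in> V"
  shows "char_poly e t z = (\<Prod>i<Q. t - weighted_grad z (F i (to_plane z)) e)"
proof -
  have "u (to_plane z) = Q_of Q (\<lambda>i. F i (to_plane z))" using harmonic_chartD(2)[OF assms(1)] assms(2) by blast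
  then show ?thesis unfolding char_poly_def Q_of_def by (simp add: prod_unfold_prod_mset image_mset.compositionality o_def)
qed

lemma char_poly_holomorphic: "char_poly e t holomorphic_on ball 0 1 - {0}"
  unfolding holomorphic_on_def
proof
  fix z :: complex assume z: "z \<in> ball 0 1 - {0}"
  then have "to_plane z \<in> ball 0 2 - {0}" by (simp add: norm_to_plane to_plane_eq_0)
  from chart[OF this] obtain V F F' F2 where V: "to_plane z \<in> V" and c: "harmonic_chart V Q u F F' F2" by blast
  have oV: "open V" by (rule C1_sheetsD(1)[OF harmonic_chartD(1)[OF c]])
  define W where "W = to_plane -` V"
  have W: "open W" "z \<in> W" unfolding W_def using V
    by (auto intro!: open_vimage oV bounded_linear.continuous_on[OF bounded_linear_to_plane] continuous_on_id)
  define h where "h i w = Complex (F' i e1 (to_plane w) \<bullet> e) (- (F' i e2 (to_plane w) \<bullet> e))" for i w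
  have "h i holomorphic_on W" if "i < Q" for i
    unfolding holomorphic_on_open[OF W(1)]
  proof
    fix w assume "w \<in> W"
    then have "to_plane w \<in> V" by (simp add: W_def)
    from sheet_gradient_holomorphic[OF c that this, of e]
    show "\<exists>f'. (h i has_field_derivative f') (at w)" unfolding h_def[abs_def] by (rule exI)
  qed
  then have "(\<lambda>w. \<Prod>i<Q. t - w * h i w) holomorphic_on W"
    by (intro holomorphic_intros) auto
  moreover have "(\<Prod>i<Q. t - w * h i w) = char_poly e t w" if "w \<in> W" for w
    unfolding char_poly_chart[OF c that[unfolded W_def vimage_eq]]
    using grad_chart[OF c that[unfolded W_def vimage_eq]] by (intro prod.cong) (auto simp: weighted_grad_def h_def)
  ultimately have "char_poly e t holomorphic_on W" by (rule holomorphic_transform)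
  then have "char_poly e t field_differentiable at z"
    using W by (rule holomorphic_on_imp_differentiable_at)
  then show "char_poly e t field_differentiable at z within ball 0 1 - {0}"
    by (rule field_differentiable_at_within)
qed

lemma size_u: "z \<in> ball 0 1 \<Longrightarrow> size (u (to_plane z)) = Q"
  using u_Q[of "to_plane z"] by (simp add: Q_points_def norm_to_plane)

lemma norm_prod_mset_bound:
  fixes f :: "'c \<Rightarrow> complex"
  assumes "\<And>x. x \<in># A \<Longrightarrow> norm (f x) \<le> B" "0 \<le> B"
  shows "norm (\<Prod>x\<in>#A. f x) \<le> B ^ size A"
  using assms(1)
proof (induction A)
  case (add x A)
  have "norm (f x) * norm (\<Prod>x\<in>#A. f x) \<le> B * B ^ size A"
    using add assms(2) by (intro mult_mono) auto
  then show ?case by (simp add: norm_mult)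
qed simp

text \<open>
  All roots tend to 0 at the origin. The inequality \<open>key\<close> controls the product quantitatively and
  avoids any continuous choice of roots.
\<close>

lemma char_poly_tendsto_power:
  assumes "e \<in> Basis"
  shows "((\<lambda>z. char_poly e t z) \<longlongrightarrow> t ^ Q) (at 0)"
proof -
  have cont: "isCont (\<lambda>s::real. (norm t + s) ^ Q - norm t ^ Q) 0" by (intro continuous_intros)
  have key: "norm ((\<Prod>P\<in>#A. t - f P) - t ^ size A) \<le> (norm t + s) ^ size A - norm t ^ size A"
    if "\<And>P. P \<in># A \<Longrightarrow> norm (f P) \<le> s" "0 \<le> s" for A :: "(real^'n) multiset" and f :: "real^'n \<Rightarrow> complex" and s
    using that(1)
  proof (induction A)
    case (add x A)
    define p where "p = (\<Prod>P\<in>#A. t - f P)"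
    have IH: "norm (p - t ^ size A) \<le> (norm t + s) ^ size A - norm t ^ size A"
      unfolding p_def using add by auto
    have fx: "norm (t - f x) \<le> norm t + s" using add.prems[of x] norm_triangle_ineq4[of t "f x"] by simp
    have "(t - f x) * p - t * t ^ size A = (t - f x) * (p - t ^ size A) - f x * t ^ size A" by (simp add: algebra_simps)
    then have "norm ((t - f x) * p - t * t ^ size A) \<le> norm (t - f x) * norm (p - t ^ size A) + norm (f x) * norm t ^ size A"
      by (metis norm_mult norm_power norm_triangle_ineq4)
    also have "\<dots> \<le> (norm t + s) * ((norm t + s) ^ size A - norm t ^ size A) + s * norm t ^ size A"
      using IH fx add.prems[of x] that(2) by (intro add_mono mult_mono) auto
    also have "\<dots> = (norm t + s) ^ Suc (size A) - norm t ^ Suc (size A)" by (simp add: algebra_simps)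
    finally show ?case by (simp add: p_def)
  qed simp
  show ?thesis
  proof (rule LIM_I)
    fix \<epsilon> :: real assume "\<epsilon> > 0"
    then obtain d where d: "d > 0" "\<And>s. \<bar>s\<bar> < d \<Longrightarrow> \<bar>(norm t + s) ^ Q - norm t ^ Q\<bar> < \<epsilon>"
      using cont unfolding continuous_at_eps_delta by (force simp: dist_real_def)
    from weighted_grad_tendsto_0[OF half_gt_zero[OF d(1)] assms] obtain \<eta> where \<eta>: "\<eta> > 0"
      "\<forall>z P. z \<noteq> 0 \<and> norm z < \<eta> \<and> P \<in># u (to_plane z) \<longrightarrow> norm (weighted_grad z P e) \<le> d / 2" by (elim exE conjE)
    have "norm (char_poly e t z - t ^ Q) < \<epsilon>" if z: "z \<noteq> 0" "norm z < min \<eta> 1" for z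
    proof -
      have sz: "size (u (to_plane z)) = Q" by (rule size_u) (use z in simp)
      have "norm (char_poly e t z - t ^ size (u (to_plane z)))
          \<le> (norm t + d / 2) ^ size (u (to_plane z)) - norm t ^ size (u (to_plane z))"
        unfolding char_poly_def by (rule key) (use \<eta>(2)[rule_format] z d(1) in simp_all)
      then show ?thesis using d(2)[of "d / 2"] d(1) by (simp add: sz)
    qed
    then show "\<exists>s>0. \<forall>x. x \<noteq> 0 \<and> norm (x - 0) < s \<longrightarrow> norm (char_poly e t x - t ^ Q) < \<epsilon>"
      using \<eta>(1) by (intro exI[of _ "min \<eta> 1"]) auto
  qed
qed

text \<open>
  Fix the number \<open>t\<close> to be the root in question. The function \<open>z \<mapsto> char_poly e t z - t ^ Q\<close> is
  holomorphic on the punctured disk, extends to the origin with value 0, and is bounded by a constant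
  \<open>C\<close> independent of \<open>t\<close>. By the Schwarz lemma it is at most \<open>C * norm z\<close>. At the point \<open>z0\<close> the
  polynomial vanishes and \<open>t ^ Q\<close> remains. This is where the exponent \<open>1 / Q\<close> comes from.
\<close>

lemma weighted_grad_growth: "\<exists>C>0. \<forall>z P e. z \<noteq> 0 \<and> norm z < 1 \<and> P \<in># u (to_plane z) \<and> e \<in> Basis \<longrightarrow> norm (weighted_grad z P e) ^ Q \<le> C * norm z"
proof -
  obtain R where R: "R > 0"
    "\<forall>z P e. z \<noteq> 0 \<and> norm z < 1 \<and> P \<in># u (to_plane z) \<and> e \<in> Basis \<longrightarrow> norm (weighted_grad z P e) \<le> R"
    using weighted_grad_bounded by (elim exE conjE)
  \<comment> \<open>The two terms bound \<open>char_poly e t z\<close> and \<open>t ^ Q\<close>; adding 1 makes the bound strict, as the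
      Schwarz lemma requires.\<close>
  define C where "C = (2 * R) ^ Q + R ^ Q + 1"
  have C: "C > 0" unfolding C_def using R(1) by (intro add_nonneg_pos add_nonneg_nonneg) auto
  have "norm (weighted_grad z0 P0 e) ^ Q \<le> C * norm z0"
    if z0: "z0 \<noteq> 0" "norm z0 < 1" and P0: "P0 \<in># u (to_plane z0)" and e: "e \<in> Basis" for z0 P0 e
  proof -
    define t where "t = weighted_grad z0 P0 e"
    have tR: "norm t \<le> R" unfolding t_def by (rule R(2)[rule_format]) (use z0 P0 e in simp)
    define f where "f z = (if z = 0 then 0 else (char_poly e t z - t ^ Q) / of_real C)" for z
    have hol0: "f holomorphic_on ball 0 1 - {0}"
    proof (rule holomorphic_transform)
      show "(\<lambda>z. (char_poly e t z - t ^ Q) / of_real C) holomorphic_on ball 0 1 - {0}"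
        using C by (intro holomorphic_intros char_poly_holomorphic) auto
    qed (simp add: f_def)
    have "isCont f 0"
    proof -
      have "((\<lambda>z. (char_poly e t z - t ^ Q) / of_real C) \<longlongrightarrow> (t ^ Q - t ^ Q) / of_real C) (at 0)"
        by (intro tendsto_divide tendsto_diff tendsto_const char_poly_tendsto_power e) (use C in auto)
      moreover have "\<forall>\<^sub>F z in at 0. (char_poly e t z - t ^ Q) / of_real C = f z"
        by (simp add: eventually_at_filter f_def)
      ultimately have "(f \<longlongrightarrow> 0) (at 0)" by (simp add: tendsto_cong)
      then show ?thesis by (simp add: isCont_def f_def)
    qed
    then have "continuous_on (ball 0 1) f"
    proof -
      have "continuous_on (ball 0 1 - {0}) f" by (rule holomorphic_on_imp_continuous_on[OF hol0])
      then have "isCont f z" if "z \<in> ball 0 1 - {0}" for z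
        using that by (simp add: continuous_on_eq_continuous_at open_Diff)
      then have "isCont f z" if "z \<in> ball 0 1" for z using that \<open>isCont f 0\<close> by (cases "z = 0") auto
      then show ?thesis by (simp add: continuous_at_imp_continuous_on)
    qed
    then have hol: "f holomorphic_on ball 0 1"
      by (rule no_isolated_singularity[OF _ hol0]) auto
    have small: "norm (f z) < 1" if "norm z < 1" for z
    proof (cases "z = 0")
      case False
      have sz: "size (u (to_plane z)) = Q" by (rule size_u) (use that in simp)
      have "norm (char_poly e t z) \<le> (2 * R) ^ size (u (to_plane z))"
        unfolding char_poly_def
      proof (rule norm_prod_mset_bound)
        fix P assume "P \<in># u (to_plane z)"
        then have "norm (weighted_grad z P e) \<le> R" using R(2)[rule_format, of z P e] False that e by simp
        then show "norm (t - weighted_grad z P e) \<le> 2 * R" using tR norm_triangle_ineq4[of t "weighted_grad z P e"] by linarith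
      qed (use R in simp)
      moreover have "norm (t ^ Q) \<le> R ^ Q" using tR by (simp add: norm_power power_mono)
      ultimately have "norm (char_poly e t z - t ^ Q) < C"
        using norm_triangle_ineq4[of "char_poly e t z" "t ^ Q"] by (simp add: sz C_def)
      then show ?thesis using False C by (simp add: f_def norm_divide)
    qed (simp add: f_def)
    have "norm (f z0) \<le> norm z0"
      by (rule Schwarz_Lemma(1)[OF hol _ small z0(2)]) (simp_all add: f_def)
    moreover have "char_poly e t z0 = 0"
    proof -
      have "0 \<in># image_mset (\<lambda>P. t - weighted_grad z0 P e) (u (to_plane z0))" using P0 by (force simp: t_def)
      then show ?thesis unfolding char_poly_def by (metis prod_mset_zero_iff)
    qed
    ultimately have "norm t ^ Q / C \<le> norm z0" using z0(1) C by (simp add: f_def norm_divide norm_power)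
    then show ?thesis using C by (simp add: t_def pos_divide_le_eq mult.commute)
  qed
  then show ?thesis using C by (intro exI[of _ C]) auto
qed

text \<open>
  Divide the weighted gradient by \<open>z\<close> again and collect the components of the target.
\<close>

lemma sheet_energy_growth:
  "\<exists>C>0. \<forall>x V F F' F2 b. x \<in> ball 0 1 - {0} \<and> x \<in> V \<and> harmonic_chart V Q u F F' F2 \<and> b \<in> Basis
    \<longrightarrow> sheet_energy Q F' b x \<le> C * norm x powr (1 / real Q - 1)"
proof -
  obtain C where C: "C > 0"
    "\<forall>z P e. z \<noteq> 0 \<and> norm z < 1 \<and> P \<in># u (to_plane z) \<and> e \<in> Basis \<longrightarrow> norm (weighted_grad z P e) ^ Q \<le> C * norm z"
    using weighted_grad_growth by (elim exE conjE)
  define C1 where "C1 = C powr (1 / real Q)"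
  define C2 where "C2 = real Q * (real (DIM(real^'n)) * C1)"
  have main: "sheet_energy Q F' b x \<le> C2 * norm x powr (1 / real Q - 1)"
    if x: "x \<in> ball 0 1 - {0}" "x \<in> V" and c: "harmonic_chart V Q u F F' F2" and b: "b \<in> Basis" for x V F F' F2 b
  proof -
    obtain z where z: "to_plane z = x" using to_plane_surj by blast
    have z0: "z \<noteq> 0" "norm z < 1" "norm z = norm x" using x z by (auto simp: norm_to_plane[symmetric] to_plane_eq_0[symmetric])
    have comp: "\<bar>F' i b x \<bullet> e\<bar> \<le> C1 * norm x powr (1 / real Q - 1)" if i: "i < Q" and e: "e \<in> Basis" for i e
    proof -
      have zV: "to_plane z \<in> V" using x z by simp
      have "F i x \<in># u x" using harmonic_chartD(2)[OF c] x(2) i by (auto simp: in_Q_of)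
      then have "norm (weighted_grad z (F i x) e) ^ Q \<le> C * norm z" using C(2)[rule_format, of z "F i x" e] z0 e z by simp
      then have "(norm (weighted_grad z (F i x) e) ^ Q) powr (1 / real Q) \<le> (C * norm z) powr (1 / real Q)"
        by (intro powr_mono2) auto
      also have "(norm (weighted_grad z (F i x) e) ^ Q) powr (1 / real Q) = norm (weighted_grad z (F i x) e)"
        using Q by (cases "weighted_grad z (F i x) e = 0") (simp_all add: powr_realpow[symmetric] powr_powr)
      also have "(C * norm z) powr (1 / real Q) = C1 * norm z powr (1 / real Q)"
        using C(1) by (simp add: C1_def powr_mult)
      finally have "norm (grad z (F i x) e) \<le> C1 * norm z powr (1 / real Q) / norm z"
        using z0(1) by (simp add: weighted_grad_def norm_mult pos_le_divide_eq mult.commute)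
      also have "\<dots> = C1 * norm x powr (1 / real Q - 1)"
        using z0 by (simp add: powr_diff)
      finally have g: "norm (grad z (F i x) e) \<le> C1 * norm x powr (1 / real Q - 1)" .
      have "grad z (F i x) e = Complex (F' i e1 x \<bullet> e) (- (F' i e2 x \<bullet> e))"
        using grad_chart[OF c zV i, of e] z by simp
      moreover have "b = e1 \<or> b = e2" using b Basis_plane(1) by auto
      ultimately have "\<bar>F' i b x \<bullet> e\<bar> \<le> norm (grad z (F i x) e)"
        using abs_Re_le_cmod[of "grad z (F i x) e"] abs_Im_le_cmod[of "grad z (F i x) e"] by auto
      then show ?thesis using g by linarith
    qed
    have "norm (F' i b x) \<le> real (DIM(real^'n)) * C1 * norm x powr (1 / real Q - 1)" if i: "i < Q" for i
    proof -
      have "norm (F' i b x) \<le> (\<Sum>e\<in>Basis. \<bar>F' i b x \<bullet> e\<bar>)" by (rule norm_le_l1)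
      also have "\<dots> \<le> (\<Sum>e\<in>(Basis::(real^'n) set). C1 * norm x powr (1 / real Q - 1))"
        by (rule sum_mono) (rule comp[OF i])
      finally show ?thesis by simp
    qed
    then have "L2_set (\<lambda>i. norm (F' i b x)) {..<Q} \<le> real (card {..<Q}) * (real (DIM(real^'n)) * C1 * norm x powr (1 / real Q - 1))"
      by (intro L2_set_le_card_mult) simp
    then show ?thesis by (simp add: sheet_energy_def C2_def mult_ac)
  qed
  have "C2 > 0" using C(1) Q by (simp add: C2_def C1_def)
  show ?thesis
    by (intro exI[of _ C2] conjI[OF \<open>C2 > 0\<close>] allI impI, elim conjE) (rule main)
qed

end

section \<open>Integrability of powers of the norm\<close>

text \<open>
  Dominate the power by the sum of \<open>2 powr (\<alpha> (k + 1))\<close> times the indicator of the ball of radius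
  \<open>2 powr - k\<close>. The integrals form a geometric series with ratio \<open>2 powr (\<alpha> - DIM('a))\<close>.
\<close>

lemma integrable_norm_powr_ball:
  fixes \<alpha> :: real
  assumes \<alpha>: "0 \<le> \<alpha>" "\<alpha> < real (DIM('a::euclidean_space))"
  shows "integrable (lebesgue_on (ball (0::'a) 1)) (\<lambda>x. norm x powr (- \<alpha>))"
proof (rule integrableI_nonneg)
  let ?n = "DIM('a)"
  have m: "(\<lambda>x::'a. norm x powr (- \<alpha>)) \<in> borel_measurable lebesgue"
    by (rule measurable_completion) simp
  then show "(\<lambda>x::'a. norm x powr (- \<alpha>)) \<in> borel_measurable (lebesgue_on (ball 0 1))"
    by (rule measurable_restrict_space1)
  define f where "f k x = ennreal (2 powr (\<alpha> * (real k + 1))) * indicator (cball 0 (2 powr (- real k))) x" for k and x :: 'a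
  have le: "ennreal (norm x powr (- \<alpha>)) \<le> (\<Sum>k. f k x)" if x: "x \<in> ball 0 1" for x :: 'a
  proof (cases "x = 0")
    case False
    define l where "l = - log 2 (norm x)"
    have l: "norm x = 2 powr (- l)" using False by (simp add: l_def)
    have "2 powr (- l) < 2 powr 0" using x by (simp add: l[symmetric])
    then have "- l < 0" by (rule powr_less_cancel) simp
    then have "l > 0" by simp
    \<comment> \<open>The dyadic shell that contains \<open>x\<close>.\<close>
    define k where "k = nat \<lfloor>l\<rfloor>"
    have k: "real k \<le> l" "l < real k + 1" using \<open>l > 0\<close> by (simp_all add: k_def)
    have "norm x powr (- \<alpha>) = 2 powr (\<alpha> * l)" by (simp add: l powr_powr mult.commute)
    also have "\<dots> \<le> 2 powr (\<alpha> * (real k + 1))" using k(2) \<alpha>(1) by (intro powr_mono mult_left_mono) auto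
    finally have "ennreal (norm x powr (- \<alpha>)) \<le> ennreal (2 powr (\<alpha> * (real k + 1)))" by (rule ennreal_leI)
    also have "\<dots> = f k x"
    proof -
      have "norm x \<le> 2 powr (- real k)" unfolding l using k(1) by simp
      then show ?thesis by (simp add: f_def)
    qed
    also have "\<dots> \<le> (\<Sum>k. f k x)" using sum_le_suminf[of "\<lambda>k. f k x" "{k}"] by simp
    finally show ?thesis .
  qed simp
  have cm: "cball (0::'a) r \<in> sets lebesgue" for r by (rule fmeasurableD[OF lmeasurable_cball])
  have fm: "f k \<in> borel_measurable lebesgue" for k
    unfolding f_def[abs_def] by (intro borel_measurable_times_ennreal borel_measurable_const borel_measurable_indicator cm)
  define V where "V = unit_ball_vol (real ?n)"
  have "(\<integral>\<^sup>+x. ennreal (norm x powr (- \<alpha>)) \<partial>lebesgue_on (ball (0::'a) 1))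
      \<le> (\<integral>\<^sup>+x. (\<Sum>k. f k x) \<partial>lebesgue_on (ball (0::'a) 1))"
    by (rule nn_integral_mono) (use le in \<open>simp add: space_restrict_space\<close>)
  also have "\<dots> \<le> (\<integral>\<^sup>+x. (\<Sum>k. f k x) \<partial>lebesgue)"
  proof -
    have "(\<integral>\<^sup>+x. (\<Sum>k. f k x) \<partial>lebesgue_on (ball (0::'a) 1)) = (\<integral>\<^sup>+x. (\<Sum>k. f k x) * indicator (ball 0 1) x \<partial>lebesgue)"
      by (rule nn_integral_restrict_space) simp
    also have "\<dots> \<le> (\<integral>\<^sup>+x. (\<Sum>k. f k x) \<partial>lebesgue)"
      by (rule nn_integral_mono) (simp split: split_indicator)
    finally show ?thesis .
  qed
  also have "\<dots> = (\<Sum>k. \<integral>\<^sup>+x. f k x \<partial>lebesgue)"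
    by (rule nn_integral_suminf) (rule fm)
  also have "\<dots> = (\<Sum>k. ennreal (2 powr \<alpha> * V * (2 powr (\<alpha> - ?n)) ^ k))"
  proof (rule suminf_cong)
    fix k
    have "(\<integral>\<^sup>+x. f k x \<partial>lebesgue) = ennreal (2 powr (\<alpha> * (real k + 1))) * emeasure lborel (cball (0::'a) (2 powr (- real k)))"
      unfolding f_def nn_integral_cmult_indicator[OF cm] by simp
    also have "\<dots> = ennreal (2 powr (\<alpha> * (real k + 1)) * (V * (2 powr (- real k)) ^ ?n))"
      by (simp add: emeasure_cball V_def ennreal_mult)
    also have "2 powr (\<alpha> * (real k + 1)) * (V * (2 powr (- real k)) ^ ?n) = 2 powr \<alpha> * V * (2 powr (\<alpha> - ?n)) ^ k"
      by (simp add: powr_realpow[symmetric] powr_powr powr_add[symmetric] algebra_simps)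
    finally show "(\<integral>\<^sup>+x. f k x \<partial>lebesgue) = ennreal (2 powr \<alpha> * V * (2 powr (\<alpha> - ?n)) ^ k)" .
  qed
  also have "\<dots> < top"
  proof -
    have "(2::real) powr (\<alpha> - ?n) < 2 powr 0" using \<alpha>(2) by (intro powr_less_mono) auto
    then have "summable (\<lambda>k. 2 powr \<alpha> * V * (2 powr (\<alpha> - ?n)) ^ k)"
      by (intro summable_mult summable_geometric) simp
    moreover have "0 \<le> 2 powr \<alpha> * V * (2 powr (\<alpha> - ?n)) ^ k" for k by (simp add: V_def)
    ultimately show ?thesis by (simp add: ennreal_suminf_neq_top less_top)
  qed
  finally show "(\<integral>\<^sup>+x. ennreal (norm x powr (- \<alpha>)) \<partial>lebesgue_on (ball (0::'a) 1)) < \<infinity>" by simp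
qed simp

section \<open>The summability exponent\<close>

theorem proposition4p1:
  fixes u :: "real^2 \<Rightarrow> (real^'n) multiset" and Q :: nat and p :: real
  assumes "Q \<ge> 1"
    and "Dir_minimizing (ball 0 2) (circle_measure 2) Q u"
    and "continuous_map (top_of_set (ball 0 2)) (Q_topology Q) u"
    and "singular_set (ball 0 2) Q u = {0}"
    and "p > 0"
    and "ereal p < (if Q = 1 then \<infinity> else ereal (2 * real Q / (real Q - 1)))"
  shows "abs_D (ball 0 2) Q u \<in> Lp (lebesgue_on (ball 0 1)) p"
proof -
  let ?\<Omega> = "ball 0 2 :: (real^2) set" and ?D = "ball 0 1 :: (real^2) set"
  have chart: "\<exists>V F F' F2. x \<in> V \<and> V \<subseteq> ?\<Omega> - {0} \<and> harmonic_chart V Q u F F' F2"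
    if x: "x \<in> ?\<Omega> - {0}" for x
  proof -
    have "x \<notin> singular_set ?\<Omega> Q u" using assms(4) x by simp
    then have "Q_regular_at ?\<Omega> Q u x" using x unfolding singular_set_def by simp
    from minimizer_has_harmonic_chart[OF open_ball bounded_ball circle_measure_outside_ball(1)
        circle_measure_outside_ball(2)[of 2, OF zero_le_numeral] assms(2,3) this]
    obtain V F F' F2 where V: "x \<in> V" "V \<subseteq> ?\<Omega>" and c: "harmonic_chart V Q u F F' F2" by (elim exE conjE)
    have "open (V - {0})" using C1_sheetsD(1)[OF harmonic_chartD(1)[OF c]] by (rule open_Diff) simp
    moreover have "x \<in> V - {0}" using V(1) x by simp
    ultimately obtain r where r: "r > 0" "ball x r \<subseteq> V - {0}" by (rule openE)
    show ?thesis
    proof (intro exI conjI)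
      show "x \<in> ball x r" using r(1) by simp
      show "ball x r \<subseteq> ?\<Omega> - {0}" using r(2) V(2) by blast
      show "harmonic_chart (ball x r) Q u F F' F2"
        by (rule harmonic_chart_subset[OF c open_ball convex_ball]) (use r(2) in blast)
    qed
  qed
  interpret minimizer_off_origin u Q
    by unfold_locales (use assms(1,3) chart in blast)+
  define \<beta> where "\<beta> = 1 / real Q - 1"
  obtain C where C: "C > 0" "\<forall>x V F F' F2 b. x \<in> ?D - {0} \<and> x \<in> V \<and> harmonic_chart V Q u F F' F2 \<and> b \<in> Basis
      \<longrightarrow> sheet_energy Q F' b x \<le> C * norm x powr \<beta>"
    using sheet_energy_growth unfolding \<beta>_def by (elim exE conjE)
  let ?a = "abs_partial ?\<Omega> Q u"
  have bound: "\<exists>\<phi>. partial_bound ?\<Omega> Q u b \<phi>" if "b \<in> Basis" for b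
    using assms(2) that unfolding Dir_minimizing_def W12_Q_def by blast
  have a: "partial_bound ?\<Omega> Q u b (?a b)" if b: "b \<in> Basis" for b
  proof -
    obtain \<phi> where "partial_bound ?\<Omega> Q u b \<phi>" using bound[OF b] ..
    from abs_partial_minimal(1)[OF open_ball this] show ?thesis .
  qed
  have a_meas: "?a b \<in> borel_measurable (lebesgue_on ?D)" if b: "b \<in> Basis" for b
  proof -
    have "?a b \<in> borel_measurable (lebesgue_on ?\<Omega>)" using a[OF b] by (simp add: partial_bound_def Lp_2_iff)
    then show ?thesis by (rule measurable_restrict_mono) (auto intro: subset_ball)
  qed
  have a_le: "AE x in lebesgue. x \<in> ?D - {0} \<longrightarrow> ?a b x \<le> C * norm x powr \<beta>" if b: "b \<in> Basis" for b
  proof (rule AE_on_open_locally)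
    fix x assume x: "x \<in> ?D - {0}"
    then have "x \<in> ?\<Omega> - {0}" by simp
    from chart[OF this] obtain V F F' F2 where V: "x \<in> V" "V \<subseteq> ?\<Omega> - {0}" and c: "harmonic_chart V Q u F F' F2"
      by (elim exE conjE)
    have "V \<subseteq> ?\<Omega>" using V(2) by blast
    from abs_partial_le_sheet_energy[OF open_ball this harmonic_chartD(1,2)[OF c] b a[OF b]]
    have "AE y in lebesgue. y \<in> V \<inter> ?D \<longrightarrow> ?a b y \<le> C * norm y powr \<beta>"
    proof eventually_elim
      case (elim y)
      show ?case
      proof
        assume y: "y \<in> V \<inter> ?D"
        then have "sheet_energy Q F' b y \<le> C * norm y powr \<beta>"
          by (intro C(2)[rule_format, of y V F F' F2 b]) (use V(2) c b in blast)
        then show "?a b y \<le> C * norm y powr \<beta>" using elim y by simp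
      qed
    qed
    moreover have "open (V \<inter> ?D)" using C1_sheetsD(1)[OF harmonic_chartD(1)[OF c]] by (rule open_Int) simp
    moreover have "x \<in> V \<inter> ?D" using V(1) x by simp
    ultimately show "\<exists>V. open V \<and> x \<in> V \<and> (AE y in lebesgue. y \<in> V \<longrightarrow> ?a b y \<le> C * norm y powr \<beta>)"
      by (intro exI[of _ "V \<inter> ?D"] conjI)
  qed
  have "AE x in lebesgue. \<forall>b\<in>Basis. x \<in> ?D - {0} \<longrightarrow> ?a b x \<le> C * norm x powr \<beta>"
    by (rule AE_finite_allI[OF finite_Basis a_le])
  moreover have "AE x in lebesgue. x \<noteq> (0 :: real^2)" by (rule AE_completion[OF AE_lborel_singleton])
  ultimately have "AE x in lebesgue. x \<in> ?D \<longrightarrow> abs_D ?\<Omega> Q u x \<le> 2 * C * norm x powr \<beta>"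
  proof eventually_elim
    case (elim x)
    show ?case
    proof
      assume x: "x \<in> ?D"
      have "abs_D ?\<Omega> Q u x \<le> (\<Sum>b\<in>Basis. \<bar>?a b x\<bar>)"
        unfolding abs_D_def L2_set_def[symmetric] by (rule L2_set_le_sum_abs)
      also have "\<dots> \<le> (\<Sum>b\<in>(Basis :: (real^2) set). C * norm x powr \<beta>)"
      proof (rule sum_mono)
        fix b :: "real^2" assume b: "b \<in> Basis"
        have "0 \<le> ?a b x" using a[OF b] x unfolding partial_bound_def by simp
        then show "\<bar>?a b x\<bar> \<le> C * norm x powr \<beta>" using elim b x by simp
      qed
      finally show "abs_D ?\<Omega> Q u x \<le> 2 * C * norm x powr \<beta>" by simp
    qed
  qed
  then have D_le: "AE x in lebesgue_on ?D. abs_D ?\<Omega> Q u x \<le> 2 * C * norm x powr \<beta>"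
    by (rule AE_restrict_space_iff[THEN iffD2, rotated]) simp
  have "(\<lambda>x. \<Sum>b\<in>Basis. (?a b x)\<^sup>2) \<in> borel_measurable (lebesgue_on ?D)"
    by (intro borel_measurable_sum borel_measurable_power a_meas)
  then have D_meas: "abs_D ?\<Omega> Q u \<in> borel_measurable (lebesgue_on ?D)"
    unfolding abs_D_def[abs_def] by (rule measurable_compose) simp
  have D_pos: "0 \<le> abs_D ?\<Omega> Q u x" for x by (simp add: abs_D_def sum_nonneg)
  \<comment> \<open>This is the only place where the upper bound on \<open>p\<close> enters: \<open>p (1 - 1 / Q) < 2\<close> is the condition for
      \<open>norm x powr (- p (1 - 1 / Q))\<close> to be integrable near the origin of the plane.\<close>
  have \<alpha>: "0 \<le> - (\<beta> * p)" "- (\<beta> * p) < 2"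
  proof -
    have "\<beta> \<le> 0" using assms(1) by (simp add: \<beta>_def)
    then show "0 \<le> - (\<beta> * p)" using assms(5) by (simp add: mult_nonpos_nonneg)
    show "- (\<beta> * p) < 2"
    proof (cases "Q = 1")
      case False
      then have Q2: "real Q > 1" using assms(1) by simp
      have "p < 2 * real Q / (real Q - 1)" using assms(6) False by simp
      then have "p * (real Q - 1) < 2 * real Q" using Q2 by (simp add: pos_less_divide_eq)
      then have "p * (real Q - 1) / real Q < 2" using Q2 by (simp add: pos_divide_less_eq)
      then show ?thesis using Q2 by (simp add: \<beta>_def field_simps)
    qed (simp add: \<beta>_def)
  qed
  have int: "integrable (lebesgue_on ?D) (\<lambda>x. (2 * C) powr p * norm x powr (\<beta> * p))"
    using integrable_norm_powr_ball[where 'a = "real^2", of "- (\<beta> * p)"] \<alpha> by simp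
  have "integrable (lebesgue_on ?D) (\<lambda>x. \<bar>abs_D ?\<Omega> Q u x\<bar> powr p)"
  proof (rule Bochner_Integration.integrable_bound[OF int])
    show "(\<lambda>x. \<bar>abs_D ?\<Omega> Q u x\<bar> powr p) \<in> borel_measurable (lebesgue_on ?D)"
      by (rule measurable_compose[OF D_meas]) simp
    show "AE x in lebesgue_on ?D. norm (\<bar>abs_D ?\<Omega> Q u x\<bar> powr p) \<le> norm ((2 * C) powr p * norm x powr (\<beta> * p))"
      using D_le
    proof eventually_elim
      case (elim x)
      have "\<bar>abs_D ?\<Omega> Q u x\<bar> powr p \<le> (2 * C * norm x powr \<beta>) powr p"
        using elim D_pos[of x] assms(5) by (intro powr_mono2) auto
      also have "\<dots> = (2 * C) powr p * norm x powr (\<beta> * p)"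
        using C(1) by (simp add: powr_mult powr_powr)
      finally show ?case by simp
    qed
  qed
  then show ?thesis unfolding Lp_def using D_meas by simp
qed

end
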